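(* Let $d>6$. There exist constants $C_1(d),C_2(d)>0$ such that for all $N>1$, \[ C_1N^{-2}\le \mathbb{P}\Big[\mathbf{0}\xleftrightarrow{\widetilde{E}^{\ge 0}}\partial B(N)\Big]\le C_2N^{-2}. \]
   Context: $\mathbb{Z}^d$ has edge set $\mathbb{L}^d=\{\{x,y\}:x,y\in\mathbb{Z}^d,|x-y|_1=1\}$; $|\cdot|$ denotes the $\ell^\infty$ norm. The metric graph $\widetilde{\mathbb{Z}}^d=\bigcup_{e\in\mathbb{L}^d}I_e$, where each $I_e$, $e=\{x,y\}$, is a compact interval of length $d$ whose two endpoints are identified with $x$ and $y$. For $N>0$, $B(N)=\{x\in\mathbb{Z}^d:|x|\le N\}$, and for $A\subset\mathbb{Z}^d$, $\partial A=\{x\in A:\exists y\in\mathbb{Z}^d\setminus A \text{ with } \{x,y\}\in\mathbb{L}^d\}$. Let $G(x,y)=\mathbb{E}_x\int_0^\infty \mathbb{1}_{S_t=y}\,dt$ be the Green's function of the continuous-time simple random walk on $\mathbb{Z}^d$ jumping to each neighbor at rate $\frac{1}{2d}$. The discrete Gaussian free field $\{\phi_x\}_{x\in\mathbb{Z}^d}$ is the centered Gaussian field with covariance $G$. The GFF $\{\widetilde\phi_v\}_{v\in\widetilde{\mathbb{Z}}^d}$ on the metric graph is obtained by setting $\widetilde\phi_x=\phi_x$ on lattice points and, on each interval $I_{\{x_1,x_2\}}$, taking an independent Brownian bridge of length $d$ with variance $2$ at time $1$, conditioned to equal $\phi_{x_1}$ and $\phi_{x_2}$ at the endpoints. $\widetilde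 E^{\ge 0}=\{v\in\widetilde{\mathbb{Z}}^d:\widetilde\phi_v\ge 0\}$, and $\mathbf{0}\xleftrightarrow{\widetilde E^{\ge0}}\partial B(N)$ is the event that there is a continuous path in $\widetilde{\mathbb{Z}}^d$ contained in $\widetilde E^{\ge 0}$ joining the origin $\mathbf{0}$ to $\partial B(N)$. *)

theory Defs
  imports "HOL-Probability.Probability"
begin

text \<open>Z^d is realised as the integer points of real^'n with d = CARD('n).
  The metric graph is realised (up to the scaling factor d of the edge lengths,
  which does not affect the topology) as the union of the unit segments of R^d
  joining nearest neighbours: the points with at most one non-integer coordinate.\<close>

definition latt :: "(real^'n) set" where
  "latt = {x. \<forall>i. x$i \<in> \<int>}"

definition mgraph :: "(real^'n) set" where
  "mgraph = {v. \<exists>i. \<forall>j. j \<noteq> i \<longrightarrow> v$j \<in> \<int>}"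

definition linf :: "real^'n \<Rightarrow> real" where
  "linf x = Max (range (\<lambda>i. \<bar>x$i\<bar>))"

definition lat_adj :: "real^'n \<Rightarrow> real^'n \<Rightarrow> bool" where
  "lat_adj x y \<longleftrightarrow> x \<in> latt \<and> y \<in> latt \<and> (\<Sum>i\<in>UNIV. \<bar>x$i - y$i\<bar>) = 1"

definition lat_ball :: "real \<Rightarrow> (real^'n) set" where
  "lat_ball N = {x \<in> latt. linf x \<le> N}"

definition lat_bdry :: "(real^'n) set \<Rightarrow> (real^'n) set" where
  "lat_bdry A = {x \<in> A. \<exists>y \<in> latt - A. lat_adj x y}"

fun srw_kernel :: "nat \<Rightarrow> real^'n \<Rightarrow> real^'n \<Rightarrow> real" where
  "srw_kernel 0 x y = (if x = y then 1 else 0)"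
| "srw_kernel (Suc n) x y =
     (\<Sum>i\<in>UNIV. srw_kernel n (x + axis i 1) y + srw_kernel n (x - axis i 1) y)
       / (2 * real CARD('n))"

text \<open>Transition probability P_x(S_t = y) of the continuous-time walk jumping to each
  neighbour at rate 1/(2d) (total jump rate 1, so the number of jumps is Poisson(t)).\<close>
definition ctrw_kernel :: "real \<Rightarrow> real^'n \<Rightarrow> real^'n \<Rightarrow> real" where
  "ctrw_kernel t x y = (\<Sum>n. exp (- t) * t ^ n / fact n * srw_kernel n x y)"

definition green :: "real^'n \<Rightarrow> real^'n \<Rightarrow> real" where
  "green x y = (LBINT t:{0..}. ctrw_kernel t x y)"

definition interp_wt :: "real^'n \<Rightarrow> real^'n \<Rightarrow> real" where
  "interp_wt u x = (\<Prod>i\<in>UNIV. max 0 (1 - \<bar>u$i - x$i\<bar>))"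

definition near_latt :: "real^'n \<Rightarrow> (real^'n) set" where
  "near_latt u = {x \<in> latt. linf (x - u) < 1}"

definition same_edge :: "real^'n \<Rightarrow> real^'n \<Rightarrow> 'n \<Rightarrow> bool" where
  "same_edge u v i \<longleftrightarrow> u$i \<notin> \<int> \<and> v$i \<notin> \<int> \<and> \<lfloor>u$i\<rfloor> = \<lfloor>v$i\<rfloor> \<and>
     (\<forall>j. j \<noteq> i \<longrightarrow> u$j = v$j \<and> u$j \<in> \<int>)"

text \<open>Covariance of an independent Brownian bridge of length d with Var(B_t) = 2t
  (variance 2 at time 1) pinned at 0; positions along the edge are d*frac.\<close>
definition bridge_cov :: "real^'n \<Rightarrow> real^'n \<Rightarrow> real" where
  "bridge_cov u v =
     (if \<exists>i. same_edge u v i then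
        (let i = (SOME i. same_edge u v i); s = frac (u$i); s' = frac (v$i)
         in 2 * real CARD('n) * min s s' * (1 - max s s'))
      else 0)"

definition mgff_cov :: "real^'n \<Rightarrow> real^'n \<Rightarrow> real" where
  "mgff_cov u v =
     (\<Sum>x\<in>near_latt u. \<Sum>y\<in>near_latt v. interp_wt u x * interp_wt v y * green x y)
     + bridge_cov u v"

text \<open>phi is (a continuous realisation of) the metric graph GFF on the probability space M:
  a centered Gaussian process on the metric graph with covariance mgff_cov
  (characterised by its joint characteristic functions), with continuous sample paths.\<close>
definition metric_gff :: "'w measure \<Rightarrow> (real^'n \<Rightarrow> 'w \<Rightarrow> real) \<Rightarrow> bool" where
  "metric_gff M \<phi> \<longleftrightarrow> prob_space M \<and>
     (\<forall>v\<in>mgraph. \<phi> v \<in> borel_measurable M) \<and>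
     (\<forall>\<omega>\<in>space M. continuous_on mgraph (\<lambda>v. \<phi> v \<omega>)) \<and>
     (\<forall>S a. finite S \<and> S \<subseteq> mgraph \<longrightarrow>
        (CLINT \<omega>|M. iexp (\<Sum>v\<in>S. a v * \<phi> v \<omega>)) =
          complex_of_real (exp (- (\<Sum>u\<in>S. \<Sum>v\<in>S. a u * a v * mgff_cov u v) / 2)))"

definition conn_nonneg :: "(real^'n \<Rightarrow> 'w \<Rightarrow> real) \<Rightarrow> 'w \<Rightarrow> real \<Rightarrow> bool" where
  "conn_nonneg \<phi> \<omega> N \<longleftrightarrow>
     (\<exists>g. path g \<and> path_image g \<subseteq> {v \<in> mgraph. \<phi> v \<omega> \<ge> 0} \<and>
          pathstart g = 0 \<and> pathfinish g \<in> lat_bdry (lat_ball N))"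

end

theory Submission
 imports Defs "HOL-Probability.Probability"
begin

text \<open>Explore, on a fine mesh of the metric graph, the nonnegative cluster C of the boundary of the box.
The mean T(x) of the harmonic extension of the unexplored negative boundary values is comparable with
the probability that x lies in C, and it is a subharmonic function of x. Exploring also the
nonpositive cluster, whose exploration is negatively correlated with that of C, expresses
T(x) T(y) through the Green function of pairs of points hit by the two clusters; in d > 6 the
triple convolution of the Green function is bounded, and the resulting inequality forces the Laplacian of T to be of
order T^2 wherever T is locally comparable with its maximum. Comparing T with quadratic functions
gives T of order N^(-2) at the origin. The lower bound follows from the opposite
inequality, Laplacian of T at most a constant times T^2, and the second moment method.\<close>

section \<open>Potential theory on a transient network\<close>

text \<open>In the continuum the field vanishes where a sign cluster ends, so the exploration
  identities would be exact. On a mesh of spacing 1/m the field jumps across the end of a cluster;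
  \<open>osc\<close> measures this jump and tends to 0 as m grows with n fixed, so the estimates
  carry an error \<open>ep\<close>, finally taken below n^(-4). No walk is run on the mesh: harmonic
  measure and killed Green functions are solutions of Dirichlet problems, and their probabilistic
  properties come from a minimum principle. Two versions of the unexplored boundary mass are needed:
  \<open>U\<close> enters exact covariance identities, while \<open>U2\<close> is monotone in the
  field, so that FKG applies; they differ by at most \<open>osc\<close>. The dimension enters
  through exponents: \<open>fdec K b\<close> is superharmonic for 2(b + 1) < d, the Green function
  is bounded with b = 12/5, each further Green factor lowers b by 1, and three factors leave b =
  2/5. This remaining decay makes the triple convolution negligible between points at a large fixed
  distance L, so that the rest of T(x) T(y) must come from increments of T.\<close>

definition lap :: "('a => 'a set) => ('a => real) => 'a => real" where
 "lap nb u v = (\<Sum>y\<in>nb v. u v - u y)"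

lemma lap_diff: "lap nb (%x. u x - w x) v = lap nb u v - lap nb w v"
 by (simp add: lap_def sum_subtractf[symmetric] algebra_simps)

lemma lap_uminus: "lap nb (%x. - u x) v = - lap nb u v"
 by (simp add: lap_def sum_negf[symmetric])

lemma lap_cmult: "lap nb (%x. c * u x) v = c * lap nb u v"
 by (simp add: lap_def sum_distrib_left right_diff_distrib)

lemma lap_multc: "lap nb (%x. u x * c) v = lap nb u v * c"
 by (simp add: lap_def sum_distrib_right left_diff_distrib)

lemma lap_const: "lap nb (%x. c) v = 0"
 by (simp add: lap_def)

lemma lap_sum: "lap nb (%x. \<Sum>z\<in>A. u z x) v = (\<Sum>z\<in>A. lap nb (u z) v)"
proof -
 have "(\<Sum>z\<in>A. lap nb (u z) v) = (\<Sum>y\<in>nb v. \<Sum>z\<in>A. u z v - u z y)"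
 unfolding lap_def by (rule sum.swap)
 then show ?thesis by (simp add: lap_def sum_subtractf)
qed

text \<open>Convergence to 0 at infinity on a discrete set, phrased without a topology or an
  exhaustion.\<close>

definition vanishing :: "'a set => ('a => real) => bool" where
 "vanishing X u \<longleftrightarrow> (ALL e>0. finite {v\<in>X. e <= \<bar>u v\<bar>})"

lemma vanishing_add:
 assumes "vanishing X u" "vanishing X w"
 shows "vanishing X (%x. u x + w x)"
 unfolding vanishing_def
proof (intro allI impI)
 fix e :: real assume "e > 0"
 have "{v\<in>X. e <= \<bar>u v + w v\<bar>} <= {v\<in>X. e/2 <= \<bar>u v\<bar>} Un {v\<in>X. e/2 <= \<bar>w v\<bar>}"
 by (auto simp: abs_if split: if_splits)
 moreover have "finite ({v\<in>X. e/2 <= \<bar>u v\<bar>} Un {v\<in>X. e/2 <= \<bar>w v\<bar>})"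
 using assms \<open>e > 0\<close> unfolding vanishing_def by (metis finite_UnI half_gt_zero)
 ultimately show "finite {v\<in>X. e <= \<bar>u v + w v\<bar>}" by (rule finite_subset)
qed

lemma vanishing_cmult:
 assumes "vanishing X u"
 shows "vanishing X (%x. c * u x)"
proof (cases "c = 0")
 case True
 then show ?thesis by (simp add: vanishing_def)
next
 case False
 show ?thesis
 unfolding vanishing_def
 proof (intro allI impI)
 fix e :: real assume "e > 0"
 then have "e / \<bar>c\<bar> > 0" using False by simp
 moreover have "{v\<in>X. e <= \<bar>c * u v\<bar>} = {v\<in>X. e / \<bar>c\<bar> <= \<bar>u v\<bar>}"
 using False by (simp add: abs_mult field_simps)
 ultimately show "finite {v\<in>X. e <= \<bar>c * u v\<bar>}"
 using assms by (simp add: vanishing_def)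
 qed
qed

lemma vanishing_multc: "vanishing X u ==> vanishing X (%x. u x * c)"
 using vanishing_cmult[of X u c] by (simp add: mult.commute)

lemma vanishing_0: "vanishing X (%x. 0)"
 by (simp add: vanishing_def)

lemma vanishing_diff:
 assumes "vanishing X u" "vanishing X w"
 shows "vanishing X (%x. u x - w x)"
 using vanishing_add[OF assms(1) vanishing_cmult[OF assms(2), of "-1"]] by simp

lemma vanishing_sum:
 "(!!z. z : A ==> vanishing X (u z)) ==> vanishing X (%x. \<Sum>z\<in>A. u z x)"
 by (induction A rule: infinite_finite_induct) (auto intro: vanishing_add vanishing_0)

text \<open>\<open>lap\<close> is the positive Laplacian, so superharmonic means \<open>lap\<close>
  >= 0. The function \<open>q\<close> stands in for connectedness and unboundedness: every vertex
  has a neighbour with strictly larger \<open>q\<close>, which is all that the minimum principle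
  uses.\<close>

locale cable =
 fixes X :: "'a set" and nb :: "'a => 'a set" and q :: "'a => real"
 and g :: "'a => 'a => real" and \<kappa> :: real
 assumes finite_nb: "v : X ==> finite (nb v)"
 and nb_subset: "v : X ==> nb v <= X"
 and nb_sym: "u : X ==> v : nb u ==> u : nb v"
 and q_increases: "v : X ==> \<exists>y\<in>nb v. q v < q y"
 and kappa_pos: "\<kappa> > 0"
 and lap_g: "v : X ==> z : X ==> lap nb (%x. g x z) v = (if v = z then \<kappa> else 0)"
 and vanishing_g: "z : X ==> vanishing X (%x. g x z)"
 and g_sym: "x : X ==> y : X ==> g x y = g y x"
begin

text \<open>A negative infimum is attained, and only at finitely many vertices. Among the minimisers
  take one with largest \<open>q\<close>: superharmonicity makes all its neighbours minimisers, yet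
  one of them has larger \<open>q\<close>.\<close>

lemma minimum_principle:
 assumes W: "W <= X" and fin: "!!m. m < 0 ==> finite {v\<in>W. u v <= m}"
 and nbW: "!!v. v : W - S ==> nb v <= W"
 and sup: "!!v. v : W - S ==> lap nb u v >= 0"
 and bd: "!!v. v : W Int S ==> u v >= 0"
 and v: "v : W"
 shows "u v >= 0"
proof (rule ccontr)
 assume "~ u v >= 0"
 then have neg: "u v < 0" by simp
 define F where "F = {x\<in>W. u x <= u v}"
 have F: "finite F" "v : F" using fin[OF neg] v by (auto simp: F_def)
 define m where "m = Min (u ` F)"
 define F2 where "F2 = {x\<in>F. u x = m}"
 have "m : u ` F" unfolding m_def using F by (intro Min_in) auto
 then have "F2 ~= {}" by (auto simp: F2_def)
 moreover have F2: "finite F2" using F by (simp add: F2_def)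
 ultimately have "Max (q ` F2) : q ` F2" by (intro Max_in) auto
 then obtain x where x: "x : F2" "q x = Max (q ` F2)" by auto
 have mle: "m <= u y" if "y : W" for y
 proof (cases "y : F")
 case True then show ?thesis unfolding m_def using F by (intro Min_le) auto
 next
 case False
 then have "u v < u y" using that by (auto simp: F_def)
 moreover have "m <= u v" unfolding m_def using F by (intro Min_le) auto
 ultimately show ?thesis by simp
 qed
 have xW: "x : W" "u x = m" "m <= u v" using x by (auto simp: F2_def F_def)
 then have xS: "x : W - S" using bd[of x] neg by auto
 have xX: "x : X" using xW W by auto
 obtain y where y: "y : nb x" "q x < q y" using q_increases[OF xX] by auto
 have le: "\<forall>z\<in>nb x. u x - u z <= 0" using nbW[OF xS] mle xW by auto
 then have "lap nb u x <= 0" unfolding lap_def by (intro sum_nonpos) auto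
 then have "(\<Sum>z\<in>nb x. u z - u x) = 0"
 using sup[OF xS] unfolding lap_def by (simp add: sum_subtractf)
 then have "u y - u x = 0"
 using le y finite_nb[OF xX] by (subst (asm) sum_nonneg_eq_0_iff) auto
 then have "y : F2" using xW nbW[OF xS] y by (auto simp: F2_def F_def)
 then have "q y <= q x" unfolding x(2) using F2 by (intro Max_ge) auto
 then show False using y by simp
qed

lemma vanishing_fin: "vanishing X u ==> m < 0 ==> finite {v\<in>X. u v <= m}"
 unfolding vanishing_def
 by (drule spec[of _ "-m"]) (auto elim!: rev_finite_subset)

lemma superharmonic_nonneg:
 assumes "vanishing X u" "!!v. v : X - S ==> lap nb u v >= 0"
 "!!v. v : X Int S ==> u v >= 0" "v : X"
 shows "u v >= 0"
 by (rule minimum_principle[where W = X and S = S])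
 (use assms vanishing_fin nb_subset in auto)

lemma harmonic_unique:
 assumes "vanishing X u" "vanishing X w" "!!v. v : X - S ==> lap nb u v = lap nb w v"
 "!!v. v : X Int S ==> u v = w v" "v : X"
 shows "u v = w v"
proof (rule antisym)
 have "w v - u v >= 0"
 by (rule superharmonic_nonneg[where S = S]) (use assms in \<open>auto intro: vanishing_diff simp: lap_diff\<close>)
 then show "u v <= w v" by simp
 have "u v - w v >= 0"
 by (rule superharmonic_nonneg[where S = S]) (use assms in \<open>auto intro: vanishing_diff simp: lap_diff\<close>)
 then show "w v <= u v" by simp
qed

lemma g_nonneg: "x : X ==> z : X ==> g x z >= 0"
 by (rule superharmonic_nonneg[where S = "{}" and u = "%x. g x z"])
 (use vanishing_g lap_g kappa_pos in auto)

section \<open>Harmonic measure and killed Green functions\<close>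

definition is_hm :: "'a set => ('a => 'a => real) => bool" where
 "is_hm S H \<longleftrightarrow> (\<forall>z\<in>S. vanishing X (%x. H x z) \<and>
 (\<forall>x\<in>X - S. lap nb (%x. H x z) x = 0) & (\<forall>x\<in>S. H x z = (if x = z then 1 else 0)))"

lemma killed_green_props:
 assumes S: "finite S" "S <= X" and H: "is_hm S H" and y: "y : X"
 defines "G \<equiv> %x. g x y - (\<Sum>z\<in>S. H x z * g z y)"
 shows "vanishing X G" "!!x. x : X - S ==> lap nb G x = (if x = y then \<kappa> else 0)"
 "!!x. x : S ==> G x = 0"
proof -
 show "vanishing X G" unfolding G_def
 using H y by (intro vanishing_diff vanishing_g vanishing_sum vanishing_multc) (auto simp: is_hm_def)
 show "lap nb G x = (if x = y then \<kappa> else 0)" if "x : X - S" for x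
 proof -
 have "lap nb (%x. \<Sum>z\<in>S. H x z * g z y) x = (\<Sum>z\<in>S. lap nb (%x. H x z) x * g z y)"
 by (simp add: lap_sum lap_multc)
 also have "... = 0" using H that by (intro sum.neutral) (auto simp: is_hm_def)
 finally show ?thesis unfolding G_def lap_diff using lap_g[of x y] that y by simp
 qed
 show "G x = 0" if "x : S" for x
 proof -
 have "(\<Sum>z\<in>S. H x z * g z y) = (\<Sum>z\<in>S. (if x = z then 1 else 0) * g z y)"
 using H that by (intro sum.cong) (auto simp: is_hm_def)
 also have "... = (\<Sum>z\<in>S. if z = x then g z y else 0)" by (intro sum.cong) auto
 also have "... = g x y" using S that by simp
 finally show ?thesis by (simp add: G_def)
 qed
qed

text \<open>As G is nonnegative, \<kappa>, the sum of G y - G x over the neighbours x of y, is at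
  most deg(y) G y.\<close>

lemma killed_green_diag_pos:
 assumes S: "finite S" "S <= X" and H: "is_hm S H" and y: "y : X - S"
 shows "g y y - (\<Sum>z\<in>S. H y z * g z y) > 0"
proof -
 let ?G = "%x. g x y - (\<Sum>z\<in>S. H x z * g z y)"
 have yX: "y : X" using y by simp
 note P = killed_green_props[OF S H yX]
 have nn: "?G x >= 0" if "x : X" for x
 by (rule superharmonic_nonneg[where S = S]) (use P kappa_pos that in auto)
 have "\<kappa> = (\<Sum>x\<in>nb y. ?G y - ?G x)" using P(2)[of y] y by (simp add: lap_def)
 also have "... <= (\<Sum>x\<in>nb y. ?G y)"
 using nn nb_subset[OF yX] by (intro sum_mono) (auto simp: subset_iff)
 finally have "\<kappa> <= real (card (nb y)) * ?G y" by simp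
 then show ?thesis using kappa_pos by (smt (verit) mult_nonneg_nonpos of_nat_0_le_iff)
qed

text \<open>One vertex v is added at a time. The killed Green function with pole v, normalised to 1
  at v, is the probability of hitting v before S; a multiple of it corrects the old kernel so that
  it vanishes at v.\<close>

lemma ex_hm: "finite S ==> S <= X ==> EX H. is_hm S H"
proof (induction S rule: finite_induct)
 case empty
 then show ?case by (simp add: is_hm_def)
next
 case (insert v S)
 then obtain H where H: "is_hm S H" by auto
 have S: "finite S" "S <= X" and v: "v : X - S" using insert by auto
 define G where "G x = g x v - (\<Sum>z\<in>S. H x z * g z v)" for x
 have vX: "v : X" using v by simp
 note P = killed_green_props[OF S H vX, folded G_def]
 have Gv: "G v > 0" using killed_green_diag_pos[OF S H v] by (simp add: G_def)
 define h where "h x = G x * inverse (G v)" for x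
 have h: "vanishing X h" "!!x. x : X - insert v S ==> lap nb h x = 0" "!!x. x : S ==> h x = 0" "h v = 1"
 using P Gv v by (auto simp: h_def[abs_def] lap_multc intro!: vanishing_multc)
 define H' where "H' x z = (if z = v then h x else H x z - h x * H v z)" for x z
 have "is_hm (insert v S) H'" unfolding is_hm_def
 proof
 fix z assume z: "z : insert v S"
 show "vanishing X (%x. H' x z) & (\<forall>x\<in>X - insert v S. lap nb (%x. H' x z) x = 0) \<and>
 (\<forall>x\<in>insert v S. H' x z = (if x = z then 1 else 0))"
 proof (cases "z = v")
 case True
 then show ?thesis using h v by (auto simp: H'_def)
 next
 case False
 then have zS: "z : S" using z by auto
 have e: "H' x z = H x z - h x * H v z" for x using False by (simp add: H'_def)
 show ?thesis unfolding e
 using H zS h v by (auto simp: is_hm_def lap_diff lap_multc intro!: vanishing_diff vanishing_multc)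
 qed
 qed
 then show ?case by blast
qed

text \<open>The solution is unique on X by \<open>harmonic_unique\<close>, so the choice is
  harmless. The value 0 for z outside S allows sums over S to be extended to larger sets.\<close>

definition hm :: "'a set => 'a => 'a => real" where
 "hm S x z = (if z : S then (SOME H. is_hm S H) x z else 0)"

text \<open>The Green function of the walk killed on S, by the last-exit form of the strong Markov
  property.\<close>

definition kg :: "'a set => 'a => 'a => real" where
 "kg S x y = g x y - (\<Sum>z\<in>S. hm S x z * g z y)"

context
 fixes S assumes S: "finite S" "S <= X"
begin

lemma is_hm_hm: "is_hm S (hm S)"
proof -
 have "is_hm S (SOME H. is_hm S H)" using ex_hm[OF S] by (rule someI_ex)
 then show ?thesis unfolding is_hm_def by (simp add: hm_def[abs_def] is_hm_def[abs_def])
qed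

lemma vanishing_hm: "vanishing X (%x. hm S x z)"
 using is_hm_hm by (cases "z : S") (auto simp: is_hm_def hm_def vanishing_0)

lemma lap_hm: "x : X - S ==> lap nb (%x. hm S x z) x = 0"
 using is_hm_hm by (cases "z : S") (auto simp: is_hm_def hm_def lap_const)

lemma hm_on: "x : S ==> hm S x z = (if x = z then 1 else 0)"
 using is_hm_hm by (cases "z : S") (auto simp: is_hm_def hm_def)

lemma sum_hm_on: "x : S ==> (\<Sum>z\<in>S. hm S x z * f z) = f x"
proof -
 assume x: "x : S"
 have "(\<Sum>z\<in>S. hm S x z * f z) = (\<Sum>z\<in>S. if z = x then f z else 0)"
 using x by (intro sum.cong) (auto simp: hm_on)
 then show ?thesis using S x by simp
qed

lemma vanishing_hm_sum: "vanishing X (%x. \<Sum>z\<in>A. hm S x z * f z)"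
 by (intro vanishing_sum vanishing_multc vanishing_hm)

lemma lap_hm_sum: "x : X - S ==> lap nb (%x. \<Sum>z\<in>A. hm S x z * f z) x = 0"
 by (simp add: lap_sum lap_multc lap_hm)

lemma vanishing_kg: "y : X ==> vanishing X (%x. kg S x y)"
 unfolding kg_def by (rule killed_green_props(1)[OF S is_hm_hm])

lemma lap_kg: "y : X ==> x : X - S ==> lap nb (%x. kg S x y) x = (if x = y then \<kappa> else 0)"
 unfolding kg_def by (rule killed_green_props(2)[OF S is_hm_hm])

lemma kg_on: "x : S ==> kg S x y = 0"
 by (simp add: kg_def sum_hm_on)

lemma kg_diag_pos: "y : X - S ==> kg S y y > 0"
 unfolding kg_def by (rule killed_green_diag_pos[OF S is_hm_hm])

lemma kg_nonneg: "x : X ==> y : X ==> kg S x y >= 0"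
 by (rule superharmonic_nonneg[where S = S and u = "%x. kg S x y"])
 (use vanishing_kg lap_kg kg_on kappa_pos in auto)

lemma kg_on2: "x : X ==> y : S ==> kg S x y = 0"
 by (rule harmonic_unique[where S = S and u = "%x. kg S x y" and w = "%x. 0"])
 (use S vanishing_kg lap_kg kg_on in \<open>auto simp: vanishing_0 lap_const\<close>)

lemma hm_nonneg: "x : X ==> hm S x z >= 0"
 by (rule superharmonic_nonneg[where S = S and u = "%x. hm S x z"])
 (use vanishing_hm lap_hm hm_on in auto)

text \<open>Minimum principle for u minus its harmonic extension from S. Only the negative part of u
  has to vanish at infinity, so constants qualify and give total harmonic measure at most 1.\<close>

lemma hm_sum_le_superharmonic:
 assumes "!!v. v : X ==> lap nb u v >= 0" "!!m. m < 0 ==> finite {v\<in>X. u v <= m}" "x : X"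
 shows "(\<Sum>z\<in>S. hm S x z * u z) <= u x"
proof -
 let ?w = "%x. u x - (\<Sum>z\<in>S. hm S x z * u z)"
 have "?w x >= 0"
 proof (rule minimum_principle[where W = X and S = S])
 fix m :: real assume m: "m < 0"
 have "{v\<in>X. ?w v <= m} <= {v\<in>X. u v <= m/2} Un {v\<in>X. - m/2 <= \<bar>\<Sum>z\<in>S. hm S v z * u z\<bar>}"
 by (auto simp: abs_if split: if_splits)
 moreover have "finite {v\<in>X. - m/2 <= \<bar>\<Sum>z\<in>S. hm S v z * u z\<bar>}"
 using vanishing_hm_sum[where A = S and f = u] m unfolding vanishing_def by (auto dest: spec[of _ "-m/2"])
 ultimately show "finite {v\<in>X. ?w v <= m}"
 using assms(2)[of "m/2"] m by (auto elim!: finite_subset)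
 next
 fix v assume v: "v : X - S"
 then show "lap nb ?w v >= 0" using assms(1)[of v] by (simp add: lap_diff lap_hm_sum)
 next
 fix v assume "v : X Int S"
 then show "?w v >= 0" by (simp add: sum_hm_on)
 qed (use assms nb_subset in auto)
 then show ?thesis by simp
qed

lemma sum_hm_le_1: "x : X ==> (\<Sum>z\<in>S. hm S x z) <= 1"
 using hm_sum_le_superharmonic[of "%_. 1" x] by (simp add: lap_const)

lemma hm_g_le: "x : X ==> y : X ==> (\<Sum>z\<in>S. hm S x z * g z y) <= g x y"
 using kg_nonneg[of x y] by (simp add: kg_def)

end

text \<open>Strong Markov property at the first visit to B: both sides agree on B, vanish at
  infinity and are harmonic off B.\<close>

lemma hm_Markov:
 assumes B: "finite B" "B <= X" and A: "A <= B" and x: "x : X"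
 shows "hm A x z = (\<Sum>y\<in>B. hm B x y * hm A y z)"
proof -
 have A': "finite A" "A <= X" using A B finite_subset by auto
 show ?thesis
 proof (rule harmonic_unique[where S = B and u = "%x. hm A x z"])
 show "lap nb (%x. hm A x z) v = lap nb (%x. \<Sum>y\<in>B. hm B x y * hm A y z) v" if "v : X - B" for v
 using that A lap_hm[OF A', of v z] lap_hm_sum[OF B, of v] by auto
 qed (use A' B x in \<open>auto simp: vanishing_hm vanishing_hm_sum sum_hm_on\<close>)
qed

lemma kg_Markov:
 assumes B: "finite B" "B <= X" and A: "A <= B" and x: "x : X" and y: "y : X"
 shows "kg A x y = (\<Sum>z\<in>B. hm B x z * kg A z y) + kg B x y"
proof -
 have A': "finite A" "A <= X" using A B finite_subset by auto
 have "kg A x y - kg B x y = (\<Sum>z\<in>B. hm B x z * kg A z y)"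
 proof (rule harmonic_unique[where S = B and u = "%x. kg A x y - kg B x y"])
 show "vanishing X (%x. kg A x y - kg B x y)" using A' B y by (intro vanishing_diff vanishing_kg)
 show "vanishing X (%x. \<Sum>z\<in>B. hm B x z * kg A z y)" by (rule vanishing_hm_sum[OF B])
 show "lap nb (%x. kg A x y - kg B x y) v = lap nb (%x. \<Sum>z\<in>B. hm B x z * kg A z y) v" if "v : X - B" for v
 using that A A' B y by (simp add: lap_diff lap_hm_sum) (subst lap_kg, auto)+
 show "kg A v y - kg B v y = (\<Sum>z\<in>B. hm B v z * kg A z y)" if "v : X Int B" for v
 using that B by (simp add: kg_on sum_hm_on)
 qed (rule x)
 then show ?thesis by simp
qed

text \<open>In the Markov decomposition at B keep only the term y = z, where \<open>hm A z z\<close>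
  is 1.\<close>

lemma hm_antimono:
 assumes B: "finite B" "B <= X" and A: "A <= B" and x: "x : X" and z: "z : A"
 shows "hm B x z <= hm A x z"
proof -
 have A': "finite A" "A <= X" using A B finite_subset by auto
 have "hm B x z * hm A z z <= (\<Sum>y\<in>B. hm B x y * hm A y z)"
 using B A A' z x by (intro member_le_sum) (auto intro!: mult_nonneg_nonneg hm_nonneg)
 then show ?thesis using hm_Markov[OF B A x, of z] hm_on[OF A' z, of z] by simp
qed

text \<open>The left-hand side is the expected time spent at y after the walk from x has met both sets.\<close>
lemma meeting_both_le:
 assumes A: "finite A" "A <= X" and B: "finite B" "B <= X" and x: "x : X" and y: "y : X"
 shows "(g x y - kg A x y) + (g x y - kg B x y) - (g x y - kg (A Un B) x y) <=
 (\<Sum>z\<in>A. hm A x z * (\<Sum>w\<in>B. hm B z w * g w y)) + (\<Sum>w\<in>B. hm B x w * (\<Sum>z\<in>A. hm A w z * g z y))"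
proof -
 let ?C = "A Un B"
 have C: "finite ?C" "?C <= X" using A B by auto
 have 1: "kg B x y - kg ?C x y = (\<Sum>z\<in>?C. hm ?C x z * kg B z y)"
 using kg_Markov[OF C _ x y, of B] by simp
 also have "... = (\<Sum>z\<in>A. hm ?C x z * kg B z y)"
 using A B by (intro sum.mono_neutral_right) (auto simp: kg_on)
 finally have 1: "kg B x y - kg ?C x y = (\<Sum>z\<in>A. hm ?C x z * kg B z y)" .
 have 2: "g x y - kg A x y = (\<Sum>z\<in>A. hm A x z * g z y)" by (simp add: kg_def)
 have 3: "g z y = (\<Sum>w\<in>B. hm B z w * g w y) + kg B z y" for z by (simp add: kg_def)
 have d: "hm A x z - hm ?C x z <= (\<Sum>w\<in>B. hm B x w * hm A w z)" if z: "z : A" for z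
 proof -
 have "hm A x z = (\<Sum>w\<in>?C. hm ?C x w * hm A w z)" using hm_Markov[OF C _ x, of A z] by simp
 also have "... = (\<Sum>w\<in>A. hm ?C x w * hm A w z) + (\<Sum>w\<in>B - A. hm ?C x w * hm A w z)"
 using A B by (subst sum.union_disjoint[symmetric]) (auto intro: sum.cong)
 also have "(\<Sum>w\<in>A. hm ?C x w * hm A w z) = (\<Sum>w\<in>A. if w = z then hm ?C x w else 0)"
 using A by (intro sum.cong) (auto simp: hm_on)
 also have "... = hm ?C x z" using A z by simp
 also have "(\<Sum>w\<in>B - A. hm ?C x w * hm A w z) <= (\<Sum>w\<in>B - A. hm B x w * hm A w z)"
 using A B C x by (intro sum_mono mult_right_mono hm_antimono hm_nonneg) auto
 also have "... <= (\<Sum>w\<in>B. hm B x w * hm A w z)"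
 using A B x by (intro sum_mono2) (auto intro!: mult_nonneg_nonneg hm_nonneg)
 finally show ?thesis by simp
 qed
 have "(g x y - kg A x y) + (g x y - kg B x y) - (g x y - kg ?C x y) =
 (\<Sum>z\<in>A. hm A x z * g z y) - (\<Sum>z\<in>A. hm ?C x z * kg B z y)" using 1 2 by simp
 also have "... = (\<Sum>z\<in>A. hm A x z * (\<Sum>w\<in>B. hm B z w * g w y)) + (\<Sum>z\<in>A. (hm A x z - hm ?C x z) * kg B z y)"
 by (subst 3) (simp add: algebra_simps sum.distrib sum_subtractf)
 also have "(\<Sum>z\<in>A. (hm A x z - hm ?C x z) * kg B z y) <= (\<Sum>z\<in>A. (\<Sum>w\<in>B. hm B x w * hm A w z) * g z y)"
 proof (intro sum_mono mult_mono d)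
 fix z assume z: "z : A"
 then have zX: "z : X" using A by auto
 show "kg B z y <= g z y" using hm_nonneg[OF B] g_nonneg B y zX unfolding kg_def
 by (auto intro!: sum_nonneg mult_nonneg_nonneg)
 show "kg B z y >= 0" by (rule kg_nonneg[OF B zX y])
 show "0 <= (\<Sum>w\<in>B. hm B x w * hm A w z)" using A B x by (intro sum_nonneg mult_nonneg_nonneg hm_nonneg) auto
 qed
 also have "... = (\<Sum>w\<in>B. hm B x w * (\<Sum>z\<in>A. hm A w z * g z y))"
 by (subst sum_distrib_right, subst sum.swap) (simp add: sum_distrib_left algebra_simps)
 finally show ?thesis by simp
qed

end

section \<open>Gaussian vectors and the Harris inequality\<close>

abbreviation std_normal :: "real measure" where
 "std_normal \<equiv> density lborel std_normal_density"

context prob_space begin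

text \<open>At t = 0 the hypothesis says that D has mean 0, so 1 + D is a probability density. Y has
  the same characteristic function under M and under the reweighted measure, hence the same law, and
  the contribution of D cancels.\<close>

lemma charfun_real_weight_unique:
 fixes D :: "'a => real"
 assumes D: "D : borel_measurable M" "!!x. \<bar>D x\<bar> <= 1"
 and Y: "Y : borel_measurable M"
 and E: "!!t. (CLINT x|M. complex_of_real (D x) * iexp (t * Y x)) = 0"
 and A: "A : sets borel"
 shows "expectation (%x. D x * indicator A (Y x)) = 0"
proof -
 have bnd: "integrable M (%x. D x * f x)" if "f : borel_measurable M" "!!x. \<bar>f x\<bar> <= 1" for f :: "'a => real"
 using D that by (intro integrable_const_bound[where B = 1]) (auto simp: abs_mult intro!: mult_le_one AE_I2)
 have intD: "integrable M D" using bnd[of "%_. 1"] by simp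
 have "(CLINT x|M. complex_of_real (D x)) = 0" using E[of 0] by simp
 then have D0: "expectation D = 0" by (simp add: integral_complex_of_real)
 let ?w = "%x. 1 + D x"
 have w: "?w x >= 0" for x using D(2)[of x] by (simp add: abs_le_iff)
 let ?N = "density M ?w"
 have em: "emeasure ?N (space M) = 1"
 proof -
 have "emeasure ?N (space M) = (\<integral>\<^sup>+x. ennreal (?w x) \<partial>M)"
 using D by (subst emeasure_density) (auto intro!: nn_integral_cong)
 also have "... = ennreal (expectation ?w)"
 using w intD by (intro nn_integral_eq_integral) auto
 also have "expectation ?w = 1" using intD D0 by (simp add: prob_space)
 finally show ?thesis by simp
 qed
 have N: "prob_space ?N" using em by (intro prob_spaceI) simp
 let ?P = "distr ?N borel Y" and ?Q = "distr M borel Y"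
 have mY: "Y : measurable ?N borel" using Y by simp
 have rP: "real_distribution ?P"
 using prob_space.real_distribution_distr[OF N] mY by simp
 have rQ: "real_distribution ?Q" using Y by (rule real_distribution_distr)
 have "char ?P t = char ?Q t" for t
 proof -
 have b1: "integrable M (%x. iexp (t * Y x))"
 using Y by (intro integrable_const_bound[where B = 1]) (auto intro!: AE_I2)
 have b2: "integrable M (%x. complex_of_real (D x) * iexp (t * Y x))"
 using D Y by (intro integrable_const_bound[where B = 1]) (auto intro!: AE_I2 simp: norm_mult)
 have "char ?P t = (CLINT x|?N. iexp (t * Y x))"
 unfolding char_def using mY by (subst integral_distr) auto
 also have "... = (CLINT x|M. ?w x *\<^sub>R iexp (t * Y x))"
 using D Y w by (subst integral_density) (auto intro!: AE_I2)
 also have "... = (CLINT x|M. iexp (t * Y x) + complex_of_real (D x) * iexp (t * Y x))"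
 by (intro Bochner_Integration.integral_cong) (auto simp: scaleR_conv_of_real algebra_simps)
 also have "... = (CLINT x|M. iexp (t * Y x))"
 using b1 b2 E[of t] by simp
 also have "... = char ?Q t"
 unfolding char_def using Y by (subst integral_distr) auto
 finally show ?thesis .
 qed
 then have PQ: "?P = ?Q" by (intro Levy_uniqueness rP rQ) (auto simp: fun_eq_iff)
 have ind: "(%x. indicator A (Y x) :: real) : borel_measurable M" using A Y by measurable
 have i1: "integrable M (%x. D x * indicator A (Y x))" by (rule bnd[OF ind]) (auto simp: indicator_def)
 have i2: "integrable M (%x. indicator A (Y x) :: real)"
 using ind by (intro integrable_const_bound[where B = 1]) (auto intro!: AE_I2 simp: indicator_def)
 have "(\<integral>y. indicat_real A y \<partial>?P) = (\<integral>x. indicat_real A (Y x) \<partial>?N)"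
 using mY A by (subst integral_distr) auto
 also have "... = (\<integral>x. ?w x *\<^sub>R indicator A (Y x) \<partial>M)"
 using D w ind by (subst integral_density) (auto intro!: AE_I2)
 also have "... = expectation (%x. indicator A (Y x) + D x * indicator A (Y x))"
 by (intro Bochner_Integration.integral_cong) (auto simp: algebra_simps)
 also have "... = expectation (%x. indicator A (Y x)) + expectation (%x. D x * indicator A (Y x))"
 using i1 i2 by simp
 also have "expectation (%x. indicat_real A (Y x)) = (\<integral>y. indicat_real A y \<partial>?Q)"
 using Y A by (subst integral_distr) auto
 finally show ?thesis unfolding PQ by simp
qed

text \<open>Conjugation changes t into -t, so the hypothesis passes to the real and imaginary parts
  of V.\<close>

lemma charfun_weight_unique:
 fixes V :: "'a => complex"
 assumes V: "V : borel_measurable M" "!!x. cmod (V x) <= 1"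
 and Y: "Y : borel_measurable M"
 and E: "!!t. (CLINT x|M. V x * iexp (t * Y x)) = 0"
 and A: "A : sets borel"
 shows "(CLINT x|M. V x * of_real (indicator A (Y x))) = 0"
proof -
 have int: "integrable M (%x. f x)" if "f : borel_measurable M" "!!x. cmod (f x) <= 1" for f :: "'a => complex"
 using that by (intro integrable_const_bound[where B = 1]) (auto intro!: AE_I2)
 have i1: "integrable M (%x. V x * iexp (t * Y x))" for t using V Y by (intro int) (auto simp: norm_mult)
 have E': "(CLINT x|M. cnj (V x) * iexp (t * Y x)) = 0" for t
 proof -
 have "(CLINT x|M. cnj (V x) * iexp (t * Y x)) = (CLINT x|M. cnj (V x * iexp ((-t) * Y x)))"
 by (intro Bochner_Integration.integral_cong) (auto simp: exp_cnj)
 also have "... = cnj (CLINT x|M. V x * iexp ((-t) * Y x))" by (rule Bochner_Integration.integral_cnj)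
 finally show ?thesis using E[of "-t"] by simp
 qed
 have i2: "integrable M (%x. cnj (V x) * iexp (t * Y x))" for t
 proof (rule int)
 have "(%x. cnj (V x)) : borel_measurable M"
 by (rule measurable_compose[OF V(1)]) (intro borel_measurable_continuous_onI continuous_intros)
 then show "(%x. cnj (V x) * iexp (t * Y x)) : borel_measurable M" using Y by measurable
 qed (use V in \<open>auto simp: norm_mult\<close>)
 have re: "complex_of_real (Re z) = (z + cnj z) / 2" and im: "complex_of_real (Im z) = (z - cnj z) / (2 * \<i>)" for z
 by (auto simp: complex_eq_iff)
 have R: "expectation (%x. Re (V x) * indicator A (Y x)) = 0"
 proof (rule charfun_real_weight_unique)
 show "\<bar>Re (V x)\<bar> <= 1" for x using V(2)[of x] abs_Re_le_cmod order_trans by blast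
 show "(CLINT x|M. complex_of_real (Re (V x)) * iexp (t * Y x)) = 0" for t
 proof -
 have "(CLINT x|M. complex_of_real (Re (V x)) * iexp (t * Y x))
 = (CLINT x|M. (V x * iexp (t * Y x) + cnj (V x) * iexp (t * Y x)) / 2)"
 unfolding re by (intro Bochner_Integration.integral_cong) (auto simp: algebra_simps)
 then show ?thesis using E[of t] E'[of t] i1[of t] i2[of t] by simp
 qed
 qed (use V Y A in auto)
 have I: "expectation (%x. Im (V x) * indicator A (Y x)) = 0"
 proof (rule charfun_real_weight_unique)
 show "\<bar>Im (V x)\<bar> <= 1" for x using V(2)[of x] abs_Im_le_cmod order_trans by blast
 show "(CLINT x|M. complex_of_real (Im (V x)) * iexp (t * Y x)) = 0" for t
 proof -
 have "(CLINT x|M. complex_of_real (Im (V x)) * iexp (t * Y x))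
 = (CLINT x|M. (V x * iexp (t * Y x) - cnj (V x) * iexp (t * Y x)) / (2 * \<i>))"
 unfolding im by (intro Bochner_Integration.integral_cong) (auto simp: algebra_simps)
 then show ?thesis using E[of t] E'[of t] i1[of t] i2[of t] by simp
 qed
 qed (use V Y A in auto)
 have iV: "integrable M (%x. V x * of_real (indicator A (Y x)))"
 using V Y A by (intro int) (auto simp: norm_mult indicator_def)
 have "Re (CLINT x|M. V x * of_real (indicator A (Y x))) = 0"
 using R integral_Re[OF iV] by simp
 moreover have "Im (CLINT x|M. V x * of_real (indicator A (Y x))) = 0"
 using I integral_Im[OF iV] by simp
 ultimately show ?thesis by (simp add: complex_eq_iff)
qed

text \<open>The exponentials are exchanged for indicators one coordinate at a time.\<close>
lemma std_normal_prod:
 assumes fin: "finite J" "finite I" "I Int J = {}"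
 and Z: "!!j. j : I Un J ==> Z j : borel_measurable M"
 and char: "!!b. (CLINT x|M. iexp (\<Sum>j\<in>I Un J. b j * Z j x)) = of_real (exp (- (\<Sum>j\<in>I Un J. (b j)\<^sup>2) / 2))"
 and A: "!!j. A j : sets borel"
 shows "(CLINT x|M. of_real (\<Prod>j\<in>J. indicator (A j) (Z j x)) * iexp (\<Sum>j\<in>I. b j * Z j x))
 = of_real ((\<Prod>j\<in>J. prob (Z j -` A j Int space M)) * exp (- (\<Sum>j\<in>I. (b j)\<^sup>2) / 2))"
 using fin Z char
proof (induction J arbitrary: I b rule: finite_induct)
 case empty
 then show ?case by simp
next
 case (insert k J)
 have IJ: "insert k I Un J = I Un insert k J" by auto
 have kI: "k ~: I" "k ~: J" using insert by auto
 have IH: "(CLINT x|M. of_real (\<Prod>j\<in>J. indicator (A j) (Z j x)) * iexp (\<Sum>j\<in>insert k I. b j * Z j x))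
 = of_real ((\<Prod>j\<in>J. prob (Z j -` A j Int space M)) * exp (- (\<Sum>j\<in>insert k I. (b j)\<^sup>2) / 2))" for b
 by (rule insert.IH) (use insert in \<open>auto simp: IJ\<close>)
 have Zk: "Z k : borel_measurable M" using insert by auto
 have mZ: "!!j. j : I ==> Z j : borel_measurable M" "!!j. j : J ==> Z j : borel_measurable M"
 using insert by auto
 define W where "W x = complex_of_real (\<Prod>j\<in>J. indicator (A j) (Z j x)) * iexp (\<Sum>j\<in>I. b j * Z j x)" for x
 have "(%x. \<Prod>j\<in>J. indicator (A j) (Z j x) :: real) : borel_measurable M"
 by (intro borel_measurable_prod measurable_compose[OF mZ(2)] borel_measurable_indicator A)
 then have mW: "W : borel_measurable M"
 unfolding W_def[abs_def] using mZ(1) by measurable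
 have W1: "cmod (W x) <= 1" for x
 by (auto simp: W_def norm_mult prod_norm[symmetric] indicator_def intro!: prod_le_1)
 define c where "c = (\<Prod>j\<in>J. prob (Z j -` A j Int space M)) * exp (- (\<Sum>j\<in>I. (b j)\<^sup>2) / 2)"
 have c1: "\<bar>c\<bar> <= 1" 
 unfolding c_def abs_mult by (intro mult_le_one) (auto simp: abs_prod intro!: prod_le_1 sum_nonneg)
 have EW: "(CLINT x|M. W x * iexp (t * Z k x)) = of_real (c * exp (- t\<^sup>2 / 2))" for t
 proof -
 have W: "(CLINT x|M. W x * iexp (t * Z k x)) =
 (CLINT x|M. of_real (\<Prod>j\<in>J. indicator (A j) (Z j x)) * iexp (\<Sum>j\<in>insert k I. (b(k := t)) j * Z j x))"
 proof (intro Bochner_Integration.integral_cong refl)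
 fix x
 have "(\<Sum>j\<in>insert k I. (b(k := t)) j * Z j x) = t * Z k x + (\<Sum>j\<in>I. b j * Z j x)"
 using kI insert.prems(1) by (auto intro!: sum.cong)
 then show "W x * iexp (t * Z k x) = of_real (\<Prod>j\<in>J. indicator (A j) (Z j x)) * iexp (\<Sum>j\<in>insert k I. (b(k := t)) j * Z j x)"
 by (simp only: W_def of_real_add distrib_left exp_add mult_ac)
 qed
 have "(\<Sum>j\<in>insert k I. ((b(k := t)) j)\<^sup>2) = t\<^sup>2 + (\<Sum>j\<in>I. (b j)\<^sup>2)"
 using kI insert.prems(1) by (auto intro!: sum.cong)
 then have "exp (- (\<Sum>j\<in>insert k I. ((b(k := t)) j)\<^sup>2) / 2) = exp (- (\<Sum>j\<in>I. (b j)\<^sup>2) / 2) * exp (- t\<^sup>2 / 2)"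
 by (simp add: exp_add[symmetric] field_simps)
 then have "(\<Prod>j\<in>J. prob (Z j -` A j Int space M)) * exp (- (\<Sum>j\<in>insert k I. ((b(k := t)) j)\<^sup>2) / 2) = c * exp (- t\<^sup>2 / 2)"
 by (simp add: c_def)
 then show ?thesis using IH[of "b(k := t)"] W by simp
 qed
 have EZ: "(CLINT x|M. iexp (t * Z k x)) = of_real (exp (- t\<^sup>2 / 2))" for t
 proof -
 let ?b = "%j. if j = k then t else 0"
 have "(\<Sum>j\<in>I Un insert k J. ?b j * Z j x) = t * Z k x" for x
 using insert.hyps insert.prems(1) kI by (subst sum.remove[of _ k]) (auto intro!: sum.neutral)
 moreover have "(\<Sum>j\<in>I Un insert k J. (?b j)\<^sup>2) = t\<^sup>2"
 using insert.hyps insert.prems(1) kI by (subst sum.remove[of _ k]) (auto intro!: sum.neutral)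
 ultimately show ?thesis using insert.prems(4)[of ?b] by simp
 qed
 \<comment> \<open>The constant c is the mean of W, and the centred W integrates to 0 against every
   exponential of \<open>Z k\<close>. Halving brings its modulus back below 1.\<close>
 let ?V = "%x. (W x - of_real c) / 2"
 have iW: "integrable M (%x. W x * f x)" "integrable M f" if "f : borel_measurable M" "!!x. cmod (f x) <= 1" for f
 using that mW W1 by (auto intro!: integrable_const_bound[where B = 1] AE_I2 simp: norm_mult mult_le_one)
 have "(CLINT x|M. ?V x * of_real (indicator (A k) (Z k x))) = 0"
 proof (rule charfun_weight_unique)
 show "cmod (?V x) <= 1" for x
 using W1[of x] c1 norm_triangle_ineq4[of "W x" "of_real c"] by (simp add: norm_divide)
 show "(CLINT x|M. ?V x * iexp (t * Z k x)) = 0" for t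
 proof -
 have m: "(%x. iexp (t * Z k x)) : borel_measurable M" using Zk by measurable
 have "(CLINT x|M. ?V x * iexp (t * Z k x)) = (CLINT x|M. (W x * iexp (t * Z k x) - of_real c * iexp (t * Z k x)) / 2)"
 by (intro Bochner_Integration.integral_cong) (auto simp: algebra_simps)
 also have "... = 0" using EW[of t] EZ[of t] iW[OF m] by simp
 finally show ?thesis .
 qed
 qed (use mW Zk A in auto)
 then have "(CLINT x|M. (W x * of_real (indicator (A k) (Z k x)) - of_real c * of_real (indicator (A k) (Z k x))) / 2) = 0"
 by (simp add: left_diff_distrib)
 moreover have m: "(%x. complex_of_real (indicator (A k) (Z k x))) : borel_measurable M" using Zk A by measurable
 ultimately have "(CLINT x|M. W x * of_real (indicator (A k) (Z k x))) = of_real c * (CLINT x|M. of_real (indicator (A k) (Z k x)))"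
 using iW[OF m] by (simp add: indicator_def)
 also have "(CLINT x|M. complex_of_real (indicator (A k) (Z k x))) = of_real (prob (Z k -` A k Int space M))"
 proof -
 have "(\<integral>x. indicat_real (A k) (Z k x) \<partial>M) = (\<integral>x. indicat_real (Z k -` A k Int space M) x \<partial>M)"
 by (intro Bochner_Integration.integral_cong) (auto simp: indicator_def)
 also have "... = prob (Z k -` A k Int space M)" by simp
 finally show ?thesis by (simp add: integral_complex_of_real)
 qed
 finally show ?case
 using insert.hyps by (simp add: W_def c_def mult_ac)
qed

lemma indep_std_normal:
 assumes fin: "finite J"
 and Z: "!!j. j : J ==> Z j : borel_measurable M"
 and char: "!!b. (CLINT x|M. iexp (\<Sum>j\<in>J. b j * Z j x)) = of_real (exp (- (\<Sum>j\<in>J. (b j)\<^sup>2) / 2))"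
 shows "indep_vars (%_. borel) Z J" "!!j. j : J ==> distr M borel (Z j) = std_normal"
proof -
 have P: "prob (\<Inter>j\<in>J'. Z j -` A j Int space M) = (\<Prod>j\<in>J'. prob (Z j -` A j Int space M))"
 if "J' <= J" "J' ~= {}" and A: "!!j. A j : sets borel" for J' A
 proof -
 have f: "finite J'" using that fin finite_subset by auto
 have c: "(CLINT x|M. iexp (\<Sum>j\<in>{} Un J'. b j * Z j x)) = of_real (exp (- (\<Sum>j\<in>{} Un J'. (b j)\<^sup>2) / 2))" for b
 proof -
 let ?b = "%j. if j : J' then b j else 0"
 have "(\<Sum>j\<in>J. ?b j * Z j x) = (\<Sum>j\<in>J'. b j * Z j x)" for x
 using that fin by (intro sum.mono_neutral_cong_right) auto
 moreover have "(\<Sum>j\<in>J. (?b j)\<^sup>2) = (\<Sum>j\<in>J'. (b j)\<^sup>2)"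
 using that fin by (intro sum.mono_neutral_cong_right) auto
 ultimately show ?thesis using char[of ?b] by simp
 qed
 have "(CLINT x|M. of_real (\<Prod>j\<in>J'. indicator (A j) (Z j x)) * iexp (\<Sum>j\<in>{}. 0 * Z j x)) =
 of_real ((\<Prod>j\<in>J'. prob (Z j -` A j Int space M)) * exp (- (\<Sum>j\<in>({}::'b set). (0::real)\<^sup>2) / 2))"
 by (rule std_normal_prod[OF f _ _ _ c A]) (use Z that in auto)
 then have "(CLINT x|M. complex_of_real (\<Prod>j\<in>J'. indicator (A j) (Z j x))) = of_real (\<Prod>j\<in>J'. prob (Z j -` A j Int space M))"
 by simp
 then have "expectation (%x. \<Prod>j\<in>J'. indicator (A j) (Z j x)) = (\<Prod>j\<in>J'. prob (Z j -` A j Int space M))"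
 by (simp only: integral_complex_of_real of_real_eq_iff)
 moreover have "expectation (%x. \<Prod>j\<in>J'. indicator (A j) (Z j x)) = expectation (indicat_real (\<Inter>j\<in>J'. Z j -` A j Int space M))"
 proof (intro Bochner_Integration.integral_cong refl)
 fix x assume "x : space M"
 then show "(\<Prod>j\<in>J'. indicat_real (A j) (Z j x)) = (indicator (\<Inter>j\<in>J'. Z j -` A j Int space M) x :: real)"
 using f by (auto simp: indicator_def prod_zero_iff)
 qed
 moreover have "(\<Inter>j\<in>J'. Z j -` A j Int space M) : events"
 using f that Z A by (intro sets.finite_INT) (auto intro!: measurable_sets[OF Z])
 ultimately show ?thesis by (simp add: integral_indicator)
 qed
 show "indep_vars (%_. borel) Z J"
 unfolding indep_vars_def2
 proof (intro conjI ballI indep_setsI)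
 show "Z i : borel_measurable M" if "i : J" for i using Z that by simp
 show "{Z i -` A Int space M |A. A : sets borel} <= events" if "i : J" for i
 using Z[OF that] by auto
 fix B J' assume J': "J' ~= {}" "J' <= J" "finite J'" and B: "\<forall>j\<in>J'. B j : {Z j -` A Int space M |A. A : sets borel}"
 have "EX A. A : sets borel & (j : J' \<longrightarrow> B j = Z j -` A Int space M)" for j
 using B by (cases "j : J'") auto
 then obtain A where A: "!!j. A j : sets borel" "!!j. j : J' ==> B j = Z j -` A j Int space M" by metis
 then show "prob (\<Inter> (B ` J')) = (\<Prod>j\<in>J'. prob (B j))" using P[of J' A] J' by (simp cong: INF_cong prod.cong)
 qed
 show "distr M borel (Z j) = std_normal" if j: "j : J" for j
 proof (rule Levy_uniqueness)
 show "real_distribution (distr M borel (Z j))" using Z[OF j] by (rule real_distribution_distr)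
 show "char (distr M borel (Z j)) = char std_normal"
 proof
 fix t
 let ?b = "%i. if i = j then t else (0::real)"
 have "(\<Sum>i\<in>J. ?b i * Z i x) = t * Z j x" for x
 using fin j by (subst sum.remove[of _ j]) (auto intro!: sum.neutral)
 moreover have "(\<Sum>i\<in>J. (?b i)\<^sup>2) = t\<^sup>2"
 using fin j by (subst sum.remove[of _ j]) (auto intro!: sum.neutral)
 ultimately have "(CLINT x|M. iexp (t * Z j x)) = of_real (exp (- t\<^sup>2 / 2))" using char[of ?b] by simp
 moreover have "char (distr M borel (Z j)) t = (CLINT x|M. iexp (t * Z j x))"
 unfolding char_def using Z[OF j] by (subst integral_distr) auto
 ultimately show "char (distr M borel (Z j)) t = char std_normal t"
 by (simp add: char_std_normal_distribution)
 qed
 qed (rule real_dist_normal_dist)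
qed

end

text \<open>With c the mean of f and d the infimum of g over the points where f >= c, monotonicity
  makes (f - c)(g - d) nonnegative everywhere; integrating gives the claim because f - c has mean
  0.\<close>

lemma Chebyshev_monotone:
 fixes f g :: "real => real"
 assumes N: "prob_space N" "sets N = sets borel"
 and f: "mono f" "f : borel_measurable borel" "!!x. \<bar>f x\<bar> <= B"
 and g: "mono g" "g : borel_measurable borel" "!!x. \<bar>g x\<bar> <= B"
 shows "(\<integral>x. f x \<partial>N) * (\<integral>x. g x \<partial>N) <= (\<integral>x. f x * g x \<partial>N)"
proof -
 interpret N: prob_space N by fact
 have m: "h : borel_measurable N" if "h : borel_measurable borel" for h :: "real => real"
 using that by (simp only: measurable_cong_sets[OF N(2) refl])
 have i: "integrable N f" "integrable N g"
 by (rule N.integrable_const_bound[where B = B]; use f(3) m[OF f(2)] g(3) m[OF g(2)] in simp)+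
 have B: "B >= 0" using f(3)[of 0] by simp
 have i2: "integrable N (%x. f x * g x)"
 proof (rule N.integrable_const_bound[where B = "B * B"])
 show "AE x in N. norm (f x * g x) <= B * B"
 using f(3) g(3) B by (intro AE_I2) (simp add: abs_mult mult_mono)
 qed (use m[OF f(2)] m[OF g(2)] in measurable)
 define c where "c = (\<integral>x. f x \<partial>N)"
 \<comment> \<open>The infimum defining d must run over a nonempty set: f cannot stay strictly below
   its mean.\<close>
 have ex: "EX y. f y >= c"
 proof (rule ccontr)
 assume "~ ?thesis"
 then have lt: "!!y. f y < c" by (simp add: not_le)
 have "(\<integral>x. c - f x \<partial>N) = 0" using i by (simp add: c_def N.prob_space)
 then have "AE x in N. c - f x = 0"
 using i(1) lt by (subst (asm) integral_nonneg_eq_0_iff_AE) (auto intro!: AE_I2 less_imp_le)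
 then have "AE x in N. False"
 proof eventually_elim
 case (elim x)
 then show ?case using lt[of x] by simp
 qed
 then show False by simp
 qed
 define d where "d = Inf (g ` {y. f y >= c})"
 have bd: "bdd_below (g ` {y. f y >= c})"
 using g(3) by (intro bdd_belowI[of _ "-B"]) (auto simp: abs_le_iff minus_le_iff)
 have "0 <= (f x - c) * (g x - d)" for x
 proof (cases "f x >= c")
 case True
 then have "d <= g x" unfolding d_def using bd by (intro cInf_lower) auto
 then show ?thesis using True by simp
 next
 case False
 have "g x <= d" unfolding d_def
 proof (rule cInf_greatest)
 fix z assume "z : g ` {y. f y >= c}"
 then obtain y where y: "z = g y" "f y >= c" by auto
 have "x <= y" using False y(2) f(1) unfolding mono_def by (meson le_cases order_trans)
 then show "g x <= z" using g(1) y by (simp add: mono_def)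
 qed (use ex in auto)
 then show ?thesis using False by (simp add: mult_nonpos_nonpos)
 qed
 then have "0 <= (\<integral>x. (f x - c) * (g x - d) \<partial>N)" by (intro Bochner_Integration.integral_nonneg)
 also have "(\<integral>x. (f x - c) * (g x - d) \<partial>N) = (\<integral>x. f x * g x - c * g x - d * f x + c * d \<partial>N)"
 by (simp add: algebra_simps)
 also have "... = (\<integral>x. f x * g x \<partial>N) - c * (\<integral>x. g x \<partial>N) - d * c + c * d"
 using i i2 by (simp add: N.prob_space c_def)
 finally show ?thesis by (simp add: c_def)
qed

text \<open>One coordinate is integrated out at a time. In that coordinate the one-dimensional
  inequality applies, and the partial integrals are again bounded and increasing in the remaining
  coordinates.\<close>

lemma Harris_bounded:
 fixes F G :: "('i => real) => real"
 assumes I: "finite I" and N: "prob_space N" "sets N = sets borel"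
 and F: "F : borel_measurable (PiM I (%_. N))" "!!x. \<bar>F x\<bar> <= B"
 "!!x y. (!!i. i : I ==> x i <= y i) ==> F x <= F y"
 and G: "G : borel_measurable (PiM I (%_. N))" "!!x. \<bar>G x\<bar> <= B"
 "!!x y. (!!i. i : I ==> x i <= y i) ==> G x <= G y"
 shows "(\<integral>x. F x \<partial>PiM I (%_. N)) * (\<integral>x. G x \<partial>PiM I (%_. N)) <= (\<integral>x. F x * G x \<partial>PiM I (%_. N))"
 using I F G
proof (induction I arbitrary: F G rule: finite_induct)
 case empty
 interpret P: prob_space "PiM {} (%_. N) :: ('i => real) measure"
 by (intro prob_space_PiM N)
 obtain a b where ab: "F = (%_. a)" "G = (%_. b)"
 proof
 show "F = (%_. F undefined)" by (rule ext, rule antisym; rule empty(3)) auto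
 show "G = (%_. G undefined)" by (rule ext, rule antisym; rule empty(6)) auto
 qed
 show ?case unfolding ab by (simp add: P.prob_space)
next
 case (insert i I)
 interpret N: prob_space N by fact
 interpret product_sigma_finite "%_::'i. N" by unfold_locales
 interpret PI: prob_space "PiM I (%_. N)" by (intro prob_space_PiM N)
 interpret PJ: prob_space "PiM (insert i I) (%_. N)" by (intro prob_space_PiM N)
 have B: "B >= 0" using insert.prems(2)[of undefined] by simp
 have int: "integrable (PiM (insert i I) (%_. N)) H"
 if "H : borel_measurable (PiM (insert i I) (%_. N))" "!!x. \<bar>H x\<bar> <= C" for H :: "('i => real) => real" and C
 using that by (intro PJ.integrable_const_bound[where B = C]) auto
 have split: "(\<integral>x. H x \<partial>PiM (insert i I) (%_. N)) = (\<integral>x. \<integral>y. H (x(i := y)) \<partial>N \<partial>PiM I (%_. N))"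
 if "H : borel_measurable (PiM (insert i I) (%_. N))" "!!x. \<bar>H x\<bar> <= C" for H :: "('i => real) => real" and C
 using insert.hyps int[OF that] by (rule product_integral_insert)
 have m2: "(%(x, y). H (x(i := y))) : borel_measurable (PiM I (%_. N) \<Otimes>\<^sub>M N)"
 if "H : borel_measurable (PiM (insert i I) (%_. N))" for H :: "('i => real) => real"
 using measurable_compose[OF measurable_add_dim[of i I "%_. N"] that]
 by (simp add: case_prod_beta')
 have m1: "(%x. \<integral>y. H (x(i := y)) \<partial>N) : borel_measurable (PiM I (%_. N))"
 if "H : borel_measurable (PiM (insert i I) (%_. N))" for H :: "('i => real) => real"
 using m2[OF that] by (rule N.borel_measurable_lebesgue_integral)
 have m0: "(%y. H (x(i := y))) : borel_measurable N" if x: "x : space (PiM I (%_. N))"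
 and H: "H : borel_measurable (PiM (insert i I) (%_. N))" for H :: "('i => real) => real" and x
 using measurable_compose[OF measurable_Pair1'[OF x] m2[OF H]] by simp
 have bd: "\<bar>\<integral>y. H (x(i := y)) \<partial>N\<bar> <= C" if "!!x. \<bar>H x\<bar> <= C" "C >= 0" for H :: "('i => real) => real" and x C
 proof (cases "integrable N (%y. H (x(i := y)))")
 case True
 have "\<bar>\<integral>y. H (x(i := y)) \<partial>N\<bar> <= (\<integral>y. \<bar>H (x(i := y))\<bar> \<partial>N)" by (rule integral_abs_bound)
 also have "... <= (\<integral>y. C \<partial>N)" using True that by (intro integral_mono) auto
 finally show ?thesis by (simp add: N.prob_space)
 next
 case False then show ?thesis using that by (simp add: not_integrable_integral_eq)
 qed
 \<comment> \<open>Restricting x to I puts it into the space of the product measure, where sections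
   are measurable. Otherwise the integral could take its default value and monotonicity for
   arbitrary x could fail.\<close>
 define f where "f x = (\<integral>y. F ((restrict x I)(i := y)) \<partial>N)" for x
 define g where "g x = (\<integral>y. G ((restrict x I)(i := y)) \<partial>N)" for x
 have sp: "restrict x I = x" if "x : space (PiM I (%_. N))" for x using that by (auto simp: space_PiM PiE_def extensional_restrict)
 have spN: "space N = UNIV" using N(2) by (metis sets_eq_imp_space_eq space_borel)
 have rx: "restrict x I : space (PiM I (%_. N))" for x by (auto simp: space_PiM spN)
 have mono: "(\<integral>y. H ((restrict x I)(i := y)) \<partial>N) <= (\<integral>y. H ((restrict x' I)(i := y)) \<partial>N)"
 if H: "H : borel_measurable (PiM (insert i I) (%_. N))" "!!x. \<bar>H x\<bar> <= B"
 "!!x y. (!!j. j : insert i I ==> x j <= y j) ==> H x <= H y" and le: "!!j. j : I ==> x j <= x' j" for H x x'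
 proof (rule integral_mono)
 show "integrable N (%y. H ((restrict x I)(i := y)))" for x
 using H m0[OF rx H(1)] by (intro N.integrable_const_bound[where B = B]) auto
 then show "integrable N (%y. H ((restrict x' I)(i := y)))" .
 show "H ((restrict x I)(i := y)) <= H ((restrict x' I)(i := y))" for y
 using le by (intro H(3)) auto
 qed
 have "(\<integral>x. f x \<partial>PiM I (%_. N)) * (\<integral>x. g x \<partial>PiM I (%_. N)) <= (\<integral>x. f x * g x \<partial>PiM I (%_. N))"
 proof (rule insert.IH)
 show "f : borel_measurable (PiM I (%_. N))"
 using m1[OF insert.prems(1)] by (rule measurable_cong[THEN iffD2, rotated]) (simp only: f_def sp)
 show "g : borel_measurable (PiM I (%_. N))"
 using m1[OF insert.prems(4)] by (rule measurable_cong[THEN iffD2, rotated]) (simp only: g_def sp)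
 show "\<bar>f x\<bar> <= B" "\<bar>g x\<bar> <= B" for x unfolding f_def g_def by (rule bd[OF insert.prems(2) B], rule bd[OF insert.prems(5) B])
 show "f x <= f y" if "!!j. j : I ==> x j <= y j" for x y
 unfolding f_def using insert.prems(1-3) that by (rule mono)
 show "g x <= g y" if "!!j. j : I ==> x j <= y j" for x y
 unfolding g_def using insert.prems(4-6) that by (rule mono)
 qed
 also have "... <= (\<integral>x. \<integral>y. F (x(i := y)) * G (x(i := y)) \<partial>N \<partial>PiM I (%_. N))"
 proof (rule integral_mono_AE)
 have b: "\<bar>F x * G x\<bar> <= B * B" for x using insert.prems(2,5) B by (auto simp: abs_mult intro!: mult_mono)
 have mFG: "(%x. F x * G x) : borel_measurable (PiM (insert i I) (%_. N))" using insert.prems by measurable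
 show "integrable (PiM I (%_. N)) (%x. \<integral>y. F (x(i := y)) * G (x(i := y)) \<partial>N)"
 proof (intro PI.integrable_const_bound[where B = "B * B"] AE_I2)
 show "norm (\<integral>y. F (x(i := y)) * G (x(i := y)) \<partial>N) <= B * B" for x
 using bd[of "%x. F x * G x" "B * B" x] b B by simp
 qed (rule m1[OF mFG])
 have "(%x. f x * g x) : borel_measurable (PiM I (%_. N))"
 using m1[OF insert.prems(1)] m1[OF insert.prems(4)]
 by (subst measurable_cong[where g = "%x. (\<integral>y. F (x(i := y)) \<partial>N) * (\<integral>y. G (x(i := y)) \<partial>N)"])
 (simp_all only: f_def g_def sp borel_measurable_times)
 then show "integrable (PiM I (%_. N)) (%x. f x * g x)"
 using bd[OF insert.prems(2) B] bd[OF insert.prems(5) B] B unfolding f_def g_def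
 by (intro PI.integrable_const_bound[where B = "B * B"]) (auto simp: abs_mult intro!: mult_mono AE_I2)
 show "AE x in PiM I (%_. N). f x * g x <= (\<integral>y. F (x(i := y)) * G (x(i := y)) \<partial>N)"
 proof (rule AE_I2)
 fix x assume x: "x : space (PiM I (%_. N))"
 have m: "(%y. H (x(i := y))) : borel_measurable borel"
 if "H : borel_measurable (PiM (insert i I) (%_. N))" for H :: "('i => real) => real"
 using m0[OF x that] by (simp only: measurable_cong_sets[OF N(2) refl])
 show "f x * g x <= (\<integral>y. F (x(i := y)) * G (x(i := y)) \<partial>N)"
 unfolding f_def g_def sp[OF x]
 by (intro Chebyshev_monotone[where B = B] N monoI insert.prems(2,3,5,6) m insert.prems(1,4)) auto
 qed
 qed
 also have "... = (\<integral>x. F x * G x \<partial>PiM (insert i I) (%_. N))"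
 proof (rule split[symmetric])
 show "\<bar>F x * G x\<bar> <= B * B" for x using insert.prems(2,5) B by (auto simp: abs_mult intro!: mult_mono)
 qed (use insert.prems in measurable)
 also have "(\<integral>x. f x \<partial>PiM I (%_. N)) = (\<integral>x. F x \<partial>PiM (insert i I) (%_. N))"
 unfolding split[OF insert.prems(1,2)] f_def by (intro Bochner_Integration.integral_cong) (simp_all only: sp)
 also have "(\<integral>x. g x \<partial>PiM I (%_. N)) = (\<integral>x. G x \<partial>PiM (insert i I) (%_. N))"
 unfolding split[OF insert.prems(4,5)] g_def by (intro Bochner_Integration.integral_cong) (simp_all only: sp)
 finally show ?case .
qed

text \<open>Truncation keeps monotonicity and reduces the square integrable case to the bounded one.\<close>
lemma Harris_inequality:
 fixes F G :: "('i => real) => real"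
 assumes I: "finite I" and N: "prob_space N" "sets N = sets borel"
 and F: "F : borel_measurable (PiM I (%_. N))" "integrable (PiM I (%_. N)) (%x. (F x)\<^sup>2)"
 "!!x y. (!!i. i : I ==> x i <= y i) ==> F x <= F y"
 and G: "G : borel_measurable (PiM I (%_. N))" "integrable (PiM I (%_. N)) (%x. (G x)\<^sup>2)"
 "!!x y. (!!i. i : I ==> x i <= y i) ==> G x <= G y"
 shows "(\<integral>x. F x \<partial>PiM I (%_. N)) * (\<integral>x. G x \<partial>PiM I (%_. N)) <= (\<integral>x. F x * G x \<partial>PiM I (%_. N))"
proof -
 let ?P = "PiM I (%_. N)"
 interpret P: prob_space ?P by (intro prob_space_PiM N)
 define T where "T k t = max (- real k) (min (real k) t)" for k t
 have T1: "\<bar>T k t\<bar> <= real k" and T2: "\<bar>T k t\<bar> <= \<bar>t\<bar>" and T3: "s <= t ==> T k s <= T k t" for k s t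
 by (auto simp: T_def)
 have T4: "(%k. T k t) \<longlonglongrightarrow> t" for t
 proof (rule tendsto_eventually)
 obtain n where n: "real n >= \<bar>t\<bar>" using real_arch_simple by metis
 have "T k t = t" if "k >= n" for k
 proof -
 have "real k >= \<bar>t\<bar>" using n that by linarith
 then show ?thesis by (auto simp: T_def)
 qed
 then show "\<forall>\<^sub>F k in sequentially. T k t = t" by (rule eventually_sequentiallyI)
 qed
 have mT: "(%x. T k (H x)) : borel_measurable ?P" if "H : borel_measurable ?P" for k H
 unfolding T_def by (intro borel_measurable_max borel_measurable_min borel_measurable_const that)
 have i1: "integrable ?P H" if "H : borel_measurable ?P" "integrable ?P (%x. (H x)\<^sup>2)" for H :: "('i => real) => real"
 using that by (rule P.square_integrable_imp_integrable)
 have iFG: "integrable ?P (%x. F x * G x)"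
 proof (rule Bochner_Integration.integrable_bound)
 show "integrable ?P (%x. (F x)\<^sup>2 + (G x)\<^sup>2)" using F(2) G(2) by simp
 have "\<bar>a * b\<bar> <= a\<^sup>2 + b\<^sup>2" for a b :: real
 proof -
 have "2 * (\<bar>a\<bar> * \<bar>b\<bar>) <= a\<^sup>2 + b\<^sup>2" using sum_squares_bound[of "\<bar>a\<bar>" "\<bar>b\<bar>"] by simp
 moreover have "0 <= \<bar>a\<bar> * \<bar>b\<bar>" by simp
 ultimately show ?thesis unfolding abs_mult by linarith
 qed
 then have "norm (F x * G x) <= norm ((F x)\<^sup>2 + (G x)\<^sup>2)" for x
 unfolding real_norm_def by (meson abs_ge_self order_trans)
 then show "AE x in ?P. norm (F x * G x) <= norm ((F x)\<^sup>2 + (G x)\<^sup>2)" by (intro AE_I2)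
 qed (intro borel_measurable_times F(1) G(1))
 have lim: "(%k. \<integral>x. T k (H x) \<partial>?P) \<longlonglongrightarrow> (\<integral>x. H x \<partial>?P)"
 if "H : borel_measurable ?P" "integrable ?P H" for H :: "('i => real) => real"
 proof (rule integral_dominated_convergence[where w = "%x. \<bar>H x\<bar>"])
 show "AE x in ?P. (%k. T k (H x)) \<longlonglongrightarrow> H x" by (intro AE_I2 T4)
 show "AE x in ?P. norm (T k (H x)) <= \<bar>H x\<bar>" for k
 unfolding real_norm_def by (intro AE_I2 T2)
 qed (intro that mT integrable_abs)+
 have lim2: "(%k. \<integral>x. T k (F x) * T k (G x) \<partial>?P) \<longlonglongrightarrow> (\<integral>x. F x * G x \<partial>?P)"
 proof (rule integral_dominated_convergence[where w = "%x. \<bar>F x * G x\<bar>"])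
 show "AE x in ?P. (%k. T k (F x) * T k (G x)) \<longlonglongrightarrow> F x * G x"
 by (intro AE_I2 tendsto_mult T4)
 show "AE x in ?P. norm (T k (F x) * T k (G x)) <= \<bar>F x * G x\<bar>" for k
 unfolding real_norm_def abs_mult by (intro AE_I2 mult_mono T2 abs_ge_zero)
 qed (intro F(1) G(1) iFG mT integrable_abs borel_measurable_times)+
 have "(\<integral>x. T k (F x) \<partial>?P) * (\<integral>x. T k (G x) \<partial>?P) <= (\<integral>x. T k (F x) * T k (G x) \<partial>?P)" for k
 proof (rule Harris_bounded[where B = "real k"])
 show "T k (F x) <= T k (F y)" if "!!i. i : I ==> x i <= y i" for x y
 by (rule T3, rule F(3), rule that)
 show "T k (G x) <= T k (G y)" if "!!i. i : I ==> x i <= y i" for x y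
 by (rule T3, rule G(3), rule that)
 qed (fact I N T1 mT[OF F(1)] mT[OF G(1)])+
 then show ?thesis
 using LIMSEQ_le[OF tendsto_mult[OF lim[OF F(1) i1[OF F(1,2)]] lim[OF G(1) i1[OF G(1,2)]]] lim2] by simp
qed

section \<open>Gaussian fields with network covariance\<close>

locale gff = prob_space M + cable X nb q g \<kappa>
 for M :: "'w measure" and X :: "'a set" and nb :: "'a => 'a set" and q :: "'a => real"
 and g :: "'a => 'a => real" and \<kappa> :: real +
 fixes \<phi> :: "'a => 'w => real"
 assumes measurable_phi: "v : X ==> \<phi> v : borel_measurable M"
 and charfun_phi: "finite V ==> V <= X ==>
 (CLINT om|M. iexp (\<Sum>v\<in>V. a v * \<phi> v om)) =
 complex_of_real (exp (- (\<Sum>u\<in>V. \<Sum>v\<in>V. a u * a v * g u v) / 2))"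
begin

section \<open>Linear functionals of the field and their moments\<close>

definition lin :: "'a set => ('a => real) => 'w => real" where
 "lin V a om = (\<Sum>v\<in>V. a v * \<phi> v om)"

definition cov :: "'a set => ('a => real) => ('a => real) => real" where
 "cov V a b = (\<Sum>u\<in>V. \<Sum>v\<in>V. a u * b v * g u v)"

lemma cov_add: "cov V (%x. a x + a' x) b = cov V a b + cov V a' b"
 by (simp add: cov_def algebra_simps sum.distrib)

lemma cov_cmult: "cov V (%x. c * a x) b = c * cov V a b"
 by (simp add: cov_def sum_distrib_left algebra_simps)

lemma cov_sum: "cov V (%x. \<Sum>i\<in>I. a i x) b = (\<Sum>i\<in>I. cov V (a i) b)"
 by (induction I rule: infinite_finite_induct) (simp_all add: cov_add, simp_all add: cov_def)

lemma cov_sym: "V <= X ==> cov V a b = cov V b a"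
 unfolding cov_def by (subst sum.swap) (auto intro!: sum.cong simp: g_sym subset_iff mult_ac)

lemma lin_add: "lin V (%x. a x + a' x) om = lin V a om + lin V a' om"
 by (simp add: lin_def algebra_simps sum.distrib)

lemma lin_cmult: "lin V (%x. c * a x) om = c * lin V a om"
 by (simp add: lin_def sum_distrib_left algebra_simps)

lemma lin_sum: "lin V (%x. \<Sum>i\<in>I. a i x) om = (\<Sum>i\<in>I. lin V (a i) om)"
 by (induction I rule: infinite_finite_induct) (simp_all add: lin_add, simp_all add: lin_def)

lemma measurable_lin: "V <= X ==> lin V a : borel_measurable M"
 unfolding lin_def[abs_def] using measurable_phi by (intro borel_measurable_sum borel_measurable_times) auto

lemma lin_delta: "finite V ==> v : V ==> lin V (%x. if x = v then 1 else 0) om = \<phi> v om"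
 unfolding lin_def by (subst sum.remove[of _ v]) (auto intro!: sum.neutral)

lemma cov_delta2: "finite V ==> v : V ==> cov V a (%x. if x = v then 1 else 0) = (\<Sum>u\<in>V. a u * g u v)"
 unfolding cov_def
 by (intro sum.cong refl, subst sum.remove[of _ v]) (auto intro!: sum.neutral)

lemma charfun_lin:
 "finite V ==> V <= X ==> (CLINT om|M. iexp (lin V a om)) = complex_of_real (exp (- cov V a a / 2))"
 using charfun_phi[of V a] by (simp add: lin_def cov_def)

lemma cov_nonneg: "finite V ==> V <= X ==> cov V a a >= 0"
proof -
 assume V: "finite V" "V <= X"
 have "cmod (CLINT om|M. iexp (lin V a om)) <= (\<integral>om. cmod (iexp (lin V a om)) \<partial>M)"
 by (rule integral_norm_bound)
 then have "exp (- cov V a a / 2) <= 1"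
 unfolding charfun_lin[OF V] by (simp add: prob_space)
 then show ?thesis by simp
qed

text \<open>Writing the law as the image of a standard normal under scaling, rather than by a
  density, includes the degenerate case of variance 0.\<close>

lemma distr_lin:
 assumes V: "finite V" "V <= X"
 shows "distr M borel (lin V a) = distr std_normal borel (%z. sqrt (cov V a a) * z)"
proof (rule Levy_uniqueness)
 interpret N: prob_space std_normal by (rule prob_space_normal_density) simp
 show "real_distribution (distr M borel (lin V a))" using V by (intro real_distribution_distr measurable_lin)
 show "real_distribution (distr std_normal borel (%z. sqrt (cov V a a) * z))"
 by (intro N.real_distribution_distr) simp
 show "char (distr M borel (lin V a)) = char (distr std_normal borel (%z. sqrt (cov V a a) * z))"
 proof
 fix t
 let ?s = "sqrt (cov V a a)"
 have "char (distr M borel (lin V a)) t = (CLINT om|M. iexp (t * lin V a om))"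
 unfolding char_def using measurable_lin V by (subst integral_distr) auto
 also have "... = (CLINT om|M. iexp (lin V (%x. t * a x) om))" by (simp add: lin_cmult)
 also have "... = complex_of_real (exp (- (t\<^sup>2 * cov V a a) / 2))"
 using charfun_lin[OF V, of "%x. t * a x"] cov_sym[OF V(2), of a "%x. t * a x"]
 by (simp add: cov_cmult power2_eq_square mult_ac)
 also have "t\<^sup>2 * cov V a a = (t * ?s)\<^sup>2" using cov_nonneg[OF V] by (simp add: power_mult_distrib)
 also have "complex_of_real (exp (- (t * ?s)\<^sup>2 / 2)) = char std_normal (t * ?s)"
 by (simp add: char_std_normal_distribution)
 also have "... = char (distr std_normal borel (%z. ?s * z)) t"
 unfolding char_def by (subst integral_distr) (auto simp: mult_ac)
 finally show "char (distr M borel (lin V a)) t = char (distr std_normal borel (%z. ?s * z)) t" .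
 qed
qed

lemma expectation_lin:
 assumes V: "finite V" "V <= X" and h: "h : borel_measurable borel"
 shows "integrable M (%om. h (lin V a om) :: real) \<longleftrightarrow> integrable std_normal (%z. h (sqrt (cov V a a) * z))"
 "expectation (%om. h (lin V a om)) = (\<integral>z. h (sqrt (cov V a a) * z) \<partial>std_normal)"
proof -
 have m: "lin V a : measurable M borel" using V by (intro measurable_lin)
 show "integrable M (%om. h (lin V a om)) \<longleftrightarrow> integrable std_normal (%z. h (sqrt (cov V a a) * z))"
 using integrable_distr_eq[OF m h] distr_lin[OF V, of a]
 integrable_distr_eq[of "%z. sqrt (cov V a a) * z" std_normal borel h] h by simp
 show "expectation (%om. h (lin V a om)) = (\<integral>z. h (sqrt (cov V a a) * z) \<partial>std_normal)"
 using integral_distr[OF m h] distr_lin[OF V, of a]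
 integral_distr[of "%z. sqrt (cov V a a) * z" std_normal borel h] h by simp
qed

lemma std_normal_power:
 "integrable std_normal (%z::real. z ^ k)"
 "(\<integral>z. z ^ 2 \<partial>std_normal) = 1" "(\<integral>z. z ^ 4 \<partial>std_normal) = 3" "(\<integral>z. z \<partial>std_normal) = 0"
proof -
 show "integrable std_normal (%z::real. z ^ k)"
 using integrable_std_normal_moment[of k] by (subst integrable_density) (auto simp: mult_ac)
 have e: "(\<integral>z. z ^ k \<partial>std_normal) = (\<integral>z. std_normal_density z * z ^ k \<partial>lborel)" for k
 by (subst integral_density) auto
 show "(\<integral>z. z ^ 2 \<partial>std_normal) = 1" "(\<integral>z. z ^ 4 \<partial>std_normal) = 3"
 unfolding e using std_normal_moment_even[of 1] std_normal_moment_even[of 2]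
 by (auto simp: has_bochner_integral_iff fact_numeral)
 show "(\<integral>z. z \<partial>std_normal) = 0"
 using e[of 1] std_normal_moment_odd[of 0] by (simp add: has_bochner_integral_iff)
qed

lemma lin_moments:
 assumes V: "finite V" "V <= X"
 shows "integrable M (%om. lin V a om ^ k)" "expectation (lin V a) = 0"
 "expectation (%om. (lin V a om)\<^sup>2) = cov V a a" "expectation (%om. (lin V a om) ^ 4) = 3 * (cov V a a)\<^sup>2"
proof -
 note I = expectation_lin(1)[OF V, of "%x. x ^ k" a] and E = expectation_lin(2)[OF V, where a = a]
 show "integrable M (%om. lin V a om ^ k)"
 using I std_normal_power(1)[of k] by (simp add: power_mult_distrib)
 show "expectation (lin V a) = 0"
 using E[of "%x. x"] std_normal_power(4) by simp
 show "expectation (%om. (lin V a om)\<^sup>2) = cov V a a"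
 using E[of "%x. x\<^sup>2"] std_normal_power(2) cov_nonneg[OF V, of a] by (simp add: power_mult_distrib)
 have "sqrt (cov V a a) ^ 4 = (cov V a a)\<^sup>2"
 using cov_nonneg[OF V, of a] power_mult[of "sqrt (cov V a a)" 2 2] by simp
 then show "expectation (%om. (lin V a om) ^ 4) = 3 * (cov V a a)\<^sup>2"
 using E[of "%x. x ^ 4"] std_normal_power(3) by (simp add: power_mult_distrib)
qed

lemma lin_square_integrable:
 assumes V: "finite V" "V <= X"
 shows "integrable M (%om. lin V a om * lin V b om)"
proof -
 have e: "(%om. lin V a om * lin V b om) = (%om. ((lin V (%x. a x + b x) om)\<^sup>2 - (lin V a om)\<^sup>2 - (lin V b om)\<^sup>2) / 2)"
 by (rule ext) (simp add: lin_add power2_eq_square algebra_simps)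
 show ?thesis unfolding e using lin_moments(1)[OF V] by simp
qed

lemma expectation_lin_lin:
 assumes V: "finite V" "V <= X"
 shows "expectation (%om. lin V a om * lin V b om) = cov V a b"
proof -
 have e: "(%om. lin V a om * lin V b om) = (%om. ((lin V (%x. a x + b x) om)\<^sup>2 - (lin V a om)\<^sup>2 - (lin V b om)\<^sup>2) / 2)"
 by (rule ext) (simp add: lin_add power2_eq_square algebra_simps)
 have "expectation (%om. lin V a om * lin V b om) = (cov V (%x. a x + b x) (%x. a x + b x) - cov V a a - cov V b b) / 2"
 unfolding e using lin_moments(1,3)[OF V] by simp
 also have "... = cov V a b"
 using cov_sym[OF V(2), of a "%x. a x + b x"] cov_sym[OF V(2), of b "%x. a x + b x"] cov_sym[OF V(2), of a b]
 by (simp add: cov_add)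
 finally show ?thesis .
qed

text \<open>The residual of the field at x given its values on S: the conditional mean is the
  harmonic extension.\<close>

definition ps :: "'a set => 'a => 'w => real" where
 "ps S x om = \<phi> x om - (\<Sum>z\<in>S. hm S x z * \<phi> z om)"

definition psc :: "'a set => 'a => 'a => real" where
 "psc S x v = (if v = x then 1 else 0) - hm S x v"

lemma psi_lin:
 assumes "finite V" "S <= V" "x : V"
 shows "lin V (psc S x) om = ps S x om"
proof -
 have "lin V (psc S x) om = lin V (%v. if v = x then 1 else 0) om - (\<Sum>v\<in>V. hm S x v * \<phi> v om)"
 by (simp add: lin_def psc_def algebra_simps sum_subtractf)
 also have "(\<Sum>v\<in>V. hm S x v * \<phi> v om) = (\<Sum>v\<in>S. hm S x v * \<phi> v om)"
 using assms by (intro sum.mono_neutral_right) (auto simp: hm_def)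
 finally show ?thesis using assms by (simp add: lin_delta ps_def)
qed

text \<open>Pairing the residual with the field at v produces the Green function minus its harmonic
  extension, that is \<open>kg S x v\<close>; in particular the residual is uncorrelated with the
  field on S.\<close>

lemma cov_psi:
 assumes V: "finite V" "V <= X" and S: "S <= V" and x: "x : V" and b: "!!v. v : V ==> v ~: B ==> b v = 0" and B: "B <= V"
 shows "cov V (psc S x) b = (\<Sum>v\<in>B. b v * kg S x v)"
proof -
 have "cov V (psc S x) b = (\<Sum>v\<in>V. b v * (\<Sum>u\<in>V. psc S x u * g u v))"
 unfolding cov_def by (subst sum.swap) (simp add: sum_distrib_left mult_ac)
 also have "... = (\<Sum>v\<in>V. b v * kg S x v)"
 proof (intro sum.cong refl)
 fix v assume "v : V"
 have "(\<Sum>u\<in>V. psc S x u * g u v) = (\<Sum>u\<in>V. (if u = x then 1 else 0) * g u v) - (\<Sum>u\<in>V. hm S x u * g u v)"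
 by (simp add: psc_def left_diff_distrib sum_subtractf)
 also have "(\<Sum>u\<in>V. (if u = x then 1 else 0) * g u v) = g x v"
 using V x by (subst sum.remove[of _ x]) (auto intro!: sum.neutral)
 also have "(\<Sum>u\<in>V. hm S x u * g u v) = (\<Sum>u\<in>S. hm S x u * g u v)"
 using V S by (intro sum.mono_neutral_right) (auto simp: hm_def)
 finally show "b v * (\<Sum>u\<in>V. psc S x u * g u v) = b v * kg S x v" by (simp add: kg_def)
 qed
 also have "... = (\<Sum>v\<in>B. b v * kg S x v)"
 using V B b by (intro sum.mono_neutral_right) auto
 finally show ?thesis .
qed

lemma cov_psi_psi:
 assumes V: "finite V" "V <= X" and S: "S <= V" and x: "x : V" and y: "y : V"
 shows "cov V (psc S x) (psc S y) = kg S x y"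
proof -
 have S': "finite S" "S <= X" using S V finite_subset by auto
 have "cov V (psc S x) (psc S y) = (\<Sum>v\<in>V. psc S y v * kg S x v)"
 by (rule cov_psi) (use assms in auto)
 also have "... = (\<Sum>v\<in>V. (if v = y then 1 else 0) * kg S x v) - (\<Sum>v\<in>V. hm S y v * kg S x v)"
 by (simp add: psc_def left_diff_distrib sum_subtractf)
 also have "(\<Sum>v\<in>V. (if v = y then 1 else 0) * kg S x v) = kg S x y"
 using V y by (subst sum.remove[of _ y]) (auto intro!: sum.neutral)
 also have "(\<Sum>v\<in>V. hm S y v * kg S x v) = 0"
 using V x kg_on2[OF S'] by (intro sum.neutral) (auto simp: hm_def subset_iff)
 finally show ?thesis by simp
qed

text \<open>Gram-Schmidt orthonormalisation along an enumeration of the vertices; the conditional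
 means are harmonic averages, so all coefficients are nonnegative.\<close>
definition gs :: "'a list => nat => 'a => real" where
 "gs vs k v = psc (set (take k vs)) (vs ! k) v / sqrt (kg (set (take k vs)) (vs ! k) (vs ! k))"

context
 fixes vs :: "'a list" assumes vs: "distinct vs" "set vs <= X"
begin

lemma gs_fresh: "k < length vs ==> vs ! k ~: set (take k vs)"
 using vs by (metis distinct_take id_take_nth_drop take_Suc_conv_app_nth distinct.simps(2) distinct_append disjoint_iff list.set_intros(1))

lemma gs_norm_pos: "k < length vs ==> kg (set (take k vs)) (vs ! k) (vs ! k) > 0"
 using gs_fresh vs set_take_subset[of k vs] nth_mem[of k vs] by (intro kg_diag_pos) auto

lemma gs_supp: "k < length vs ==> v ~: set (take (Suc k) vs) ==> gs vs k v = 0"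
 by (auto simp: gs_def psc_def hm_def take_Suc_conv_app_nth)

lemma cov_gs_left:
 assumes k: "k < length vs" and b: "!!v. v : set vs ==> v ~: B ==> b v = 0" and B: "B <= set vs"
 shows "cov (set vs) (gs vs k) b = (\<Sum>v\<in>B. b v * kg (set (take k vs)) (vs ! k) v) / sqrt (kg (set (take k vs)) (vs ! k) (vs ! k))"
proof -
 let ?n = "sqrt (kg (set (take k vs)) (vs ! k) (vs ! k))"
 have e: "gs vs k = (%v. (1 / ?n) * psc (set (take k vs)) (vs ! k) v)"
 by (rule ext) (simp add: gs_def)
 have "cov (set vs) (gs vs k) b = (1 / ?n) * cov (set vs) (psc (set (take k vs)) (vs ! k)) b"
 unfolding e by (rule cov_cmult)
 then have "cov (set vs) (gs vs k) b = cov (set vs) (psc (set (take k vs)) (vs ! k)) b / ?n" by simp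
 also have "cov (set vs) (psc (set (take k vs)) (vs ! k)) b = (\<Sum>v\<in>B. b v * kg (set (take k vs)) (vs ! k) v)"
 using vs k set_take_subset[of k vs] b B by (intro cov_psi) auto
 finally show ?thesis .
qed

lemma cov_gs_less:
 assumes "j < k" "k < length vs"
 shows "cov (set vs) (gs vs k) (gs vs j) = 0"
proof -
 let ?S = "set (take k vs)"
 have S: "finite ?S" "?S <= X" using vs set_take_subset[of k vs] by auto
 have sub: "set (take (Suc j) vs) <= ?S" using assms by (intro set_take_subset_set_take) auto
 have "cov (set vs) (gs vs k) (gs vs j) = (\<Sum>v\<in>?S. gs vs j v * kg ?S (vs ! k) v) / sqrt (kg ?S (vs ! k) (vs ! k))"
 using assms sub gs_supp[of j] set_take_subset[of k vs] by (intro cov_gs_left) auto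
 also have "(\<Sum>v\<in>?S. gs vs j v * kg ?S (vs ! k) v) = 0"
 using kg_on2[OF S] vs assms by (intro sum.neutral) (auto simp: subset_iff)
 finally show ?thesis by simp
qed

lemma cov_gs_self:
 assumes k: "k < length vs"
 shows "cov (set vs) (gs vs k) (gs vs k) = 1"
proof -
 let ?S = "set (take k vs)" and ?x = "vs ! k"
 have S: "finite ?S" "?S <= X" using vs set_take_subset[of k vs] by auto
 have ins: "set (take (Suc k) vs) = insert ?x ?S" using k by (simp add: take_Suc_conv_app_nth)
 have "cov (set vs) (gs vs k) (gs vs k) = (\<Sum>v\<in>insert ?x ?S. gs vs k v * kg ?S ?x v) / sqrt (kg ?S ?x ?x)"
 using k ins gs_supp[of k] set_take_subset[of k vs] by (intro cov_gs_left) auto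
 also have "(\<Sum>v\<in>insert ?x ?S. gs vs k v * kg ?S ?x v) = gs vs k ?x * kg ?S ?x ?x + (\<Sum>v\<in>?S. gs vs k v * kg ?S ?x v)"
 using gs_fresh[OF k] by (intro sum.insert) auto
 also have "(\<Sum>v\<in>?S. gs vs k v * kg ?S ?x v) = 0"
 using kg_on2[OF S] vs k by (intro sum.neutral) (auto simp: subset_iff)
 also have "gs vs k ?x = 1 / sqrt (kg ?S ?x ?x)"
 using gs_fresh[OF k] by (simp add: gs_def psc_def hm_def)
 also have "(1 / sqrt (kg ?S ?x ?x) * kg ?S ?x ?x + 0) / sqrt (kg ?S ?x ?x) = 1"
 using gs_norm_pos[OF k] by simp
 finally show ?thesis .
qed

lemma cov_gs: "j < length vs ==> k < length vs ==> cov (set vs) (gs vs k) (gs vs j) = (if j = k then 1 else 0)"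
proof (cases j k rule: linorder_cases)
 case greater
 assume "j < length vs"
 with greater have "cov (set vs) (gs vs j) (gs vs k) = 0" by (intro cov_gs_less)
 then show ?thesis using greater by (subst cov_sym[OF vs(2)]) simp
qed (use cov_gs_less cov_gs_self in auto)

text \<open>The field at the k-th vertex is a positive multiple of the k-th basis vector plus a
  harmonic average of the field at earlier vertices. Both have nonnegative weights, so the induction
  preserves the sign; this sign is what carries the Harris inequality over to the field.\<close>

lemma ex_gs_coeff:
 assumes "k < length vs"
 shows "EX l. (ALL j. l j >= 0) & (ALL v. (if v = vs ! k then 1 else 0) = (\<Sum>j<length vs. l j * gs vs j v))"
 using assms
proof (induction k rule: less_induct)
 case (less k)
 let ?S = "set (take k vs)" and ?x = "vs ! k" and ?m = "length vs"
 have S: "finite ?S" "?S <= X" using vs set_take_subset[of k vs] by auto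
 define P where "P z l \<longleftrightarrow> (ALL j. l j >= 0) & (ALL v. (if v = z then 1 else 0) = (\<Sum>j<?m. l j * gs vs j v))" for z and l :: "nat => real"
 have ex: "EX l. P z l" if z: "z : ?S" for z
 proof -
 obtain i where i: "i < k" "z = vs ! i" using z less.prems by (auto simp: in_set_conv_nth)
 then show ?thesis using less.IH[of i] less.prems unfolding P_def by simp
 qed
 define l where "l z = (SOME l. P z l)" for z
 have Pl: "P z (l z)" if "z : ?S" for z
 unfolding l_def using ex[OF that] by (rule someI_ex)
 have l1: "l z j >= 0" if "z : ?S" for z j
 using Pl[OF that] unfolding P_def by (elim conjE) (erule spec)
 have l2: "(if v = z then 1 else 0) = (\<Sum>j<?m. l z j * gs vs j v)" if "z : ?S" for z v
 using Pl[OF that] unfolding P_def by (elim conjE) (erule spec)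
 let ?l = "%j. (if j = k then sqrt (kg ?S ?x ?x) else 0) + (\<Sum>z\<in>?S. hm ?S ?x z * l z j)"
 have pos: "kg ?S ?x ?x > 0" using gs_norm_pos[OF less.prems] .
 have xX: "?x : X" using vs less.prems by auto
 have "?l j >= 0" for j
 using pos by (intro add_nonneg_nonneg sum_nonneg mult_nonneg_nonneg hm_nonneg[OF S xX] l1) auto
 moreover have "(if v = ?x then 1 else 0) = (\<Sum>j<?m. ?l j * gs vs j v)" for v
 proof -
 have 1: "(\<Sum>j<?m. ?l j * gs vs j v) = (\<Sum>j<?m. (if j = k then sqrt (kg ?S ?x ?x) else 0) * gs vs j v) + (\<Sum>j<?m. \<Sum>z\<in>?S. hm ?S ?x z * (l z j * gs vs j v))"
 by (simp only: distrib_right sum.distrib sum_distrib_right mult.assoc)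
 have 2: "(\<Sum>j<?m. (if j = k then sqrt (kg ?S ?x ?x) else 0) * gs vs j v) = psc ?S ?x v"
 proof -
 have "(\<Sum>j<?m. (if j = k then sqrt (kg ?S ?x ?x) else 0) * gs vs j v) = sqrt (kg ?S ?x ?x) * gs vs k v"
 using less.prems by (subst sum.remove[of _ k]) (auto intro!: sum.neutral)
 then show ?thesis using pos by (simp add: gs_def)
 qed
 have 3: "(\<Sum>j<?m. \<Sum>z\<in>?S. hm ?S ?x z * (l z j * gs vs j v)) = hm ?S ?x v"
 proof -
 have "(\<Sum>j<?m. hm ?S ?x z * (l z j * gs vs j v)) = (if v = z then hm ?S ?x z else 0)" if z: "z : ?S" for z
 proof -
 have "(\<Sum>j<?m. hm ?S ?x z * (l z j * gs vs j v)) = hm ?S ?x z * (\<Sum>j<?m. l z j * gs vs j v)"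
 by (simp only: sum_distrib_left)
 then show ?thesis unfolding l2[OF z, of v, symmetric] by (cases "v = z") simp_all
 qed
 then have "(\<Sum>z\<in>?S. \<Sum>j<?m. hm ?S ?x z * (l z j * gs vs j v)) = (\<Sum>z\<in>?S. if v = z then hm ?S ?x z else 0)"
 by (rule sum.cong[OF refl])
 then have "(\<Sum>j<?m. \<Sum>z\<in>?S. hm ?S ?x z * (l z j * gs vs j v)) = (\<Sum>z\<in>?S. if v = z then hm ?S ?x z else 0)"
 by (subst sum.swap)
 then show ?thesis unfolding sum.delta'[OF S(1)] by (simp add: hm_def)
 qed
 show ?thesis unfolding 1 2 3 by (simp add: psc_def)
 qed
 ultimately show ?case by (intro exI[of _ ?l] conjI allI)
qed

lemma indep_gs:
 "indep_vars (%_. borel) (%k. lin (set vs) (gs vs k)) {..<length vs}"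
 "!!k. k < length vs ==> distr M borel (lin (set vs) (gs vs k)) = std_normal"
 "indep_vars (%_. borel) (%k om. - lin (set vs) (gs vs k) om) {..<length vs}"
 "!!k. k < length vs ==> distr M borel (%om. - lin (set vs) (gs vs k) om) = std_normal"
proof -
 have m: "lin (set vs) (gs vs k) : borel_measurable M" for k using vs by (intro measurable_lin)
 have c: "(CLINT om|M. iexp (\<Sum>k\<in>{..<length vs}. b k * lin (set vs) (gs vs k) om)) =
 of_real (exp (- (\<Sum>k\<in>{..<length vs}. (b k)\<^sup>2) / 2))" for b
 proof -
 let ?a = "%v. \<Sum>k<length vs. b k * gs vs k v"
 have "cov (set vs) ?a ?a = (\<Sum>k<length vs. b k * cov (set vs) (gs vs k) ?a)"
 by (simp add: cov_sum cov_cmult)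
 also have "... = (\<Sum>k<length vs. b k * cov (set vs) ?a (gs vs k))"
 using vs by (simp add: cov_sym[of _ _ ?a])
 also have "... = (\<Sum>k<length vs. b k * b k)"
 proof (intro sum.cong refl)
 fix k assume k: "k : {..<length vs}"
 have "cov (set vs) ?a (gs vs k) = (\<Sum>j<length vs. b j * (if k = j then 1 else 0))"
 using k by (simp add: cov_sum cov_cmult cov_gs)
 also have "... = b k" using k by (subst sum.remove[of _ k]) (auto intro!: sum.neutral)
 finally show "b k * cov (set vs) ?a (gs vs k) = b k * b k" by simp
 qed
 finally have "cov (set vs) ?a ?a = (\<Sum>k<length vs. (b k)\<^sup>2)" by (simp add: power2_eq_square)
 then show ?thesis using charfun_lin[of "set vs" ?a] vs by (simp add: lin_sum lin_cmult)
 qed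
 show "indep_vars (%_. borel) (%k. lin (set vs) (gs vs k)) {..<length vs}"
 by (rule indep_std_normal(1)) (use m c in auto)
 show "distr M borel (lin (set vs) (gs vs k)) = std_normal" if "k < length vs" for k
 by (rule indep_std_normal(2)[of "{..<length vs}"]) (use m c that in auto)
 have c': "(CLINT om|M. iexp (\<Sum>k\<in>{..<length vs}. b k * - lin (set vs) (gs vs k) om)) =
 of_real (exp (- (\<Sum>k\<in>{..<length vs}. (b k)\<^sup>2) / 2))" for b
 using c[of "%k. - b k"] by simp
 show "indep_vars (%_. borel) (%k om. - lin (set vs) (gs vs k) om) {..<length vs}"
 by (rule indep_std_normal(1)) (use m c' in auto)
 show "distr M borel (%om. - lin (set vs) (gs vs k) om) = std_normal" if "k < length vs" for k
 by (rule indep_std_normal(2)[of "{..<length vs}" "%k om. - lin (set vs) (gs vs k) om"]) (use m c' that in auto)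
qed

lemma ex_gs_coeff':
 assumes v: "v : set vs"
 shows "ALL j<length vs. cov (set vs) (%x. if x = v then 1 else 0) (gs vs j) >= 0"
 "\<phi> v om = (\<Sum>j<length vs. cov (set vs) (%x. if x = v then 1 else 0) (gs vs j) * lin (set vs) (gs vs j) om)"
proof -
 let ?V = "set vs" and ?d = "%x. if x = v then 1 else (0::real)"
 obtain k where k: "k < length vs" "v = vs ! k" using v by (auto simp: in_set_conv_nth)
 obtain l where l: "ALL j. l j >= 0" "!!x. ?d x = (\<Sum>j<length vs. l j * gs vs j x)"
 using ex_gs_coeff[OF k(1)] k(2) by blast
 have c: "cov ?V ?d (gs vs j) = l j" if j: "j < length vs" for j
 proof -
 have "cov ?V ?d (gs vs j) = (\<Sum>i<length vs. l i * (if j = i then 1 else 0))"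
 unfolding l(2) using j by (simp add: cov_sum cov_cmult cov_gs)
 also have "... = l j" using j by (subst sum.remove[of _ j]) (auto intro!: sum.neutral)
 finally show ?thesis .
 qed
 show "ALL j<length vs. cov ?V ?d (gs vs j) >= 0" using c l by simp
 have "\<phi> v om = lin ?V ?d om" using v by (simp add: lin_delta)
 also have "... = (\<Sum>j<length vs. l j * lin ?V (gs vs j) om)"
 unfolding l(2) by (simp add: lin_sum lin_cmult)
 finally show "\<phi> v om = (\<Sum>j<length vs. cov ?V ?d (gs vs j) * lin ?V (gs vs j) om)" by (simp add: c)
qed

lemma lin_expand:
 "lin (set vs) a om = (\<Sum>j<length vs. cov (set vs) a (gs vs j) * lin (set vs) (gs vs j) om)"
proof -
 let ?V = "set vs" and ?d = "%v x. if x = v then 1 else (0::real)"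
 have a: "cov ?V a b = (\<Sum>v\<in>?V. a v * cov ?V (?d v) b)" for b
 proof -
 have "cov ?V a b = (\<Sum>u\<in>?V. \<Sum>v\<in>?V. a u * b v * g u v)" by (simp add: cov_def)
 also have "... = (\<Sum>u\<in>?V. a u * cov ?V (?d u) b)"
 proof (intro sum.cong refl)
 fix u assume u: "u : ?V"
 have "cov ?V (?d u) b = (\<Sum>v\<in>?V. b v * g u v)"
 unfolding cov_def using u by (subst sum.remove[of _ u]) (auto intro!: sum.neutral)
 then show "(\<Sum>v\<in>?V. a u * b v * g u v) = a u * cov ?V (?d u) b"
 by (simp add: sum_distrib_left mult_ac)
 qed
 finally show ?thesis .
 qed
 have "lin ?V a om = (\<Sum>v\<in>?V. a v * (\<Sum>j<length vs. cov ?V (?d v) (gs vs j) * lin ?V (gs vs j) om))"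
 unfolding lin_def[of ?V a] using ex_gs_coeff'(2) by (intro sum.cong) auto
 also have "... = (\<Sum>v\<in>?V. \<Sum>j<length vs. a v * (cov ?V (?d v) (gs vs j) * lin ?V (gs vs j) om))"
 by (simp only: sum_distrib_left)
 also have "... = (\<Sum>j<length vs. \<Sum>v\<in>?V. a v * (cov ?V (?d v) (gs vs j) * lin ?V (gs vs j) om))"
 by (rule sum.swap)
 also have "... = (\<Sum>j<length vs. (\<Sum>v\<in>?V. a v * cov ?V (?d v) (gs vs j)) * lin ?V (gs vs j) om)"
 by (simp only: sum_distrib_right mult.assoc)
 finally show ?thesis by (simp only: a[symmetric])
qed

end

section \<open>Positive Gaussian representation, FKG and conditional laws given the field on a
  set\<close>

definition res :: "'a set => 'w => 'a => real" where
 "res V om = (\<lambda>v\<in>V. \<phi> v om)"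

lemma measurable_res: "V <= X ==> res V : measurable M (PiM V (%_. borel))"
 unfolding res_def[abs_def] by (intro measurable_restrict measurable_phi) auto

text \<open>The field is a linear image, with nonnegative matrix L, of independent standard normals.
  The negated field uses the same L with negated normals, which have the same law; this gives the
  sign symmetry.\<close>

lemma Gaussian_representation:
 assumes V: "finite V" "V <= X" "V ~= {}"
 obtains m :: nat and Z :: "'w => nat => real" and L :: "'a => nat => real" where
 "!!v j. v : V ==> j < m ==> L v j >= 0"
 "!!om. res V om = (\<lambda>v\<in>V. \<Sum>j<m. L v j * Z om j)"
 "!!om. (\<lambda>v\<in>V. - \<phi> v om) = (\<lambda>v\<in>V. \<Sum>j<m. L v j * (\<lambda>j\<in>{..<m}. - Z om j) j)"
 "Z : measurable M (PiM {..<m} (%_. borel))"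
 "distr M (PiM {..<m} (%_. borel)) Z = PiM {..<m} (%_. std_normal)"
 "(%om. \<lambda>j\<in>{..<m}. - Z om j) : measurable M (PiM {..<m} (%_. borel))"
 "distr M (PiM {..<m} (%_. borel)) (%om. \<lambda>j\<in>{..<m}. - Z om j) = PiM {..<m} (%_. std_normal)"
proof -
 obtain vs where vs: "set vs = V" "distinct vs" using finite_distinct_list[OF V(1)] by auto
 have vs': "distinct vs" "set vs <= X" using vs V by auto
 define m where "m = length vs"
 define z where "z j = lin V (gs vs j)" for j
 define Z where "Z om = (\<lambda>j\<in>{..<m}. z j om)" for om
 define L where "L v j = cov V (%x. if x = v then 1 else 0) (gs vs j)" for v j
 have m0: "{..<m} ~= {}" using V(3) vs(1) by (auto simp: m_def lessThan_empty_iff)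
 have mz: "z j : borel_measurable M" for j unfolding z_def using V by (intro measurable_lin)
 have Z': "(\<lambda>j\<in>{..<m}. - Z om j) = (\<lambda>j\<in>{..<m}. - z j om)" for om by (auto simp: Z_def)
 have e: "\<phi> v om = (\<Sum>j<m. L v j * z j om)" if "v : V" for v om
 using ex_gs_coeff'(2)[OF vs', of v om] that vs by (simp add: L_def z_def m_def)
 have d: "distr M (PiM {..<m} (%_. borel)) (%om. \<lambda>j\<in>{..<m}. y j om) = PiM {..<m} (%_. std_normal)"
 if "indep_vars (%_. borel) y {..<m}" "!!j. j < m ==> distr M borel (y j) = std_normal" "!!j. y j : borel_measurable M" for y
 proof -
 have "distr M (PiM {..<m} (%_. borel)) (%om. \<lambda>j\<in>{..<m}. y j om) = PiM {..<m} (%j. distr M borel (y j))"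
 using that(1) by (subst (asm) indep_vars_iff_distr_eq_PiM'[OF m0 that(3)])
 also have "... = PiM {..<m} (%_. std_normal)" using that(2) by (intro PiM_cong) auto
 finally show ?thesis .
 qed
 show thesis
 proof (rule that[of m L Z])
 show "L v j >= 0" if "v : V" "j < m" for v j
 using ex_gs_coeff'(1)[OF vs', of v] that vs by (simp add: L_def m_def)
 show "res V om = (\<lambda>v\<in>V. \<Sum>j<m. L v j * Z om j)" for om
 unfolding res_def by (intro restrict_ext) (simp add: e Z_def)
 show "(\<lambda>v\<in>V. - \<phi> v om) = (\<lambda>v\<in>V. \<Sum>j<m. L v j * (\<lambda>j\<in>{..<m}. - Z om j) j)" for om
 by (intro restrict_ext) (simp add: e Z_def sum_negf)
 show "Z : measurable M (PiM {..<m} (%_. borel))"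
 unfolding Z_def[abs_def] by (intro measurable_restrict mz)
 show "(%om. \<lambda>j\<in>{..<m}. - Z om j) : measurable M (PiM {..<m} (%_. borel))"
 unfolding Z' by (intro measurable_restrict borel_measurable_uminus mz)
 show "distr M (PiM {..<m} (%_. borel)) Z = PiM {..<m} (%_. std_normal)"
 unfolding Z_def[abs_def] using indep_gs(1,2)[OF vs'] vs mz by (intro d) (auto simp: z_def m_def)
 show "distr M (PiM {..<m} (%_. borel)) (%om. \<lambda>j\<in>{..<m}. - Z om j) = PiM {..<m} (%_. std_normal)"
 unfolding Z' using indep_gs(3,4)[OF vs'] vs mz by (intro d) (auto simp: z_def m_def)
 qed
qed

lemma measurable_linear_PiM:
 "(%z. \<lambda>v\<in>V. \<Sum>j<m. L v j * z j) : measurable (PiM {..<m::nat} (%_. borel)) (PiM V (%_. borel :: real measure))"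
 by (intro measurable_restrict borel_measurable_sum borel_measurable_times borel_measurable_const measurable_component_singleton) auto

lemma symmetric_law:
 assumes V: "finite V" "V <= X" "V ~= {}" and F: "F : borel_measurable (PiM V (%_. borel))"
 shows "expectation (%om. F (\<lambda>v\<in>V. - \<phi> v om)) = expectation (%om. F (res V om) :: real)"
proof -
 obtain m Z L where L: "!!v j. v : V ==> j < m ==> L v j >= 0" and Z:
 "!!om. res V om = (\<lambda>v\<in>V. \<Sum>j<m. L v j * Z om j)"
 "!!om. (\<lambda>v\<in>V. - \<phi> v om) = (\<lambda>v\<in>V. \<Sum>j<m. L v j * (\<lambda>j\<in>{..<m}. - Z om j) j)"
 "Z : measurable M (PiM {..<m::nat} (%_. borel))"
 "distr M (PiM {..<m} (%_. borel)) Z = PiM {..<m} (%_. std_normal)"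
 "(%om. \<lambda>j\<in>{..<m}. - Z om j) : measurable M (PiM {..<m} (%_. borel))"
 "distr M (PiM {..<m} (%_. borel)) (%om. \<lambda>j\<in>{..<m}. - Z om j) = PiM {..<m} (%_. std_normal)"
 by (rule Gaussian_representation[OF V], rule that)
 let ?F = "%z. F (\<lambda>v\<in>V. \<Sum>j<m. L v j * z j)"
 have mF: "?F : borel_measurable (PiM {..<m} (%_. borel))"
 by (rule measurable_compose[OF measurable_linear_PiM F])
 have "expectation (%om. F (\<lambda>v\<in>V. - \<phi> v om)) = (\<integral>z. ?F z \<partial>distr M (PiM {..<m} (%_. borel)) (%om. \<lambda>j\<in>{..<m}. - Z om j))"
 unfolding Z(2) by (rule integral_distr[OF Z(5) mF, symmetric])
 also have "... = (\<integral>z. ?F z \<partial>distr M (PiM {..<m} (%_. borel)) Z)" by (simp only: Z(4,6))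
 also have "... = expectation (%om. F (res V om))"
 unfolding Z(1) by (rule integral_distr[OF Z(3) mF])
 finally show ?thesis .
qed

text \<open>Increasing functions of the field are increasing functions of the independent normals,
  because the matrix L is nonnegative.\<close>

lemma FKG:
 assumes V: "finite V" "V <= X" "V ~= {}"
 and F: "F : borel_measurable (PiM V (%_. borel))" "integrable M (%om. (F (res V om))\<^sup>2)"
 "!!x y. (!!v. v : V ==> x v <= y v) ==> F x <= F y"
 and G: "G : borel_measurable (PiM V (%_. borel))" "integrable M (%om. (G (res V om))\<^sup>2)"
 "!!x y. (!!v. v : V ==> x v <= y v) ==> G x <= G y"
 shows "expectation (%om. F (res V om)) * expectation (%om. G (res V om)) <= expectation (%om. F (res V om) * G (res V om) :: real)"
proof -
 obtain m Z L where L: "!!v j. v : V ==> j < m ==> L v j >= 0" and Z: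
 "!!om. res V om = (\<lambda>v\<in>V. \<Sum>j<m. L v j * Z om j)"
 "!!om. (\<lambda>v\<in>V. - \<phi> v om) = (\<lambda>v\<in>V. \<Sum>j<m. L v j * (\<lambda>j\<in>{..<m}. - Z om j) j)"
 "Z : measurable M (PiM {..<m::nat} (%_. borel))"
 "distr M (PiM {..<m} (%_. borel)) Z = PiM {..<m} (%_. std_normal)"
 "(%om. \<lambda>j\<in>{..<m}. - Z om j) : measurable M (PiM {..<m} (%_. borel))"
 "distr M (PiM {..<m} (%_. borel)) (%om. \<lambda>j\<in>{..<m}. - Z om j) = PiM {..<m} (%_. std_normal)"
 by (rule Gaussian_representation[OF V], rule that)
 let ?l = "%z. \<lambda>v\<in>V. \<Sum>j<m. L v j * z j"
 let ?P = "PiM {..<m} (%_. std_normal)"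
 have s: "sets ?P = sets (PiM {..<m} (%_. borel))" by (intro sets_PiM_cong) auto
 have mc: "H : borel_measurable ?P \<longleftrightarrow> H : borel_measurable (PiM {..<m} (%_. borel))" for H :: "(nat => real) => real"
 by (simp only: measurable_cong_sets[OF s refl])
 have m: "(%z. H (?l z)) : borel_measurable (PiM {..<m} (%_. borel))" if "H : borel_measurable (PiM V (%_. borel))" for H :: "('a => real) => real"
 by (rule measurable_compose[OF measurable_linear_PiM that])
 have E: "expectation (%om. H (res V om)) = (\<integral>z. H (?l z) \<partial>?P)" if "H : borel_measurable (PiM V (%_. borel))" for H :: "('a => real) => real"
 unfolding Z(1) Z(4)[symmetric] by (rule integral_distr[OF Z(3) m[OF that], symmetric])
 have I: "integrable ?P (%z. (H (?l z))\<^sup>2)" if "H : borel_measurable (PiM V (%_. borel))" "integrable M (%om. (H (res V om))\<^sup>2)" for H :: "('a => real) => real"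
 unfolding Z(4)[symmetric] using that(2) unfolding Z(1)
 by (subst integrable_distr_eq[OF Z(3)]) (use m[OF that(1)] in auto)
 have mono: "H (?l x) <= H (?l y)" if "!!x y. (!!v. v : V ==> x v <= y v) ==> H x <= H y" "!!i. i : {..<m} ==> x i <= y i" for H :: "('a => real) => real" and x y
 proof (rule that(1))
 fix v assume v: "v : V"
 have "(\<Sum>j<m. L v j * x j) <= (\<Sum>j<m. L v j * y j)"
 by (intro sum_mono mult_left_mono that(2) L v) auto
 then show "?l x v <= ?l y v" using v by simp
 qed
 have mFG: "(%x. F x * G x) : borel_measurable (PiM V (%_. borel))"
 by (intro borel_measurable_times F(1) G(1))
 have "(\<integral>z. F (?l z) \<partial>?P) * (\<integral>z. G (?l z) \<partial>?P) <= (\<integral>z. F (?l z) * G (?l z) \<partial>?P)"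
 proof (rule Harris_inequality)
 show "(%z. F (?l z)) : borel_measurable ?P" "(%z. G (?l z)) : borel_measurable ?P"
 unfolding mc by (rule m[OF F(1)], rule m[OF G(1)])
 show "F (?l x) <= F (?l y)" if "!!i. i : {..<m} ==> x i <= y i" for x y
 by (rule mono) (fact F(3), fact that)
 show "G (?l x) <= G (?l y)" if "!!i. i : {..<m} ==> x i <= y i" for x y
 by (rule mono) (fact G(3), fact that)
 show "prob_space std_normal" by (rule prob_space_normal_density) simp
 show "integrable ?P (%z. (F (?l z))\<^sup>2)" by (rule I[OF F(1,2)])
 show "integrable ?P (%z. (G (?l z))\<^sup>2)" by (rule I[OF G(1,2)])
 qed simp_all
 then show ?thesis using E[OF F(1)] E[OF G(1)] E[OF mFG] by simp
qed

text \<open>Listing S before x and y splits the orthonormal basis: the field on S involves only the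
  first K basis vectors, the residuals at x and y only the later ones.\<close>

lemma psi_indep:
 assumes S: "finite S" "S <= X" and x: "x : X" and y: "y : X"
 and F: "F : borel_measurable (PiM S (%_. borel))" "integrable M (%om. F (res S om))"
 and h: "h : borel_measurable (borel \<Otimes>\<^sub>M borel)" "integrable M (%om. h (ps S x om, ps S y om) :: real)"
 shows "integrable M (%om. F (res S om) * h (ps S x om, ps S y om))"
 "expectation (%om. F (res S om) * h (ps S x om, ps S y om)) =
 expectation (%om. F (res S om)) * expectation (%om. h (ps S x om, ps S y om))"
proof -
 obtain sl where sl: "set sl = S" "distinct sl" using finite_distinct_list[OF S(1)] by auto
 obtain rl where rl: "set rl = {x, y} - S" "distinct rl" using finite_distinct_list[of "{x, y} - S"] by auto
 define vs where "vs = sl @ rl"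
 have vs: "distinct vs" "set vs <= X" and V: "set vs = S Un {x, y}" using sl rl S x y by (auto simp: vs_def)
 define K where "K = length sl"
 define m where "m = length vs"
 have K: "K <= m" "take K vs = sl" by (auto simp: K_def m_def vs_def)
 let ?z = "%j. lin (set vs) (gs vs j)"
 have left: "\<phi> v om = (\<Sum>j<K. cov (set vs) (%x. if x = v then 1 else 0) (gs vs j) * ?z j om)" if v: "v : S" for v om
 proof -
 have c0: "cov (set vs) (%x. if x = v then 1 else 0) (gs vs j) = 0" if j: "j < m" "~ j < K" for j
 proof -
 have vj: "v : set (take j vs)" using v sl j set_take_subset_set_take[of K j vs] K by auto
 have "cov (set vs) (gs vs j) (%x. if x = v then 1 else 0) = (\<Sum>u\<in>{v}. (if u = v then 1 else 0) * kg (set (take j vs)) (vs ! j) u) / sqrt (kg (set (take j vs)) (vs ! j) (vs ! j))"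
 using j v V by (intro cov_gs_left[OF vs]) (auto simp: m_def)
 also have "... = 0" using kg_on2[of "set (take j vs)" "vs ! j" v] vs vj j set_take_subset[of j vs] by (auto simp: m_def subset_iff)
 finally show ?thesis using cov_sym[OF vs(2), of "gs vs j" "%x. if x = v then 1 else 0"] by simp
 qed
 have "\<phi> v om = (\<Sum>j<m. cov (set vs) (%x. if x = v then 1 else 0) (gs vs j) * ?z j om)"
 using ex_gs_coeff'(2)[OF vs, of v om] v V by (simp add: m_def)
 also have "... = (\<Sum>j<K. cov (set vs) (%x. if x = v then 1 else 0) (gs vs j) * ?z j om)"
 using K c0 by (intro sum.mono_neutral_right) auto
 finally show ?thesis .
 qed
 have right: "ps S v om = (\<Sum>j\<in>{K..<m}. cov (set vs) (psc S v) (gs vs j) * ?z j om)" if v: "v : set vs" for v om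
 proof -
 have c0: "cov (set vs) (psc S v) (gs vs j) = 0" if j: "j < K" for j
 proof -
 have sub: "set (take (Suc j) vs) <= S" using set_take_subset_set_take[of "Suc j" K vs] K j sl by auto
 have "cov (set vs) (psc S v) (gs vs j) = (\<Sum>u\<in>S. gs vs j u * kg S v u)"
 using v V vs sub j K gs_supp[OF vs, of j] S(1) by (intro cov_psi) (auto simp: m_def)
 also have "... = 0" using kg_on2[OF S] v vs by (intro sum.neutral) auto
 finally show ?thesis .
 qed
 have "ps S v om = lin (set vs) (psc S v) om" using v V S(1) by (intro psi_lin[symmetric]) auto
 also have "... = (\<Sum>j<m. cov (set vs) (psc S v) (gs vs j) * ?z j om)" by (simp add: lin_expand[OF vs, of "psc S v"] m_def)
 also have "... = (\<Sum>j\<in>{K..<m}. cov (set vs) (psc S v) (gs vs j) * ?z j om)"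
 using K c0 by (intro sum.mono_neutral_right) auto
 finally show ?thesis .
 qed
 have ind: "indep_var (PiM {..<K} (%_. borel)) (%om. restrict (%j. ?z j om) {..<K}) (PiM {K..<m} (%_. borel)) (%om. restrict (%j. ?z j om) {K..<m})"
 using indep_gs(1)[OF vs] K by (intro indep_var_restrict[of _ _ "{..<length vs}"]) (auto simp: m_def)
 define f1 where "f1 z = F (\<lambda>v\<in>S. \<Sum>j<K. cov (set vs) (%x. if x = v then 1 else 0) (gs vs j) * z j)" for z
 define f2 where "f2 z = h (\<Sum>j\<in>{K..<m}. cov (set vs) (psc S x) (gs vs j) * z j, \<Sum>j\<in>{K..<m}. cov (set vs) (psc S y) (gs vs j) * z j)" for z
 have m1: "f1 : borel_measurable (PiM {..<K} (%_. borel))"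
 unfolding f1_def[abs_def] by (rule measurable_compose[OF measurable_linear_PiM F(1)])
 have m2: "f2 : borel_measurable (PiM {K..<m} (%_. borel))"
 unfolding f2_def[abs_def]
 by (rule measurable_compose[OF _ h(1)])
 (intro measurable_Pair borel_measurable_sum borel_measurable_times borel_measurable_const measurable_component_singleton)
 have e1: "f1 (restrict (%j. ?z j om) {..<K}) = F (res S om)" for om
 unfolding f1_def res_def by (rule arg_cong[where f = F], intro restrict_ext) (simp add: left)
 have e2: "f2 (restrict (%j. ?z j om) {K..<m}) = h (ps S x om, ps S y om)" for om
 unfolding f2_def using V by (simp add: right)
 have ind2: "indep_var borel (%om. F (res S om)) borel (%om. h (ps S x om, ps S y om))"
 using indep_var_compose[OF ind m1 m2] by (simp add: o_def e1 e2)
 show "integrable M (%om. F (res S om) * h (ps S x om, ps S y om))"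
 using indep_var_integrable[OF ind2 F(2) h(2)] .
 show "expectation (%om. F (res S om) * h (ps S x om, ps S y om)) =
 expectation (%om. F (res S om)) * expectation (%om. h (ps S x om, ps S y om))"
 using indep_var_lebesgue_integral[OF ind2 F(2) h(2)] .
qed

lemma conditional_mean:
 assumes S: "finite S" "S <= X" and x: "x : X"
 and F: "F : borel_measurable (PiM S (%_. borel))" "integrable M (%om. F (res S om) :: real)"
 shows "integrable M (%om. F (res S om) * ps S x om)" "expectation (%om. F (res S om) * ps S x om) = 0"
proof -
 let ?V = "insert x S"
 have V: "finite ?V" "?V <= X" "S <= ?V" "x : ?V" using S x by auto
 have p: "ps S x = lin ?V (psc S x)" using V by (auto simp: psi_lin)
 have i: "integrable M (%om. fst (ps S x om, ps S x om))" 
 using lin_moments(1)[OF V(1,2), of "psc S x" 1] by (simp add: p)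
 show "integrable M (%om. F (res S om) * ps S x om)"
 using psi_indep(1)[OF S x x F, of fst] i by simp
 show "expectation (%om. F (res S om) * ps S x om) = 0"
 using psi_indep(2)[OF S x x F, of fst] i lin_moments(2)[OF V(1,2), of "psc S x"] by (simp add: p)
qed

lemma conditional_covariance:
 assumes S: "finite S" "S <= X" and x: "x : X" and y: "y : X"
 and F: "F : borel_measurable (PiM S (%_. borel))" "integrable M (%om. F (res S om) :: real)"
 shows "integrable M (%om. F (res S om) * (ps S x om * ps S y om))"
 "expectation (%om. F (res S om) * (ps S x om * ps S y om)) = expectation (%om. F (res S om)) * kg S x y"
proof -
 let ?V = "insert x (insert y S)"
 have V: "finite ?V" "?V <= X" "S <= ?V" "x : ?V" "y : ?V" using S x y by auto
 have p: "ps S x = lin ?V (psc S x)" "ps S y = lin ?V (psc S y)" using V by (auto simp: psi_lin)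
 let ?h = "%p::real \<times> real. fst p * snd p"
 have i: "integrable M (%om. ?h (ps S x om, ps S y om))" 
 using lin_square_integrable[OF V(1,2)] by (simp add: p)
 have m: "?h : borel_measurable (borel \<Otimes>\<^sub>M borel)" by measurable
 show "integrable M (%om. F (res S om) * (ps S x om * ps S y om))"
 using psi_indep(1)[OF S x y F m i] by simp
 show "expectation (%om. F (res S om) * (ps S x om * ps S y om)) = expectation (%om. F (res S om)) * kg S x y"
 using psi_indep(2)[OF S x y F m i] cov_psi_psi[OF V] expectation_lin_lin[OF V(1,2)] by (simp add: p)
qed

end

section \<open>Exploration of a random set of vertices\<close>

text \<open>The filler 0 is arbitrary: it is used only for functions whose value on the relevant
  event depends on the coordinates in S.\<close>

definition ext0 :: "'a set => ('a => real) => 'a => real" where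
 "ext0 S f v = (if v : S then f v else 0)"

context gff begin

lemma integrable_phi_power: "v : X ==> integrable M (%om. \<phi> v om ^ k)"
 using lin_moments(1)[of "{v}" "%_. 1" k] by (simp add: lin_def)

lemma expectation_phi2: "v : X ==> w : X ==> expectation (%om. \<phi> v om * \<phi> w om) = g v w"
 "v : X ==> expectation (\<phi> v) = 0"
proof -
 assume v: "v : X"
 show "expectation (\<phi> v) = 0" using lin_moments(2)[of "{v}" "%_. 1"] v by (simp add: lin_def[abs_def])
 assume w: "w : X"
 let ?V = "{v, w}"
 have e: "\<phi> v = lin ?V (%x. if x = v then 1 else 0)" "\<phi> w = lin ?V (%x. if x = w then 1 else 0)"
 by (auto simp: lin_delta)
 have "cov ?V (%x. if x = v then 1 else 0) (%x. if x = w then 1 else 0) = (\<Sum>u\<in>?V. (if u = v then 1 else 0) * g u w)"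
 by (rule cov_delta2) auto
 also have "... = g v w" by (cases "v = w") auto
 finally show "expectation (%om. \<phi> v om * \<phi> w om) = g v w"
 using expectation_lin_lin[of ?V] v w e by simp
qed

lemma sq_prod_integrable:
 fixes F G :: "'w => real"
 assumes "F : borel_measurable M" "G : borel_measurable M" "integrable M (%x. (F x)\<^sup>2)" "integrable M (%x. (G x)\<^sup>2)"
 shows "integrable M (%x. F x * G x)"
proof (rule Bochner_Integration.integrable_bound)
 show "integrable M (%x. (F x)\<^sup>2 + (G x)\<^sup>2)" using assms(3,4) by simp
 have "\<bar>a * b\<bar> <= \<bar>a\<^sup>2 + b\<^sup>2\<bar>" for a b :: real
 proof -
 have "2 * (\<bar>a\<bar> * \<bar>b\<bar>) <= a\<^sup>2 + b\<^sup>2" using sum_squares_bound[of "\<bar>a\<bar>" "\<bar>b\<bar>"] by simp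
 moreover have "0 <= \<bar>a\<bar> * \<bar>b\<bar>" by simp
 ultimately show ?thesis unfolding abs_mult by linarith
 qed
 then show "AE x in M. norm (F x * G x) <= norm ((F x)\<^sup>2 + (G x)\<^sup>2)"
 unfolding real_norm_def by (intro AE_I2)
 show "(%x. F x * G x) : borel_measurable M" using assms(1,2) by (rule borel_measurable_times)
qed

end

text \<open>A local random set: it can be recognised from the field on it, so that conditioning on the
 event that it equals a given set is conditioning on the field on that set.\<close>
locale local_set = gff M X nb q g \<kappa> \<phi>
 for M :: "'w measure" and X :: "'a set" and nb :: "'a => 'a set" and q :: "'a => real"
 and g :: "'a => 'a => real" and \<kappa> :: real and \<phi> +
 fixes V :: "'a set" and T :: "('a => real) => 'a set"
 assumes V: "finite V" "V <= X"
 and T_sub: "T f <= V"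
 and T_local: "(!!v. v : T f ==> f v = f' v) ==> T f' = T f"
 and T_meas: "(%f. if T f = S then 1 else 0 :: real) : borel_measurable (PiM V (%_. borel))"
begin

definition hT :: "('a => real) => 'a => real" where
 "hT f x = (\<Sum>z\<in>T f. hm (T f) x z * f z)"

lemma measurable_ext0: "S <= V ==> (%f. \<lambda>v\<in>V. ext0 S f v) : measurable (PiM S (%_. borel)) (PiM V (%_. borel))"
proof (rule measurable_restrict)
 fix v assume "v : V"
 show "(%f. ext0 S f v) : borel_measurable (PiM S (%_. borel))"
 unfolding ext0_def by (cases "v : S") auto
qed

text \<open>The part of F carried by the event that T equals S, rewritten as a function of the field
  on S alone. Locality of T and F makes this rewriting correct (\<open>slice_res\<close>).\<close>

definition slice :: "(('a => real) => real) => 'a set => ('a => real) => real" where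
 "slice F S f = F (\<lambda>v\<in>V. ext0 S f v) * (if T (\<lambda>v\<in>V. ext0 S f v) = S then 1 else 0)"

context
 fixes F :: "('a => real) => real"
 assumes F_meas: "F : borel_measurable (PiM V (%_. borel))"
 and F_local: "!!f f'. (!!v. v : T f ==> f v = f' v) ==> F f' = F f"
begin

lemma slice_meas: "S <= V ==> slice F S : borel_measurable (PiM S (%_. borel))"
 unfolding slice_def[abs_def]
 by (intro borel_measurable_times measurable_compose[OF measurable_ext0 F_meas] measurable_compose[OF measurable_ext0 T_meas])

lemma slice_res:
 assumes S: "S <= V"
 shows "slice F S (res S om) = F (res V om) * (if T (res V om) = S then 1 else 0)"
proof -
 let ?e = "\<lambda>v\<in>V. ext0 S (res S om) v"
 have ag: "?e v = res V om v" if "v : S" for v using that S by (auto simp: ext0_def res_def)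
 show ?thesis
 proof (cases "T (res V om) = S")
 case True
 have "T ?e = T (res V om)" by (rule T_local) (use ag True in simp)
 moreover have "F ?e = F (res V om)" by (rule F_local) (use ag True in simp)
 ultimately show ?thesis using True by (simp add: slice_def)
 next
 case False
 have "T ?e ~= S"
 proof
 assume *: "T ?e = S"
 have "T (res V om) = T ?e" by (rule T_local) (use ag * in simp)
 then show False using * False by simp
 qed
 then show ?thesis using False by (simp add: slice_def)
 qed
qed

lemma sum_slices: "F (res V om) = (\<Sum>S\<in>Pow V. slice F S (res S om))"
proof -
 have "(\<Sum>S\<in>Pow V. slice F S (res S om)) = (\<Sum>S\<in>Pow V. if S = T (res V om) then F (res V om) else 0)"
 by (intro sum.cong) (auto simp: slice_res)
 also have "... = F (res V om)" using V T_sub by simp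
 finally show ?thesis by simp
qed

lemma slice_le: "S <= V ==> \<bar>slice F S (res S om)\<bar> <= \<bar>F (res V om)\<bar>"
 by (simp add: slice_res)

end

lemma measurable_F_res: "F : borel_measurable (PiM V (%_. borel)) ==> (%om. F (res V om)) : borel_measurable M"
 by (rule measurable_compose[OF measurable_res[OF V(2)]])

text \<open>Split F into its slices over the finitely many values S of T. Each slice is a function
  of the field on S, against which the residual at x has mean 0, so the field at x may be replaced
  by its harmonic extension.\<close>

lemma stopped_mean:
 assumes F: "F : borel_measurable (PiM V (%_. borel))" "!!f f'. (!!v. v : T f ==> f v = f' v) ==> F f' = F f"
 and sq: "integrable M (%om. (F (res V om))\<^sup>2)" and x: "x : X"
 shows "expectation (%om. F (res V om) * \<phi> x om) = expectation (%om. F (res V om) * hT (res V om) x)"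
proof -
 note mF = measurable_F_res[OF F(1)]
 have iF: "integrable M (%om. F (res V om))" using mF sq by (rule square_integrable_imp_integrable)
 have s_meas: "(%om. slice F S (res S om)) : borel_measurable M" if "S <= V" for S
 using measurable_compose[OF measurable_res slice_meas[OF F that]] that V by auto
 have s_int: "integrable M (%om. slice F S (res S om))" if "S <= V" for S
 by (rule Bochner_Integration.integrable_bound[OF iF s_meas[OF that]]) (use slice_le[OF F that] in auto)
 have s_sq: "integrable M (%om. (slice F S (res S om))\<^sup>2)" if "S <= V" for S
 proof (rule Bochner_Integration.integrable_bound[OF sq])
 show "AE om in M. norm ((slice F S (res S om))\<^sup>2) <= norm ((F (res V om))\<^sup>2)"
 using power_mono[OF slice_le[OF F that], where n = 2] by (intro AE_I2) simp
 qed (intro borel_measurable_power s_meas that)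
 have each: "expectation (%om. slice F S (res S om) * \<phi> x om) = expectation (%om. slice F S (res S om) * (\<Sum>z\<in>S. hm S x z * \<phi> z om))
 & integrable M (%om. slice F S (res S om) * \<phi> x om) & integrable M (%om. slice F S (res S om) * (\<Sum>z\<in>S. hm S x z * \<phi> z om))" if S: "S <= V" for S
 proof -
 have S': "finite S" "S <= X" using S V finite_subset by auto
 note c = conditional_mean[OF S' x slice_meas[OF F S] s_int[OF S]]
 have i: "integrable M (%om. slice F S (res S om) * \<phi> x om)"
 using s_meas[OF S] s_sq[OF S] integrable_phi_power[OF x, of 2] measurable_phi[OF x] by (intro sq_prod_integrable)
 have e: "slice F S (res S om) * (\<Sum>z\<in>S. hm S x z * \<phi> z om) = slice F S (res S om) * \<phi> x om - slice F S (res S om) * ps S x om" for om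
 by (simp add: ps_def algebra_simps)
 show ?thesis unfolding e using i c by simp
 qed
 have "expectation (%om. F (res V om) * \<phi> x om) = expectation (%om. \<Sum>S\<in>Pow V. slice F S (res S om) * \<phi> x om)"
 by (intro Bochner_Integration.integral_cong refl, subst sum_slices[OF F]) (assumption | rule sum_distrib_right)+
 also have "... = (\<Sum>S\<in>Pow V. expectation (%om. slice F S (res S om) * \<phi> x om))"
 using each by (intro Bochner_Integration.integral_sum) auto
 also have "... = (\<Sum>S\<in>Pow V. expectation (%om. slice F S (res S om) * (\<Sum>z\<in>S. hm S x z * \<phi> z om)))"
 using each by (intro sum.cong) auto
 also have "... = expectation (%om. \<Sum>S\<in>Pow V. slice F S (res S om) * (\<Sum>z\<in>S. hm S x z * \<phi> z om))"
 using each by (intro Bochner_Integration.integral_sum[symmetric]) auto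
 also have "... = expectation (%om. F (res V om) * hT (res V om) x)"
 proof (intro Bochner_Integration.integral_cong refl)
 fix om
 have "(\<Sum>S\<in>Pow V. slice F S (res S om) * (\<Sum>z\<in>S. hm S x z * \<phi> z om)) =
 (\<Sum>S\<in>Pow V. if S = T (res V om) then F (res V om) * (\<Sum>z\<in>S. hm S x z * \<phi> z om) else 0)"
 using slice_res[OF F] by (intro sum.cong) auto
 also have "... = F (res V om) * (\<Sum>z\<in>T (res V om). hm (T (res V om)) x z * \<phi> z om)" using V T_sub by simp
 also have "(\<Sum>z\<in>T (res V om). hm (T (res V om)) x z * \<phi> z om) = hT (res V om) x"
 unfolding hT_def using T_sub by (intro sum.cong) (auto simp: res_def)
 finally show "(\<Sum>S\<in>Pow V. slice F S (res S om) * (\<Sum>z\<in>S. hm S x z * \<phi> z om)) = F (res V om) * hT (res V om) x" .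
 qed
 finally show ?thesis .
qed

lemma integrable_kgT: "x : X ==> y : X ==> integrable M (%om. kg (T (res V om)) x y)"
proof -
 assume xy: "x : X" "y : X"
 have e: "kg (T (res V om)) x y = (\<Sum>S\<in>Pow V. (if T (res V om) = S then 1 else 0) * kg S x y)" for om
 proof -
 have "(\<Sum>S\<in>Pow V. (if T (res V om) = S then 1 else 0) * kg S x y) = (\<Sum>S\<in>Pow V. if S = T (res V om) then kg S x y else 0)"
 by (intro sum.cong) auto
 then show ?thesis using V T_sub by simp
 qed
 have "integrable M (%om. if T (res V om) = S then 1 else 0 :: real)" for S
 by (rule integrable_const_bound[where B = 1]) (use measurable_F_res[OF T_meas] in auto)
 then show ?thesis unfolding e by (intro Bochner_Integration.integrable_sum integrable_mult_left)
qed

text \<open>On each slice write the field at x and y as harmonic extension plus residual. The mixed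
  products have mean 0 and the product of residuals contributes the killed Green function.\<close>

lemma stopped_covariance:
 assumes x: "x : X" and y: "y : X"
 shows "g x y = expectation (%om. hT (res V om) x * hT (res V om) y) + expectation (%om. kg (T (res V om)) x y)"
proof -
 let ?I = "%S om. if T (res V om) = S then 1 else 0 :: real"
 let ?h = "%S x om. \<Sum>z\<in>S. hm S x z * \<phi> z om"
 let ?o = "%_::'a => real. 1 :: real"
 have o: "?o : borel_measurable (PiM V (%_. borel))" "!!f f'. (!!v. v : T f ==> f v = f' v) ==> ?o f' = ?o f" by auto
 have sI: "slice ?o S (res S om) = ?I S om" if "S <= V" for S om
 using slice_res[OF o that] by simp
 have mI: "?I S : borel_measurable M" for S by (rule measurable_F_res[OF T_meas])
 have iI: "integrable M (?I S)" for S by (rule integrable_const_bound[where B = 1]) (use mI in auto)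
 have each: "expectation (%om. ?I S om * (\<phi> x om * \<phi> y om)) = expectation (%om. ?I S om * (?h S x om * ?h S y om)) + expectation (?I S) * kg S x y
 & integrable M (%om. ?I S om * (\<phi> x om * \<phi> y om)) & integrable M (%om. ?I S om * (?h S x om * ?h S y om))" if S: "S <= V" for S
 proof -
 have S': "finite S" "S <= X" using S V finite_subset by auto
 have hlin: "?h S w om = lin S (hm S w) om" for w om by (simp add: lin_def)
 define G where "G w f = slice ?o S f * (\<Sum>z\<in>S. hm S w z * f z)" for w f
 have Gm: "G w : borel_measurable (PiM S (%_. borel))" for w
 unfolding G_def[abs_def]
 by (intro borel_measurable_times slice_meas[OF o S] borel_measurable_sum borel_measurable_const measurable_component_singleton)
 have Gr: "G w (res S om) = ?I S om * ?h S w om" for w om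
 unfolding G_def sI[OF S] by (simp add: res_def)
 have hm2: "integrable M (%om. (?h S w om) ^ k)" for w k unfolding hlin by (rule lin_moments(1)[OF S'])
 have mh: "(%om. ?h S w om) : borel_measurable M" for w unfolding hlin using S' by (intro measurable_lin)
 have Ib: "integrable M (%om. ?I S om * Y om)" if "integrable M Y" for Y :: "'w => real"
 by (rule Bochner_Integration.integrable_bound[OF that]) (use mI that in auto)
 have Gi: "integrable M (%om. G w (res S om))" for w
 unfolding Gr using hm2[of w 1] by (intro Ib) simp
 have c1: "integrable M (%om. G x (res S om) * ps S y om)" "expectation (%om. G x (res S om) * ps S y om) = 0"
 by (rule conditional_mean[OF S' y Gm Gi])+
 have c2: "integrable M (%om. G y (res S om) * ps S x om)" "expectation (%om. G y (res S om) * ps S x om) = 0"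
 by (rule conditional_mean[OF S' x Gm Gi])+
 have si: "integrable M (%om. slice ?o S (res S om))" using iI unfolding sI[OF S] .
 note c3 = conditional_covariance[OF S' x y slice_meas[OF o S] si, unfolded sI[OF S]]
 have hh: "integrable M (%om. ?I S om * (?h S x om * ?h S y om))"
 using hm2[of x 2] hm2[of y 2] by (intro Ib sq_prod_integrable mh)
 have e: "?I S om * (\<phi> x om * \<phi> y om) = ?I S om * (?h S x om * ?h S y om) + G x (res S om) * ps S y om + G y (res S om) * ps S x om + ?I S om * (ps S x om * ps S y om)" for om
 unfolding Gr by (simp add: ps_def algebra_simps)
 show ?thesis unfolding e using hh c1 c2 c3 by simp
 qed
 have one: "(\<Sum>S\<in>Pow V. ?I S om * Y S) = Y (T (res V om))" for om and Y :: "'a set => real"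
 proof -
 have "(\<Sum>S\<in>Pow V. ?I S om * Y S) = (\<Sum>S\<in>Pow V. if S = T (res V om) then Y S else 0)" by (intro sum.cong) auto
 then show ?thesis using V T_sub by simp
 qed
 have "g x y = expectation (%om. \<Sum>S\<in>Pow V. ?I S om * (\<phi> x om * \<phi> y om))"
 using one[of _ "%_. \<phi> x _ * \<phi> y _"] expectation_phi2(1)[OF x y] by (simp add: one)
 also have "... = (\<Sum>S\<in>Pow V. expectation (%om. ?I S om * (\<phi> x om * \<phi> y om)))"
 using each by (intro Bochner_Integration.integral_sum) auto
 also have "... = (\<Sum>S\<in>Pow V. expectation (%om. ?I S om * (?h S x om * ?h S y om)) + expectation (?I S) * kg S x y)"
 using each by (intro sum.cong) auto
 also have "... = expectation (%om. \<Sum>S\<in>Pow V. ?I S om * (?h S x om * ?h S y om)) + expectation (%om. \<Sum>S\<in>Pow V. ?I S om * kg S x y)"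
 using each iI by (simp add: sum.distrib Bochner_Integration.integral_sum)
 also have "... = expectation (%om. hT (res V om) x * hT (res V om) y) + expectation (%om. kg (T (res V om)) x y)"
 proof -
 have h: "hT (res V om) w = ?h (T (res V om)) w om" for w om
 unfolding hT_def using T_sub by (intro sum.cong) (auto simp: res_def)
 show ?thesis by (simp only: one h)
 qed
 finally show ?thesis .
qed

end

section \<open>Boundary clusters\<close>

text \<open>The vertices V carry the field, D is the set from which the clusters are explored.\<close>
locale box = gff M X nb q g \<kappa> \<phi>
 for M :: "'w measure" and X :: "'a set" and nb :: "'a => 'a set" and q :: "'a => real"
 and g :: "'a => 'a => real" and \<kappa> :: real and \<phi> +
 fixes V D :: "'a set"
 assumes V: "finite V" "V <= X" and D: "D <= V" "D ~= {}"
 and interior: "v : V - D ==> nb v <= V"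
begin

inductive_set cl :: "'a set => 'a set" for P :: "'a set" where
 cl_base: "z : D ==> z : P ==> z : cl P"
| cl_step: "v : cl P ==> w : P ==> w : V ==> v : nb w ==> w : cl P"

text \<open>What an exploration of the cluster reveals: the cluster and the vertices at which it
  stopped. \<open>Sc\<close> adds the whole of D, since every starting vertex is inspected.\<close>

definition Kc :: "'a set => 'a set" where
 "Kc P = cl P Un {w\<in>V. nb w Int cl P ~= {}}"

definition Sc :: "'a set => 'a set" where
 "Sc P = Kc P Un D"

definition pos :: "('a => real) => 'a set" where
 "pos f = {v\<in>V. f v >= 0}"

definition neg :: "('a => real) => 'a set" where
 "neg f = {v\<in>V. f v <= 0}"

lemma cl_sub: "cl P <= P" and cl_V: "cl P <= V"
proof -
 show "cl P <= P" by (rule subsetI, erule cl.cases) auto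
 show "cl P <= V" using D by (intro subsetI, erule_tac cl.cases) auto
qed

lemma Kc_V: "Kc P <= V" using cl_V by (auto simp: Kc_def)
lemma Sc_V: "Sc P <= V" using Kc_V D by (auto simp: Sc_def)

lemma Sc_fin: "finite (Sc P)" "Sc P <= X"
 using Sc_V[of P] V finite_subset by auto

lemma cl_mono: assumes "P <= P'" shows "cl P <= cl P'"
proof
 fix x assume "x : cl P"
 then show "x : cl P'"
 by induction (use assms in \<open>auto intro: cl.intros\<close>)
qed

lemma Kc_mono: "P <= P' ==> Kc P <= Kc P'"
 using cl_mono[of P P'] by (auto simp: Kc_def)

lemma Sc_mono: "P <= P' ==> Sc P <= Sc P'"
 using Kc_mono[of P P'] by (auto simp: Sc_def)

text \<open>The growth of the cluster consults P only at vertices of D and at neighbours of cluster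
  vertices, all of which lie in \<open>Sc P\<close>.\<close>

lemma cl_local:
 assumes agree: "!!v. v : Sc P ==> v : P \<longleftrightarrow> v : P'"
 shows "cl P' = cl P"
proof
 show "cl P' <= cl P"
 proof
 fix x assume "x : cl P'"
 then show "x : cl P"
 proof induction
 case (cl_base z)
 then show ?case using agree[of z] by (auto simp: Sc_def intro: cl.cl_base)
 next
 case (cl_step v w)
 then have "w : Sc P" by (auto simp: Sc_def Kc_def)
 then show ?case using agree[of w] cl_step by (auto intro: cl.cl_step)
 qed
 qed
 show "cl P <= cl P'"
 proof
 fix x assume "x : cl P"
 then show "x : cl P'"
 proof induction
 case (cl_base z)
 then show ?case using agree[of z] by (auto simp: Sc_def intro: cl.cl_base)
 next
 case (cl_step v w)
 then have "w : cl P" by (auto intro: cl.cl_step)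
 then have "w : Sc P" by (auto simp: Sc_def Kc_def)
 then show ?case using agree[of w] cl_step by (auto intro: cl.cl_step)
 qed
 qed
qed

lemma Sc_local: "(!!v. v : Sc P ==> v : P \<longleftrightarrow> v : P') ==> Sc P' = Sc P"
 using cl_local[of P P'] by (simp add: Sc_def Kc_def)

lemma pos_agree: "v : V ==> f v = f' v ==> v : pos f \<longleftrightarrow> v : pos f'"
 and neg_agree: "v : V ==> f v = f' v ==> v : neg f \<longleftrightarrow> v : neg f'"
 by (auto simp: pos_def neg_def)

lemma pos_mono: "(!!v. v : V ==> f v <= f' v) ==> pos f <= pos f'"
 and neg_antimono: "(!!v. v : V ==> f v <= f' v) ==> neg f' <= neg f"
 unfolding pos_def neg_def by (auto intro: order_trans)

text \<open>The pair of sign patterns takes finitely many values, so an arbitrary function of it is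
  a finite combination of products of sign indicators.\<close>

lemma measurable_patterns:
 "(%f. \<Phi> (pos f) (neg f) :: real) : borel_measurable (PiM V (%_. borel))"
proof -
 let ?N = "PiM V (%_. borel :: real measure)"
 have 1: "(%f. if v : pos f then 1 else 0 :: real) : borel_measurable ?N" "(%f. if v : neg f then 1 else 0 :: real) : borel_measurable ?N" if "v : V" for v
 unfolding pos_def neg_def using that by measurable
 have e: "(if pos f = A then 1 else 0 :: real) = (\<Prod>v\<in>V. if v : A then (if v : pos f then 1 else 0) else 1 - (if v : pos f then 1 else 0))"
 "(if neg f = A then 1 else 0 :: real) = (\<Prod>v\<in>V. if v : A then (if v : neg f then 1 else 0) else 1 - (if v : neg f then 1 else 0))"
 if A: "A <= V" for A f
 proof -
 have gen: "(if B = A then 1 else 0 :: real) = (\<Prod>v\<in>V. if v : A then (if v : B then 1 else 0) else 1 - (if v : B then 1 else 0))" if "B <= V" for B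
 proof (cases "B = A")
 case True have "(\<Prod>v\<in>V. if v : A then (if v : A then 1 else 0) else 1 - (if v : A then 1 else 0 :: real)) = 1" by (rule prod.neutral) simp
 then show ?thesis unfolding True by simp
 next
 case False
 then obtain v where "v : V" "(v : A) ~= (v : B)" using A \<open>B <= V\<close> by auto
 then have "(\<Prod>v\<in>V. if v : A then (if v : B then 1 else 0) else 1 - (if v : B then 1 else 0 :: real)) = 0"
 using V by (intro prod_zero) auto
 then show ?thesis using False by simp
 qed
 show "(if pos f = A then 1 else 0 :: real) = (\<Prod>v\<in>V. if v : A then (if v : pos f then 1 else 0) else 1 - (if v : pos f then 1 else 0))"
 by (rule gen) (auto simp: pos_def)
 show "(if neg f = A then 1 else 0 :: real) = (\<Prod>v\<in>V. if v : A then (if v : neg f then 1 else 0) else 1 - (if v : neg f then 1 else 0))"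
 by (rule gen) (auto simp: neg_def)
 qed
 have 2: "(%f. if pos f = A then 1 else 0 :: real) : borel_measurable ?N" "(%f. if neg f = A then 1 else 0 :: real) : borel_measurable ?N" if A: "A <= V" for A
 proof -
 have p: "(%f. if v : A then h f else 1 - h f) : borel_measurable ?N" if "h : borel_measurable ?N" for v and h :: "('a => real) => real"
 using that by (cases "v : A") simp_all
 show "(%f. if pos f = A then 1 else 0 :: real) : borel_measurable ?N"
 unfolding e(1)[OF A] by (intro borel_measurable_prod p 1)
 show "(%f. if neg f = A then 1 else 0 :: real) : borel_measurable ?N"
 unfolding e(2)[OF A] by (intro borel_measurable_prod p 1)
 qed
 have "\<Phi> (pos f) (neg f) = (\<Sum>A\<in>Pow V. \<Sum>B\<in>Pow V. (if pos f = A then 1 else 0) * (if neg f = B then 1 else 0) * \<Phi> A B)" for f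
 proof -
 have in1: "pos f : Pow V" "neg f : Pow V" by (auto simp: pos_def neg_def)
 have "(\<Sum>A\<in>Pow V. \<Sum>B\<in>Pow V. (if pos f = A then 1 else 0) * (if neg f = B then 1 else 0) * \<Phi> A B)
 = (\<Sum>A\<in>Pow V. if A = pos f then (\<Sum>B\<in>Pow V. if B = neg f then \<Phi> A B else 0) else 0)"
 by (intro sum.cong refl) (auto intro!: sum.cong)
 also have "... = \<Phi> (pos f) (neg f)" using V in1 by simp
 finally show ?thesis by simp
 qed
 then have "(%f. \<Phi> (pos f) (neg f)) = (%f. \<Sum>A\<in>Pow V. \<Sum>B\<in>Pow V. (if pos f = A then 1 else 0) * (if neg f = B then 1 else 0) * \<Phi> A B)"
 by (rule ext)
 moreover have "... : borel_measurable ?N"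
 by (intro borel_measurable_sum borel_measurable_times borel_measurable_const 2) auto
 ultimately show ?thesis by simp
qed

lemma measurable_coord: "v : V ==> (%f. f v :: real) : borel_measurable (PiM V (%_. borel))"
 by (rule measurable_component_singleton)

lemma local_set_pos: "local_set M X nb q g \<kappa> \<phi> V (%f. Sc (pos f))"
proof unfold_locales
 show "Sc (pos f') = Sc (pos f)" if "!!v. v : Sc (pos f) ==> f v = f' v" for f f'
 proof (rule Sc_local)
 fix v assume v: "v : Sc (pos f)"
 show "v : pos f \<longleftrightarrow> v : pos f'" by (rule pos_agree[where f = f and f' = f', OF subsetD[OF Sc_V v] that[OF v]])
 qed
 show "(%f. if Sc (pos f) = S then 1 else 0 :: real) : borel_measurable (PiM V (%_. borel))" for S
 by (rule measurable_patterns[of "%A B. if Sc A = S then 1 else 0"])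
qed (auto simp: V Sc_V[THEN subsetD])

lemma local_set_neg: "local_set M X nb q g \<kappa> \<phi> V (%f. Sc (neg f))"
proof unfold_locales
 show "Sc (neg f') = Sc (neg f)" if "!!v. v : Sc (neg f) ==> f v = f' v" for f f'
 proof (rule Sc_local)
 fix v assume v: "v : Sc (neg f)"
 show "v : neg f \<longleftrightarrow> v : neg f'" by (rule neg_agree[where f = f and f' = f', OF subsetD[OF Sc_V v] that[OF v]])
 qed
 show "(%f. if Sc (neg f) = S then 1 else 0 :: real) : borel_measurable (PiM V (%_. borel))" for S
 by (rule measurable_patterns[of "%A B. if Sc B = S then 1 else 0"])
qed (auto simp: V Sc_V[THEN subsetD])

lemma local_set_both: "local_set M X nb q g \<kappa> \<phi> V (%f. Sc (pos f) Un Sc (neg f))"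
proof unfold_locales
 show "Sc (pos f') Un Sc (neg f') = Sc (pos f) Un Sc (neg f)" if "!!v. v : Sc (pos f) Un Sc (neg f) ==> f v = f' v" for f f'
 proof -
 have "Sc (pos f') = Sc (pos f)"
 proof (rule Sc_local)
 fix v assume v: "v : Sc (pos f)"
 show "v : pos f \<longleftrightarrow> v : pos f'" by (rule pos_agree[where f = f and f' = f', OF subsetD[OF Sc_V v] that[OF UnI1[OF v]]])
 qed
 moreover have "Sc (neg f') = Sc (neg f)"
 proof (rule Sc_local)
 fix v assume v: "v : Sc (neg f)"
 show "v : neg f \<longleftrightarrow> v : neg f'" by (rule neg_agree[where f = f and f' = f', OF subsetD[OF Sc_V v] that[OF UnI2[OF v]]])
 qed
 ultimately show ?thesis by simp
 qed
 show "(%f. if Sc (pos f) Un Sc (neg f) = S then 1 else 0 :: real) : borel_measurable (PiM V (%_. borel))" for S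
 by (rule measurable_patterns[of "%A B. if Sc A Un Sc B = S then 1 else 0"])
qed (auto simp: V Sc_V[THEN subsetD])

text \<open>The oscillation over the edges of V bounds the field next to a cluster it does not belong to.\<close>
definition osc :: "('a => real) => real" where
 "osc f = (\<Sum>v\<in>V. \<Sum>w\<in>nb v Int V. (f v - f w) ^ 4) powr (1/4)"

lemma osc_nonneg: "osc f >= 0" by (simp add: osc_def)

lemma osc_bound:
 assumes "v : V" "w : nb v" "w : V"
 shows "\<bar>f v - f w\<bar> <= osc f"
proof -
 have fin: "finite (nb v Int V)" for v using V by auto
 have "(f v - f w) ^ 4 <= (\<Sum>w\<in>nb v Int V. (f v - f w) ^ 4)"
 using assms fin by (intro member_le_sum) auto
 also have "... <= (\<Sum>v\<in>V. \<Sum>w\<in>nb v Int V. (f v - f w) ^ 4)"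
 using assms V by (intro member_le_sum[where f = "%v. \<Sum>w\<in>nb v Int V. (f v - f w) ^ 4"]) (auto intro!: sum_nonneg)
 finally have "\<bar>f v - f w\<bar> ^ 4 <= (\<Sum>v\<in>V. \<Sum>w\<in>nb v Int V. (f v - f w) ^ 4)" by simp
 then have "(\<bar>f v - f w\<bar> ^ 4) powr (1/4) <= osc f"
 unfolding osc_def by (intro powr_mono2) auto
 moreover have "(\<bar>f v - f w\<bar> ^ 4) powr (1/4) = \<bar>f v - f w\<bar>"
 proof (cases "f v = f w")
 case False
 then have "\<bar>f v - f w\<bar> ^ 4 = \<bar>f v - f w\<bar> powr 4" by simp
 then have "(\<bar>f v - f w\<bar> ^ 4) powr (1/4) = \<bar>f v - f w\<bar> powr (4 * (1/4))" by (simp only: powr_powr)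
 then show ?thesis by simp
 qed simp
 ultimately show ?thesis by simp
qed

definition hS :: "'a set => ('a => real) => 'a => real" where
 "hS S f x = (\<Sum>z\<in>S. hm S x z * f z)"

text \<open>Off the positive cluster all revealed values are negative, so minus their harmonic
  extension is a nonnegative function.\<close>

definition U :: "('a => real) => 'a => real" where
 "U f x = (if x : cl (pos f) then 0 else - hS (Sc (pos f)) f x)"

text \<open>Only the vertices of D away from the explored cluster contribute. Each factor decreases
  when the field increases, which is what makes FKG applicable; the omitted boundary values along
  the cluster are at most \<open>osc\<close>.\<close>

definition U2 :: "('a => real) => 'a => real" where
 "U2 f x = (\<Sum>z\<in>D. if z : Kc (pos f) then 0 else hm (Sc (pos f)) x z * max 0 (- f z))"

lemma hS_on: "x : Sc P ==> hS (Sc P) f x = f x"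
 unfolding hS_def by (rule sum_hm_on[OF Sc_fin])

lemma box_minimum:
 assumes W: "W <= V" and v: "v : W"
 and i: "!!v. v : W - S ==> v ~: D & nb v <= W & lap nb u v >= 0"
 and b: "!!v. v : W Int S ==> u v >= 0"
 shows "u v >= 0"
proof (rule minimum_principle[where W = W and S = S])
 show "finite {v : W. u v <= m}" for m
 by (rule finite_subset[OF _ finite_subset[OF W V(1)]]) auto
 show "W <= X" using W V(2) by (rule subset_trans)
 show "nb v <= W" "lap nb u v >= 0" if "v : W - S" for v using i[OF that] by simp_all
 show "u v >= 0" if "v : W Int S" for v by (rule b[OF that])
qed (rule v)

lemma outside_nb:
 assumes "v : V - cl P" "v ~: Sc P"
 shows "v ~: D" "nb v <= V - cl P"
proof -
 show "v ~: D" using assms by (auto simp: Sc_def)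
 then have "nb v <= V" using interior assms by auto
 moreover have "nb v Int cl P = {}" using assms by (auto simp: Sc_def Kc_def)
 ultimately show "nb v <= V - cl P" by auto
qed

lemma neg_off_cluster:
 assumes "v : Kc (pos f)" "v ~: cl (pos f)"
 shows "f v < 0" "- f v <= osc f"
proof -
 obtain w where w: "w : nb v" "w : cl (pos f)" and v: "v : V" using assms by (auto simp: Kc_def)
 have "v ~: pos f" using cl_step[OF w(2) _ v w(1)] assms by auto
 then show n: "f v < 0" using v by (auto simp: pos_def)
 have "w : pos f" "w : V" using w cl_sub cl_V by auto
 then have "f w >= 0" by (simp add: pos_def)
 then show "- f v <= osc f" using osc_bound[OF v w(1) \<open>w : V\<close>, of f] n by linarith
qed

lemma D_off_cluster: "v : D ==> v ~: cl (pos f) ==> f v < 0"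
 using cl_base[of v "pos f"] D by (auto simp: pos_def)

lemma U_nonneg: "x : V ==> U f x >= 0"
proof (cases "x : cl (pos f)")
 case False
 assume x: "x : V"
 let ?S = "Sc (pos f)"
 have "- hS ?S f x >= 0"
 proof (rule box_minimum[where W = "V - cl (pos f)" and S = ?S and u = "%x. - hS ?S f x"])
 fix v assume v: "v : V - cl (pos f) - ?S"
 have vX: "v : X - ?S" using v V by auto
 show "v ~: D & nb v <= V - cl (pos f) & 0 <= lap nb (%x. - hS ?S f x) v"
 using outside_nb[of v "pos f"] v lap_hm_sum[OF Sc_fin vX] by (simp add: hS_def lap_uminus)
 next
 fix v assume v: "v : (V - cl (pos f)) Int ?S"
 then have "v : Kc (pos f) | v : D" by (auto simp: Sc_def)
 then have "f v < 0" using v neg_off_cluster(1)[of v f] D_off_cluster[of v f] by auto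
 then show "- hS ?S f v >= 0" using v by (simp add: hS_on)
 qed (use x False in auto)
 then show ?thesis using False by (simp add: U_def)
qed (simp add: U_def)

lemma U2_eq_hm_sum: "U2 f x = (\<Sum>z\<in>Sc (pos f). hm (Sc (pos f)) x z * (if z : D & z ~: Kc (pos f) then max 0 (- f z) else 0))"
proof -
 have "(\<Sum>z\<in>Sc (pos f). hm (Sc (pos f)) x z * (if z : D & z ~: Kc (pos f) then max 0 (- f z) else 0))
 = (\<Sum>z\<in>D. hm (Sc (pos f)) x z * (if z : D & z ~: Kc (pos f) then max 0 (- f z) else 0))"
 using Sc_fin by (intro sum.mono_neutral_right) (auto simp: Sc_def)
 also have "... = U2 f x" unfolding U2_def by (intro sum.cong) auto
 finally show ?thesis by simp
qed

lemma U2_nonneg: "x : X ==> U2 f x >= 0"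
 unfolding U2_def using hm_nonneg[OF Sc_fin] by (intro sum_nonneg) auto

lemma U2_on: "x : Sc (pos f) ==> U2 f x = (if x : D & x ~: Kc (pos f) then max 0 (- f x) else 0)"
 unfolding U2_eq_hm_sum by (rule sum_hm_on[OF Sc_fin])

lemma U2_Kc: "x : Kc (pos f) ==> U2 f x = 0"
 by (simp add: U2_on Sc_def)

lemma lap_U2: "x : X - Sc (pos f) ==> lap nb (U2 f) x = 0"
 using lap_hm_sum[OF Sc_fin, of x "pos f" _ "Sc (pos f)"] by (simp add: U2_eq_hm_sum[abs_def])

lemma lap_U2_le: "x : V - D ==> lap nb (U2 f) x <= 0"
proof (cases "x : Kc (pos f)")
 case True
 assume x: "x : V - D"
 then have "nb x <= X" using V nb_subset by auto
 then show ?thesis unfolding lap_def using U2_Kc[OF True] U2_nonneg by (intro sum_nonpos) auto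
next
 case False
 assume "x : V - D"
 then have "x : X - Sc (pos f)" using False V by (auto simp: Sc_def)
 then show ?thesis by (simp add: lap_U2)
qed

text \<open>Compare boundary values off the cluster. Where the exploration stopped they differ by
  -f, which lies between 0 and \<open>osc\<close> because a neighbour in the cluster is nonnegative;
  at the other vertices of D they agree. The minimum principle extends both bounds to x.\<close>

lemma U_U2:
 assumes x: "x : V"
 shows "U2 f x <= U f x" "U f x <= U2 f x + osc f"
proof -
 let ?S = "Sc (pos f)" and ?W = "V - cl (pos f)"
 have "U2 f x <= U f x & U f x <= U2 f x + osc f"
 proof (cases "x : cl (pos f)")
 case True
 then have "U2 f x = 0" by (intro U2_Kc) (auto simp: Kc_def)
 then show ?thesis using True osc_nonneg by (simp add: U_def)
 next
 case False
 have i: "v ~: D & nb v <= ?W & lap nb (%x. - hS ?S f x) v = 0 & lap nb (U2 f) v = 0" if v: "v : ?W - ?S" for v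
 proof -
 have vX: "v : X - ?S" using v V by auto
 show ?thesis using outside_nb[of v "pos f"] v lap_hm_sum[OF Sc_fin vX] lap_U2[OF vX] by (simp add: hS_def lap_uminus)
 qed
 have b: "0 <= - hS ?S f v - U2 f v & - hS ?S f v - U2 f v <= osc f" if v: "v : ?W Int ?S" for v
 proof (cases "v : Kc (pos f)")
 case True
 then show ?thesis using neg_off_cluster[of v f] v U2_Kc[OF True] by (auto simp: hS_on)
 next
 case False
 then have "v : D" using v by (auto simp: Sc_def)
 then show ?thesis using D_off_cluster[of v f] v False osc_nonneg[of f] by (auto simp: hS_on U2_on)
 qed
 have lz: "lap nb (%x. - hS ?S f x - U2 f x) v = 0" if "v : ?W - ?S" for v
 using i[OF that] by (simp only: lap_diff)
 have "- hS ?S f x - U2 f x >= 0"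
 proof (rule box_minimum[where W = ?W and S = ?S and u = "%x. - hS ?S f x - U2 f x"])
 fix v assume v: "v : ?W - ?S"
 show "v ~: D & nb v <= ?W & 0 <= lap nb (%x. - hS ?S f x - U2 f x) v" using i[OF v] lz[OF v] by simp
 next
 fix v assume "v : ?W Int ?S"
 from b[OF this] show "0 <= - hS ?S f v - U2 f v" by blast
 next
 show "?W <= V" by blast
 show "x : ?W" using x False by blast
 qed
 moreover have "osc f - (- hS ?S f x - U2 f x) >= 0"
 proof (rule box_minimum[where W = ?W and S = ?S and u = "%x. osc f - (- hS ?S f x - U2 f x)"])
 fix v assume v: "v : ?W - ?S"
 have "lap nb (%x. osc f - (- hS ?S f x - U2 f x)) v = lap nb (%x. osc f) v - lap nb (%x. - hS ?S f x - U2 f x) v"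
 by (rule lap_diff)
 then show "v ~: D & nb v <= ?W & 0 <= lap nb (%x. osc f - (- hS ?S f x - U2 f x)) v" using i[OF v] lz[OF v] by (simp add: lap_const)
 next
 fix v assume "v : ?W Int ?S"
 from b[OF this] show "0 <= osc f - (- hS ?S f v - U2 f v)" by linarith
 next
 show "?W <= V" by blast
 show "x : ?W" using x False by blast
 qed
 ultimately show ?thesis using False by (simp add: U_def)
 qed
 then show "U2 f x <= U f x" "U f x <= U2 f x + osc f" by auto
qed

text \<open>A larger field enlarges the explored set, which removes vertices of D from the sum and,
  by \<open>hm_antimono\<close>, lowers the harmonic measure of the remaining ones.\<close>

lemma U2_antimono:
 assumes le: "!!v. v : V ==> f v <= f' v" and x: "x : X"
 shows "U2 f' x <= U2 f x"
 unfolding U2_def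
proof (rule sum_mono)
 fix z assume z: "z : D"
 have P: "pos f <= pos f'" by (rule pos_mono) (rule le)
 show "(if z : Kc (pos f') then 0 else hm (Sc (pos f')) x z * max 0 (- f' z)) <=
 (if z : Kc (pos f) then 0 else hm (Sc (pos f)) x z * max 0 (- f z))"
 proof (cases "z : Kc (pos f')")
 case True
 then show ?thesis using hm_nonneg[OF Sc_fin x] by auto
 next
 case False
 then have z': "z ~: Kc (pos f)" using Kc_mono[OF P] by auto
 have "hm (Sc (pos f')) x z <= hm (Sc (pos f)) x z"
 by (rule hm_antimono[OF Sc_fin Sc_mono[OF P] x]) (use z in \<open>simp add: Sc_def\<close>)
 moreover have "max 0 (- f' z) <= max 0 (- f z)" using le[of z] z D by auto
 ultimately show ?thesis using False z' hm_nonneg[OF Sc_fin x] by (auto intro!: mult_mono)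
 qed
qed

text \<open>Every vertex of D has a sign and so belongs to one of the two clusters. Off both
  clusters the revealed vertices are therefore those where an exploration stopped, and there the
  field is bounded by its jump to a neighbour of the other sign.\<close>

lemma both_bound:
 assumes x: "x : V" "x ~: cl (pos f)" "x ~: cl (neg f)"
 shows "\<bar>hS (Sc (pos f) Un Sc (neg f)) f x\<bar> <= osc f"
proof -
 let ?S = "Sc (pos f) Un Sc (neg f)" and ?W = "V - cl (pos f) - cl (neg f)"
 have S: "finite ?S" "?S <= X" using Sc_fin by auto
 have i: "v ~: D & nb v <= ?W & lap nb (%x. hS ?S f x) v = 0" if v: "v : ?W - ?S" for v
 proof -
 have vX: "v : X - ?S" using v V by auto
 show ?thesis using outside_nb[of v "pos f"] outside_nb[of v "neg f"] v lap_hm_sum[OF S vX] by (auto simp: hS_def)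
 qed
 have b: "\<bar>hS ?S f v\<bar> <= osc f" if v: "v : ?W Int ?S" for v
 proof -
 have e: "hS ?S f v = f v" unfolding hS_def using v by (intro sum_hm_on[OF S]) auto
 have vD: "v ~: D"
 proof
 assume vD: "v : D"
 then have "v : pos f | v : neg f" using D by (auto simp: pos_def neg_def)
 then show False using cl_base[OF vD] v by auto
 qed
 have vV: "v : V" using v by auto
 consider w where "w : nb v" "w : cl (pos f)" | w where "w : nb v" "w : cl (neg f)"
 using v vD by (auto simp: Sc_def Kc_def)
 then show ?thesis
 proof cases
 case 1
 have "v ~: pos f" using cl_step[OF 1(2) _ vV 1(1)] v by auto
 moreover have "w : pos f" "w : V" using 1 cl_sub cl_V by auto
 ultimately show ?thesis unfolding e using osc_bound[OF vV 1(1), of f] vV by (auto simp: pos_def)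
 next
 case 2
 have "v ~: neg f" using cl_step[OF 2(2) _ vV 2(1)] v by auto
 moreover have "w : neg f" "w : V" using 2 cl_sub cl_V by auto
 ultimately show ?thesis unfolding e using osc_bound[OF vV 2(1), of f] vV by (auto simp: neg_def)
 qed
 qed
 have "osc f - c * hS ?S f x >= 0" if c: "c = 1 | c = -1" for c
 proof (rule box_minimum[where W = ?W and S = ?S and u = "%x. osc f - c * hS ?S f x"])
 fix v assume v: "v : ?W - ?S"
 have "lap nb (%x. osc f - c * hS ?S f x) v = 0"
 using i[OF v] by (simp only: lap_diff lap_const lap_cmult)
 then show "v ~: D & nb v <= ?W & 0 <= lap nb (%x. osc f - c * hS ?S f x) v" using i[OF v] by simp
 next
 fix v assume "v : ?W Int ?S"
 from b[OF this] show "0 <= osc f - c * hS ?S f v" using c by (auto simp: abs_le_iff)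
 next
 show "?W <= V" by blast
 show "x : ?W" using x by blast
 qed
 from this[of 1] this[of "-1"] show ?thesis by (simp add: abs_le_iff)
qed

end

section \<open>The Green function of the lattice walk\<close>

definition avg :: "(real^'n => real) => real^'n => real" where
 "avg u x = (\<Sum>i\<in>UNIV. u (x + axis i 1) + u (x - axis i 1)) / (2 * real CARD('n))"

lemma srw_kernel_Suc: "srw_kernel (Suc n) x y = avg (%x. srw_kernel n x y) x"
 by (simp add: avg_def)

lemma avg_mono: "(!!x. u x <= w x) ==> avg u x <= avg w x"
 unfolding avg_def by (intro divide_right_mono sum_mono add_mono) auto

lemma avg_add: "avg (%x. u x + w x) x = avg u x + avg w x"
 by (simp add: avg_def sum.distrib add_divide_distrib)

lemma avg_cmult: "avg (%x. c * u x) x = c * avg u x"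
 by (simp add: avg_def sum_distrib_left distrib_left)

lemma avg_const: "avg (%x::real^'n. c) x = c"
 by (simp add: avg_def)

lemma avg_sum: "avg (%x. \<Sum>z\<in>A. u z x) x = (\<Sum>z\<in>A. avg (u z) x)"
 by (induction A rule: infinite_finite_induct) (simp_all add: avg_add avg_const)

lemma srw_kernel_nonneg: "srw_kernel n x y >= 0"
 by (induction n arbitrary: x) (auto intro!: divide_nonneg_nonneg sum_nonneg add_nonneg_nonneg)

text \<open>Induction over the first step: the potential of h over m + 1 steps is at most h + avg f,
  hence at most f. The bound is uniform in m, so it can also be used to prove that the potential
  converges.\<close>

lemma potential_partial_le:
 fixes f h :: "real^'n => real"
 assumes f: "!!x. f x >= 0" and h: "!!x. h x >= 0" "!!x. h x <= f x - avg f x" and F: "finite F"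
 shows "(\<Sum>v\<in>F. (\<Sum>n<m. srw_kernel n x v) * h v) <= f x"
proof (induction m arbitrary: x)
 case 0
 then show ?case using f by simp
next
 case (Suc m)
 have "(\<Sum>n<Suc m. srw_kernel n x v) = srw_kernel 0 x v + (\<Sum>n<m. srw_kernel (Suc n) x v)" for v
 by (rule sum.lessThan_Suc_shift)
 also have "... v = srw_kernel 0 x v + avg (%x. \<Sum>n<m. srw_kernel n x v) x" for v
 by (simp only: srw_kernel_Suc avg_sum)
 finally have e: "(\<Sum>n<Suc m. srw_kernel n x v) = srw_kernel 0 x v + avg (%x. \<Sum>n<m. srw_kernel n x v) x" for v .
 have "(\<Sum>v\<in>F. (\<Sum>n<Suc m. srw_kernel n x v) * h v) =
 (\<Sum>v\<in>F. srw_kernel 0 x v * h v) + (\<Sum>v\<in>F. h v * avg (%x. \<Sum>n<m. srw_kernel n x v) x)"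
 unfolding e by (simp add: distrib_left distrib_right sum.distrib mult.commute)
 moreover have "(\<Sum>v\<in>F. h v * avg (%x. \<Sum>n<m. srw_kernel n x v) x) = avg (%x. \<Sum>v\<in>F. h v * (\<Sum>n<m. srw_kernel n x v)) x"
 by (simp only: avg_sum avg_cmult)
 moreover have "... <= avg f x"
 using Suc by (intro avg_mono) (simp add: mult.commute)
 moreover have "(\<Sum>v\<in>F. srw_kernel 0 x v * h v) <= h x"
 proof -
 have "(\<Sum>v\<in>F. srw_kernel 0 x v * h v) = (\<Sum>v\<in>F. if x = v then h v else 0)"
 by (intro sum.cong) auto
 then show ?thesis using F h(1)[of x] by simp
 qed
 ultimately show ?case using h(2)[of x] by linarith
qed

lemma powr_Taylor:
 fixes b u :: real
 assumes b: "b > 0" and u: "\<bar>u\<bar> <= 1/2"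
 shows "(1 + u) powr (- b) <= 1 - b * u + b * (b + 1) / 2 * u\<^sup>2 + (b * (b + 1) * (b + 2) * 2 powr (b + 3)) * \<bar>u\<bar> ^ 3"
proof (cases "u = 0")
 case True then show ?thesis by simp
next
 case False
 define diff where "diff m t = (if m = 0 then 1 else if m = 1 then - b else if m = 2 then b * (b+1) else - (b * (b+1) * (b+2))) * (1 + t) powr (- b - real m)" for m :: nat and t
 have "EX t. (if u < 0 then u < t & t < 0 else 0 < t & t < u) \<and>
 (1 + u) powr (-b) = (\<Sum>m<3. diff m 0 / fact m * (u - 0) ^ m) + diff 3 t / fact 3 * (u - 0) ^ 3"
 proof (rule Taylor[where a = "-1/2" and b = "1/2"])
 show "diff 0 = (%u. (1 + u) powr (-b))" by (simp add: diff_def fun_eq_iff)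
 show "ALL m t. m < 3 & -1/2 <= t & t <= 1/2 \<longrightarrow> (diff m has_real_derivative diff (Suc m) t) (at t)"
 proof (intro allI impI)
 fix m :: nat and t :: real assume *: "m < 3 & -1/2 <= t & t <= 1/2"
 then have t: "1 + t > 0" by simp
 have "m = 0 | m = 1 | m = 2" using * by auto
 then show "(diff m has_real_derivative diff (Suc m) t) (at t)"
 using t unfolding diff_def
 by (elim disjE) (auto intro!: derivative_eq_intros simp: algebra_simps)
 qed
 qed (use u False in auto)
 then obtain t where t: "if u < 0 then u < t & t < 0 else 0 < t & t < u"
 and e: "(1 + u) powr (-b) = (\<Sum>m<3. diff m 0 / fact m * u ^ m) + diff 3 t / fact 3 * u ^ 3" by auto
 have t2: "1 + t >= 1/2" using t u by (auto split: if_splits)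
 have "(1 + t) powr (- b - 3) <= (1/2) powr (- b - 3)"
 using t2 b by (intro powr_mono2') auto
 also have "(1/2) powr (- b - 3) = 2 powr (b + 3)"
 by (simp add: powr_divide powr_minus_divide[symmetric] powr_minus field_simps)
 (metis add.commute minus_diff_eq powr_minus_divide diff_minus_eq_add)?
 finally have p: "(1 + t) powr (- b - 3) <= 2 powr (b + 3)" .
 have "diff 3 t / fact 3 * u ^ 3 <= \<bar>diff 3 t / fact 3 * u ^ 3\<bar>" by (rule abs_ge_self)
 also have "... = (b * (b + 1) * (b + 2)) * (1 + t) powr (- b - 3) / 6 * \<bar>u\<bar> ^ 3"
 using b by (simp add: diff_def abs_mult power_abs fact_numeral)
 also have "... <= (b * (b + 1) * (b + 2)) * 2 powr (b + 3) / 1 * \<bar>u\<bar> ^ 3"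
 using b p by (intro mult_right_mono frac_le mult_left_mono mult_nonneg_nonneg) auto
 finally have r: "diff 3 t / fact 3 * u ^ 3 <= (b * (b + 1) * (b + 2) * 2 powr (b + 3)) * \<bar>u\<bar> ^ 3" by simp
 have "(\<Sum>m<3. diff m 0 / fact m * u ^ m) = 1 - b * u + b * (b + 1) / 2 * u\<^sup>2"
 by (simp add: diff_def numeral_3_eq_3 numeral_2_eq_2)
 then show ?thesis using e r by simp
qed

text \<open>The radial power |x|^(-2b), smoothed at the origin by K; a large K also absorbs the
  lattice error of the Laplacian.\<close>

definition fdec :: "real => real => real^'n => real" where
 "fdec K b x = ((norm x)\<^sup>2 + K) powr (- b)"

lemma norm_axis_step:
 fixes x :: "real^'n"
 shows "(norm (x + axis i 1))\<^sup>2 = (norm x)\<^sup>2 + 1 + 2 * x $ i" "(norm (x - axis i 1))\<^sup>2 = (norm x)\<^sup>2 + 1 - 2 * x $ i"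
 by (simp_all add: power2_norm_eq_inner inner_add_left inner_add_right inner_diff_left inner_diff_right inner_axis inner_axis')

lemma norm_sq_sum: "(norm (x::real^'n))\<^sup>2 = (\<Sum>i\<in>UNIV. (x $ i)\<^sup>2)"
proof -
 have "(norm x)\<^sup>2 = inner x x" by (rule power2_norm_eq_inner)
 then show ?thesis by (simp only: inner_vec_def inner_real_def power2_eq_square)
qed

text \<open>In the continuum the Laplacian of |x|^(-2b) has the sign of 2(b + 1) - d. On the
  lattice, an expansion to third order adds an error smaller than the main term by a factor of order
  sqrt(|x|^2 + K).\<close>

lemma fdec_superharmonic:
 assumes b: "b > 0" "2 * (b + 1) < real CARD('n)"
 obtains K0 c where "K0 >= 1" "c > 0"
 "!!K (x::real^'n). K >= K0 ==> c * fdec K (b + 1) x <= fdec K b x - avg (fdec K b) x"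
proof -
 let ?d = "real CARD('n)"
 define C where "C = b * (b + 1) * (b + 2) * 2 powr (b + 3)"
 define \<alpha> where "\<alpha> = 1 - 2 * (b + 1) / ?d"
 define C' where "C' = b * (b + 1) / 2 + 27 * C"
 have d: "?d > 0" by simp
 have \<alpha>: "\<alpha> > 0" using b by (simp add: \<alpha>_def field_simps)
 have C: "C > 0" "C' > 0" using b by (auto simp: C_def C'_def intro!: add_pos_pos)
 \<comment> \<open>The value 36 forces r >= 6, so that a change of the squared norm by at most 3r is
   a relative change of at most 1/2, the range of \<open>powr_Taylor\<close>. The other entry makes
   C'/r at most half of the main term b \<alpha>.\<close>
 define K0 where "K0 = max 36 ((2 * C' / (b * \<alpha>))\<^sup>2)"
 show thesis
 proof (rule that[of K0 "b * \<alpha> / 2"])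
 show "K0 >= 1" by (simp add: K0_def)
 show "b * \<alpha> / 2 > 0" using b \<alpha> by simp
 fix K and x :: "real^'n" assume K: "K >= K0"
 define s where "s = (norm x)\<^sup>2 + K"
 define r where "r = sqrt s"
 have s: "s >= K0" "s >= 36" using K by (auto simp: s_def K0_def intro: add_increasing)
 have r: "r >= 6" "r > 0" "s = r\<^sup>2" "norm x <= r"
 using s K by (auto simp: r_def K0_def s_def intro!: real_le_rsqrt)
 have rC: "r >= 2 * C' / (b * \<alpha>)"
 proof -
 have "(2 * C' / (b * \<alpha>))\<^sup>2 <= s" using s by (simp add: K0_def)
 then show ?thesis unfolding r_def by (rule real_le_rsqrt)
 qed
 have pair: "fdec K b (x + axis i 1) + fdec K b (x - axis i 1) <=
 s powr (-b) * (2 - 2 * b / s + b * (b + 1) / 2 * (2 + 8 * (x $ i)\<^sup>2) / s\<^sup>2 + 54 * C / (r * s))" for i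
 proof -
 have xi: "\<bar>x $ i\<bar> <= r" using component_le_norm_cart[of x i] r by simp
 have one: "(s + w) powr (-b) <= s powr (-b) * (1 - b * (w / s) + b * (b + 1) / 2 * (w / s)\<^sup>2 + C * (27 / (r * s)))"
 if w: "\<bar>w\<bar> <= 3 * r" for w
 proof -
 have ws: "\<bar>w / s\<bar> <= 3 / r" using w r by (simp add: field_simps power2_eq_square)
 also have "3 / r <= 1/2" using r by (simp add: field_simps)
 finally have u: "\<bar>w / s\<bar> <= 1/2" .
 have "\<bar>w / s\<bar> ^ 3 <= (3 / r) ^ 3" using ws by (intro power_mono) auto
 also have "... = 27 / (r * s)" using r by (simp add: power_divide power3_eq_cube power2_eq_square)
 finally have cube: "\<bar>w / s\<bar> ^ 3 <= 27 / (r * s)" .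
 have "s + w = s * (1 + w / s)" using s by (simp add: field_simps)
 then have "(s + w) powr (-b) = s powr (-b) * (1 + w / s) powr (-b)"
 using s u by (simp add: powr_mult abs_le_iff)
 also have "... <= s powr (-b) * (1 - b * (w / s) + b * (b + 1) / 2 * (w / s)\<^sup>2 + C * \<bar>w / s\<bar> ^ 3)"
 using powr_Taylor[OF b(1) u] by (intro mult_left_mono) (auto simp: C_def)
 also have "... <= s powr (-b) * (1 - b * (w / s) + b * (b + 1) / 2 * (w / s)\<^sup>2 + C * (27 / (r * s)))"
 using cube C by (intro mult_left_mono add_left_mono) auto
 finally show ?thesis .
 qed
 have "fdec K b (x + axis i 1) = (s + (1 + 2 * x $ i)) powr (-b)" "fdec K b (x - axis i 1) = (s + (1 - 2 * x $ i)) powr (-b)"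
 by (simp_all add: fdec_def norm_axis_step s_def algebra_simps)
 moreover have "\<bar>1 + 2 * x $ i\<bar> <= 3 * r" "\<bar>1 - 2 * x $ i\<bar> <= 3 * r" using xi r by auto
 ultimately have "fdec K b (x + axis i 1) + fdec K b (x - axis i 1) <=
 s powr (-b) * (1 - b * ((1 + 2 * x $ i) / s) + b * (b + 1) / 2 * ((1 + 2 * x $ i) / s)\<^sup>2 + C * (27 / (r * s)))
 + s powr (-b) * (1 - b * ((1 - 2 * x $ i) / s) + b * (b + 1) / 2 * ((1 - 2 * x $ i) / s)\<^sup>2 + C * (27 / (r * s)))"
 using one by (simp add: add_mono)
 also have "... = s powr (-b) * ((1 - b * ((1 + 2 * x $ i) / s) + b * (b + 1) / 2 * ((1 + 2 * x $ i) / s)\<^sup>2 + C * (27 / (r * s)))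
 + (1 - b * ((1 - 2 * x $ i) / s) + b * (b + 1) / 2 * ((1 - 2 * x $ i) / s)\<^sup>2 + C * (27 / (r * s))))"
 by (simp only: distrib_left)
 also have "(1 - b * ((1 + 2 * x $ i) / s) + b * (b + 1) / 2 * ((1 + 2 * x $ i) / s)\<^sup>2 + C * (27 / (r * s)))
 + (1 - b * ((1 - 2 * x $ i) / s) + b * (b + 1) / 2 * ((1 - 2 * x $ i) / s)\<^sup>2 + C * (27 / (r * s)))
 = 2 - 2 * b / s + b * (b + 1) / 2 * (2 + 8 * (x $ i)\<^sup>2) / s\<^sup>2 + 54 * C / (r * s)"
 using r s by (simp add: field_simps power2_eq_square)
 finally show ?thesis .
 qed
 have "avg (fdec K b) x <= (\<Sum>i\<in>UNIV. s powr (-b) * (2 - 2 * b / s + b * (b + 1) / 2 * (2 + 8 * (x $ i)\<^sup>2) / s\<^sup>2 + 54 * C / (r * s))) / (2 * ?d)"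
 unfolding avg_def using pair by (intro divide_right_mono sum_mono) auto
 also have "... = s powr (-b) * (?d * (2 - 2 * b / s + 54 * C / (r * s)) + b * (b + 1) / 2 / s\<^sup>2 * (2 * ?d + 8 * (norm x)\<^sup>2)) / (2 * ?d)"
 proof -
 define a1 where "a1 = 2 - 2 * b / s + 54 * C / (r * s)"
 define a2 where "a2 = b * (b + 1) / 2 / s\<^sup>2"
 have "s powr (-b) * (2 - 2 * b / s + b * (b + 1) / 2 * (2 + 8 * (x $ i)\<^sup>2) / s\<^sup>2 + 54 * C / (r * s))
 = s powr (-b) * (a1 + 2 * a2) + s powr (-b) * 8 * a2 * (x $ i)\<^sup>2" for i
 proof -
 have "b * (b + 1) / 2 * (2 + 8 * (x $ i)\<^sup>2) / s\<^sup>2 = a2 * (2 + 8 * (x $ i)\<^sup>2)" by (simp add: a2_def)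
 then show ?thesis unfolding a1_def by (simp add: algebra_simps)
 qed
 then have "(\<Sum>i\<in>UNIV. s powr (-b) * (2 - 2 * b / s + b * (b + 1) / 2 * (2 + 8 * (x $ i)\<^sup>2) / s\<^sup>2 + 54 * C / (r * s)))
 = ?d * (s powr (-b) * (a1 + 2 * a2)) + s powr (-b) * 8 * a2 * (norm x)\<^sup>2"
 unfolding norm_sq_sum by (simp add: sum.distrib sum_distrib_left)
 also have "... = s powr (-b) * (?d * a1 + a2 * (2 * ?d + 8 * (norm x)\<^sup>2))" by (simp add: algebra_simps)
 finally show ?thesis by (simp only: a1_def a2_def)
 qed
 finally have A: "avg (fdec K b) x <= s powr (-b) * (?d * (2 - 2 * b / s + 54 * C / (r * s)) + b * (b + 1) / 2 / s\<^sup>2 * (2 * ?d + 8 * (norm x)\<^sup>2)) / (2 * ?d)" .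
 have nx: "(norm x)\<^sup>2 <= s" using K by (simp add: s_def K0_def)
 have rs: "r * s <= s\<^sup>2" using r s by (simp add: power2_eq_square)
 have "(?d * (2 - 2 * b / s + 54 * C / (r * s)) + b * (b + 1) / 2 / s\<^sup>2 * (2 * ?d + 8 * (norm x)\<^sup>2)) / (2 * ?d)
 = 1 - b / s + 27 * C / (r * s) + b * (b + 1) / 2 * (1 / s\<^sup>2) + b * (b + 1) / 2 * (4 * ((norm x)\<^sup>2 / s\<^sup>2) / ?d)"
 proof -
 define a1 where "a1 = 2 - 2 * b / s + 54 * C / (r * s)"
 define a2 where "a2 = b * (b + 1) / 2 / s\<^sup>2"
 have "(?d * a1 + a2 * (2 * ?d + 8 * (norm x)\<^sup>2)) / (2 * ?d) = a1 / 2 + a2 + a2 * (4 * (norm x)\<^sup>2) / ?d"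
 using d by (simp add: field_simps)
 moreover have "a1 / 2 = 1 - b / s + 27 * C / (r * s)" by (simp add: a1_def diff_divide_distrib add_divide_distrib)
 moreover have "a2 = b * (b + 1) / 2 * (1 / s\<^sup>2)" "a2 * (4 * (norm x)\<^sup>2) / ?d = b * (b + 1) / 2 * (4 * ((norm x)\<^sup>2 / s\<^sup>2) / ?d)"
 by (simp_all add: a2_def)
 ultimately show ?thesis by (simp only: a1_def a2_def)
 qed
 also have "... <= 1 - b / s + 27 * C / (r * s) + b * (b + 1) / 2 * (1 / (r * s)) + b * (b + 1) / 2 * (4 * (1 / s) / ?d)"
 proof -
 have "1 / s\<^sup>2 <= 1 / (r * s)" using rs r s by (intro divide_left_mono) auto
 moreover have "(norm x)\<^sup>2 / s\<^sup>2 <= 1 / s" using nx s by (simp add: field_simps power2_eq_square)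
 ultimately show ?thesis using b by (intro add_mono mult_left_mono divide_right_mono order_refl) auto
 qed
 also have "... = 1 - b * \<alpha> / s + C' / (r * s)"
 using d s r by (simp add: \<alpha>_def C'_def field_simps)
 also have "... <= 1 - b * \<alpha> / 2 / s"
 proof -
 have "C' / r <= b * \<alpha> / 2" using rC r b \<alpha> by (simp add: field_simps)
 then have "C' / r / s <= b * \<alpha> / 2 / s" using s by (intro divide_right_mono) auto
 then show ?thesis by (simp add: field_simps)
 qed
 finally have B: "(?d * (2 - 2 * b / s + 54 * C / (r * s)) + b * (b + 1) / 2 / s\<^sup>2 * (2 * ?d + 8 * (norm x)\<^sup>2)) / (2 * ?d) <= 1 - b * \<alpha> / 2 / s" .
 have "avg (fdec K b) x <= s powr (-b) * (1 - b * \<alpha> / 2 / s)"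
 using A mult_left_mono[OF B, of "s powr (-b)"] by simp
 also have "s powr (-b) * (1 - b * \<alpha> / 2 / s) = s powr (-b) - b * \<alpha> / 2 * s powr (- b - 1)"
 using s by (simp add: powr_diff right_diff_distrib)
 finally show "b * \<alpha> / 2 * fdec K (b + 1) x <= fdec K b x - avg (fdec K b) x"
 by (simp add: fdec_def s_def)
 qed
qed

section \<open>The Green function as a series, its decay and its convolutions\<close>

lemma srw_kernel_translate: "srw_kernel n (x + a) (y + a) = srw_kernel n x (y::real^'n)"
proof (induction n arbitrary: x)
 case (Suc n)
 have "x + a + axis i 1 = x + axis i 1 + a" "x + a - axis i 1 = x - axis i 1 + a" for i by (auto simp: algebra_simps)
 then show ?case by (simp only: srw_kernel.simps Suc)
qed simp

lemma srw_kernel_reflect: "srw_kernel n (- x) (- y) = srw_kernel n x (y::real^'n)"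
proof (induction n arbitrary: x)
 case (Suc n)
 have "- x + axis i 1 = - (x - axis i 1)" "- x - axis i 1 = - (x + axis i 1)" for i by (auto simp: algebra_simps)
 then show ?case by (simp only: srw_kernel.simps Suc add.commute)
qed simp

lemma srw_kernel_sym: "srw_kernel n x y = srw_kernel n y (x::real^'n)"
proof -
 have "srw_kernel n x y = srw_kernel n (- x + (x + y)) (- y + (x + y))"
 unfolding srw_kernel_translate srw_kernel_reflect ..
 then show ?thesis by (simp add: algebra_simps)
qed

lemma nn_integral_exp_power: "(\<integral>\<^sup>+t. ennreal (exp (- t) * t ^ n / fact n) * indicator {0..} t \<partial>lborel) = 1"
proof -
 have "(\<integral>\<^sup>+t. ennreal (exp (- t) * t ^ n / fact n) * indicator {0..} t \<partial>lborel) =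
 (\<integral>\<^sup>+t. ennreal (1 / fact n) * (ennreal (t ^ n * exp (- t)) * indicator {0..} t) \<partial>lborel)"
 by (intro nn_integral_cong) (auto simp: indicator_def ennreal_mult[symmetric] mult_ac)
 also have "... = ennreal (1 / fact n) * ennreal (fact n)"
 by (subst nn_integral_cmult) (auto simp: nn_intergal_power_times_exp_Ici)
 also have "... = 1" by (simp add: ennreal_mult[symmetric])
 finally show ?thesis .
qed

text \<open>The number of jumps is Poisson, and each weight exp(-t) t^n / n! has integral 1 over
  time; nonnegativity allows sum and integral to be exchanged.\<close>

lemma green_eq_suminf:
 fixes x y :: "real^'n"
 assumes S: "summable (%n. srw_kernel n x y)"
 shows "green x y = (\<Sum>n. srw_kernel n x y)"
proof -
 let ?p = "%n. srw_kernel n x y"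
 have p: "?p n >= 0" for n by (rule srw_kernel_nonneg)
 obtain B where B: "!!n. ?p n <= B" "B >= 0"
 proof -
 have "Bseq ?p" using summable_LIMSEQ_zero[OF S] by (intro convergent_imp_Bseq convergentI)
 then obtain B where "B > 0" "!!n. norm (?p n) <= B" by (auto simp: Bseq_def)
 then show thesis using that[of B] by (simp add: abs_le_iff)
 qed
 have sm: "summable (%n. exp (- t) * t ^ n / fact n * ?p n)" if t: "t >= 0" for t :: real
 proof (rule summable_comparison_test')
 have "summable (%n. inverse (fact n) * t ^ n)" using summable_exp[of t] by simp
 from summable_mult[OF this, of "exp (-t) * B"] show "summable (%n. exp (- t) * B * (inverse (fact n) * t ^ n))" .
 show "norm (exp (- t) * t ^ n / fact n * ?p n) <= exp (- t) * B * (inverse (fact n) * t ^ n)" for n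
 using t B p[of n] mult_left_mono[OF B(1)[of n], of "exp (- t) * t ^ n / fact n"]
 by (simp add: field_simps)
 qed
 have "ennreal (\<integral>t. indicator {0..} t *\<^sub>R ctrw_kernel t x y \<partial>lborel) = ennreal (suminf ?p)" if "(%t. ctrw_kernel t x y) : borel_measurable lborel"
 proof -
 have nn: "indicator {0..} t *\<^sub>R ctrw_kernel t x y >= 0" for t
 using sm[of t] p by (cases "t >= 0") (auto simp: ctrw_kernel_def intro!: suminf_nonneg)
 have "(\<integral>\<^sup>+t. ennreal (indicator {0..} t *\<^sub>R ctrw_kernel t x y) \<partial>lborel) =
 (\<integral>\<^sup>+t. (\<Sum>n. ennreal (?p n) * (ennreal (exp (- t) * t ^ n / fact n) * indicator {0..} t)) \<partial>lborel)"
 proof (intro nn_integral_cong)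
 fix t :: real
 show "ennreal (indicator {0..} t *\<^sub>R ctrw_kernel t x y) = (\<Sum>n. ennreal (?p n) * (ennreal (exp (- t) * t ^ n / fact n) * indicator {0..} t))"
 proof (cases "t >= 0")
 case True
 have "ennreal (ctrw_kernel t x y) = (\<Sum>n. ennreal (exp (- t) * t ^ n / fact n * ?p n))"
 unfolding ctrw_kernel_def using True p sm[OF True] by (intro suminf_ennreal2[symmetric]) auto
 then show ?thesis using True p by (simp add: ennreal_mult[symmetric] mult_ac)
 qed simp
 qed
 also have "... = (\<Sum>n. ennreal (?p n) * (\<integral>\<^sup>+t. ennreal (exp (- t) * t ^ n / fact n) * indicator {0..} t \<partial>lborel))"
 by (subst nn_integral_suminf) (auto simp: nn_integral_cmult)
 also have "... = (\<Sum>n. ennreal (?p n))" by (simp add: nn_integral_exp_power)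
 also have "... = ennreal (suminf ?p)" using S p by (intro suminf_ennreal2)
 finally have e: "(\<integral>\<^sup>+t. ennreal (indicator {0..} t *\<^sub>R ctrw_kernel t x y) \<partial>lborel) = ennreal (suminf ?p)" .
 have "(\<integral>t. indicator {0..} t *\<^sub>R ctrw_kernel t x y \<partial>lborel) = enn2real (\<integral>\<^sup>+t. ennreal (indicator {0..} t *\<^sub>R ctrw_kernel t x y) \<partial>lborel)"
 using that nn by (intro integral_eq_nn_integral) auto
 then show ?thesis unfolding e using suminf_nonneg[OF S p] by simp
 qed
 moreover have "(%t. ctrw_kernel t x y) : borel_measurable lborel"
 unfolding ctrw_kernel_def by measurable
 ultimately have "ennreal (green x y) = ennreal (suminf ?p)"
 by (simp add: green_def set_lebesgue_integral_def)
 moreover have "green x y >= 0"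
 unfolding green_def set_lebesgue_integral_def ctrw_kernel_def
 using sm p by (intro Bochner_Integration.integral_nonneg) (auto simp: indicator_def intro!: suminf_nonneg)
 ultimately show ?thesis using suminf_nonneg[OF S p] by (simp add: ennreal_inj)
qed

lemma avg_translate: "avg (%x. u (x - y)) x = avg u (x - y)"
 by (simp add: avg_def algebra_simps)

lemma avg_mono_le:
 assumes "!!x. u x >= 0"
 shows "u (x + axis i 1) <= 2 * real CARD('n) * avg u (x::real^'n)" "u (x - axis i 1) <= 2 * real CARD('n) * avg u x"
proof -
 have e: "2 * real CARD('n) * avg u x = (\<Sum>i\<in>UNIV. u (x + axis i 1) + u (x - axis i 1))" by (simp add: avg_def)
 have "u (x + axis i 1) + u (x - axis i 1) <= (\<Sum>i\<in>UNIV. u (x + axis i 1) + u (x - axis i 1))"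
 using assms by (intro member_le_sum) auto
 then show "u (x + axis i 1) <= 2 * real CARD('n) * avg u x" "u (x - axis i 1) <= 2 * real CARD('n) * avg u x"
 unfolding e using assms[of "x + axis i 1"] assms[of "x - axis i 1"] by linarith+
qed

lemma fdec_pos: "K >= 1 ==> fdec K b x > 0"
 unfolding fdec_def by (smt (verit) powr_gt_zero zero_le_power2)

lemma fdec_le_1: "K >= 1 ==> b >= 0 ==> fdec K b x <= 1"
 unfolding fdec_def using powr_mono2'[of "- b" 1 "(norm x)\<^sup>2 + K"] by (simp add: add_increasing)

lemma fdec_tail:
 assumes "K >= 1" "R > 0" "norm x >= R"
 shows "fdec K (b + 1) x <= fdec K b x / R\<^sup>2"
proof -
 let ?s = "(norm x)\<^sup>2 + K"
 have s: "?s >= R\<^sup>2" "?s > 0" using assms power_mono[of R "norm x" 2] by (auto intro: add_increasing2 add_nonneg_pos)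
 have "fdec K (b + 1) x = fdec K b x / ?s" using s by (simp add: fdec_def powr_diff)
 also have "... <= fdec K b x / R\<^sup>2" using s fdec_pos[OF assms(1), of b x] assms by (intro divide_left_mono) (auto intro!: mult_pos_pos)
 finally show ?thesis .
qed

context
 fixes dummy :: "'n::finite itself"
 assumes d7: "CARD('n) > 6"
begin

text \<open>The exponent 12/5 is admissible since 2(12/5 + 1) = 34/5 < 7 <= d, and it heads a chain
  12/5, 7/5, 2/5 of unit steps that stays positive. Decay and convolution bounds are both instances
  of \<open>potential_partial_le\<close>.\<close>

lemma green_summable_bound:
 obtains K C where "K >= 1" "C >= 1"
 "!!x y::real^'n. summable (%n. srw_kernel n x y)"
 "!!x y::real^'n. green x y <= C * fdec K (12/5) (x - y)"
 "!!F (x::real^'n) y b. finite F ==> b : {2/5, 7/5} ==> (\<Sum>v\<in>F. green x v * fdec K (b + 1) (v - y)) <= C * fdec K b (x - y)"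
proof -
 have d: "real CARD('n) >= 7" using d7 by simp
 obtain K1 c1 where 1: "K1 >= 1" "c1 > 0" "!!K (x::real^'n). K >= K1 ==> c1 * fdec K (2/5 + 1) x <= fdec K (2/5) x - avg (fdec K (2/5)) x"
 by (rule fdec_superharmonic[where 'n = 'n, of "2/5"]) (use d in auto)
 obtain K2 c2 where 2: "K2 >= 1" "c2 > 0" "!!K (x::real^'n). K >= K2 ==> c2 * fdec K (7/5 + 1) x <= fdec K (7/5) x - avg (fdec K (7/5)) x"
 by (rule fdec_superharmonic[where 'n = 'n, of "7/5"]) (use d in auto)
 obtain K3 c3 where 3: "K3 >= 1" "c3 > 0" "!!K (x::real^'n). K >= K3 ==> c3 * fdec K (12/5 + 1) x <= fdec K (12/5) x - avg (fdec K (12/5)) x"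
 by (rule fdec_superharmonic[where 'n = 'n, of "12/5"]) (use d in auto)
 define K where "K = max K1 (max K2 K3)"
 have K: "K >= K1" "K >= K2" "K >= K3" "K >= 1" using 1 by (auto simp: K_def)
 define c where "c = min c1 c2"
 have c: "c > 0" "c <= c1" "c <= c2" using 1 2 by (auto simp: c_def)
 \<comment> \<open>A point mass of height h0 lies below the Laplacian of
   \<open>fdec K (12/5)\<close>, so h0 times the partial Green sums is dominated by that function.
   This gives summability and decay at once.\<close>
 define h0 where "h0 = c3 * fdec K (12/5 + 1) (0::real^'n)"
 have h0: "h0 > 0" unfolding h0_def by (intro mult_pos_pos 3(2) fdec_pos K(4))
 have sh: "h x >= 0 & h x <= f x - avg f x"
 if "f = (%x. fdec K (12/5) (x - y))" "h = (%x. if x = y then h0 else 0)" for f h and x y :: "real^'n"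
 proof -
 have "avg f x = avg (fdec K (12/5)) (x - y)" unfolding that(1) by (rule avg_translate)
 moreover have "c3 * fdec K (12/5 + 1) (x - y) > 0" by (intro mult_pos_pos 3(2) fdec_pos K(4))
 ultimately show ?thesis using 3(3)[OF K(3), of "x - y"] h0 unfolding that h0_def by (cases "x = y") auto
 qed
 have part: "(\<Sum>n<m. srw_kernel n x y) <= fdec K (12/5) (x - y) / h0" for m and x y :: "real^'n"
 proof -
 have "(\<Sum>v\<in>{y}. (\<Sum>n<m. srw_kernel n x v) * (if v = y then h0 else 0)) <= fdec K (12/5) (x - y)"
 by (rule potential_partial_le[where f = "%x. fdec K (12/5) (x - y)" and h = "%x. if x = y then h0 else 0"])
 (use sh[OF refl refl] fdec_pos[OF K(4), THEN less_imp_le] in auto)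
 then show ?thesis using h0 by (simp add: field_simps)
 qed
 have sm: "summable (%n. srw_kernel n x y)" for x y :: "real^'n"
 by (rule summableI_nonneg_bounded[where x = "fdec K (12/5) (x - y) / h0"]) (use part srw_kernel_nonneg in auto)
 have gr: "green x y = (\<Sum>n. srw_kernel n x y)" for x y :: "real^'n" by (rule green_eq_suminf[OF sm])
 have g1: "green x y <= fdec K (12/5) (x - y) / h0" for x y :: "real^'n"
 unfolding gr by (intro suminf_le_const sm part)
 have conv: "(\<Sum>v\<in>F. green x v * fdec K (b + 1) (v - y)) <= (1 / c) * fdec K b (x - y)"
 if F: "finite F" and b: "b : {2/5, 7/5}" for F and x y :: "real^'n" and b
 proof (rule LIMSEQ_le_const2)
 show "(%m. \<Sum>v\<in>F. (\<Sum>n<m. srw_kernel n x v) * fdec K (b + 1) (v - y)) \<longlonglongrightarrow> (\<Sum>v\<in>F. green x v * fdec K (b + 1) (v - y))"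
 unfolding gr by (intro tendsto_sum tendsto_mult tendsto_const summable_LIMSEQ sm)
 have hh: "c * fdec K (b + 1) (x - y) <= fdec K b (x - y) - avg (%x. fdec K b (x - y)) x" for x
 proof -
 have "c * fdec K (b + 1) (x - y) <= (if b = 2/5 then c1 else c2) * fdec K (b + 1) (x - y)"
 using c fdec_pos[OF K(4), of "b + 1" "x - y"] by (intro mult_right_mono) auto
 also have "... <= fdec K b (x - y) - avg (fdec K b) (x - y)"
 proof (cases "b = 2/5")
 case True
 show ?thesis unfolding True using 1(3)[OF K(1), of "x - y"] by simp
 next
 case False
 then have b: "b = 7/5" using b by simp
 show ?thesis unfolding b using 2(3)[OF K(2), of "x - y"] by simp
 qed
 finally show ?thesis by (simp only: avg_translate[of "fdec K b"])
 qed
 have "(\<Sum>v\<in>F. (\<Sum>n<m. srw_kernel n x v) * fdec K (b + 1) (v - y)) <= (1 / c) * fdec K b (x - y)" for m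
 proof -
 have "(\<Sum>v\<in>F. (\<Sum>n<m. srw_kernel n x v) * (c * fdec K (b + 1) (v - y))) <= fdec K b (x - y)"
 by (rule potential_partial_le[where f = "%x. fdec K b (x - y)" and h = "%x. c * fdec K (b + 1) (x - y)"])
 (use hh fdec_pos[OF K(4), of "b + 1" "_ - y", THEN less_imp_le] fdec_pos[OF K(4), of b "_ - y", THEN less_imp_le] c F in auto)
 moreover have "(\<Sum>v\<in>F. (\<Sum>n<m. srw_kernel n x v) * (c * fdec K (b + 1) (v - y))) = c * (\<Sum>v\<in>F. (\<Sum>n<m. srw_kernel n x v) * fdec K (b + 1) (v - y))"
 by (simp add: sum_distrib_left mult_ac)
 ultimately show ?thesis using c by (simp add: field_simps)
 qed
 then show "EX N. ALL m>=N. (\<Sum>v\<in>F. (\<Sum>n<m. srw_kernel n x v) * fdec K (b + 1) (v - y)) <= (1 / c) * fdec K b (x - y)" by blast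
 qed
 define C where "C = max 1 (max (1 / c) (1 / h0))"
 have C: "C >= 1" "C >= 1 / c" "C >= 1 / h0" by (auto simp: C_def)
 show thesis
 proof (rule that[of K C])
 show "green x y <= C * fdec K (12/5) (x - y)" for x y :: "real^'n"
 using g1[of x y] mult_right_mono[OF C(3), of "fdec K (12/5) (x - y)"] fdec_pos[OF K(4), of "12/5" "x - y"] by simp
 show "(\<Sum>v\<in>F. green x v * fdec K (b + 1) (v - y)) <= C * fdec K b (x - y)"
 if "finite F" "b : {2/5, 7/5}" for F and x y :: "real^'n" and b
 using conv[OF that, of x y] mult_right_mono[OF C(2), of "fdec K b (x - y)"] fdec_pos[OF K(4), of b "x - y"] by simp
 qed (use K C sm in auto)
qed

lemma green_suminf: "green x y = (\<Sum>n. srw_kernel n x (y::real^'n))" and summable_srw: "summable (%n. srw_kernel n x (y::real^'n))"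
proof -
 show s: "summable (%n. srw_kernel n x y)" by (rule green_summable_bound) blast
 show "green x y = (\<Sum>n. srw_kernel n x y)" by (rule green_eq_suminf[OF s])
qed

lemma green_nonneg: "green x (y::real^'n) >= 0"
 unfolding green_suminf by (intro suminf_nonneg summable_srw srw_kernel_nonneg)

lemma green_sym: "green x y = green y (x::real^'n)"
 unfolding green_suminf by (subst srw_kernel_sym) rule

lemma green_renewal: "green x y = (if x = y then 1 else 0) + avg (%x. green x y) (x::real^'n)"
proof -
 have "(\<Sum>n. srw_kernel (Suc n) x y) = avg (%x. \<Sum>n. srw_kernel n x y) x"
 unfolding srw_kernel.simps avg_def
 by (simp add: suminf_divide suminf_sum suminf_add summable_srw summable_sum summable_add)
 moreover have "(\<Sum>n. srw_kernel n x y) = srw_kernel 0 x y + (\<Sum>n. srw_kernel (Suc n) x y)"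
 using suminf_split_head[OF summable_srw[of x y]] by simp
 ultimately show ?thesis by (simp add: green_suminf)
qed

lemma green_diag_ge_1: "green x (x::real^'n) >= 1"
 using green_renewal[of x x] avg_mono[of "%_. 0" "%z. green z x" x] green_nonneg by (simp add: avg_const)

text \<open>A given neighbour is chosen with probability 1/(2d), so one averaging step already gives
  a Harnack bound, valid at the pole too.\<close>

lemma green_neighbour:
 "green (x + axis i 1) y <= 2 * real CARD('n) * green x (y::real^'n)"
 "green (x - axis i 1) y <= 2 * real CARD('n) * green x (y::real^'n)"
proof -
 have "avg (%z. green z y) x <= green x y" using green_renewal[of x y] by auto
 then have "2 * real CARD('n) * avg (%z. green z y) x <= 2 * real CARD('n) * green x y" by (intro mult_left_mono) auto
 then show "green (x + axis i 1) y <= 2 * real CARD('n) * green x y" "green (x - axis i 1) y <= 2 * real CARD('n) * green x y"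
 using avg_mono_le[of "%z. green z y" x i] green_nonneg by (meson order_trans)+
qed

text \<open>The last Green factor is replaced by its bound with exponent 12/5, and summing against
  each further factor lowers the exponent by one. In the last clause one unit of exponent is traded
  for the factor R^(-2).\<close>

lemma green_convolutions:
 obtains K C where "K >= 1" "C >= 1"
 "!!x y::real^'n. green x y <= C * fdec K (12/5) (x - y)"
 "!!F (x::real^'n) y. finite F ==> (\<Sum>v\<in>F. green x v * green v y) <= C * fdec K (7/5) (x - y)"
 "!!F F' (x::real^'n) y. finite F ==> finite F' ==> (\<Sum>v\<in>F. \<Sum>w\<in>F'. green x v * green v w * green w y) <= C * fdec K (2/5) (x - y)"
 "!!F (x::real^'n) R. finite F ==> R > 0 ==> (!!v. v : F ==> norm (v - x) >= R) ==> (\<Sum>v\<in>F. green x v * green v x) <= C / R\<^sup>2"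
proof -
 obtain K C where K: "K >= 1" "C >= 1" and _: "!!x y::real^'n. summable (%n. srw_kernel n x y)" and K':
 "!!x y::real^'n. green x y <= C * fdec K (12/5) (x - y)"
 "!!F (x::real^'n) y b. finite F ==> b : {2/5, 7/5} ==> (\<Sum>v\<in>F. green x v * fdec K (b + 1) (v - y)) <= C * fdec K b (x - y)"
 by (rule green_summable_bound, rule that)
 note G = green_nonneg fdec_pos[OF K(1), THEN less_imp_le]
 have g2: "(\<Sum>v\<in>F. green x v * green v y) <= C * C * fdec K (7/5) (x - y)" if "finite F" for F and x y :: "real^'n"
 proof -
 have "(\<Sum>v\<in>F. green x v * green v y) <= (\<Sum>v\<in>F. green x v * (C * fdec K (12/5) (v - y)))"
 by (intro sum_mono mult_left_mono K' G)
 also have "... = C * (\<Sum>v\<in>F. green x v * fdec K (7/5 + 1) (v - y))" by (simp add: sum_distrib_left mult_ac)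
 also have "... <= C * (C * fdec K (7/5) (x - y))" using K by (intro mult_left_mono K'(2) that) auto
 finally show ?thesis by simp
 qed
 have g3: "(\<Sum>v\<in>F. \<Sum>w\<in>F'. green x v * green v w * green w y) <= C * C * C * fdec K (2/5) (x - y)"
 if "finite F" "finite F'" for F F' and x y :: "real^'n"
 proof -
 have "(\<Sum>v\<in>F. \<Sum>w\<in>F'. green x v * green v w * green w y) = (\<Sum>v\<in>F. green x v * (\<Sum>w\<in>F'. green v w * green w y))"
 by (simp add: sum_distrib_left mult_ac)
 also have "... <= (\<Sum>v\<in>F. green x v * (C * C * fdec K (7/5) (v - y)))"
 by (intro sum_mono mult_left_mono g2 that G)
 also have "... = C * C * (\<Sum>v\<in>F. green x v * fdec K (2/5 + 1) (v - y))" by (simp add: sum_distrib_left mult_ac)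
 also have "... <= C * C * (C * fdec K (2/5) (x - y))" using K by (intro mult_left_mono K'(2) that) auto
 finally show ?thesis by simp
 qed
 have g4: "(\<Sum>v\<in>F. green x v * green v x) <= C * C / R\<^sup>2" if F: "finite F" and R: "R > 0" and far: "!!v. v : F ==> norm (v - x) >= R" for F R and x :: "real^'n"
 proof -
 have "(\<Sum>v\<in>F. green x v * green v x) <= (\<Sum>v\<in>F. green x v * (C * (fdec K (2/5 + 1) (v - x) / R\<^sup>2)))"
 proof (intro sum_mono mult_left_mono G)
 fix v assume v: "v : F"
 have "green v x <= C * fdec K (7/5 + 1) (v - x)" using K'(1)[of v x] by simp
 also have "... <= C * (fdec K (7/5) (v - x) / R\<^sup>2)"
 using K fdec_tail[OF K(1) R far[OF v], of "7/5"] by (intro mult_left_mono) auto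
 finally show "green v x <= C * (fdec K (2/5 + 1) (v - x) / R\<^sup>2)" by simp
 qed
 also have "... = C / R\<^sup>2 * (\<Sum>v\<in>F. green x v * fdec K (2/5 + 1) (v - x))" by (simp add: sum_distrib_left sum_divide_distrib mult_ac)
 also have "... <= C / R\<^sup>2 * (C * fdec K (2/5) (x - x))" using K R by (intro mult_left_mono K'(2) F) auto
 also have "... <= C / R\<^sup>2 * (C * 1)" using K fdec_le_1[OF K(1), of "2/5" "x - x"] by (intro mult_left_mono) auto
 finally show ?thesis by simp
 qed
 have CC: "C <= C * C * C" "C * C <= C * C * C"
 using K(2) mult_mono[of 1 "C * C" C C] mult_mono[of 1 C 1 C] mult_mono[of 1 C "C * C" "C * C"] by (auto simp: mult_ac)
 show thesis
 proof (rule that[of K "C * C * C"])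
 show "1 <= C * C * C" using CC K by linarith
 show "green x y <= C * C * C * fdec K (12/5) (x - y)" for x y :: "real^'n"
 by (rule order_trans[OF K'(1)]) (intro mult_right_mono CC G)
 show "(\<Sum>v\<in>F. green x v * green v y) <= C * C * C * fdec K (7/5) (x - y)" if "finite F" for F and x y :: "real^'n"
 by (rule order_trans[OF g2[OF that]]) (intro mult_right_mono CC G)
 show "(\<Sum>v\<in>F. green x v * green v x) <= C * C * C / R\<^sup>2" if "finite F" "R > 0" "!!v. v : F ==> norm (v - x) >= R" for F R and x :: "real^'n"
 by (rule order_trans[OF g4[OF that]]) (use that in \<open>auto intro!: divide_right_mono CC\<close>)
 qed (use K(1) g3 in blast)+
qed

end

section \<open>Moment identities for boundary clusters\<close>

lemma (in prob_space) std_normal_half_moments: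
 "(\<integral>z. max 0 z \<partial>std_normal) > 0" "measure std_normal {..<0} > 0"
proof -
 interpret N: prob_space std_normal by (rule prob_space_normal_density) simp
 have i: "integrable std_normal (%z::real. z ^ k)" for k
 using integrable_std_normal_moment[of k] by (subst integrable_density) (auto simp: mult_ac)
 have e: "(\<integral>z. z ^ k \<partial>std_normal) = (\<integral>z. std_normal_density z * z ^ k \<partial>lborel)" for k
 by (subst integral_density) auto
 have i1: "integrable std_normal (%z::real. z)" using i[of 1] by simp
 have z0: "(\<integral>z. z \<partial>std_normal) = 0" using e[of 1] std_normal_moment_odd[of 0] by (simp add: has_bochner_integral_iff)
 have z2: "(\<integral>z. z\<^sup>2 \<partial>std_normal) = 1" unfolding e using std_normal_moment_even[of 1] by (auto simp: has_bochner_integral_iff fact_numeral)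
 have nz: "~ (AE z in std_normal. z = 0)"
 proof
 assume "AE z in std_normal. z = 0"
 then have "(\<integral>z. z\<^sup>2 \<partial>std_normal) = (\<integral>z. 0 \<partial>std_normal)"
 by (intro integral_cong_AE) (auto elim!: eventually_mono)
 then show False using z2 by simp
 qed
 have im: "integrable std_normal (%z::real. max 0 z)" using i1 by simp
 show "(\<integral>z. max 0 z \<partial>std_normal) > 0"
 proof (rule ccontr)
 assume "~ ?thesis"
 moreover have "(\<integral>z. max 0 z \<partial>std_normal) >= 0" by (intro Bochner_Integration.integral_nonneg) simp
 ultimately have m0: "(\<integral>z. max 0 z \<partial>std_normal) = 0" by linarith
 have "(\<integral>z. 2 * max 0 z - z \<partial>std_normal) = 0" using im i1 m0 z0 by simp
 moreover have "(%z::real. 2 * max 0 z - z) = (%z. \<bar>z\<bar>)" by (auto simp: fun_eq_iff)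
 ultimately have "(\<integral>z. \<bar>z\<bar> \<partial>std_normal) = 0" by simp
 then have "AE z in std_normal. \<bar>z\<bar> = 0" using i1 by (subst (asm) integral_nonneg_eq_0_iff_AE) auto
 then show False using nz by simp
 qed
 show "measure std_normal {..<0} > 0"
 proof (rule ccontr)
 assume "~ ?thesis"
 then have "N.prob {..<0} = 0" using measure_nonneg[of std_normal "{..<0}"] by linarith
 then have ae: "AE z in std_normal. z ~: {..<0}" using N.prob_eq_0[of "{..<0}"] by simp
 then have "AE z in std_normal. z = 0"
 using i1 z0 by (subst integral_nonneg_eq_0_iff_AE[symmetric]) auto
 then show False using nz by simp
 qed
qed

context box begin

definition L2 :: "(('a => real) => real) => bool" where
 "L2 F \<longleftrightarrow> F : borel_measurable (PiM V (%_. borel)) & integrable M (%om. (F (res V om))\<^sup>2)"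

abbreviation EE :: "(('a => real) => real) => real" where
 "EE F \<equiv> expectation (%om. F (res V om))"

lemma V_ne: "V ~= {}" using D by auto

lemma measurable_Fres: "F : borel_measurable (PiM V (%_. borel)) ==> (%om. F (res V om)) : borel_measurable M"
 by (rule measurable_compose[OF measurable_res[OF V(2)]])

lemma L2_integrable: "L2 F ==> integrable M (%om. F (res V om))"
 unfolding L2_def by (intro square_integrable_imp_integrable[of "%om. F (res V om)"] measurable_Fres) auto

lemma L2_mult: "L2 F ==> L2 G ==> integrable M (%om. F (res V om) * G (res V om))"
 unfolding L2_def by (intro sq_prod_integrable[of "%om. F (res V om)" "%om. G (res V om)"] measurable_Fres) auto

definition asum :: "('a => real) => real" where
 "asum f = (\<Sum>z\<in>V. \<bar>f z\<bar>)"

lemma L2_coord: "v : V ==> L2 (%f. f v)"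
 unfolding L2_def using measurable_coord[of v] integrable_phi_power[of v 2] V by (auto simp: res_def)

lemma L2_bound:
 assumes "F : borel_measurable (PiM V (%_. borel))" "!!f. \<bar>F f\<bar> <= \<bar>G f\<bar>" "L2 G"
 shows "L2 F"
 unfolding L2_def
proof (intro conjI assms(1))
 show "integrable M (%om. (F (res V om))\<^sup>2)"
 proof (rule Bochner_Integration.integrable_bound)
 show "integrable M (%om. (G (res V om))\<^sup>2)" using assms(3) by (simp add: L2_def)
 show "(%om. (F (res V om))\<^sup>2) : borel_measurable M"
 using measurable_Fres[OF assms(1)] by (intro borel_measurable_power)
 have "(F f)\<^sup>2 <= (G f)\<^sup>2" for f using assms(2)[of f] by (simp add: abs_le_square_iff)
 then show "AE om in M. norm ((F (res V om))\<^sup>2) <= norm ((G (res V om))\<^sup>2)"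
 by (intro AE_I2) simp
 qed
qed

lemma L2_add: "L2 F ==> L2 G ==> L2 (%f. F f + G f)"
proof -
 assume F: "L2 F" and G: "L2 G"
 have e: "(F f + G f)\<^sup>2 = (F f)\<^sup>2 + (G f)\<^sup>2 + 2 * (F f * G f)" for f by (simp add: power2_sum)
 show ?thesis using L2_mult[OF F G] F G unfolding L2_def e by auto
qed

lemma L2_cmult: "L2 F ==> L2 (%f. c * F f)"
 unfolding L2_def by (auto simp: power_mult_distrib)

lemma L2_const: "L2 (%f. c)" unfolding L2_def by auto

lemma L2_uminus: "L2 F ==> L2 (%f. - F f)"
 using L2_cmult[of F "-1"] by simp

lemma L2_diff: "L2 F ==> L2 G ==> L2 (%f. F f - G f)"
 using L2_add[OF _ L2_uminus, of F G] by simp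

lemma L2_sum: "(!!z. z : A ==> L2 (F z)) ==> L2 (%f. \<Sum>z\<in>A. F z f)"
 by (induction A rule: infinite_finite_induct) (auto intro: L2_const L2_add)

lemma L2_abs: "L2 F ==> L2 (%f. \<bar>F f\<bar>)"
 unfolding L2_def by auto

lemma L2_pattern: 
 assumes "L2 F"
 shows "L2 (%f. (if Q (pos f) (neg f) then 1 else 0) * F f)"
proof (rule L2_bound[OF _ _ assms])
 show "(%f. (if Q (pos f) (neg f) then 1 else 0) * F f) : borel_measurable (PiM V (%_. borel))"
 using measurable_patterns[of "%A B. if Q A B then 1 else 0"] assms by (intro borel_measurable_times) (auto simp: L2_def)
qed auto

lemma L2_event: "L2 (%f. if Q (pos f) (neg f) then 1 else 0)"
 using L2_pattern[OF L2_const[of 1], of Q] by simp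

definition mono_fun :: "(('a => real) => real) => bool" where
 "mono_fun F \<longleftrightarrow> (ALL f f'. (\<forall>v\<in>V. f v <= f' v) \<longrightarrow> F f <= F f')"

lemma FKG': "L2 F ==> mono_fun F ==> L2 G ==> mono_fun G ==> EE F * EE G <= EE (%f. F f * G f)"
proof -
 assume F: "L2 F" "mono_fun F" and G: "L2 G" "mono_fun G"
 have m: "H x <= H y" if "mono_fun H" "!!v. v : V ==> x v <= y v" for H x y
 by (rule that(1)[unfolded mono_fun_def, rule_format]) (rule that(2))
 show ?thesis
 by (rule FKG[OF V V_ne F(1)[unfolded L2_def, THEN conjunct1] F(1)[unfolded L2_def, THEN conjunct2] m[OF F(2)]
 G(1)[unfolded L2_def, THEN conjunct1] G(1)[unfolded L2_def, THEN conjunct2] m[OF G(2)]])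
qed

lemma FKG_opp:
 assumes F: "L2 F" "mono_fun F" and G: "L2 G" "mono_fun (%f. - G f)"
 shows "EE (%f. F f * G f) <= EE F * EE G"
 using FKG'[OF F L2_uminus[OF G(1)] G(2)] by simp

lemma FKG_anti:
 assumes F: "L2 F" "mono_fun (%f. - F f)" and G: "L2 G" "mono_fun (%f. - G f)"
 shows "EE F * EE G <= EE (%f. F f * G f)"
 using FKG'[OF L2_uminus[OF F(1)] F(2) L2_uminus[OF G(1)] G(2)] by simp

lemma EE_mono: "L2 F ==> L2 G ==> (!!om. F (res V om) <= G (res V om)) ==> EE F <= EE G"
 by (intro integral_mono L2_integrable)

definition ax :: "'a => ('a => real) => real" where
 "ax x f = (if x : cl (pos f) then 1 else 0) * f x"

definition bx :: "'a => ('a => real) => real" where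
 "bx x f = (if x : cl (neg f) then 1 else 0) * f x"

text \<open>In the continuum, exploring both clusters would reveal the field there and zeros
  elsewhere; \<open>ex\<close> is the mesh defect of this statement.\<close>

definition ex :: "'a => ('a => real) => real" where
 "ex x f = hS (Sc (pos f) Un Sc (neg f)) f x - ax x f - bx x f"

lemma ax_nonneg: "ax x f >= 0"
 using cl_sub[of "pos f"] by (auto simp: ax_def pos_def)

lemma hS_pos: "x : V ==> hS (Sc (pos f)) f x = ax x f - U f x"
proof -
 assume "x : V"
 show ?thesis
 proof (cases "x : cl (pos f)")
 case True
 then have "x : Sc (pos f)" by (auto simp: Sc_def Kc_def)
 then show ?thesis using True by (simp add: hS_on ax_def U_def)
 qed (simp add: ax_def U_def)
qed

lemma pos_uminus: "pos (%v. - f v) = neg f" and neg_uminus: "neg (%v. - f v) = pos f"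
 by (auto simp: pos_def neg_def)

lemma hS_uminus: "hS S (%v. - f v) x = - hS S f x"
 by (simp add: hS_def sum_negf)

lemma hS_neg: "x : V ==> hS (Sc (neg f)) f x = bx x f + U (%v. - f v) x"
 using hS_pos[of x "%v. - f v"] by (simp add: pos_uminus hS_uminus ax_def bx_def)

lemma ex_bound:
 assumes x: "x : V"
 shows "\<bar>ex x f\<bar> <= osc f"
proof -
 let ?S = "Sc (pos f) Un Sc (neg f)"
 have S: "finite ?S" "?S <= X" using Sc_fin by auto
 have both0: "f x = 0" if "x : cl (pos f)" "x : cl (neg f)"
 using subsetD[OF cl_sub that(1)] subsetD[OF cl_sub that(2)] by (simp add: pos_def neg_def)
 show ?thesis
 proof (cases "x : cl (pos f) | x : cl (neg f)")
 case True
 then have "x : ?S" by (auto simp: Sc_def Kc_def)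
 then have "hS ?S f x = f x" unfolding hS_def by (rule sum_hm_on[OF S])
 then have "ex x f = 0" using True both0 by (auto simp: ex_def ax_def bx_def)
 then show ?thesis by (simp add: osc_nonneg)
 next
 case False
 then show ?thesis using both_bound[of x f] x by (simp add: ex_def ax_def bx_def)
 qed
qed

lemma L2_ax: "x : V ==> L2 (ax x)"
 unfolding ax_def[abs_def] by (rule L2_pattern[OF L2_coord, of x "%A B. x : cl A"])

lemma L2_bx: "x : V ==> L2 (bx x)"
 unfolding bx_def[abs_def] by (rule L2_pattern[OF L2_coord, of x "%A B. x : cl B"])

lemma L2_hS:
 assumes x: "x : V" and Q: "!!A B. Q A B <= V"
 shows "L2 (%f. hS (Q (pos f) (neg f)) f x)"
proof -
 have e: "hS (Q (pos f) (neg f)) f x = (\<Sum>z\<in>V. hm (Q (pos f) (neg f)) x z * f z)" for f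
 unfolding hS_def using V Q[of "pos f" "neg f"] by (intro sum.mono_neutral_left) (auto simp: hm_def)
 have xX: "x : X" using x V by auto
 have "L2 (%f. hm (Q (pos f) (neg f)) x z * f z)" if z: "z : V" for z
 proof (rule L2_bound[OF _ _ L2_coord[OF z]])
 show "(%f. hm (Q (pos f) (neg f)) x z * f z) : borel_measurable (PiM V (%_. borel))"
 by (intro borel_measurable_times measurable_coord z measurable_patterns[of "%A B. hm (Q A B) x z"])
 fix f
 let ?S = "Q (pos f) (neg f)"
 have S: "finite ?S" "?S <= X" using Q[of "pos f" "neg f"] V finite_subset by auto
 have "hm ?S x z <= 1"
 proof (cases "z : ?S")
 case True
 then have "hm ?S x z <= (\<Sum>z\<in>?S. hm ?S x z)" using S hm_nonneg[OF S xX] by (intro member_le_sum) auto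
 then show ?thesis using sum_hm_le_1[OF S xX] by linarith
 qed (simp add: hm_def)
 then show "\<bar>hm ?S x z * f z\<bar> <= \<bar>f z\<bar>" using hm_nonneg[OF S xX, of z] by (simp add: abs_mult mult_left_le_one_le)
 qed
 then show ?thesis unfolding e by (rule L2_sum)
qed

lemma L2_U: "x : V ==> L2 (%f. U f x)"
proof -
 assume x: "x : V"
 have "L2 (%f. ax x f - hS (Sc (pos f)) f x)"
 by (rule L2_diff[OF L2_ax[OF x] L2_hS[OF x, of "%A B. Sc A"]]) (rule Sc_V)
 then show ?thesis using hS_pos[OF x] by simp
qed

lemma L2_U': "x : V ==> L2 (%f. U (%v. - f v) x)"
proof -
 assume x: "x : V"
 have "L2 (%f. hS (Sc (neg f)) f x - bx x f)"
 by (rule L2_diff[OF L2_hS[OF x, of "%A B. Sc B"] L2_bx[OF x]]) (rule Sc_V)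
 then show ?thesis using hS_neg[OF x] by simp
qed

lemma L2_U2: "x : V ==> L2 (%f. U2 f x)"
proof (rule L2_bound[OF _ _ L2_U])
 assume x: "x : V"
 have m: "(%f. if z : Kc (pos f) then 0 else hm (Sc (pos f)) x z * max 0 (- f z)) : borel_measurable (PiM V (%_. borel))" if z: "z : D" for z
 proof -
 have zV: "z : V" using z D by auto
 have "(%f. (if z : Kc (pos f) then 0 else hm (Sc (pos f)) x z) * max 0 (- f z)) : borel_measurable (PiM V (%_. borel))"
 by (intro borel_measurable_times borel_measurable_max borel_measurable_uminus borel_measurable_const measurable_coord zV
 measurable_patterns[of "%A B. if z : Kc A then 0 else hm (Sc A) x z"])
 moreover have "(%f. (if z : Kc (pos f) then 0 else hm (Sc (pos f)) x z) * max 0 (- f z)) = (%f. if z : Kc (pos f) then 0 else hm (Sc (pos f)) x z * max 0 (- f z))"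
 by (rule ext) simp
 ultimately show ?thesis by simp
 qed
 show "(%f. U2 f x) : borel_measurable (PiM V (%_. borel))"
 unfolding U2_def using m by (rule borel_measurable_sum)
 show "\<bar>U2 f x\<bar> <= \<bar>U f x\<bar>" for f using U_U2(1)[OF x, of f] U2_nonneg[of x f] x V by auto
qed

lemma osc_pow4: "osc f ^ 4 = (\<Sum>v\<in>V. \<Sum>w\<in>nb v Int V. (f v - f w) ^ 4)"
proof -
 have n: "(\<Sum>v\<in>V. \<Sum>w\<in>nb v Int V. (f v - f w) ^ 4) >= 0" by (intro sum_nonneg) auto
 show ?thesis
 proof (cases "(\<Sum>v\<in>V. \<Sum>w\<in>nb v Int V. (f v - f w) ^ 4) = 0")
 case False
 then have p: "(\<Sum>v\<in>V. \<Sum>w\<in>nb v Int V. (f v - f w) ^ 4) > 0" using n by simp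
 have "osc f ^ 4 = osc f powr 4" using p by (simp add: osc_def)
 also have "... = (\<Sum>v\<in>V. \<Sum>w\<in>nb v Int V. (f v - f w) ^ 4) powr (1/4 * 4)" unfolding osc_def by (simp only: powr_powr)
 finally show ?thesis using p by simp
 qed (simp add: osc_def)
qed

lemma integrable_diff4: "v : X ==> w : X ==> integrable M (%om. (\<phi> v om - \<phi> w om) ^ 4)"
 "v : X ==> w : X ==> expectation (%om. (\<phi> v om - \<phi> w om) ^ 4) = 3 * (g v v - 2 * g v w + g w w)\<^sup>2"
proof -
 assume vw: "v : X" "w : X"
 let ?V = "{v, w}" and ?a = "%x. (if x = v then 1 else 0) - (if x = w then 1 else (0::real))"
 have l: "lin ?V ?a om = \<phi> v om - \<phi> w om" for om
 by (cases "v = w") (auto simp: lin_def)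
 have c: "cov ?V ?a ?a = g v v - 2 * g v w + g w w"
 using g_sym[OF vw] by (cases "v = w") (auto simp: cov_def)
 have V2: "finite ?V" "?V <= X" using vw by auto
 show "integrable M (%om. (\<phi> v om - \<phi> w om) ^ 4)" using lin_moments(1)[OF V2, of ?a 4] by (simp add: l)
 show "expectation (%om. (\<phi> v om - \<phi> w om) ^ 4) = 3 * (g v v - 2 * g v w + g w w)\<^sup>2"
 using lin_moments(4)[OF V2, of ?a] by (simp add: l c)
qed

lemma g_le_diag: "x : X ==> v : X ==> g x v <= g v v"
proof -
 assume x: "x : X" and v: "v : X"
 have "g v v - g x v >= 0"
 proof (rule minimum_principle[where W = X and S = "{v}" and u = "%x. g v v - g x v"])
 fix m :: real assume m: "m < 0"
 have "{z : X. g v v - g z v <= m} <= {z : X. - m <= \<bar>g z v\<bar>}" using g_nonneg[OF v v] by auto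
 moreover have "finite {z : X. - m <= \<bar>g z v\<bar>}" using vanishing_g[OF v] m unfolding vanishing_def by simp
 ultimately show "finite {z : X. g v v - g z v <= m}" by (rule finite_subset)
 next
 fix z assume "z : X - {v}"
 then show "lap nb (%x. g v v - g x v) z >= 0" using lap_g[of z v] v
 by (simp only: lap_diff lap_const) simp
 qed (use x nb_subset in auto)
 then show ?thesis by simp
qed

lemma g_edge: "v : X ==> w : nb v ==> g v v - g w v <= \<kappa>"
proof -
 assume v: "v : X" and w: "w : nb v"
 have "g v v - g w v <= (\<Sum>w\<in>nb v. g v v - g w v)"
 using g_le_diag v nb_subset[OF v] finite_nb[OF v] w by (intro member_le_sum) (auto simp: subset_iff)
 also have "... = \<kappa>" using lap_g[OF v v] by (simp add: lap_def)
 finally show ?thesis .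
qed

text \<open>An edge increment is Gaussian with variance at most 2 \<kappa>, so its fourth moment is
  at most 3 (2 \<kappa>)^2. With \<kappa> of order 1/m and of order m edges, the sum of fourth
  moments is of order 1/m, while second moments would only give a bound of order 1; hence the fourth
  powers in \<open>osc\<close>.\<close>

lemma L2_osc: "L2 osc" and expectation_osc4: "integrable M (%om. osc (res V om) ^ 4)" 
 "EE (%f. osc f ^ 4) <= 12 * \<kappa>\<^sup>2 * (\<Sum>v\<in>V. real (card (nb v)))"
proof -
 have fin: "finite (nb v Int V)" for v using V by auto
 have i: "integrable M (%om. (res V om v - res V om w) ^ 4)" if "v : V" "w : nb v Int V" for v w
 using integrable_diff4(1)[of v w] that V by (auto simp: res_def)
 show i4: "integrable M (%om. osc (res V om) ^ 4)"
 unfolding osc_pow4 by (intro Bochner_Integration.integrable_sum i)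
 have m: "osc : borel_measurable (PiM V (%_. borel))"
 unfolding osc_def[abs_def] by (intro powr_real_measurable borel_measurable_sum borel_measurable_power borel_measurable_diff borel_measurable_const measurable_coord) auto
 show "L2 osc" unfolding L2_def
 proof (intro conjI m)
 show "integrable M (%om. (osc (res V om))\<^sup>2)"
 proof (rule Bochner_Integration.integrable_bound)
 show "integrable M (%om. 1 + osc (res V om) ^ 4)" using i4 by simp
 show "(%om. (osc (res V om))\<^sup>2) : borel_measurable M" using measurable_Fres[OF m] by simp
 have "t\<^sup>2 <= 1 + t ^ 4" for t :: real
 proof -
 have "0 <= (t\<^sup>2 - 1)\<^sup>2" by simp
 moreover have "(t\<^sup>2 - 1)\<^sup>2 = t ^ 4 - 2 * t\<^sup>2 + 1" by (simp add: power2_eq_square algebra_simps power4_eq_xxxx)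
 ultimately show ?thesis using zero_le_power2[of t] by linarith
 qed
 then show "AE om in M. norm ((osc (res V om))\<^sup>2) <= norm (1 + osc (res V om) ^ 4)" by (intro AE_I2) simp
 qed
 qed
 have "EE (%f. osc f ^ 4) = (\<Sum>v\<in>V. \<Sum>w\<in>nb v Int V. expectation (%om. (res V om v - res V om w) ^ 4))"
 proof -
 have "EE (%f. osc f ^ 4) = (\<Sum>v\<in>V. expectation (%om. \<Sum>w\<in>nb v Int V. (res V om v - res V om w) ^ 4))"
 unfolding osc_pow4 by (rule Bochner_Integration.integral_sum) (intro Bochner_Integration.integrable_sum i)
 also have "... = (\<Sum>v\<in>V. \<Sum>w\<in>nb v Int V. expectation (%om. (res V om v - res V om w) ^ 4))"
 by (rule sum.cong[OF refl], rule Bochner_Integration.integral_sum, rule i)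
 finally show ?thesis .
 qed
 also have "... <= (\<Sum>v\<in>V. \<Sum>w\<in>nb v Int V. 12 * \<kappa>\<^sup>2)"
 proof (intro sum_mono)
 fix v w assume v: "v : V" and w: "w : nb v Int V"
 have vX: "v : X" "w : X" using v w V by auto
 have "expectation (%om. (res V om v - res V om w) ^ 4) = 3 * (g v v - 2 * g v w + g w w)\<^sup>2"
 using integrable_diff4(2)[OF vX] v w by (simp add: res_def)
 also have "... <= 3 * (2 * \<kappa>)\<^sup>2"
 proof (intro mult_left_mono power_mono)
 have "g v v - g w v <= \<kappa>" using g_edge vX w by auto
 moreover have "g w w - g v w <= \<kappa>" using g_edge[of w v] nb_sym[of v w] vX w by auto
 ultimately show "g v v - 2 * g v w + g w w <= 2 * \<kappa>" using g_sym[OF vX] by simp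
 show "0 <= g v v - 2 * g v w + g w w" using g_le_diag[of w v] g_le_diag[of v w] vX g_sym[OF vX] by simp
 qed auto
 finally show "expectation (%om. (res V om v - res V om w) ^ 4) <= 12 * \<kappa>\<^sup>2" by (simp add: power_mult_distrib)
 qed
 also have "... <= (\<Sum>v\<in>V. real (card (nb v)) * (12 * \<kappa>\<^sup>2))"
 proof (rule sum_mono)
 fix v assume "v : V"
 then have "finite (nb v)" using V finite_nb by auto
 then have "card (nb v Int V) <= card (nb v)" by (intro card_mono) auto
 then show "(\<Sum>w\<in>nb v Int V. 12 * \<kappa>\<^sup>2) <= real (card (nb v)) * (12 * \<kappa>\<^sup>2)" by (simp add: mult_right_mono)
 qed
 finally show "EE (%f. osc f ^ 4) <= 12 * \<kappa>\<^sup>2 * (\<Sum>v\<in>V. real (card (nb v)))"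
 by (simp add: sum_distrib_left mult_ac)
qed

definition TT :: "'a => real" where "TT x = EE (%f. U2 f x)"

definition pc :: "'a => real" where "pc x = EE (%f. if x : cl (pos f) then 1 else 0)"

definition JJ :: "'a set => 'a => 'a => real" where "JJ S x y = g x y - kg S x y"

text \<open>\<open>JJ S x y\<close> measures the time at y after the walk from x has met S, so by
  inclusion-exclusion \<open>K2\<close> measures the time at y after it has met both explored
  sets.\<close>

definition K2 :: "'a => 'a => ('a => real) => real" where
 "K2 x y f = JJ (Sc (pos f)) x y + JJ (Sc (neg f)) x y - JJ (Sc (pos f) Un Sc (neg f)) x y"

interpretation Lp: local_set M X nb q g \<kappa> \<phi> V "%f. Sc (pos f)" by (rule local_set_pos)
interpretation Ln: local_set M X nb q g \<kappa> \<phi> V "%f. Sc (neg f)" by (rule local_set_neg)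
interpretation Lb: local_set M X nb q g \<kappa> \<phi> V "%f. Sc (pos f) Un Sc (neg f)" by (rule local_set_both)

lemma hT_eq: "Lp.hT f x = hS (Sc (pos f)) f x" "Ln.hT f x = hS (Sc (neg f)) f x"
 "Lb.hT f x = hS (Sc (pos f) Un Sc (neg f)) f x"
 by (simp_all add: Lp.hT_def Ln.hT_def Lb.hT_def hS_def)

lemma res_V: "x : V ==> res V om x = \<phi> x om" by (simp add: res_def)

text \<open>The stopped harmonic extension has the mean of the field, which is 0, so its part on the
  cluster balances its negative part elsewhere.\<close>

lemma expectation_ax: assumes x: "x : V" shows "EE (ax x) = EE (%f. U f x)"
proof -
 have xX: "x : X" using x V by auto
 have "expectation (%om. 1 * \<phi> x om) = expectation (%om. 1 * Lp.hT (res V om) x)"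
 by (rule Lp.stopped_mean[where F = "%_. 1"]) (use xX in auto)
 then have "expectation (%om. ax x (res V om) - U (res V om) x) = 0"
 using expectation_phi2(2)[OF xX] by (simp add: hT_eq hS_pos[OF x])
 then show ?thesis using L2_integrable[OF L2_ax[OF x]] L2_integrable[OF L2_U[OF x]] by simp
qed

lemma TT_le: assumes x: "x : V" shows "TT x <= EE (ax x)" "EE (ax x) <= TT x + EE osc" "TT x >= 0"
proof -
 show "TT x <= EE (ax x)" unfolding expectation_ax[OF x] TT_def
 by (rule EE_mono[OF L2_U2[OF x] L2_U[OF x]]) (rule U_U2(1)[OF x])
 have "EE (%f. U f x) <= EE (%f. U2 f x + osc f)"
 by (rule EE_mono[OF L2_U[OF x] L2_add[OF L2_U2[OF x] L2_osc]]) (rule U_U2(2)[OF x])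
 then show "EE (ax x) <= TT x + EE osc" unfolding expectation_ax[OF x] TT_def
 using L2_integrable[OF L2_U2[OF x]] L2_integrable[OF L2_osc] by simp
 show "TT x >= 0" unfolding TT_def using x V U2_nonneg by (intro Bochner_Integration.integral_nonneg) auto
qed

lemma mono_cl: "mono_fun (%f. if x : cl (pos f) then 1 else 0)"
 unfolding mono_fun_def
proof (intro allI impI)
 fix f f' :: "'a => real" assume "\<forall>v\<in>V. f v <= f' v"
 then have "cl (pos f) <= cl (pos f')" by (intro cl_mono pos_mono) auto
 then show "(if x : cl (pos f) then 1 else 0) <= (if x : cl (pos f') then 1 else (0::real))" by auto
qed

lemma mono_ax: "x : V ==> mono_fun (ax x)"
 unfolding mono_fun_def
proof (intro allI impI)
 fix f f' :: "'a => real" assume x: "x : V" and le: "\<forall>v\<in>V. f v <= f' v"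
 then have "cl (pos f) <= cl (pos f')" by (intro cl_mono pos_mono) auto
 then show "ax x f <= ax x f'" using le x ax_nonneg[of x f'] by (auto simp: ax_def)
qed

lemma mono_U2: "x : X ==> mono_fun (%f. - U2 f x)"
 unfolding mono_fun_def
proof (intro allI impI)
 fix f f' :: "'a => real" assume x: "x : X" and le: "\<forall>v\<in>V. f v <= f' v"
 have "U2 f' x <= U2 f x" by (rule U2_antimono[OF le[THEN bspec] x])
 then show "- U2 f x <= - U2 f' x" by simp
qed

lemma expectation_pos_part:
 assumes x: "x : V" "g x x >= 1"
 shows "EE (%f. max 0 (f x)) >= (\<integral>z. max 0 z \<partial>std_normal)"
proof -
 have xX: "{x} <= X" using x V by auto
 have l: "lin {x} (%_. 1) = \<phi> x" by (simp add: lin_def fun_eq_iff)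
 have c: "cov {x} (%_. 1) (%_. 1) = g x x" by (simp add: cov_def)
 have "EE (%f. max 0 (f x)) = (\<integral>z. max 0 (sqrt (g x x) * z) \<partial>std_normal)"
 using expectation_lin(2)[OF _ xX, of "%z. max 0 z" "%_. 1"] x by (simp add: l c res_V)
 also have "... = (\<integral>z. sqrt (g x x) * max 0 z \<partial>std_normal)"
 using x by (intro Bochner_Integration.integral_cong) (auto simp: max_def zero_le_mult_iff mult_le_0_iff)
 also have "... = sqrt (g x x) * (\<integral>z. max 0 z \<partial>std_normal)" by simp
 also have "... >= 1 * (\<integral>z. max 0 z \<partial>std_normal)"
 using x std_normal_half_moments(1) by (intro mult_right_mono) auto
 finally show ?thesis by simp
qed

text \<open>FKG for the event that x is in the cluster and the positive part of the field at x;
  their product is \<open>ax x\<close>.\<close>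

lemma pc_bound:
 assumes x: "x : V" "g x x >= 1"
 shows "pc x * (\<integral>z. max 0 z \<partial>std_normal) <= EE (ax x)" "0 <= pc x" "pc x <= 1"
proof -
 have m: "L2 (%f. max 0 (f x))"
 proof (rule L2_bound[OF _ _ L2_coord[OF x(1)]])
 show "(%f. max 0 (f x :: real)) : borel_measurable (PiM V (%_. borel))"
 using measurable_coord[OF x(1)] by simp
 qed auto
 have mm: "mono_fun (%f. max 0 (f x))" 
 unfolding mono_fun_def
 proof (intro allI impI)
 fix f f' :: "'a => real" assume "\<forall>v\<in>V. f v <= f' v"
 then have "f x <= f' x" using x(1) by (rule bspec)
 then show "max 0 (f x) <= max 0 (f' x)" by (rule max.mono[OF order_refl])
 qed
 have e: "L2 (%f. if x : cl (pos f) then 1 else 0)" by (rule L2_event[of "%A B. x : cl A"])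
 show p0: "0 <= pc x" unfolding pc_def by (intro Bochner_Integration.integral_nonneg) auto
 show "pc x <= 1" using EE_mono[OF e L2_const[of 1]] by (simp add: pc_def prob_space)
 have "pc x * EE (%f. max 0 (f x)) <= EE (%f. (if x : cl (pos f) then 1 else 0) * max 0 (f x))"
 unfolding pc_def by (rule FKG'[OF e mono_cl m mm])
 also have "(%f. (if x : cl (pos f) then 1 else 0) * max 0 (f x)) = ax x"
 proof (rule ext)
 fix f show "(if x : cl (pos f) then 1 else 0) * max 0 (f x) = ax x f"
 using cl_sub[of "pos f"] by (auto simp: ax_def pos_def)
 qed
 finally show "pc x * (\<integral>z. max 0 z \<partial>std_normal) <= EE (ax x)"
 using mult_left_mono[OF expectation_pos_part[OF x] p0] by linarith
qed

lemma ax_U_zero: "ax x f * U f x = 0" by (simp add: ax_def U_def)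

text \<open>The functions \<open>ax x\<close> and \<open>U\<close> at x are never both nonzero, so
  the square of the stopped extension is the sum of their squares; its mean is known from the
  stopped covariance with x = y.\<close>

lemma second_moment_ax:
 assumes x: "x : V"
 shows "EE (%f. (ax x f)\<^sup>2) <= EE (%f. JJ (Sc (pos f)) x x)"
proof -
 have xX: "x : X" using x V by auto
 have "g x x = EE (%f. hS (Sc (pos f)) f x * hS (Sc (pos f)) f x) + EE (%f. kg (Sc (pos f)) x x)"
 using Lp.stopped_covariance[OF xX xX] by (simp add: hT_eq)
 moreover have "EE (%f. JJ (Sc (pos f)) x x) = g x x - EE (%f. kg (Sc (pos f)) x x)"
 using Lp.integrable_kgT[OF xX xX] by (simp add: JJ_def prob_space)
 moreover have "EE (%f. (ax x f)\<^sup>2) <= EE (%f. hS (Sc (pos f)) f x * hS (Sc (pos f)) f x)"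
 proof (rule integral_mono)
 show "integrable M (%om. (ax x (res V om))\<^sup>2)" using L2_ax[OF x] by (simp add: L2_def)
 have L: "L2 (%f. hS (Sc (pos f)) f x)" by (rule L2_hS[OF x, of "%A B. Sc A"]) (rule Sc_V)
 show "integrable M (%om. hS (Sc (pos (res V om))) (res V om) x * hS (Sc (pos (res V om))) (res V om) x)" by (rule L2_mult[OF L L])
 fix om
 let ?a = "ax x (res V om)" and ?u = "U (res V om) x"
 have "(?a - ?u) * (?a - ?u) = ?a\<^sup>2 + ?u\<^sup>2 - 2 * (?a * ?u)" by (simp add: power2_eq_square algebra_simps)
 moreover have "?a * ?u = 0" by (rule ax_U_zero)
 moreover have "0 <= ?u\<^sup>2" by (rule zero_le_power2)
 ultimately show "?a\<^sup>2 <= hS (Sc (pos (res V om))) (res V om) x * hS (Sc (pos (res V om))) (res V om) x"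
 unfolding hS_pos[OF x] by linarith
 qed
 ultimately show ?thesis by linarith
qed

end

section \<open>The two-arm identity and correlation inequalities\<close>

context box begin

definition PP :: "(('a => real) => real) => (('a => real) => real) => real" where
 "PP F G = EE (%f. F f * G f)"

lemma PP_sym: "PP F G = PP G F" by (simp add: PP_def mult.commute)

lemma PP_add: "L2 F ==> L2 G ==> L2 H ==> PP (%f. F f + G f) H = PP F H + PP G H"
 unfolding PP_def using L2_mult[of F H] L2_mult[of G H] by (simp add: distrib_right)

lemma PP_diff: "L2 F ==> L2 G ==> L2 H ==> PP (%f. F f - G f) H = PP F H - PP G H"
 unfolding PP_def using L2_mult[of F H] L2_mult[of G H] by (simp add: left_diff_distrib)

lemma PP_add2: "L2 F ==> L2 G ==> L2 H ==> PP H (%f. F f + G f) = PP H F + PP H G"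
 using PP_add[of F G H] by (simp add: PP_sym)

lemma PP_diff2: "L2 F ==> L2 G ==> L2 H ==> PP H (%f. F f - G f) = PP H F - PP H G"
 using PP_diff[of F G H] by (simp add: PP_sym)

interpretation Lp: local_set M X nb q g \<kappa> \<phi> V "%f. Sc (pos f)" by (rule local_set_pos)
interpretation Ln: local_set M X nb q g \<kappa> \<phi> V "%f. Sc (neg f)" by (rule local_set_neg)
interpretation Lb: local_set M X nb q g \<kappa> \<phi> V "%f. Sc (pos f) Un Sc (neg f)" by (rule local_set_both)

lemma hT_eq': "Lp.hT f x = hS (Sc (pos f)) f x" "Ln.hT f x = hS (Sc (neg f)) f x"
 "Lb.hT f x = hS (Sc (pos f) Un Sc (neg f)) f x"
 by (simp_all add: Lp.hT_def Ln.hT_def Lb.hT_def hS_def)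

lemma hS_both: "hS (Sc (pos f) Un Sc (neg f)) f x = ax x f + bx x f + ex x f"
 by (simp add: ex_def)

lemma L2_hSb: "x : V ==> L2 (%f. hS (Sc (pos f) Un Sc (neg f)) f x)"
 by (rule L2_hS[where Q = "%A B. Sc A Un Sc B"]) (auto intro: subsetD[OF Sc_V])

lemma L2_ex: "x : V ==> L2 (ex x)"
 unfolding ex_def[abs_def] by (intro L2_diff L2_hSb L2_ax L2_bx)

lemma ax_local:
 assumes "!!v. v : S ==> f v = f' v" "Sc (pos f) <= S"
 shows "ax x f' = ax x f"
proof -
 have "cl (pos f') = cl (pos f)"
 proof (rule cl_local)
 fix v assume v: "v : Sc (pos f)"
 show "v : pos f \<longleftrightarrow> v : pos f'"
 by (rule pos_agree[where f = f and f' = f', OF subsetD[OF Sc_V v] assms(1)[OF subsetD[OF assms(2) v]]])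
 qed
 moreover have "x : cl (pos f) ==> f x = f' x" using assms by (auto simp: Sc_def Kc_def)
 ultimately show ?thesis by (auto simp: ax_def)
qed

lemma bx_local:
 assumes "!!v. v : S ==> f v = f' v" "Sc (neg f) <= S"
 shows "bx x f' = bx x f"
proof -
 have "cl (neg f') = cl (neg f)"
 proof (rule cl_local)
 fix v assume v: "v : Sc (neg f)"
 show "v : neg f \<longleftrightarrow> v : neg f'"
 by (rule neg_agree[where f = f and f' = f', OF subsetD[OF Sc_V v] assms(1)[OF subsetD[OF assms(2) v]]])
 qed
 moreover have "x : cl (neg f) ==> f x = f' x" using assms by (auto simp: Sc_def Kc_def)
 ultimately show ?thesis by (auto simp: bx_def)
qed

lemma expectation_JJ:
 assumes xy: "x : X" "y : X"
 shows "integrable M (%om. JJ (Sc (pos (res V om))) x y)" "EE (%f. JJ (Sc (pos f)) x y) = PP (%f. hS (Sc (pos f)) f x) (%f. hS (Sc (pos f)) f y)"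
 "integrable M (%om. JJ (Sc (neg (res V om))) x y)" "EE (%f. JJ (Sc (neg f)) x y) = PP (%f. hS (Sc (neg f)) f x) (%f. hS (Sc (neg f)) f y)"
 "integrable M (%om. JJ (Sc (pos (res V om)) Un Sc (neg (res V om))) x y)"
 "EE (%f. JJ (Sc (pos f) Un Sc (neg f)) x y) = PP (%f. hS (Sc (pos f) Un Sc (neg f)) f x) (%f. hS (Sc (pos f) Un Sc (neg f)) f y)"
 using Lp.stopped_covariance[OF xy] Lp.integrable_kgT[OF xy] Ln.stopped_covariance[OF xy] Ln.integrable_kgT[OF xy]
 Lb.stopped_covariance[OF xy] Lb.integrable_kgT[OF xy]
 by (simp_all add: JJ_def PP_def hT_eq' prob_space)

text \<open>Three stopped covariances express E K2 by the extensions from the positive, the negative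
  and both explorations. Moreover \<open>ax\<close> is determined by the positive exploration alone,
  so its product with the field at another vertex may be stopped there or at both explorations;
  equating the results, and likewise for \<open>bx\<close>, gives four relations that eliminate
  every product with \<open>bx\<close>.\<close>

lemma two_arm_identity:
 assumes x: "x : V" and y: "y : V"
 shows "PP (ax x) (%f. U f y) + PP (ax y) (%f. U f x) =
 PP (%f. U f x) (%f. U f y) + PP (%f. U (%v. - f v) x) (%f. U (%v. - f v) y) - EE (K2 x y)
 - PP (ax x) (ex y) - PP (ax y) (ex x) - PP (ex x) (ex y)"
proof -
 have xX: "x : X" "y : X" using x y V by auto
 let ?u = "%x f. U f x" and ?u' = "%x f. U (%v. - f v) x"
 note L = L2_ax[OF x] L2_ax[OF y] L2_bx[OF x] L2_bx[OF y] L2_ex[OF x] L2_ex[OF y]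
 L2_U[OF x] L2_U[OF y] L2_U'[OF x] L2_U'[OF y]
 have hp: "(%f. hS (Sc (pos f)) f w) = (%f. ax w f - ?u w f)" if "w : V" for w using hS_pos[OF that] by (simp add: fun_eq_iff)
 have hn: "(%f. hS (Sc (neg f)) f w) = (%f. bx w f + ?u' w f)" if "w : V" for w using hS_neg[OF that] by (simp add: fun_eq_iff)
 have hb: "(%f. hS (Sc (pos f) Un Sc (neg f)) f w) = (%f. ax w f + bx w f + ex w f)" for w by (simp add: hS_both fun_eq_iff)
 have Lab: "L2 (%f. ax w f + bx w f)" "L2 (%f. ax w f + bx w f + ex w f)" "L2 (%f. ax w f - ?u w f)" "L2 (%f. bx w f + ?u' w f)" if "w : V" for w
 by (rule L2_add[OF L2_ax[OF that] L2_bx[OF that]], rule L2_add[OF L2_add[OF L2_ax[OF that] L2_bx[OF that]] L2_ex[OF that]],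
 rule L2_diff[OF L2_ax[OF that] L2_U[OF that]], rule L2_add[OF L2_bx[OF that] L2_U'[OF that]])
 note L' = L Lab[OF x] Lab[OF y]
 have K: "EE (K2 x y) = PP (%f. ax x f - ?u x f) (%f. ax y f - ?u y f) + PP (%f. bx x f + ?u' x f) (%f. bx y f + ?u' y f)
 - PP (%f. ax x f + bx x f + ex x f) (%f. ax y f + bx y f + ex y f)"
 proof -
 have "EE (K2 x y) = EE (%f. JJ (Sc (pos f)) x y) + EE (%f. JJ (Sc (neg f)) x y) - EE (%f. JJ (Sc (pos f) Un Sc (neg f)) x y)"
 unfolding K2_def using expectation_JJ(1,3,5)[OF xX] by simp
 then show ?thesis
 unfolding expectation_JJ(2,4,6)[OF xX] hp[OF x] hp[OF y] hn[OF x] hn[OF y] hb .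
 qed
 have A: "PP (ax w) (%f. ax v f - ?u v f) = PP (ax w) (%f. ax v f + bx v f + ex v f)" if w: "w : V" and v: "v : V" for w v
 proof -
 have vX: "v : X" using v V by auto
 have m: "ax w : borel_measurable (PiM V (%_. borel))" "integrable M (%om. (ax w (res V om))\<^sup>2)"
 using L2_ax[OF w] by (auto simp: L2_def)
 have "expectation (%om. ax w (res V om) * \<phi> v om) = expectation (%om. ax w (res V om) * Lp.hT (res V om) v)"
 proof (rule Lp.stopped_mean[OF m(1) _ m(2) vX])
 fix f f' :: "'a => real" assume "!!v. v : Sc (pos f) ==> f v = f' v"
 then show "ax w f' = ax w f" by (rule ax_local[OF _ subset_refl])
 qed
 moreover have "expectation (%om. ax w (res V om) * \<phi> v om) = expectation (%om. ax w (res V om) * Lb.hT (res V om) v)"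
 proof (rule Lb.stopped_mean[OF m(1) _ m(2) vX])
 fix f f' :: "'a => real" assume "!!v. v : Sc (pos f) Un Sc (neg f) ==> f v = f' v"
 then show "ax w f' = ax w f" by (rule ax_local[OF _ Un_upper1])
 qed
 ultimately show ?thesis unfolding PP_def hT_eq' by (simp add: hS_pos[OF v] hS_both)
 qed
 have B: "PP (bx w) (%f. bx v f + ?u' v f) = PP (bx w) (%f. ax v f + bx v f + ex v f)" if w: "w : V" and v: "v : V" for w v
 proof -
 have vX: "v : X" using v V by auto
 have m: "bx w : borel_measurable (PiM V (%_. borel))" "integrable M (%om. (bx w (res V om))\<^sup>2)"
 using L2_bx[OF w] by (auto simp: L2_def)
 have "expectation (%om. bx w (res V om) * \<phi> v om) = expectation (%om. bx w (res V om) * Ln.hT (res V om) v)"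
 proof (rule Ln.stopped_mean[OF m(1) _ m(2) vX])
 fix f f' :: "'a => real" assume "!!v. v : Sc (neg f) ==> f v = f' v"
 then show "bx w f' = bx w f" by (rule bx_local[OF _ subset_refl])
 qed
 moreover have "expectation (%om. bx w (res V om) * \<phi> v om) = expectation (%om. bx w (res V om) * Lb.hT (res V om) v)"
 proof (rule Lb.stopped_mean[OF m(1) _ m(2) vX])
 fix f f' :: "'a => real" assume "!!v. v : Sc (pos f) Un Sc (neg f) ==> f v = f' v"
 then show "bx w f' = bx w f" by (rule bx_local[OF _ Un_upper2])
 qed
 ultimately show ?thesis unfolding PP_def hT_eq' by (simp add: hS_neg[OF v] hS_both)
 qed
 have A1: "PP (ax x) (ax y) - PP (ax x) (?u y) = PP (ax x) (ax y) + PP (ax x) (bx y) + PP (ax x) (ex y)"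
 using A[OF x y] unfolding PP_diff2[OF L(2) L(8) L(1)] PP_add2[OF Lab(1)[OF y] L(6) L(1)] PP_add2[OF L(2) L(4) L(1)] .
 have A2: "PP (ax y) (ax x) - PP (ax y) (?u x) = PP (ax y) (ax x) + PP (ax y) (bx x) + PP (ax y) (ex x)"
 using A[OF y x] unfolding PP_diff2[OF L(1) L(7) L(2)] PP_add2[OF Lab(1)[OF x] L(5) L(2)] PP_add2[OF L(1) L(3) L(2)] .
 have B1: "PP (bx x) (bx y) + PP (bx x) (?u' y) = PP (bx x) (ax y) + PP (bx x) (bx y) + PP (bx x) (ex y)"
 using B[OF x y] unfolding PP_add2[OF L(4) L(10) L(3)] PP_add2[OF Lab(1)[OF y] L(6) L(3)] PP_add2[OF L(2) L(4) L(3)] .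
 have B2: "PP (bx y) (bx x) + PP (bx y) (?u' x) = PP (bx y) (ax x) + PP (bx y) (bx x) + PP (bx y) (ex x)"
 using B[OF y x] unfolding PP_add2[OF L(3) L(9) L(4)] PP_add2[OF Lab(1)[OF x] L(5) L(4)] PP_add2[OF L(1) L(3) L(4)] .
 have K1: "PP (%f. ax x f - ?u x f) (%f. ax y f - ?u y f) = PP (ax x) (ax y) - PP (ax x) (?u y) - (PP (?u x) (ax y) - PP (?u x) (?u y))"
 by (simp only: PP_diff[OF L(1) L(7) Lab(3)[OF y]] PP_diff2[OF L(2) L(8) L(1)] PP_diff2[OF L(2) L(8) L(7)])
 have K2: "PP (%f. bx x f + ?u' x f) (%f. bx y f + ?u' y f) = PP (bx x) (bx y) + PP (bx x) (?u' y) + (PP (?u' x) (bx y) + PP (?u' x) (?u' y))"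
 by (simp only: PP_add[OF L(3) L(9) Lab(4)[OF y]] PP_add2[OF L(4) L(10) L(3)] PP_add2[OF L(4) L(10) L(9)])
 have K3: "PP (%f. ax x f + bx x f + ex x f) (%f. ax y f + bx y f + ex y f) =
 (PP (ax x) (ax y) + PP (ax x) (bx y) + PP (ax x) (ex y)) + (PP (bx x) (ax y) + PP (bx x) (bx y) + PP (bx x) (ex y))
 + (PP (ex x) (ax y) + PP (ex x) (bx y) + PP (ex x) (ex y))"
 by (simp only: PP_add[OF Lab(1)[OF x] L(5) Lab(2)[OF y]] PP_add[OF L(1) L(3) Lab(2)[OF y]]
 PP_add2[OF Lab(1)[OF y] L(6) L(1)] PP_add2[OF L(2) L(4) L(1)] PP_add2[OF Lab(1)[OF y] L(6) L(3)] PP_add2[OF L(2) L(4) L(3)]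
 PP_add2[OF Lab(1)[OF y] L(6) L(5)] PP_add2[OF L(2) L(4) L(5)])
 show ?thesis
 using K K1 K2 K3 A1 A2 B1 B2 PP_sym[of "?u x" "ax y"] PP_sym[of "?u' x" "bx y"] PP_sym[of "bx x" "ax y"]
 PP_sym[of "ex x" "ax y"] PP_sym[of "ex x" "bx y"] PP_sym[of "bx y" "bx x"] PP_sym[of "bx y" "ax x"] PP_sym[of "ax y" "ax x"]
 by linarith
qed

lemma L2_sq_coord: "v : V ==> L2 (%f. (f v)\<^sup>2)"
 unfolding L2_def using measurable_coord[of v] integrable_phi_power[of v 4] V by (auto simp: res_def power_mult[symmetric])

lemma L2_ax_sq: "x : V ==> L2 (%f. (ax x f)\<^sup>2)"
proof (rule L2_bound[OF _ _ L2_sq_coord])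
 assume x: "x : V"
 show "(%f. (ax x f)\<^sup>2) : borel_measurable (PiM V (%_. borel))"
 by (rule borel_measurable_power) (use L2_ax[OF x] in \<open>simp add: L2_def\<close>)
 show "\<bar>(ax x f)\<^sup>2\<bar> <= \<bar>(f x)\<^sup>2\<bar>" for f by (simp add: ax_def)
qed

text \<open>Truncation at level R: \<open>ax\<close> is at most R times the cluster indicator plus
  ax^2 / R. The second part decouples by FKG, since ax^2 is increasing and \<open>U2\<close>
  decreasing in the field.\<close>

lemma ax_U2_bound:
 assumes x: "x : V" and y: "y : V" and R: "R > 0"
 shows "PP (ax x) (%f. U2 f y) <= R * EE (%f. (if x : cl (pos f) then 1 else 0) * U2 f y) + EE (%f. (ax x f)\<^sup>2) * TT y / R"
proof -
 have yX: "y : X" using y V by auto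
 have Li: "L2 (%f. (if x : cl (pos f) then 1 else 0) * U2 f y)"
 by (rule L2_pattern[OF L2_U2[OF y], of "%A B. x : cl A"])
 have i: "integrable M (%om. (ax x (res V om))\<^sup>2 * U2 (res V om) y)"
 using L2_mult[OF L2_ax_sq[OF x] L2_U2[OF y]] .
 have "PP (ax x) (%f. U2 f y) <= EE (%f. R * ((if x : cl (pos f) then 1 else 0) * U2 f y) + (1 / R) * ((ax x f)\<^sup>2 * U2 f y))"
 unfolding PP_def
 proof (rule integral_mono)
 show "integrable M (%om. ax x (res V om) * U2 (res V om) y)" using L2_mult[OF L2_ax[OF x] L2_U2[OF y]] .
 show "integrable M (%om. R * ((if x : cl (pos (res V om)) then 1 else 0) * U2 (res V om) y) + (1 / R) * ((ax x (res V om))\<^sup>2 * U2 (res V om) y))"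
 using L2_integrable[OF Li] i by simp
 fix om
 let ?f = "res V om"
 have "ax x ?f <= R * (if x : cl (pos ?f) then 1 else 0) + (ax x ?f)\<^sup>2 / R"
 proof (cases "x : cl (pos ?f)")
 case True
 have "0 <= (ax x ?f - R)\<^sup>2" by simp
 then have "2 * ax x ?f * R <= (ax x ?f)\<^sup>2 + R * R" by (simp add: power2_eq_square algebra_simps)
 moreover have "0 <= ax x ?f * R" using ax_nonneg R by simp
 ultimately have "ax x ?f * R <= (ax x ?f)\<^sup>2 + R * R" by linarith
 then show ?thesis using True R by (simp add: field_simps power2_eq_square)
 qed (simp add: ax_def)
 from mult_right_mono[OF this U2_nonneg[OF yX, of ?f]]
 show "ax x ?f * U2 ?f y <= R * ((if x : cl (pos ?f) then 1 else 0) * U2 ?f y) + (1 / R) * ((ax x ?f)\<^sup>2 * U2 ?f y)"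
 by (simp add: distrib_right mult.assoc)
 qed
 also have "... = R * EE (%f. (if x : cl (pos f) then 1 else 0) * U2 f y) + (1 / R) * EE (%f. (ax x f)\<^sup>2 * U2 f y)"
 using L2_integrable[OF Li] i by simp
 also have "EE (%f. (ax x f)\<^sup>2 * U2 f y) <= EE (%f. (ax x f)\<^sup>2) * TT y"
 unfolding TT_def
 proof (rule FKG_opp[OF L2_ax_sq[OF x] _ L2_U2[OF y] mono_U2[OF yX]])
 show "mono_fun (%f. (ax x f)\<^sup>2)"
 unfolding mono_fun_def
 proof (intro allI impI)
 fix f f' :: "'a => real" assume "\<forall>v\<in>V. f v <= f' v"
 then have "ax x f <= ax x f'" using mono_ax[OF x] unfolding mono_fun_def by blast
 then show "(ax x f)\<^sup>2 <= (ax x f')\<^sup>2" using ax_nonneg by (intro power_mono)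
 qed
 qed
 finally show ?thesis using R by (simp add: mult_left_mono divide_right_mono)
qed

text \<open>Weighted forms of 2ab <= a^2 + b^2, with weight chosen so that both resulting terms are
  of order ep.\<close>

lemma osc_L1:
 assumes e: "ep > 0" "EE (%f. (osc f)\<^sup>2) <= ep\<^sup>2"
 shows "EE osc <= ep" "L2 F ==> EE (%f. osc f * \<bar>F f\<bar>) <= ep * (1 + EE (%f. (F f)\<^sup>2))"
proof -
 have i: "integrable M (%om. (osc (res V om))\<^sup>2)" using L2_osc by (simp add: L2_def)
 show main: "EE (%f. osc f * \<bar>F f\<bar>) <= ep * (1 + EE (%f. (F f)\<^sup>2))" if F: "L2 F" for F
 proof -
 have iF: "integrable M (%om. (F (res V om))\<^sup>2)" using F by (simp add: L2_def)
 have "EE (%f. osc f * \<bar>F f\<bar>) <= EE (%f. (osc f)\<^sup>2 / ep + ep * (F f)\<^sup>2)"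
 proof (rule integral_mono)
 show "integrable M (%om. osc (res V om) * \<bar>F (res V om)\<bar>)" using L2_mult[OF L2_osc L2_abs[OF F]] .
 show "integrable M (%om. (osc (res V om))\<^sup>2 / ep + ep * (F (res V om))\<^sup>2)" using i iF by simp
 fix om
 let ?o = "osc (res V om)" and ?F = "\<bar>F (res V om)\<bar>"
 have "0 <= (?o - ep * ?F)\<^sup>2" by simp
 then have "2 * (?o * ?F) * ep <= ?o\<^sup>2 + (ep * ?F)\<^sup>2" by (simp add: power2_diff algebra_simps)
 moreover have "0 <= (?o * ?F) * ep" using osc_nonneg e by simp
 ultimately have "(?o * ?F) * ep <= ?o\<^sup>2 + (ep * ?F)\<^sup>2" by linarith
 then show "?o * ?F <= ?o\<^sup>2 / ep + ep * (F (res V om))\<^sup>2" using e(1) by (simp add: field_simps power2_eq_square)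
 qed
 also have "... = EE (%f. (osc f)\<^sup>2) / ep + ep * EE (%f. (F f)\<^sup>2)" using i iF by simp
 also have "EE (%f. (osc f)\<^sup>2) / ep <= ep" using e by (simp add: field_simps power2_eq_square)
 finally show ?thesis by (simp add: algebra_simps)
 qed
 have "EE osc <= EE (%f. ((osc f)\<^sup>2 / ep + ep) / 2)"
 proof (rule integral_mono[OF L2_integrable[OF L2_osc]])
 show "integrable M (%om. ((osc (res V om))\<^sup>2 / ep + ep) / 2)" using i by simp
 fix om
 let ?o = "osc (res V om)"
 have "0 <= (?o - ep)\<^sup>2" by simp
 then show "?o <= (?o\<^sup>2 / ep + ep) / 2" using e(1) by (simp add: field_simps power2_eq_square)
 qed
 also have "... = (EE (%f. (osc f)\<^sup>2) / ep + ep) / 2" using i by (simp add: prob_space)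
 also have "... <= ep" using e by (simp add: field_simps power2_eq_square)
 finally show "EE osc <= ep" .
qed

lemma EE_coord_sq: "x : V ==> EE (%f. (f x)\<^sup>2) = g x x"
 using expectation_phi2(1)[of x x] V by (auto simp: res_def power2_eq_square)

text \<open>FKG for two decreasing functions bounds T(x) T(y) by E[U2 U2] <= E[U U]. The identity
  then applies; the analogous product for the negated field is nonnegative and is dropped, and every
  product with \<open>ex\<close> is an \<open>osc\<close> error.\<close>

lemma two_arm_lower:
 assumes x: "x : V" and y: "y : V" and e: "ep > 0" "EE (%f. (osc f)\<^sup>2) <= ep\<^sup>2"
 shows "TT x * TT y <= PP (ax x) (%f. U2 f y) + PP (ax y) (%f. U2 f x) + EE (K2 x y) + 2 * ep * (2 + g x x + g y y) + ep\<^sup>2"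
proof -
 have xX: "x : X" "y : X" using x y V by auto
 have uu: "TT x * TT y <= PP (%f. U f x) (%f. U f y)"
 proof -
 have "TT x * TT y <= PP (%f. U2 f x) (%f. U2 f y)" unfolding TT_def PP_def
 by (rule FKG_anti[OF L2_U2[OF x] mono_U2[OF xX(1)] L2_U2[OF y] mono_U2[OF xX(2)]])
 also have "... <= PP (%f. U f x) (%f. U f y)" unfolding PP_def
 proof (rule integral_mono[OF L2_mult[OF L2_U2[OF x] L2_U2[OF y]] L2_mult[OF L2_U[OF x] L2_U[OF y]]])
 show "U2 (res V om) x * U2 (res V om) y <= U (res V om) x * U (res V om) y" for om
 using U_U2(1)[OF x] U_U2(1)[OF y] U2_nonneg xX U_nonneg[OF x] by (intro mult_mono) auto
 qed
 finally show ?thesis .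
 qed
 have u'u': "0 <= PP (%f. U (%v. - f v) x) (%f. U (%v. - f v) y)"
 unfolding PP_def using U_nonneg x y by (intro Bochner_Integration.integral_nonneg) simp
 have fx: "\<bar>ax w f\<bar> <= \<bar>f w\<bar>" for w f by (simp add: ax_def)
 have oa: "EE (%f. osc f * \<bar>f w\<bar>) <= ep * (1 + g w w)" if w: "w : V" for w
 using osc_L1(2)[OF e L2_coord[OF w]] EE_coord_sq[OF w] by simp
 have ae: "\<bar>PP (ax w) (ex v)\<bar> <= ep * (1 + g w w)" if w: "w : V" and v: "v : V" for w v
 proof -
 have "\<bar>PP (ax w) (ex v)\<bar> <= EE (%f. \<bar>ax w f * ex v f\<bar>)" unfolding PP_def by (rule integral_abs_bound)
 also have "... <= EE (%f. osc f * \<bar>f w\<bar>)"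
 proof (rule integral_mono)
 show "integrable M (%om. \<bar>ax w (res V om) * ex v (res V om)\<bar>)" using L2_mult[OF L2_ax[OF w] L2_ex[OF v]] by simp
 show "integrable M (%om. osc (res V om) * \<bar>res V om w\<bar>)" using L2_mult[OF L2_osc L2_abs[OF L2_coord[OF w]]] .
 show "\<bar>ax w (res V om) * ex v (res V om)\<bar> <= osc (res V om) * \<bar>res V om w\<bar>" for om
 unfolding abs_mult mult.commute[of "osc _"] using fx ex_bound[OF v] by (intro mult_mono) auto
 qed
 finally show ?thesis using oa[OF w] by linarith
 qed
 have aU: "PP (ax w) (%f. U f v) <= PP (ax w) (%f. U2 f v) + ep * (1 + g w w)" if w: "w : V" and v: "v : V" for w v
 proof -
 have "PP (ax w) (%f. U f v) <= EE (%f. ax w f * U2 f v + osc f * \<bar>f w\<bar>)" unfolding PP_def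
 proof (rule integral_mono[OF L2_mult[OF L2_ax[OF w] L2_U[OF v]]])
 show "integrable M (%om. ax w (res V om) * U2 (res V om) v + osc (res V om) * \<bar>res V om w\<bar>)"
 using L2_mult[OF L2_osc L2_abs[OF L2_coord[OF w]]] L2_mult[OF L2_ax[OF w] L2_U2[OF v]] by simp
 fix om
 let ?f = "res V om"
 have "ax w ?f * U ?f v <= ax w ?f * (U2 ?f v + osc ?f)" using U_U2(2)[OF v] ax_nonneg by (intro mult_left_mono) auto
 also have "... <= ax w ?f * U2 ?f v + osc ?f * \<bar>?f w\<bar>"
 using fx[of w ?f] ax_nonneg[of w ?f] osc_nonneg[of ?f] mult_right_mono[of "ax w ?f" "\<bar>?f w\<bar>" "osc ?f"] by (simp add: distrib_left mult.commute)
 finally show "ax w ?f * U ?f v <= ax w ?f * U2 ?f v + osc ?f * \<bar>?f w\<bar>" .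
 qed
 also have "... = PP (ax w) (%f. U2 f v) + EE (%f. osc f * \<bar>f w\<bar>)" unfolding PP_def
 using L2_mult[OF L2_osc L2_abs[OF L2_coord[OF w]]] L2_mult[OF L2_ax[OF w] L2_U2[OF v]] by simp
 finally show ?thesis using oa[OF w] by linarith
 qed
 have ee: "\<bar>PP (ex x) (ex y)\<bar> <= ep\<^sup>2"
 proof -
 have "\<bar>PP (ex x) (ex y)\<bar> <= EE (%f. \<bar>ex x f * ex y f\<bar>)" unfolding PP_def by (rule integral_abs_bound)
 also have "... <= EE (%f. (osc f)\<^sup>2)"
 proof (rule integral_mono)
 show "integrable M (%om. \<bar>ex x (res V om) * ex y (res V om)\<bar>)" using L2_mult[OF L2_ex[OF x] L2_ex[OF y]] by simp
 show "integrable M (%om. (osc (res V om))\<^sup>2)" using L2_osc by (simp add: L2_def)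
 show "\<bar>ex x (res V om) * ex y (res V om)\<bar> <= (osc (res V om))\<^sup>2" for om
 unfolding abs_mult power2_eq_square using ex_bound[OF x] ex_bound[OF y] osc_nonneg by (intro mult_mono) auto
 qed
 finally show ?thesis using e by linarith
 qed
 show ?thesis
 using two_arm_identity[OF x y] uu u'u' ae[OF x y] ae[OF y x] ee aU[OF x y] aU[OF y x]
 by (simp add: algebra_simps abs_le_iff)
qed

lemma symmetric_event: "EE (%f. if Q (neg f) then 1 else 0) = EE (%f. if Q (pos f) then 1 else 0)"
proof -
 have "neg (res V om) = pos (\<lambda>v\<in>V. - \<phi> v om)" for om by (auto simp: neg_def pos_def res_def)
 then have "EE (%f. if Q (neg f) then 1 else 0) = expectation (%om. if Q (pos (\<lambda>v\<in>V. - \<phi> v om)) then 1 else 0)" by simp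
 also have "... = EE (%f. if Q (pos f) then 1 else 0)"
 by (rule symmetric_law[OF V V_ne, of "%f. if Q (pos f) then 1 else 0"]) (rule measurable_patterns[of "%A B. if Q A then 1 else 0"])
 finally show ?thesis .
qed

lemma mono_hit: "mono_fun (%f. if Sc (pos f) Int A ~= {} then 1 else 0)"
 unfolding mono_fun_def
proof (intro allI impI)
 fix f f' :: "'a => real" assume "\<forall>v\<in>V. f v <= f' v"
 then have "Sc (pos f) <= Sc (pos f')" by (intro Sc_mono pos_mono) auto
 then show "(if Sc (pos f) Int A ~= {} then 1 else 0) <= (if Sc (pos f') Int A ~= {} then 1 else (0::real))" by auto
qed

text \<open>The first event is increasing and the second decreasing in the field; the sign symmetry
  then expresses the probability of the second through the positive exploration.\<close>

lemma hit_negative_correlation: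
 "EE (%f. (if Sc (pos f) Int A ~= {} then 1 else 0) * (if Sc (neg f) Int B ~= {} then 1 else 0)) <=
 EE (%f. if Sc (pos f) Int A ~= {} then 1 else 0) * EE (%f. if Sc (pos f) Int B ~= {} then 1 else 0)"
proof -
 have m: "mono_fun (%f. - (if Sc (neg f) Int B ~= {} then 1 else 0))"
 unfolding mono_fun_def
 proof (intro allI impI)
 fix f f' :: "'a => real" assume "\<forall>v\<in>V. f v <= f' v"
 then have "Sc (neg f') <= Sc (neg f)" by (intro Sc_mono neg_antimono) auto
 then show "- (if Sc (neg f) Int B ~= {} then 1 else 0) <= - (if Sc (neg f') Int B ~= {} then 1 else (0::real))" by auto
 qed
 have "EE (%f. (if Sc (pos f) Int A ~= {} then 1 else 0) * (if Sc (neg f) Int B ~= {} then 1 else 0)) <=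
 EE (%f. if Sc (pos f) Int A ~= {} then 1 else 0) * EE (%f. if Sc (neg f) Int B ~= {} then 1 else 0)"
 by (rule FKG_opp[OF L2_event[of "%P Q. Sc P Int A ~= {}"] mono_hit L2_event[of "%P Q. Sc Q Int B ~= {}"] m])
 then show ?thesis using symmetric_event[of "%P. Sc P Int B ~= {}"] by simp
qed

lemma all_negative:
 assumes B: "finite B" "B <= V" "!!w. w : B ==> g w w > 0"
 shows "measure std_normal {..<0} ^ card B <= EE (%f. if B Int pos f = {} then 1 else 0)"
 using B
proof (induction B rule: finite_induct)
 case empty
 then show ?case by (simp add: prob_space)
next
 case (insert w B)
 let ?c = "measure std_normal {..<0::real}"
 have w: "w : V" "g w w > 0" using insert by auto
 have anti: "mono_fun (%f. - (if A Int pos f = {} then 1 else 0))" for A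
 unfolding mono_fun_def
 proof (intro allI impI)
 fix f f' :: "'a => real" assume "\<forall>v\<in>V. f v <= f' v"
 then have "pos f <= pos f'" by (intro pos_mono) auto
 then show "- (if A Int pos f = {} then 1 else 0) <= - (if A Int pos f' = {} then 1 else (0::real))" by auto
 qed
 have single: "EE (%f. if {w} Int pos f = {} then 1 else 0) = ?c"
 proof -
 have wX: "{w} <= X" using w V by auto
 have l: "lin {w} (%_. 1) = \<phi> w" by (simp add: lin_def fun_eq_iff)
 have c: "cov {w} (%_. 1) (%_. 1) = g w w" by (simp add: cov_def)
 have "EE (%f. if {w} Int pos f = {} then 1 else 0) = expectation (%om. indicat_real {..<0} (\<phi> w om))"
 using w by (intro Bochner_Integration.integral_cong) (auto simp: pos_def res_def)
 also have "... = (\<integral>z. indicat_real {..<0} (sqrt (g w w) * z) \<partial>std_normal)"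
 using expectation_lin(2)[OF _ wX, of "indicat_real {..<0}" "%_. 1"] by (simp add: l c)
 also have "... = (\<integral>z. indicat_real {..<0} z \<partial>std_normal)"
 using w by (intro Bochner_Integration.integral_cong) (auto simp: indicator_def mult_less_0_iff)
 also have "... = ?c" by simp
 finally show ?thesis .
 qed
 have "?c ^ card (insert w B) = ?c * ?c ^ card B" using insert.hyps by simp
 also have "... <= ?c * EE (%f. if B Int pos f = {} then 1 else 0)" using insert by (intro mult_left_mono) auto
 also have "... = EE (%f. if {w} Int pos f = {} then 1 else 0) * EE (%f. if B Int pos f = {} then 1 else 0)" by (simp only: single)
 also have "... <= EE (%f. (if {w} Int pos f = {} then 1 else 0) * (if B Int pos f = {} then 1 else 0))"
 by (rule FKG_anti[OF L2_event[of "%P Q. {w} Int P = {}"] anti L2_event[of "%P Q. B Int P = {}"] anti])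
 also have "(%f. (if {w} Int pos f = {} then 1 else 0) * (if B Int pos f = {} then 1 else 0)) = (%f. if insert w B Int pos f = {} then 1 else (0::real))"
 by (auto simp: fun_eq_iff)
 finally show ?case .
qed

end

section \<open>Mesh points of the metric graph\<close>

lemma axis_nth_if [simp]: "axis i s $ j = (if j = i then s else (0::real))"
 by (simp add: axis_def)

lemma norm_axis_real: "norm (axis i s :: real^'n) = \<bar>s\<bar>"
proof -
 have "axis i s = s *\<^sub>R (axis i 1 :: real^'n)" by (simp add: vec_eq_iff)
 then show ?thesis by simp
qed

lemma Ints_abs_less_1_eq: "a : \<int> ==> b : \<int> ==> \<bar>a - b\<bar> < 1 ==> a = (b::real)"
 by (auto elim!: Ints_cases)

lemma not_Ints_between: "a : \<int> ==> 0 < s ==> s < 1 ==> a + s ~: (\<int>::real set)"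
proof
 assume a: "a : \<int>" "0 < s" "s < 1" "a + s : \<int>"
 then have "a + s = a" by (intro Ints_abs_less_1_eq) auto
 then show False using a by simp
qed

lemma linf_less_iff: "linf x < r \<longleftrightarrow> (ALL j. \<bar>x $ j\<bar> < r)" and linf_le_iff: "linf x <= r \<longleftrightarrow> (ALL j. \<bar>x $ j\<bar> <= r)"
 by (auto simp: linf_def)

lemma latt_axis: "x : latt ==> s : \<int> ==> x + axis i s : latt" "x : latt ==> s : \<int> ==> x - axis i s : latt"
 by (auto simp: latt_def)

lemma edge_in_mgraph: "x : latt ==> x + axis i s : mgraph" "x : latt ==> x - axis i s : mgraph"
 by (auto simp: latt_def mgraph_def)

lemma mgraph_cases:
 assumes "v : mgraph"
 obtains x i s where "x : latt" "0 <= s" "s < 1" "v = x + axis i s"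
proof -
 obtain i where i: "!!j. j ~= i ==> v $ j : \<int>" using assms by (auto simp: mgraph_def)
 show ?thesis
 proof (rule that)
 show "(\<chi> j. real_of_int \<lfloor>v $ j\<rfloor>) : latt" by (simp add: latt_def)
 show "0 <= frac (v $ i)" "frac (v $ i) < 1" by (auto simp: frac_lt_1)
 have "v $ j = ((\<chi> j. real_of_int \<lfloor>v $ j\<rfloor>) + axis i (frac (v $ i))) $ j" for j
 proof (cases "j = i")
 case True
 then show ?thesis by (simp add: frac_def)
 next
 case False
 then obtain a where "v $ j = of_int a" using i[of j] by (auto elim: Ints_cases)
 then show ?thesis using False by simp
 qed
 then show "v = (\<chi> j. real_of_int \<lfloor>v $ j\<rfloor>) + axis i (frac (v $ i))"
 unfolding vec_eq_iff by blast
 qed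
qed

text \<open>At s = 0 or s = 1 one endpoint drops out of \<open>near_latt\<close>, but its weight is
  then 0, so the formula holds on closed edges.\<close>

lemma interp_axis:
 fixes x :: "real^'n"
 assumes x: "x : latt" and s: "0 <= s" "s <= 1"
 shows "(\<Sum>z\<in>near_latt (x + axis i s). interp_wt (x + axis i s) z * F z) = (1 - s) * F x + s * F (x + axis i 1)"
proof -
 let ?u = "x + axis i s" and ?y = "x + axis i 1"
 have y: "?y : latt" using x by (intro latt_axis) auto
 have sub: "near_latt ?u <= {x, ?y}"
 proof
 fix z assume "z : near_latt ?u"
 then have z: "z : latt" "!!j. \<bar>z $ j - ?u $ j\<bar> < 1" by (auto simp: near_latt_def linf_less_iff)
 have zj: "z $ j = x $ j" if "j ~= i" for j
 using z(2)[of j] z(1) x that by (intro Ints_abs_less_1_eq) (auto simp: latt_def)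
 have "z $ i = x $ i | z $ i = x $ i + 1"
 proof -
 have "z $ i : \<int>" "x $ i : \<int>" using z(1) x by (simp_all add: latt_def)
 then obtain a b where "z $ i = of_int a" "x $ i = of_int b" by (elim Ints_cases)
 moreover from this have "a = b | a = b + 1" using z(2)[of i] s by simp linarith
 ultimately show ?thesis by auto
 qed
 then have "z = x | z = ?y"
 proof
 assume "z $ i = x $ i"
 then have "z $ j = x $ j" for j using zj[of j] by (cases "j = i") auto
 then show ?thesis by (simp add: vec_eq_iff)
 next
 assume "z $ i = x $ i + 1"
 then have "z $ j = ?y $ j" for j using zj[of j] by (cases "j = i") auto
 then have "z = ?y" unfolding vec_eq_iff by blast
 then show ?thesis by simp
 qed
 then show "z : {x, ?y}" by simp
 qed
 have w1: "interp_wt ?u x = 1 - s"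
 proof -
 have "interp_wt ?u x = (\<Prod>j\<in>UNIV. if j = i then 1 - s else 1)" unfolding interp_wt_def using s by (intro prod.cong) auto
 then show ?thesis by simp
 qed
 have w2: "interp_wt ?u ?y = s"
 proof -
 have "interp_wt ?u ?y = (\<Prod>j\<in>UNIV. if j = i then s else 1)" unfolding interp_wt_def using s by (intro prod.cong) auto
 then show ?thesis by simp
 qed
 have "(\<Sum>z\<in>near_latt ?u. interp_wt ?u z * F z) = (\<Sum>z\<in>{x, ?y}. interp_wt ?u z * F z)"
 proof (rule sum.mono_neutral_left)
 show "\<forall>z\<in>{x, ?y} - near_latt ?u. interp_wt ?u z * F z = 0"
 proof
 fix z assume z: "z : {x, ?y} - near_latt ?u"
 then have "~ linf (z - ?u) < 1" using x y by (auto simp: near_latt_def)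
 then obtain j where "\<bar>z $ j - ?u $ j\<bar> >= 1" by (auto simp: linf_less_iff not_less)
 then have "max 0 (1 - \<bar>?u $ j - z $ j\<bar>) = 0" by (simp only: abs_minus_commute[of "z $ j"] max_absorb1 diff_le_0_iff_le)
 then have "interp_wt ?u z = 0" unfolding interp_wt_def by (intro prod_zero bexI[of _ j]) auto
 then show "interp_wt ?u z * F z = 0" by simp
 qed
 qed (use sub in auto)
 also have "... = (1 - s) * F x + s * F ?y"
 proof -
 have "x ~= ?y" by (auto simp: vec_eq_iff)
 then show ?thesis by (simp add: w1 w2)
 qed
 finally show ?thesis .
qed

lemma bridge_latt: "u : latt ==> bridge_cov u v = 0" "v : latt ==> bridge_cov u v = 0"
 by (auto simp: bridge_cov_def same_edge_def latt_def)

lemma bridge_axis: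
 fixes x :: "real^'n"
 assumes x: "x : latt" and y: "y : latt" and s: "0 <= s" "s <= 1" and t: "0 <= t" "t <= 1"
 shows "bridge_cov (x + axis i s) (y + axis j t) = (if x = y & i = j then 2 * real CARD('n) * min s t * (1 - max s t) else 0)"
proof (cases "s : \<int> | t : \<int>")
 case True
 have "s = 0 | s = 1" if "s : \<int>" using that s by (auto elim!: Ints_cases)
 moreover have "t = 0 | t = 1" if "t : \<int>" using that t by (auto elim!: Ints_cases)
 ultimately have "min s t * (1 - max s t) = 0" using True s t by (auto simp: min_def max_def)
 then show ?thesis using True bridge_latt latt_axis[OF x, of s i] latt_axis[OF y, of t j] by (auto simp: mult.assoc)
next
 case False
 then have s': "0 < s" "s < 1" and t': "0 < t" "t < 1" using s t by (auto simp: less_le)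
 have xi: "x $ k : \<int>" "y $ k : \<int>" for k using x y by (auto simp: latt_def)
 have ns: "x $ k + s ~: \<int>" "y $ k + t ~: \<int>" for k using not_Ints_between xi s' t' by auto
 have fl: "\<lfloor>x $ k + s\<rfloor> = x $ k" "\<lfloor>y $ k + t\<rfloor> = y $ k" for k
 using xi[of k] s' t' by (auto elim!: Ints_cases simp: floor_unique)
 have fr: "frac (x $ k + s) = s" "frac (y $ k + t) = t" for k using fl by (auto simp: frac_def)
 have se: "same_edge (x + axis i s) (y + axis j t) k \<longleftrightarrow> x = y & i = j & k = i" for k
 proof
 assume e: "same_edge (x + axis i s) (y + axis j t) k"
 have k: "k = i" "k = j" using e xi[of k] by (auto simp: same_edge_def split: if_splits)
 moreover have "x $ l = y $ l" for l
 proof (cases "l = k")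
 case True
 have "\<lfloor>x $ k + s\<rfloor> = \<lfloor>y $ k + t\<rfloor>" using e k by (auto simp: same_edge_def)
 then have "real_of_int \<lfloor>x $ k + s\<rfloor> = real_of_int \<lfloor>y $ k + t\<rfloor>" by simp
 then show ?thesis using True fl by simp
 next
 case False
 then show ?thesis using e k by (auto simp: same_edge_def)
 qed
 ultimately show "x = y & i = j & k = i" by (auto simp: vec_eq_iff)
 next
 assume "x = y & i = j & k = i"
 moreover have "\<lfloor>y $ k + s\<rfloor> = \<lfloor>y $ k + t\<rfloor>" if "x = y" for k using fl[of k] that by (metis of_int_eq_iff)
 ultimately show "same_edge (x + axis i s) (y + axis j t) k" using ns xi by (auto simp: same_edge_def)
 qed
 show ?thesis
 proof (cases "x = y & i = j")
 case True
 then have "same_edge (x + axis i s) (y + axis j t) = (%k. k = i)" using se by (intro ext) blast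
 then have "(SOME k. same_edge (x + axis i s) (y + axis j t) k) = i" by simp
 moreover have "EX k. same_edge (x + axis i s) (y + axis j t) k" using se True by blast
 moreover have "frac ((x + axis i s) $ i) = s" "frac ((y + axis j t) $ i) = t" using fr True by auto
 ultimately show ?thesis using True unfolding bridge_cov_def Let_def by (simp only: if_True simp_thms)
 next
 case False
 then show ?thesis unfolding bridge_cov_def by (auto simp: se)
 qed
qed

lemma mgff_cov_axis:
 fixes x y :: "real^'n" and i j :: 'n
 assumes x: "x : latt" and y: "y : latt" and s: "0 <= s" "s <= 1" and t: "0 <= t" "t <= 1"
 defines "H \<equiv> %a. (1 - t) * green a y + t * green a (y + axis j 1)"
 shows "mgff_cov (x + axis i s) (y + axis j t) = (1 - s) * H x + s * H (x + axis i 1) +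
 (if x = y & i = j then 2 * real CARD('n) * min s t * (1 - max s t) else 0)"
proof -
 have "(\<Sum>a\<in>near_latt (x + axis i s). \<Sum>b\<in>near_latt (y + axis j t).
 interp_wt (x + axis i s) a * interp_wt (y + axis j t) b * green a b) =
 (\<Sum>a\<in>near_latt (x + axis i s). interp_wt (x + axis i s) a * (\<Sum>b\<in>near_latt (y + axis j t). interp_wt (y + axis j t) b * green a b))"
 by (simp add: sum_distrib_left mult.assoc)
 also have "... = (\<Sum>a\<in>near_latt (x + axis i s). interp_wt (x + axis i s) a * H a)"
 by (simp add: interp_axis[OF y t] H_def)
 also have "... = (1 - s) * H x + s * H (x + axis i 1)" by (rule interp_axis[OF x s])
 finally show ?thesis unfolding mgff_cov_def bridge_axis[OF x y s t] by simp
qed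

lemma axis_0 [simp]: "axis i (0::real) = 0" by (simp add: axis_def vec_eq_iff)

lemma mgff_cov_latt:
 fixes x :: "real^'n"
 assumes x: "x : latt" and y: "y : latt" and s: "0 <= s" "s <= 1"
 shows "mgff_cov (x + axis i s) y = (1 - s) * green x y + s * green (x + axis i 1) y"
 using mgff_cov_axis[OF x y s, of 0 i i] s by simp

lemma finite_latt_box: "finite {x::real^'n. x : latt & linf x <= r}"
proof (rule finite_subset)
 show "{x::real^'n. x : latt & linf x <= r} <= (%h. \<chi> i. h i) ` (UNIV \<rightarrow>\<^sub>E real_of_int ` {- \<lceil>r\<rceil>..\<lceil>r\<rceil>})"
 proof
 fix x :: "real^'n" assume x: "x : {x. x : latt & linf x <= r}"
 have "x $ i : real_of_int ` {- \<lceil>r\<rceil>..\<lceil>r\<rceil>}" for i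
 proof -
 obtain a where a: "x $ i = of_int a" using x by (auto simp: latt_def elim: Ints_cases)
 have "\<bar>x $ i\<bar> <= r" using x by (auto simp: linf_le_iff)
 then have "\<bar>a\<bar> <= \<lceil>r\<rceil>" using a by linarith
 then have "a : {- \<lceil>r\<rceil>..\<lceil>r\<rceil>}" by auto
 then show ?thesis using a by (intro image_eqI[of _ _ a]) simp_all
 qed
 then show "x : (%h. \<chi> i. h i) ` (UNIV \<rightarrow>\<^sub>E real_of_int ` {- \<lceil>r\<rceil>..\<lceil>r\<rceil>})"
 by (intro image_eqI[of _ _ "%i. x $ i"]) auto
 qed
qed (auto intro!: finite_imageI finite_PiE)

lemma linf_le_norm: "linf x <= norm (x::real^'n)"
 by (auto simp: linf_le_iff component_le_norm_cart)

lemma finite_latt_ball: "finite {x::real^'n. x : latt & norm (x - a) <= r}"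
proof (rule finite_subset[OF _ finite_latt_box[of "r + norm a"]])
 show "{x : latt. norm (x - a) <= r} <= {x : latt. linf x <= r + norm a}"
 proof safe
 fix x assume "norm (x - a) <= r"
 moreover have "norm x <= norm (x - a) + norm a" using norm_triangle_ineq[of "x - a" a] by simp
 ultimately show "linf x <= r + norm a" using linf_le_norm[of x] by linarith
 qed
qed

section \<open>The mesh as a network whose Green function is the covariance\<close>

definition mX :: "nat => (real^'n) set" where
 "mX m = {v\<in>mgraph. ALL i. real m * v $ i : \<int>}"

text \<open>Requiring w in \<open>mgraph\<close> rules out sideways steps from the interior of an
  edge.\<close>

definition mnb :: "nat => real^'n => (real^'n) set" where
 "mnb m v = {w\<in>mgraph. EX i. w = v + axis i (1 / real m) | w = v - axis i (1 / real m)}"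

locale mesh =
 fixes m :: nat and ty :: "'n::finite itself"
 assumes m: "m >= 2" and d7: "CARD('n) > 6"
begin

lemma edge_in_mX: "x : latt ==> x + axis i (of_int k / real m) : mX m"
proof -
 assume x: "x : latt"
 have "real m * x $ j : \<int>" for j using x by (auto simp: latt_def intro: Ints_mult)
 moreover have "real m * (x $ j + of_int k / real m) = real m * x $ j + of_int k" for j using m by (simp add: field_simps)
 ultimately show ?thesis using edge_in_mgraph[OF x] by (auto simp: mX_def)
qed

lemma latt_in_mX: "x : latt ==> x : mX m"
 using edge_in_mX[of x undefined 0] by simp

lemma mX_cases:
 fixes v :: "real^'n"
 assumes "v : mX m"
 obtains x i k where "x : latt" "k < m" "v = x + axis i (real k / real m)"
proof -
 obtain x i s where v: "x : latt" "0 <= s" "s < 1" "v = x + axis i s"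
 by (rule mgraph_cases[of v]) (use assms in \<open>simp add: mX_def\<close>)
 have "real m * x $ i : \<int>" using v by (auto simp: latt_def intro: Ints_mult)
 moreover have "real m * (x $ i + s) : \<int>" using assms v by (auto simp: mX_def dest!: spec[of _ i])
 ultimately have "real m * s : \<int>" using Ints_diff[of "real m * (x $ i + s)" "real m * x $ i"] by (simp add: algebra_simps)
 then obtain k where k: "real m * s = of_int k" by (auto elim: Ints_cases)
 have "0 <= real m * s" using v by simp
 then have "k >= 0" using k by simp
 moreover have "real m * s < real m * 1" using v m by (intro mult_strict_left_mono) auto
 ultimately have "nat k < m" using k by linarith
 moreover have "s = real (nat k) / real m" using k \<open>k >= 0\<close> m by (simp add: field_simps)
 ultimately show ?thesis using that[OF v(1), of "nat k" i] v(4) by simp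
qed

lemma finite_mX_ball: "finite {v::real^'n. v : mX m & norm v <= r}"
proof (rule finite_subset)
 show "{v::real^'n. v : mX m & norm v <= r} <= (%(x, i, k). x + axis i (real k / real m)) ` ({x. x : latt & norm (x - 0) <= r + 1} \<times> UNIV \<times> {..<m})"
 proof safe
 fix v :: "real^'n" assume v: "v : mX m" "norm v <= r"
 obtain x i k where x: "x : latt" "k < m" "v = x + axis i (real k / real m)" using mX_cases[OF v(1)] by metis
 have "norm x <= norm v + norm (axis i (real k / real m) :: real^'n)" using norm_triangle_ineq4[of v "axis i (real k / real m)"] x by simp
 also have "norm (axis i (real k / real m) :: real^'n) <= 1" using x by (simp add: norm_axis_real)
 finally show "v : (%(x, i, k). x + axis i (real k / real m)) ` ({x. x : latt & norm (x - 0) <= r + 1} \<times> UNIV \<times> {..<m})"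
 using v x by (intro image_eqI[of _ _ "(x, i, k)"]) auto
 qed
qed (auto intro!: finite_imageI finite_cartesian_product finite_latt_ball[of 0, simplified])

lemma mnb_latt:
 fixes x :: "real^'n"
 assumes "x : latt"
 shows "mnb m x = (%i. x + axis i (1 / real m)) ` UNIV Un (%i. x - axis i (1 / real m)) ` UNIV"
 using edge_in_mgraph[OF assms] by (auto simp: mnb_def)

lemma not_Ints_frac: "0 < k ==> k < m ==> a : \<int> ==> a + real k / real m ~: \<int>"
 by (rule not_Ints_between) (auto simp: field_simps)

lemma mgraph_two_axes:
 fixes x :: "real^'n"
 assumes "x + axis i s + axis j t : mgraph" "x : latt" "i ~= j" "!!a. a : \<int> ==> a + s ~: \<int>" "!!a. a : \<int> ==> a + t ~: \<int>"
 shows False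
proof -
 obtain l where "!!k. k ~= l ==> (x + axis i s + axis j t) $ k : \<int>" using assms(1) by (auto simp: mgraph_def)
 then have "(x + axis i s + axis j t) $ i : \<int> | (x + axis i s + axis j t) $ j : \<int>" using assms(3) by metis
 then have "x $ i + s : \<int> | x $ j + t : \<int>" using assms(3) by simp
 then show False using assms(2) assms(4)[of "x $ i"] assms(5)[of "x $ j"] by (simp add: latt_def)
qed

lemma not_Ints_inv: "a : \<int> ==> a + 1 / real m ~: \<int>" "a : \<int> ==> a + - (1 / real m) ~: \<int>"
proof -
 show "a + 1 / real m ~: \<int>" if "a : \<int>" for a using not_Ints_frac[of 1 a] m that by simp
 from this[of "- a"] show "a : \<int> ==> a + - (1 / real m) ~: \<int>" using Ints_minus[of "a + - (1 / real m)"] by auto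
qed

lemma axis_uminus: "x - axis i s = x + axis i (- s)" for s :: real by (simp add: vec_eq_iff)

lemma mnb_edge:
 fixes x :: "real^'n"
 assumes x: "x : latt" and k: "0 < k" "k < m"
 shows "mnb m (x + axis i (real k / real m)) = {x + axis i (real (k + 1) / real m), x + axis i (real (k - 1) / real m)}"
proof -
 have e: "x + axis i (real k / real m) + axis i (1 / real m) = x + axis i (real (k + 1) / real m)"
 "x + axis i (real k / real m) - axis i (1 / real m) = x + axis i (real (k - 1) / real m)"
 using k by (auto simp: vec_eq_iff field_simps of_nat_diff)
 have 1: "j = i" if "x + axis i (real k / real m) + axis j (1 / real m) : mgraph" for j
 by (rule ccontr) (rule mgraph_two_axes[OF that x _ not_Ints_frac[OF k] not_Ints_inv(1)], simp_all)
 have 2: "j = i" if "x + axis i (real k / real m) - axis j (1 / real m) : mgraph" for j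
 by (rule ccontr) (rule mgraph_two_axes[OF that[unfolded axis_uminus] x _ not_Ints_frac[OF k] not_Ints_inv(2)], simp_all)
 show ?thesis
 proof
 show "mnb m (x + axis i (real k / real m)) <= {x + axis i (real (k + 1) / real m), x + axis i (real (k - 1) / real m)}"
 proof
 fix w assume "w : mnb m (x + axis i (real k / real m))"
 then obtain j where w: "w : mgraph" and j: "w = x + axis i (real k / real m) + axis j (1 / real m) | w = x + axis i (real k / real m) - axis j (1 / real m)"
 unfolding mnb_def by blast
 from j show "w : {x + axis i (real (k + 1) / real m), x + axis i (real (k - 1) / real m)}"
 proof
 assume a: "w = x + axis i (real k / real m) + axis j (1 / real m)"
 then have "j = i" using 1 w by metis
 then show ?thesis using a e(1) by simp
 next
 assume a: "w = x + axis i (real k / real m) - axis j (1 / real m)"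
 then have "j = i" using 2 w by metis
 then show ?thesis using a e(2) by simp
 qed
 qed
 have "x + axis i (real (k + 1) / real m) : mnb m (x + axis i (real k / real m))"
 unfolding mnb_def using edge_in_mgraph(1)[OF x, of i "real (k + 1) / real m"] e(1)[symmetric] by blast
 moreover have "x + axis i (real (k - 1) / real m) : mnb m (x + axis i (real k / real m))"
 unfolding mnb_def using edge_in_mgraph(1)[OF x, of i "real (k - 1) / real m"] e(2)[symmetric] by blast
 ultimately show "{x + axis i (real (k + 1) / real m), x + axis i (real (k - 1) / real m)} <= mnb m (x + axis i (real k / real m))" by simp
 qed
qed

lemma lap_edge:
 fixes x :: "real^'n"
 assumes x: "x : latt" and k: "0 < k" "k < m"
 shows "lap (mnb m) u (x + axis i (real k / real m)) =
 2 * u (x + axis i (real k / real m)) - u (x + axis i (real (k + 1) / real m)) - u (x + axis i (real (k - 1) / real m))"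
proof -
 have "x + axis i (real (k + 1) / real m) ~= x + axis i (real (k - 1) / real m)"
 using k m by (auto simp: vec_eq_iff field_simps of_nat_diff)
 then show ?thesis unfolding lap_def mnb_edge[OF x k] by simp
qed

lemma lap_latt:
 fixes x :: "real^'n"
 assumes x: "x : latt"
 shows "lap (mnb m) u x = (\<Sum>i\<in>UNIV. 2 * u x - u (x + axis i (1 / real m)) - u (x - axis i (1 / real m)))"
proof -
 let ?p = "%i. x + axis i (1 / real m)" and ?q = "%i. x - axis i (1 / real m)"
 have m0: "1 / real m > 0" using m by simp
 have ip: "inj ?p" 
 proof
 fix i j assume "?p i = ?p j"
 then have "?p i $ i = ?p j $ i" by simp
 then show "i = j" using m0 by (auto split: if_splits)
 qed
 have iq: "inj ?q"
 proof
 fix i j assume "?q i = ?q j"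
 then have "?q i $ i = ?q j $ i" by simp
 then show "i = j" using m0 by (auto split: if_splits)
 qed
 have d: "?p ` UNIV Int ?q ` UNIV = {}"
 proof -
 have "?p i ~= ?q j" for i j
 proof
 assume "?p i = ?q j"
 then have "?p i $ i = ?q j $ i" by simp
 then show False using m0 by (auto split: if_splits)
 qed
 then show ?thesis by auto
 qed
 have "lap (mnb m) u x = (\<Sum>w\<in>?p ` UNIV. u x - u w) + (\<Sum>w\<in>?q ` UNIV. u x - u w)"
 unfolding lap_def mnb_latt[OF x] using d by (intro sum.union_disjoint) auto
 also have "... = (\<Sum>i\<in>UNIV. u x - u (?p i)) + (\<Sum>i\<in>UNIV. u x - u (?q i))"
 using ip iq by (simp add: sum.reindex)
 also have "... = (\<Sum>i\<in>UNIV. 2 * u x - u (?p i) - u (?q i))" by (simp add: sum.distrib[symmetric] algebra_simps)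
 finally show ?thesis .
qed

end

context mesh begin

lemma edge_unique:
 fixes x y :: "real^'n"
 assumes x: "x : latt" and y: "y : latt" and k: "0 < k" "k < m" and l: "l < m"
 shows "x + axis i (real k / real m) = y + axis j (real l / real m) \<longleftrightarrow> x = y & i = j & k = l"
proof
 assume e: "x + axis i (real k / real m) = y + axis j (real l / real m)"
 have ec: "(x + axis i (real k / real m)) $ a = (y + axis j (real l / real m)) $ a" for a using e by simp
 have int: "x $ a : \<int>" "y $ a : \<int>" for a using x y by (simp_all add: latt_def)
 have ij: "i = j"
 proof (rule ccontr)
 assume "i ~= j"
 then have "x $ i + real k / real m = y $ i" using ec[of i] by simp
 then show False using not_Ints_frac[OF k, of "x $ i"] int by simp
 qed
 have i: "x $ i + real k / real m = y $ i + real l / real m" using ec[of i] ij by simp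
 have "real k / real m < 1" "real l / real m < 1" "0 <= real k / real m" "0 <= real l / real m" using k l by auto
 then have "x $ i = y $ i" by (intro Ints_abs_less_1_eq[OF int]) (use i in linarith)
 moreover from this have "real k / real m = real l / real m" using i by simp
 then have "k = l" using m by simp
 moreover have "x $ a = y $ a" if "a ~= i" for a using ec[of a] ij that by simp
 ultimately show "x = y & i = j & k = l" using ij unfolding vec_eq_iff by metis
qed simp

lemma latt_edge_unique:
 fixes x y :: "real^'n"
 assumes x: "x : latt" and y: "y : latt" and l: "l < m"
 shows "x = y + axis j (real l / real m) \<longleftrightarrow> x = y & l = 0"
proof
 assume e: "x = y + axis j (real l / real m)"
 show "x = y & l = 0"
 proof (cases "l = 0")
 case False
 have "y $ j + real l / real m ~: \<int>" using not_Ints_frac[of l "y $ j"] False l y by (simp add: latt_def)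
 moreover have "x $ j = y $ j + real l / real m" using e by simp
 moreover have "x $ j : \<int>" using x by (simp add: latt_def)
 ultimately have False by simp
 then show ?thesis ..
 qed (use e in simp)
qed simp

lemma fraction_bounds: "k <= m ==> 0 <= real k / real m" "k <= m ==> real k / real m <= 1"
 by (auto simp: divide_le_eq_1)

text \<open>min(s, t)(1 - max(s, t)) is the Green function of minus the second derivative on the
  unit interval, so its second difference is a point mass at t.\<close>

lemma tent_second_difference:
 assumes k: "0 < k" "k < m" and l: "l < m" and h: "h = 1 / real m"
 shows "2 * (min (real k * h) (real l * h) * (1 - max (real k * h) (real l * h)))
 - min (real (k + 1) * h) (real l * h) * (1 - max (real (k + 1) * h) (real l * h))
 - min (real (k - 1) * h) (real l * h) * (1 - max (real (k - 1) * h) (real l * h)) = (if k = l then h else 0)"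
proof -
 have h0: "h > 0" using h m by simp
 have mm: "min (real a * h) (real b * h) = real (min a b) * h" "max (real a * h) (real b * h) = real (max a b) * h" for a b :: nat
 using h0 by (auto simp: min_def max_def)
 consider "k < l" | "k = l" | "l < k" by linarith
 then show ?thesis
 proof cases
 case 1
 then have "min k l = k" "max k l = l" "min (k+1) l = k + 1" "max (k+1) l = l" "min (k-1) l = k - 1" "max (k - 1) l = l" by auto
 then show ?thesis unfolding mm using 1 k by (simp add: of_nat_diff algebra_simps)
 next
 case 2
 then have "min k l = k" "max k l = k" "min (k+1) l = k" "max (k+1) l = k + 1" "min (k-1) l = k - 1" "max (k - 1) l = k" by auto
 then show ?thesis unfolding mm using 2 k by (simp add: of_nat_diff algebra_simps)
 next
 case 3
 then have "min k l = l" "max k l = k" "min (k+1) l = l" "max (k+1) l = k + 1" "min (k-1) l = l" "max (k - 1) l = k - 1" by auto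
 then show ?thesis unfolding mm using 3 k by (simp add: of_nat_diff algebra_simps)
 qed
qed

text \<open>Along an edge the interpolated Green function is affine, so only the bridge covariance
  has a second difference.\<close>

lemma lap_mgff_edge:
 fixes x y :: "real^'n"
 assumes x: "x : latt" and y: "y : latt" and k: "0 < k" "k < m" and l: "l < m"
 shows "lap (mnb m) (%u. mgff_cov u (y + axis j (real l / real m))) (x + axis i (real k / real m)) =
 (if x = y & i = j & k = l then 2 * real CARD('n) / real m else 0)"
proof -
 define h where "h = 1 / real m"
 define t where "t = real l / real m"
 define H where "H = (%a. (1 - t) * green a y + t * green a (y + axis j 1))"
 define b where "b = (%a. min (real a * h) (real l * h) * (1 - max (real a * h) (real l * h)))"
 have val: "mgff_cov (x + axis i (real a / real m)) (y + axis j (real l / real m)) =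
 (1 - real a * h) * H x + real a * h * H (x + axis i 1) + (if x = y & i = j then 2 * real CARD('n) * b a else 0)" if "a <= m" for a
 using mgff_cov_axis[OF x y fraction_bounds[OF that] fraction_bounds[of l], of i j] l
 unfolding H_def b_def t_def h_def by (simp add: mult.assoc)
 have rk: "real (k - 1) = real k - 1" "real (k - Suc 0) = real k - 1" "real (k + 1) = real k + 1" using k by (simp_all add: of_nat_diff)
 have "lap (mnb m) (%u. mgff_cov u (y + axis j (real l / real m))) (x + axis i (real k / real m)) =
 (if x = y & i = j then 2 * real CARD('n) * (2 * b k - b (k + 1) - b (k - 1)) else 0)"
 unfolding lap_edge[OF x k] val[of k, OF less_imp_le[OF k(2)]] val[of "k + 1", OF Suc_leI[OF k(2), unfolded Suc_eq_plus1]] val[of "k - 1", OF le_trans[OF diff_le_self less_imp_le[OF k(2)]]]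
 by (simp add: rk algebra_simps)
 also have "2 * b k - b (k + 1) - b (k - 1) = (if k = l then h else 0)"
 unfolding b_def by (rule tent_second_difference[OF k l h_def])
 finally show ?thesis by (simp add: h_def)
qed

text \<open>The interpolated Green function has Laplacian masses proportional to 1 - t and t at the
  ends of the edge carrying the pole. The end slopes of the bridge covariance cancel exactly these
  masses, except when the pole is itself the lattice point.\<close>

lemma lap_mgff_latt:
 fixes x y :: "real^'n"
 assumes x: "x : latt" and y: "y : latt" and l: "l < m"
 shows "lap (mnb m) (%u. mgff_cov u (y + axis j (real l / real m))) x = (if x = y & l = 0 then 2 * real CARD('n) / real m else 0)"
proof -
 define t where "t = real l / real m"
 define h where "h = 1 / real m"
 define H where "H = (%a. (1 - t) * green a y + t * green a (y + axis j 1))"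
 let ?d = "2 * real CARD('n)"
 have t: "0 <= t" "t <= 1" using l by (auto simp: t_def)
 have h: "0 <= h" "h <= 1" "h <= 1 - h" using m by (auto simp: h_def field_simps)
 have tl: "t <= 1 - h" using l by (simp add: t_def h_def field_simps)
 have lh: "l ~= 0 ==> h <= t" by (simp add: t_def h_def field_simps divide_right_mono)
 have t0: "l = 0 \<longleftrightarrow> t = 0" using m by (simp add: t_def)
 have v0: "mgff_cov x (y + axis j t) = H x"
 using mgff_cov_axis[OF x y _ _ t, of 0 j j] t unfolding H_def by simp
 have vp: "mgff_cov (x + axis i h) (y + axis j t) = (1 - h) * H x + h * H (x + axis i 1) + (if i = j then (if x = y & l ~= 0 then ?d * h * (1 - t) else 0) else 0)" for i
 proof -
 have "min h t * (1 - max h t) = (if l ~= 0 then h * (1 - t) else 0)"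
 using lh t0 h by (auto simp: min_def max_def)
 then show ?thesis using mgff_cov_axis[OF x y h(1,2) t, of i j] unfolding H_def by (auto simp: mult.assoc)
 qed
 have vm: "mgff_cov (x - axis i h) (y + axis j t) = h * H (x - axis i 1) + (1 - h) * H x + (if i = j then (if x = y + axis j 1 then ?d * h * t else 0) else 0)" for i
 proof -
 have x': "x - axis i 1 : latt" using latt_axis(2)[OF x, of 1 i] by simp
 have e: "x - axis i h = (x - axis i 1) + axis i (1 - h)" "x = x - axis i 1 + axis i 1" by (simp_all add: vec_eq_iff)
 have "min (1 - h) t * (1 - max (1 - h) t) = h * t" using tl by (simp add: min_def max_def)
 moreover have "x - axis i 1 = y \<longleftrightarrow> x = y + axis i 1" by (auto simp: algebra_simps)
 ultimately show ?thesis using mgff_cov_axis[OF x' y _ _ t, of "1 - h" i j] h e(2)[symmetric] unfolding e(1) H_def by (auto simp: mult.assoc)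
 qed
 have aH: "H x - avg H x = (1 - t) * (if x = y then 1 else 0) + t * (if x = y + axis j 1 then 1 else 0)"
 proof -
 have "avg H x = (1 - t) * avg (%a. green a y) x + t * avg (%a. green a (y + axis j 1)) x"
 unfolding H_def by (simp only: avg_add avg_cmult)
 moreover have "H x = (1 - t) * ((if x = y then 1 else 0) + avg (%a. green a y) x) + t * ((if x = y + axis j 1 then 1 else 0) + avg (%a. green a (y + axis j 1)) x)"
 unfolding H_def using green_renewal[OF d7, of x y] green_renewal[OF d7, of x "y + axis j 1"] by simp
 ultimately show ?thesis by (simp only: distrib_left)
 qed
 have "(\<Sum>i\<in>UNIV. 2 * mgff_cov x (y + axis j t) - mgff_cov (x + axis i h) (y + axis j t) - mgff_cov (x - axis i h) (y + axis j t))
 = (\<Sum>i\<in>UNIV. h * (2 * H x - (H (x + axis i 1) + H (x - axis i 1)))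
 - (if i = j then (if x = y & l ~= 0 then ?d * h * (1 - t) else 0) else 0) - (if i = j then (if x = y + axis j 1 then ?d * h * t else 0) else 0))"
 unfolding v0 vp vm by (intro sum.cong refl) (simp add: algebra_simps)
 also have "... = h * (\<Sum>i\<in>UNIV. 2 * H x - (H (x + axis i 1) + H (x - axis i 1))) - (if x = y & l ~= 0 then ?d * h * (1 - t) else 0) - (if x = y + axis j 1 then ?d * h * t else 0)"
 by (simp only: sum_subtractf sum_distrib_left[symmetric] sum.delta[OF finite] UNIV_I if_True)
 also have "(\<Sum>i\<in>UNIV. 2 * H x - (H (x + axis i 1) + H (x - axis i 1))) = ?d * (H x - avg H x)"
 unfolding avg_def by (simp add: sum_subtractf field_simps)
 also have "h * (?d * (H x - avg H x)) - (if x = y & l ~= 0 then ?d * h * (1 - t) else 0) - (if x = y + axis j 1 then ?d * h * t else 0)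
 = (if x = y & l = 0 then ?d * h else 0)"
 unfolding aH using t0 by (auto simp: algebra_simps)
 finally show ?thesis unfolding lap_latt[OF x] t_def h_def by simp
qed

text \<open>Restricting the metric graph field to any mesh thus gives the free field of the mesh
  network, with \<kappa> = 2d/m.\<close>

lemma lap_mgff:
 fixes v z :: "real^'n"
 assumes v: "v : mX m" and z: "z : mX m"
 shows "lap (mnb m) (%u. mgff_cov u z) v = (if v = z then 2 * real CARD('n) / real m else 0)"
proof -
 obtain y j l where z': "y : latt" "l < m" "z = y + axis j (real l / real m)" by (rule mX_cases[OF z])
 obtain x i k where v': "x : latt" "k < m" "v = x + axis i (real k / real m)" by (rule mX_cases[OF v])
 show ?thesis
 proof (cases "k = 0")
 case True
 then have "v = x" using v' by simp
 then show ?thesis unfolding z'(3) by (simp only: lap_mgff_latt[OF v'(1) z'(1,2)] latt_edge_unique[OF v'(1) z'(1,2)])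
 next
 case False
 then show ?thesis unfolding z'(3) v'(3) by (simp only: lap_mgff_edge[OF v'(1) z'(1) _ v'(2) z'(2)] edge_unique[OF v'(1) z'(1) _ v'(2) z'(2)] neq0_conv)
 qed
qed

lemma mgff_sym:
 fixes u v :: "real^'n"
 assumes u: "u : mX m" and v: "v : mX m"
 shows "mgff_cov u v = mgff_cov v u"
proof -
 obtain y j l where z': "y : latt" "l < m" "v = y + axis j (real l / real m)" by (rule mX_cases[OF v])
 obtain x i k where v': "x : latt" "k < m" "u = x + axis i (real k / real m)" by (rule mX_cases[OF u])
 note b = fraction_bounds[OF less_imp_le[OF v'(2)]] fraction_bounds[OF less_imp_le[OF z'(2)]]
 have gen: "(1 - s) * ((1 - t) * A + t * B) + s * ((1 - t) * C + t * D) = (1 - t) * ((1 - s) * A + s * C) + t * ((1 - s) * B + s * D)" for s t A B C D :: real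
 by (simp add: algebra_simps)
 show ?thesis unfolding z'(3) v'(3) mgff_cov_axis[OF v'(1) z'(1) b] mgff_cov_axis[OF z'(1) v'(1) b(3,4) b(1,2)]
 green_sym[OF d7, of y x] green_sym[OF d7, of "y + axis j 1" x] green_sym[OF d7, of y "x + axis i 1"] green_sym[OF d7, of "y + axis j 1" "x + axis i 1"]
 by (rule arg_cong2[where f = "(+)"], rule gen) (auto simp: min.commute max.commute)
qed

lemma green_decay:
 obtains C where "C >= 1" "!!x y::real^'n. !!r. r > 0 ==> norm (x - y) >= r ==> green x y <= C / r\<^sup>2"
proof (rule green_convolutions[OF d7])
 fix K C :: real assume K: "K >= 1" "C >= 1" and G: "!!x y::real^'n. green x y <= C * fdec K (12/5) (x - y)"
 show ?thesis
 proof (rule that[OF K(2)])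
 fix x y :: "real^'n" and r :: real assume r: "r > 0" "norm (x - y) >= r"
 have "fdec K (7/5 + 1) (x - y) <= fdec K (7/5) (x - y) / r\<^sup>2" by (rule fdec_tail[OF K(1) r])
 also have "... <= 1 / r\<^sup>2" by (intro divide_right_mono fdec_le_1 K) auto
 finally have "fdec K (12/5) (x - y) <= 1 / r\<^sup>2" by simp
 from mult_left_mono[OF this, of C] show "green x y <= C / r\<^sup>2" using G[of x y] K by simp
 qed
qed

lemma mgff_vanishing:
 fixes z :: "real^'n"
 assumes z: "z : mX m"
 shows "vanishing (mX m) (%x. mgff_cov x z)"
 unfolding vanishing_def
proof (intro allI impI)
 fix e :: real assume e: "e > 0"
 obtain C where C: "C >= 1" "!!x y::real^'n. !!r. r > 0 ==> norm (x - y) >= r ==> green x y <= C / r\<^sup>2"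
 by (rule green_decay, rule that; blast)
 obtain y j l where z': "y : latt" "l < m" "z = y + axis j (real l / real m)" by (rule mX_cases[OF z])
 \<comment> \<open>With this radius C / r^2 is e/2.\<close>
 define r where "r = sqrt (2 * C / e)"
 have r: "r > 0" "C / r\<^sup>2 < e" using e C by (auto simp: r_def field_simps)
 have G: "green a b < e" "0 <= green a b" if "norm (a - b) >= r" for a b :: "real^'n"
 using C(2)[OF r(1) that] r(2) green_nonneg[OF d7, of a b] by linarith+
 show "finite {v : mX m. e <= \<bar>mgff_cov v z\<bar>}"
 proof (rule finite_subset[OF _ finite_mX_ball[of "norm y + r + 3"]], safe)
 fix v assume v: "v : mX m" "e <= \<bar>mgff_cov v z\<bar>"
 obtain x i k where v': "x : latt" "k < m" "v = x + axis i (real k / real m)" by (rule mX_cases[OF v(1)])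
 note b = fraction_bounds[OF less_imp_le[OF v'(2)]] fraction_bounds[OF less_imp_le[OF z'(2)]]
 show "norm v <= norm y + r + 3"
 proof (rule ccontr)
 assume "~ ?thesis"
 then have n: "norm v > norm y + r + 3" by simp
 have "norm v <= norm x + real k / real m"
 using norm_triangle_ineq[of x "axis i (real k / real m)"] v'(3) by (simp add: norm_axis_real)
 then have nx: "norm x > norm y + r + 2" using n b(2) by linarith
 have nx1: "norm (x + axis i 1) > norm y + r + 1"
 using norm_triangle_ineq4[of "x + axis i 1" "axis i 1"] nx by simp
 have far: "norm (a - c) >= r" if "norm a > norm y + r + 1" "norm c <= norm y + 1" for a c :: "real^'n"
 using norm_triangle_ineq2[of a c] that by linarith
 have ny1: "norm (y + axis j 1) <= norm y + 1" using norm_triangle_ineq[of y "axis j 1"] by simp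
 have ne: "x ~= y" using nx r by auto
 let ?s = "real k / real m" and ?t = "real l / real m"
 let ?H = "%a. (1 - ?t) * green a y + ?t * green a (y + axis j 1)"
 have H: "0 <= ?H a" "?H a < e" if "norm a > norm y + r + 1" for a
 proof -
 have g: "green a y < e" "green a (y + axis j 1) < e" "0 <= green a y" "0 <= green a (y + axis j 1)" using G far[OF that] ny1 by auto
 show "0 <= ?H a" using g b by simp
 show "?H a < e" using convex_bound_lt[OF g(1,2), of "1 - ?t" ?t] b by simp
 qed
 have H2: "0 <= ?H x" "?H x < e" "0 <= ?H (x + axis i 1)" "?H (x + axis i 1) < e" using H[of x] H[of "x + axis i 1"] nx nx1 by auto
 have "mgff_cov v z = (1 - ?s) * ?H x + ?s * ?H (x + axis i 1)"
 unfolding v'(3) z'(3) mgff_cov_axis[OF v'(1) z'(1) b] using ne by simp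
 moreover have "(1 - ?s) * ?H x + ?s * ?H (x + axis i 1) < e" using convex_bound_lt[OF H2(2,4), of "1 - ?s" ?s] b by simp
 moreover have "0 <= (1 - ?s) * ?H x + ?s * ?H (x + axis i 1)" using b green_nonneg[OF d7] by (intro add_nonneg_nonneg mult_nonneg_nonneg) auto
 ultimately show False using v(2) by linarith
 qed
 qed
qed

text \<open>A step away from the origin along the edge of v enlarges one coordinate in modulus and
  keeps the others; this provides \<open>q\<close> in \<open>cable\<close>.\<close>

lemma mnb_increases:
 fixes v :: "real^'n"
 assumes v: "v : mX m"
 shows "\<exists>y\<in>mnb m v. (norm v)\<^sup>2 < (norm y)\<^sup>2"
proof -
 obtain x i k where v': "x : latt" "k < m" "v = x + axis i (real k / real m)" by (rule mX_cases[OF v])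
 define s where "s = (if v $ i >= 0 then 1 / real m else - (1 / real m))"
 have e: "v + axis i s = x + axis i (real k / real m + s)" by (simp add: v' vec_eq_iff)
 have g: "v + axis i s : mgraph" unfolding e by (rule edge_in_mgraph[OF v'(1)])
 have "v + axis i s = v + axis i (1 / real m) | v + axis i s = v - axis i (1 / real m)" by (auto simp: s_def vec_eq_iff)
 then have "v + axis i s : mnb m v" using g unfolding mnb_def by blast
 moreover have "(norm v)\<^sup>2 < (norm (v + axis i s))\<^sup>2"
 unfolding norm_sq_sum
 proof (rule sum_strict_mono_ex1)
 have m0: "1 / real m > 0" using m by simp
 have lt: "(v $ i)\<^sup>2 < (v $ i + s)\<^sup>2"
 proof (cases "v $ i >= 0")
 case True
 then show ?thesis using m0 by (intro power_strict_mono) (auto simp: s_def)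
 next
 case False
 have "(- (v $ i))\<^sup>2 < (- (v $ i) + 1 / real m)\<^sup>2" using m0 False by (intro power_strict_mono) auto
 moreover have "(- (v $ i) + 1 / real m)\<^sup>2 = (v $ i + s)\<^sup>2" using False by (simp add: s_def power2_commute)
 ultimately show ?thesis by simp
 qed
 show "\<forall>a\<in>UNIV. (v $ a)\<^sup>2 <= ((v + axis i s) $ a)\<^sup>2"
 proof
 fix a show "(v $ a)\<^sup>2 <= ((v + axis i s) $ a)\<^sup>2" using lt by (cases "a = i") auto
 qed
 have "(v $ i)\<^sup>2 < (v $ i + s)\<^sup>2" by (rule lt)
 then show "\<exists>a\<in>UNIV. (v $ a)\<^sup>2 < ((v + axis i s) $ a)\<^sup>2" by (intro bexI[of _ i]) auto
 qed simp
 ultimately show ?thesis by blast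
qed

lemma mnb_props:
 fixes v :: "real^'n"
 assumes v: "v : mX m"
 shows "finite (mnb m v)" "mnb m v <= mX m" "card (mnb m v) <= 2 * CARD('n)" "u : mnb m v ==> v : mnb m u"
proof -
 have sub: "mnb m v <= (%i. v + axis i (1 / real m)) ` UNIV Un (%i. v - axis i (1 / real m)) ` UNIV" by (auto simp: mnb_def)
 show "finite (mnb m v)" by (rule finite_subset[OF sub]) auto
 have "card (mnb m v) <= card ((%i. v + axis i (1 / real m)) ` UNIV Un (%i. v - axis i (1 / real m)) ` UNIV)"
 by (rule card_mono[OF _ sub]) auto
 also have "... <= card ((%i. v + axis i (1 / real m)) ` UNIV) + card ((%i. v - axis i (1 / real m)) ` UNIV)" by (rule card_Un_le)
 also have "... <= CARD('n) + CARD('n)" by (intro add_mono card_image_le) auto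
 finally show "card (mnb m v) <= 2 * CARD('n)" by simp
 show "mnb m v <= mX m"
 proof
 fix w assume w: "w : mnb m v"
 then obtain i where i: "w = v + axis i (1 / real m) | w = v - axis i (1 / real m)" and g: "w : mgraph" unfolding mnb_def by blast
 have "real m * w $ j : \<int>" for j
 proof -
 have vj: "real m * v $ j : \<int>" using v by (simp add: mX_def)
 have "real m * w $ j = real m * v $ j | real m * w $ j = real m * v $ j + 1 | real m * w $ j = real m * v $ j - 1"
 using i m by (cases "j = i") (auto simp: field_simps)
 then show ?thesis using vj by auto
 qed
 then show "w : mX m" using g by (simp add: mX_def)
 qed
 assume u: "u : mnb m v"
 then obtain i where i: "u = v + axis i (1 / real m) | u = v - axis i (1 / real m)" unfolding mnb_def by blast
 then have "v = u + axis i (1 / real m) | v = u - axis i (1 / real m)" by (auto simp: vec_eq_iff)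
 then show "v : mnb m u" using v unfolding mnb_def mX_def by blast
qed

lemma cable_mesh: "cable (mX m) (mnb m) (%v::real^'n. (norm v)\<^sup>2) mgff_cov (2 * real CARD('n) / real m)"
proof
 show "2 * real CARD('n) / real m > 0" using m by simp
qed (rule mnb_props mnb_increases mgff_vanishing lap_mgff mgff_sym; assumption)+

text \<open>The nearer endpoint c of the edge of v has interpolation weight at least 1/2, and the
  Green function is at least 1 on the diagonal, whence the lower bound. The farther endpoint is
  controlled through \<open>green_neighbour\<close>.\<close>

lemma exists_ncell:
 fixes v :: "real^'n"
 assumes v: "v : mX m"
 shows "\<exists>c\<in>latt. norm (v - c) <= 1/2 & (\<forall>w\<in>latt. mgff_cov v w <= 2 * real CARD('n) * green c w) & 1/2 <= mgff_cov v c"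
proof -
 obtain x i k where v': "x : latt" "k < m" "v = x + axis i (real k / real m)" by (rule mX_cases[OF v])
 let ?s = "real k / real m" and ?y = "x + axis i 1" and ?d = "2 * real CARD('n)"
 note b = fraction_bounds[OF less_imp_le[OF v'(2)]]
 have y: "?y : latt" using latt_axis(1)[OF v'(1), of 1] by simp
 have d1: "?d >= 1" using d7 by simp
 have cov: "mgff_cov v w = (1 - ?s) * green x w + ?s * green ?y w" if "w : latt" for w
 unfolding v'(3) by (rule mgff_cov_latt[OF v'(1) that b])
 have pos: "0 <= green a w" for a w :: "real^'n" by (rule green_nonneg[OF d7])
 show ?thesis
 proof (cases "?s <= 1/2")
 case True
 have "mgff_cov v w <= ?d * green x w" if w: "w : latt" for w
 proof -
 have "green x w <= ?d * green x w" using mult_right_mono[OF d1 pos[of x w]] by simp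
 moreover have "green ?y w <= ?d * green x w" by (rule green_neighbour(1)[OF d7])
 ultimately show ?thesis unfolding cov[OF w] using b by (intro convex_bound_le) auto
 qed
 moreover have "1/2 <= mgff_cov v x"
 proof -
 have "1/2 <= 1 - ?s" using True by linarith
 then have "1/2 * 1 <= (1 - ?s) * green x x" using green_diag_ge_1[OF d7, of x] by (intro mult_mono) linarith+
 then show ?thesis unfolding cov[OF v'(1)] using b pos[of ?y x] by (simp add: add_increasing2)
 qed
 moreover have "norm (v - x) <= 1/2" using True v'(3) by (simp add: norm_axis_real)
 ultimately show ?thesis using v'(1) by blast
 next
 case False
 have xy: "x = ?y - axis i 1" by simp
 have "mgff_cov v w <= ?d * green ?y w" if w: "w : latt" for w
 proof -
 have "green ?y w <= ?d * green ?y w" using mult_right_mono[OF d1 pos[of ?y w]] by simp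
 moreover have "green x w <= ?d * green ?y w" using green_neighbour(2)[OF d7, of ?y i w] unfolding xy[symmetric] .
 ultimately show ?thesis unfolding cov[OF w] using b by (intro convex_bound_le) auto
 qed
 moreover have "1/2 <= mgff_cov v ?y"
 proof -
 have "1/2 <= ?s" using False by linarith
 then have "1/2 * 1 <= ?s * green ?y ?y" using green_diag_ge_1[OF d7, of ?y] by (intro mult_mono) linarith+
 then show ?thesis unfolding cov[OF y] using b pos[of x ?y] by (simp add: add_increasing)
 qed
 moreover have "norm (v - ?y) <= 1/2"
 proof -
 have "v - ?y = axis i (?s - 1)" using v'(3) by (simp add: vec_eq_iff)
 then show ?thesis using False b by (simp add: norm_axis_real)
 qed
 ultimately show ?thesis using y by blast
 qed
qed

definition ncell :: "real^'n => real^'n" where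
 "ncell v = (SOME c. c : latt & norm (v - c) <= 1/2 & (\<forall>w\<in>latt. mgff_cov v w <= 2 * real CARD('n) * green c w) & 1/2 <= mgff_cov v c)"

lemma ncell:
 assumes v: "v : mX m"
 shows "ncell v : latt" "norm (v - ncell v) <= 1/2" "w : latt ==> mgff_cov v w <= 2 * real CARD('n) * green (ncell v) w" "1/2 <= mgff_cov v (ncell v)"
proof -
 have "EX c. c : latt & norm (v - c) <= 1/2 & (\<forall>w\<in>latt. mgff_cov v w <= 2 * real CARD('n) * green c w) & 1/2 <= mgff_cov v c"
 using exists_ncell[OF v] by blast
 from someI_ex[OF this] have "ncell v : latt & norm (v - ncell v) <= 1/2 & (\<forall>w\<in>latt. mgff_cov v w <= 2 * real CARD('n) * green (ncell v) w) & 1/2 <= mgff_cov v (ncell v)"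
 unfolding ncell_def .
 then show "ncell v : latt" "norm (v - ncell v) <= 1/2" "w : latt ==> mgff_cov v w <= 2 * real CARD('n) * green (ncell v) w" "1/2 <= mgff_cov v (ncell v)"
 by blast+
qed

end

section \<open>The field on a box\<close>

definition mV :: "nat => nat => (real^'n) set" where
 "mV m n = {v\<in>mX m. linf v <= real n}"

text \<open>Lattice points suffice as boundary: a mesh point inside an edge that lies in a face has
  all its neighbours in the box.\<close>

definition mD :: "nat => (real^'n) set" where
 "mD n = {v\<in>latt. linf v = real n}"

lemma linf_eqI: "linf x <= r ==> \<bar>x $ i\<bar> = r ==> linf x = r"
 using linf_less_iff[of x r] by (auto simp: less_le)

lemma linf_attained: obtains i where "\<bar>x $ i\<bar> = linf x"
proof -
 have "linf x : range (%i. \<bar>x $ i\<bar>)" unfolding linf_def by (intro Max_in) auto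
 then show ?thesis using that by auto
qed

lemma Ints_abs_less_Suc: "a : \<int> ==> \<bar>a\<bar> < real n ==> \<bar>a\<bar> + 1 <= real n"
proof -
 assume a: "a : \<int>" "\<bar>a\<bar> < real n"
 then obtain b where b: "a = of_int b" by (auto elim: Ints_cases)
 have "real_of_int \<bar>b\<bar> < real_of_int (int n)" using a b by simp
 then have "\<bar>b\<bar> + 1 <= int n" by linarith
 then have "real_of_int (\<bar>b\<bar> + 1) <= real_of_int (int n)" by linarith
 then show ?thesis using b by simp
qed

lemma mult_nat_abs: "real m * \<bar>a\<bar> = \<bar>real m * a\<bar>" by (simp add: abs_mult)

locale mesh_box = mesh m ty for m :: nat and ty :: "'n::finite itself" +
 fixes M :: "'w measure" and \<phi> :: "real^'n => 'w => real" and n :: nat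
 assumes gff: "metric_gff M \<phi>" and n1: "n >= 1"
begin

lemma mnb_in_mV:
 fixes v w :: "real^'n"
 assumes v: "v : mV m n - mD n" and w: "w : mnb m v"
 shows "w : mV m n"
proof -
 have vX: "v : mX m" and vl: "!!j. \<bar>v $ j\<bar> <= real n" using v by (auto simp: mV_def linf_le_iff)
 have wX: "w : mX m" using mnb_props(2)[OF vX] w by blast
 obtain i s where s: "s = 1 / real m | s = - (1 / real m)" and ws: "w = v + axis i s" and wg: "w : mgraph"
 using w unfolding mnb_def axis_uminus by blast
 have m0: "real m > 0" using m by simp
 \<comment> \<open>A non-lattice vertex on a face lies inside an edge contained in the face, and the
   metric graph has no perpendicular step there.\<close>
 have lt: "\<bar>v $ i\<bar> < real n"
 proof (rule ccontr)
 assume "~ ?thesis"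
 then have e: "\<bar>v $ i\<bar> = real n" using vl[of i] by simp
 then have "linf v = real n" using vl by (intro linf_eqI) (auto simp: linf_le_iff)
 then have "v ~: latt" using v by (simp add: mD_def)
 then obtain j where j: "v $ j ~: \<int>" by (auto simp: latt_def)
 have "v $ i = real n | v $ i = - real n" using e by linarith
 then have vi: "v $ i : \<int>" by auto
 then have ij: "j ~= i" using j by auto
 obtain l where l: "!!k. k ~= l ==> w $ k : \<int>" using wg by (auto simp: mgraph_def)
 have "w $ j ~: \<int>" using j ij ws by simp
 moreover have "w $ i ~: \<int>" using not_Ints_inv[OF vi] s ws by auto
 ultimately show False using l[of i] l[of j] ij by metis
 qed
 have "real m * v $ i : \<int>" using vX by (simp add: mX_def)
 moreover have "\<bar>real m * v $ i\<bar> < real (m * n)" using lt m0 by (simp add: mult_nat_abs[symmetric])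
 ultimately have "\<bar>real m * v $ i\<bar> + 1 <= real (m * n)" by (rule Ints_abs_less_Suc)
 then have "real m * (\<bar>v $ i\<bar> + 1 / real m) <= real m * real n" using m0 by (simp add: mult_nat_abs distrib_left)
 then have "\<bar>v $ i\<bar> + 1 / real m <= real n" using m0 by simp
 moreover have "\<bar>s\<bar> = 1 / real m" using s m0 by auto
 ultimately have "\<bar>v $ i + s\<bar> <= real n" using abs_triangle_ineq[of "v $ i" s] by linarith
 then have "\<bar>w $ j\<bar> <= real n" for j using vl[of j] ws by (cases "j = i") auto
 then show ?thesis using wX by (simp add: mV_def linf_le_iff)
qed

lemma finite_mV: "finite (mV m n :: (real^'n) set)"
proof (rule finite_subset[OF _ finite_mX_ball[of "real CARD('n) * real n"]])
 show "(mV m n :: (real^'n) set) <= {v : mX m. norm v <= real CARD('n) * real n}"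
 proof safe
 fix v :: "real^'n" assume v: "v : mV m n"
 then show "v : mX m" by (simp add: mV_def)
 have "norm v <= (\<Sum>i\<in>UNIV. \<bar>v $ i\<bar>)" by (rule norm_le_l1_cart)
 also have "... <= (\<Sum>i\<in>(UNIV::'n set). real n)" using v by (intro sum_mono) (auto simp: mV_def linf_le_iff)
 finally show "norm v <= real CARD('n) * real n" by simp
 qed
qed

lemma mD_sub: "(mD n :: (real^'n) set) <= mV m n" by (auto simp: mD_def mV_def latt_in_mX)

lemma mD_ne: "(mD n :: (real^'n) set) ~= {}"
proof -
 have "(\<chi> i. real n) : (mD n :: (real^'n) set)" by (auto simp: mD_def latt_def linf_def)
 then show ?thesis by blast
qed

sublocale box M "mX m :: (real^'n) set" "mnb m" "%v. (norm v)\<^sup>2" mgff_cov "2 * real CARD('n) / real m" \<phi> "mV m n" "mD n"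
proof (intro box.intro gff.intro gff_axioms.intro box_axioms.intro)
 have XG: "mX m <= (mgraph :: (real^'n) set)" by (auto simp: mX_def)
 show "prob_space M" using gff by (simp add: metric_gff_def)
 show "cable (mX m) (mnb m) (%v::real^'n. (norm v)\<^sup>2) mgff_cov (2 * real CARD('n) / real m)" by (rule cable_mesh)
 show "\<phi> v : borel_measurable M" if "v : mX m" for v using gff that XG unfolding metric_gff_def by blast
 show "(CLINT om|M. iexp (\<Sum>v\<in>V. a v * \<phi> v om)) = complex_of_real (exp (- (\<Sum>u\<in>V. \<Sum>v\<in>V. a u * a v * mgff_cov u v) / 2))"
 if "finite V" "V <= mX m" for V a using gff that XG unfolding metric_gff_def by (meson subset_trans)
 show "finite (mV m n :: (real^'n) set)" by (rule finite_mV)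
 show "mV m n <= (mX m :: (real^'n) set)" by (auto simp: mV_def)
 show "(mD n :: (real^'n) set) <= mV m n" by (rule mD_sub)
 show "(mD n :: (real^'n) set) ~= {}" by (rule mD_ne)
 show "mnb m v <= (mV m n :: (real^'n) set)" if "v : mV m n - mD n" for v using mnb_in_mV that by blast
qed

lemma latt_in_mV: "x : latt ==> linf x <= real n ==> x : mV m n"
 by (simp add: mV_def latt_in_mX)

lemma latt_step:
 assumes "x : latt" "linf x < real n" "\<bar>s\<bar> = 1"
 shows "x + axis i s : latt" "linf (x + axis i s) <= real n"
proof -
 have "s = 1 | s = - 1" using assms by linarith
 then show "x + axis i s : latt" using latt_axis(1)[OF assms(1)] by auto
 have "\<bar>x $ j\<bar> + 1 <= real n" for j
 using assms by (intro Ints_abs_less_Suc) (auto simp: latt_def linf_less_iff)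
 moreover have "\<bar>(x + axis i s) $ j\<bar> <= \<bar>x $ j\<bar> + 1" for j
 using abs_triangle_ineq[of "x $ j" s] assms(3) by (cases "j = i") auto
 ultimately have "\<bar>(x + axis i s) $ j\<bar> <= real n" for j by (meson order_trans)
 then show "linf (x + axis i s) <= real n" by (simp add: linf_le_iff)
qed

lemma signed_edge:
 fixes x :: "real^'n"
 assumes x: "x : latt" and k: "0 < k" "k < m" and s: "s = 1 | s = - 1"
 shows "mnb m (x + axis i (s * real k / real m)) = {x + axis i (s * real (k + 1) / real m), x + axis i (s * real (k - 1) / real m)}"
 "lap (mnb m) u (x + axis i (s * real k / real m)) =
 2 * u (x + axis i (s * real k / real m)) - u (x + axis i (s * real (k + 1) / real m)) - u (x + axis i (s * real (k - 1) / real m))"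
proof -
 have "mnb m (x + axis i (s * real k / real m)) = {x + axis i (s * real (k + 1) / real m), x + axis i (s * real (k - 1) / real m)} \<and>
 lap (mnb m) u (x + axis i (s * real k / real m)) =
 2 * u (x + axis i (s * real k / real m)) - u (x + axis i (s * real (k + 1) / real m)) - u (x + axis i (s * real (k - 1) / real m))"
 using s
 proof
 assume s: "s = 1"
 show ?thesis unfolding s mult_1 using mnb_edge[OF x k, of i] lap_edge[OF x k, of u i] by blast
 next
 assume s: "s = - 1"
 have x': "x - axis i 1 : latt" using latt_axis(2)[OF x, of 1 i] by simp
 have k': "0 < m - k" "m - k < m" using k by auto
 \<comment> \<open>An edge in a negative direction is the positive edge of its other endpoint, read
   backwards.\<close>
 have e: "x + axis i (s * real k / real m) = (x - axis i 1) + axis i (real (m - k) / real m)"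
 "x + axis i (s * real (k + 1) / real m) = (x - axis i 1) + axis i (real (m - k - 1) / real m)"
 "x + axis i (s * real (k - 1) / real m) = (x - axis i 1) + axis i (real (m - k + 1) / real m)"
 using k s by (auto simp: vec_eq_iff of_nat_diff field_simps)
 show ?thesis unfolding e mnb_edge[OF x' k'] lap_edge[OF x' k'] by auto
 qed
 then show "mnb m (x + axis i (s * real k / real m)) = {x + axis i (s * real (k + 1) / real m), x + axis i (s * real (k - 1) / real m)}"
 "lap (mnb m) u (x + axis i (s * real k / real m)) =
 2 * u (x + axis i (s * real k / real m)) - u (x + axis i (s * real (k + 1) / real m)) - u (x + axis i (s * real (k - 1) / real m))"
 by blast+
qed

lemma convex_sequence:
 fixes a :: "nat => real"
 assumes c: "!!k. 0 < k ==> k < m ==> 2 * a k - a (k + 1) - a (k - 1) <= 0"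
 shows "real m * (a 1 - a 0) <= a m - a 0"
proof -
 have inc: "a (k + 1) - a k >= a 1 - a 0" if "k < m" for k
 using that
 proof (induction k)
 case (Suc k)
 then show ?case using c[of "Suc k"] by simp
 qed simp
 have "real k * (a 1 - a 0) <= a k - a 0" if "k <= m" for k
 using that
 proof (induction k)
 case (Suc k)
 then show ?case using inc[of k] by (simp add: algebra_simps)
 qed simp
 then show ?thesis by simp
qed

text \<open>Subharmonicity on the mesh makes u convex along each of the 2d edges at x, so m times
  the first increment is at most the increment over the whole edge. Summing over the edges turns
  subharmonicity at x into the lattice inequality.\<close>

lemma avg_ge_of_lap:
 fixes x :: "real^'n"
 assumes x: "x : latt" and l0: "lap (mnb m) u x <= 0"
 and le: "!!i s k. s = 1 | s = - 1 ==> 0 < k ==> k < m ==> lap (mnb m) u (x + axis i (s * real k / real m)) <= 0"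
 shows "u x <= avg u x"
proof -
 have m0: "real m > 0" using m by simp
 have step: "real m * (u (x + axis i (s / real m)) - u x) <= u (x + axis i s) - u x" if s: "s = 1 | s = - 1" for i s
 proof -
 have "real m * (u (x + axis i (s * real 1 / real m)) - u (x + axis i (s * real 0 / real m))) <= u (x + axis i (s * real m / real m)) - u (x + axis i (s * real 0 / real m))"
 proof (rule convex_sequence)
 fix k assume k: "0 < k" "k < m"
 show "2 * u (x + axis i (s * real k / real m)) - u (x + axis i (s * real (k + 1) / real m)) - u (x + axis i (s * real (k - 1) / real m)) <= 0"
 using le[OF s k] unfolding signed_edge(2)[OF x k s] .
 qed
 then show ?thesis using m0 by simp
 qed
 have "(\<Sum>i\<in>UNIV. 2 * u x - u (x + axis i (1 / real m)) - u (x - axis i (1 / real m))) <= 0"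
 using l0 unfolding lap_latt[OF x] .
 then have "0 <= real m * - (\<Sum>i\<in>UNIV. 2 * u x - u (x + axis i (1 / real m)) - u (x - axis i (1 / real m)))" using m0 by (intro mult_nonneg_nonneg) simp_all
 also have "... = (\<Sum>i\<in>UNIV. real m * (u (x + axis i (1 / real m)) - u x) + real m * (u (x + axis i (- 1 / real m)) - u x))"
 unfolding sum_negf[symmetric] sum_distrib_left by (intro sum.cong refl) (simp add: algebra_simps axis_uminus)
 also have "... <= (\<Sum>i\<in>UNIV. (u (x + axis i 1) - u x) + (u (x + axis i (- 1)) - u x))"
 by (intro sum_mono add_mono step) auto
 also have "... = 2 * real CARD('n) * (avg u x - u x)"
 unfolding avg_def axis_uminus by (simp add: sum.distrib sum_subtractf field_simps)
 finally show ?thesis using d7 by (simp add: zero_le_mult_iff)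
qed

lemma star_in_box:
 fixes x :: "real^'n"
 assumes x: "x : latt" "linf x < real n" and s: "s = 1 | s = - 1" and k: "0 < k" "k < m"
 shows "x + axis i (s * real k / real m) : mV m n - mD n" "x + axis i (s * real k / real m) ~: latt"
proof -
 have q: "0 < real k / real m" "real k / real m < 1" using k by auto
 have ni: "a + s * real k / real m ~: \<int>" if "a : \<int>" for a
 using s
 proof
 assume "s = 1" then show ?thesis using not_Ints_frac[OF k that] by simp
 next
 assume "s = - 1"
 moreover have "- a + real k / real m ~: \<int>" using not_Ints_frac[OF k, of "- a"] that by simp
 ultimately show ?thesis using Ints_minus[of "a - real k / real m"] by auto
 qed
 show nl: "x + axis i (s * real k / real m) ~: latt"
 proof
 assume "x + axis i (s * real k / real m) : latt"
 then have "(x + axis i (s * real k / real m)) $ i : \<int>" unfolding latt_def by blast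
 then show False using ni[of "x $ i"] x by (simp add: latt_def)
 qed
 have "x + axis i (s * real k / real m) : mX m"
 proof -
 have "x + axis i (of_int (if s = 1 then int k else - int k) / real m) : mX m" by (rule edge_in_mX[OF x(1)])
 moreover have "of_int (if s = 1 then int k else - int k) / real m = s * real k / real m" using s by auto
 ultimately show ?thesis by simp
 qed
 moreover have "linf (x + axis i (s * real k / real m)) <= real n"
 proof -
 have a: "\<bar>s * real k / real m\<bar> <= 1" using s q by (auto simp: abs_mult)
 have "\<bar>x $ j\<bar> + 1 <= real n" for j using x by (intro Ints_abs_less_Suc) (auto simp: latt_def linf_less_iff)
 moreover have "\<bar>(x + axis i (s * real k / real m)) $ j\<bar> <= \<bar>x $ j\<bar> + 1" for j
 proof (cases "j = i")
 case True
 have "\<bar>x $ i + s * real k / real m\<bar> <= \<bar>x $ i\<bar> + 1" using abs_triangle_ineq[of "x $ i" "s * real k / real m"] a by linarith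
 then show ?thesis using True by simp
 qed simp
 ultimately have "\<bar>(x + axis i (s * real k / real m)) $ j\<bar> <= real n" for j by (meson order_trans)
 then show ?thesis by (simp add: linf_le_iff)
 qed
 ultimately show "x + axis i (s * real k / real m) : mV m n - mD n" using nl by (simp add: mV_def mD_def)
qed

lemma U2_subharmonic:
 fixes x :: "real^'n"
 assumes x: "x : latt" "linf x < real n"
 shows "U2 f x <= avg (U2 f) x"
proof (rule avg_ge_of_lap[OF x(1)])
 have "x : mV m n - mD n" using x latt_in_mV[of x] by (simp add: mD_def)
 then show "lap (mnb m) (U2 f) x <= 0" by (rule lap_U2_le)
 show "lap (mnb m) (U2 f) (x + axis i (s * real k / real m)) <= 0" if "s = 1 | s = - 1" "0 < k" "k < m" for i s k
 by (rule lap_U2_le[OF star_in_box(1)[OF x that]])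
qed

section \<open>Mesh clusters seen from the lattice\<close>

definition RR :: "(real^'n) set => ((real^'n) \<times> (real^'n)) set" where
 "RR P = {(w, w'). w : latt & w' : latt & (EX i s. (s = 1 | s = - 1) & w' = w + axis i s & (ALL l<=m. w + axis i (s * real l / real m) : P))}"

definition on_spur :: "(real^'n) set => real^'n => real^'n => bool" where
 "on_spur P w c \<longleftrightarrow> (EX s i j. (s = 1 | s = - 1) & j < m & c = w + axis i (s * real j / real m) & (ALL l<=j. w + axis i (s * real l / real m) : cl P))"

text \<open>The cluster grows along edges, so it consists of fully traversed edges attached to D and
  of partial edges hanging from them. The induction keeps track of the partial edge leading to c and
  turns it into a full one when depth m is reached.\<close>

lemma cl_spur:
 fixes c :: "real^'n"
 assumes "c : cl P"
 shows "\<exists>w\<in>latt. w : cl P & on_spur P w c & (\<exists>z\<in>mD n. (z, w) : (RR P)\<^sup>*)"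
 using assms
proof induction
 case (cl_base z)
 have z: "z : latt" "z : cl P" using cl_base cl.cl_base[OF cl_base] by (simp_all add: mD_def)
 have "on_spur P z z" unfolding on_spur_def using z m by (intro exI[of _ 1] exI[of _ undefined] exI[of _ 0]) auto
 then show ?case using z cl_base by blast
next
 case (cl_step c c')
 have c': "c' : cl P" by (rule cl.cl_step) (use cl_step in auto)
 have "c' : mX m" using cl_step(3) by (simp add: mV_def)
 then have nb: "c' : mnb m c" using mnb_props(4) cl_step(4) by blast
 obtain w z where w: "w : latt" "w : cl P" and sp: "on_spur P w c" and z: "z : mD n" "(z, w) : (RR P)\<^sup>*" using cl_step.IH by blast
 obtain s i j where s: "s = 1 | s = - 1" and j: "j < m" and c: "c = w + axis i (s * real j / real m)" and on: "!!l. l <= j ==> w + axis i (s * real l / real m) : cl P"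
 using sp unfolding on_spur_def by blast
 show ?case
 proof (cases "j = 0")
 case True
 then have "c = w" using c by simp
 then obtain i' s' where s': "s' = 1 | s' = - 1" "c' = w + axis i' (s' * real 1 / real m)"
 using nb unfolding mnb_def axis_uminus by fastforce
 have "on_spur P w c'" unfolding on_spur_def
 proof (intro exI conjI)
 show "s' = 1 | s' = - 1" "c' = w + axis i' (s' * real 1 / real m)" by (rule s')+
 show "1 < m" using m by simp
 show "ALL l<=1. w + axis i' (s' * real l / real m) : cl P"
 proof (intro allI impI)
 fix l :: nat assume "l <= 1"
 then have "l = 0 | l = 1" by linarith
 then show "w + axis i' (s' * real l / real m) : cl P" using w c' s' by auto
 qed
 qed
 then show ?thesis using w z by blast
 next
 case False
 then have j0: "0 < j" by simp
 have "c' = w + axis i (s * real (j + 1) / real m) | c' = w + axis i (s * real (j - 1) / real m)"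
 using nb unfolding c signed_edge(1)[OF w(1) j0 j s] by blast
 then show ?thesis
 proof
 assume a: "c' = w + axis i (s * real (j - 1) / real m)"
 have "on_spur P w c'" unfolding on_spur_def
 by (intro exI[of _ s] exI[of _ i] exI[of _ "j - 1"] conjI s a) (use j on in auto)
 then show ?thesis using w z by blast
 next
 assume a: "c' = w + axis i (s * real (j + 1) / real m)"
 have on': "w + axis i (s * real l / real m) : cl P" if "l <= j + 1" for l
 proof (cases "l <= j")
 case False
 then have "l = j + 1" using that by simp
 then show ?thesis using a c' by simp
 qed (rule on)
 show ?thesis
 proof (cases "j + 1 < m")
 case True
 have "on_spur P w c'" unfolding on_spur_def
 by (intro exI[of _ s] exI[of _ i] exI[of _ "j + 1"] conjI s a True allI impI on')
 then show ?thesis using w z by blast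
 next
 case False
 then have jm: "j + 1 = m" using j by simp
 have a': "c' = w + axis i s" using a m unfolding jm by simp
 have l: "c' : latt" unfolding a' using s latt_axis(1)[OF w(1)] by auto
 have "ALL l<=m. w + axis i (s * real l / real m) : P"
 proof (intro allI impI)
 fix l assume "l <= m"
 then show "w + axis i (s * real l / real m) : P" using on'[of l] cl_sub[of P] jm by blast
 qed
 then have "(w, c') : RR P" unfolding RR_def using w l s a' by blast
 then have "(z, c') : (RR P)\<^sup>*" using z by (meson rtrancl.rtrancl_into_rtrancl)
 moreover have "on_spur P c' c'" unfolding on_spur_def using c' m by (intro exI[of _ 1] exI[of _ undefined] exI[of _ 0]) auto
 ultimately show ?thesis using l c' z by blast
 qed
 qed
 qed
qed

lemma cl_near_latt:
 fixes c :: "real^'n"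
 assumes "c : cl P"
 obtains w where "w : latt" "w : cl P" "norm (w - c) < 1"
proof -
 obtain w where w: "w : latt" "w : cl P" and sp: "on_spur P w c" using cl_spur[OF assms] by blast
 then obtain s i j where s: "s = 1 | s = - 1" and j: "j < m" and c: "c = w + axis i (s * real j / real m)"
 unfolding on_spur_def by blast
 have "norm (w - c) = \<bar>s * real j / real m\<bar>" unfolding c using norm_axis_real[of i "s * real j / real m"] by (simp add: norm_minus_commute[of w])
 also have "... < 1" using s j by (auto simp: abs_mult)
 finally show ?thesis using that w by blast
qed

lemma latt_near_edge:
 fixes x w :: "real^'n"
 assumes x: "x : latt" and w: "w : latt" and s: "s = 1 | s = - 1" and k: "k <= m"
 and d: "norm (w - (x + axis i (s * real k / real m))) < 1"
 shows "w = x | w = x + axis i s"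
proof -
 let ?c = "x + axis i (s * real k / real m)"
 have q: "0 <= real k / real m" "real k / real m <= 1" using k by (rule fraction_bounds)+
 have dj: "\<bar>w $ j - ?c $ j\<bar> < 1" for j
 using component_le_norm_cart[of "w - ?c" j] d by simp
 have o: "w $ j = x $ j" if "j ~= i" for j using dj[of j] that x w by (intro Ints_abs_less_1_eq) (auto simp: latt_def)
 have "w $ i : \<int>" "x $ i : \<int>" using x w by (auto simp: latt_def)
 then obtain a b where ab: "w $ i = of_int a" "x $ i = of_int b" by (elim Ints_cases)
 have "\<bar>of_int a - (of_int b + s * (real k / real m))\<bar> < 1" using dj[of i] ab by simp
 then have "a = b | real_of_int a = of_int b + s"
 using s
 proof (elim disjE)
 assume "s = 1" "\<bar>of_int a - (of_int b + s * (real k / real m))\<bar> < 1"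
 then have "\<bar>of_int a - (of_int b + real k / real m)\<bar> < 1" by simp
 then have "real_of_int a - of_int b < 2" "real_of_int a - of_int b > - 1" using q by linarith+
 then have "a = b | a = b + 1" by linarith
 then show ?thesis using \<open>s = 1\<close> by auto
 next
 assume "s = - 1" "\<bar>of_int a - (of_int b + s * (real k / real m))\<bar> < 1"
 then have "\<bar>of_int a - (of_int b - real k / real m)\<bar> < 1" by simp
 then have "real_of_int a - of_int b < 1" "real_of_int a - of_int b > - 2" using q by linarith+
 then have "a = b | a = b - 1" by linarith
 then show ?thesis using \<open>s = - 1\<close> by auto
 qed
 then have "w $ i = x $ i | w $ i = x $ i + s" using ab by auto
 then show ?thesis
 proof
 assume "w $ i = x $ i"
 then have "w $ j = x $ j" for j using o by (cases "j = i") auto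
 then show ?thesis by (simp add: vec_eq_iff)
 next
 assume "w $ i = x $ i + s"
 then have "w $ j = (x + axis i s) $ j" for j using o by (cases "j = i") auto
 then have "w = x + axis i s" unfolding vec_eq_iff by blast
 then show ?thesis ..
 qed
qed

definition near_cl :: "real^'n => (real^'n) set => bool" where
 "near_cl x P \<longleftrightarrow> x : cl P | (EX i. x + axis i 1 : cl P | x + axis i (- 1) : cl P)"

text \<open>A cluster vertex on the closed star of x would have a lattice cluster vertex at distance
  less than 1, which could only be x or one of its neighbours.\<close>

lemma far_from_cl:
 fixes x :: "real^'n"
 assumes x: "x : latt" "linf x < real n" and far: "~ near_cl x P"
 shows "x ~: Sc P" "s = 1 | s = - 1 ==> 0 < k ==> k < m ==> x + axis i (s * real k / real m) ~: Sc P"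
proof -
 have nc: "x + axis i (s * real k / real m) ~: cl P" if s: "s = 1 | s = - 1" and k: "k <= m" for s i k
 proof
 assume c: "x + axis i (s * real k / real m) : cl P"
 obtain w where w: "w : latt" "w : cl P" "norm (w - (x + axis i (s * real k / real m))) < 1" by (rule cl_near_latt[OF c])
 have "w = x | w = x + axis i s" by (rule latt_near_edge[OF x(1) w(1) s k w(3)])
 then show False using w(2) far s unfolding near_cl_def by blast
 qed
 have m1: "1 <= m" using m by simp
 have x0: "x ~: cl P" using far by (simp add: near_cl_def)
 have xD: "x ~: mD n" using x by (simp add: mD_def)
 show "x ~: Sc P"
 proof
 assume "x : Sc P"
 then obtain c where "c : mnb m x" "c : cl P" using x0 xD unfolding Sc_def Kc_def by blast
 then show False using nc[of 1 1] nc[of "- 1" 1] m1 unfolding mnb_latt[OF x(1)] axis_uminus by auto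
 qed
 assume s: "s = 1 | s = - 1" and k: "0 < k" "k < m"
 show "x + axis i (s * real k / real m) ~: Sc P"
 proof
 assume "x + axis i (s * real k / real m) : Sc P"
 then obtain c where "c : mnb m (x + axis i (s * real k / real m))" "c : cl P"
 using nc[OF s, of k i] star_in_box(1)[OF x s k, of i] k unfolding Sc_def Kc_def by auto
 then show False using nc[OF s, of "k + 1" i] nc[OF s, of "k - 1" i] k unfolding signed_edge(1)[OF x(1) k s] by auto
 qed
qed

text \<open>When the cluster avoids x and its lattice neighbours, the exploration misses the whole
  open star of x, so \<open>U2\<close> is mesh harmonic there and \<open>avg_ge_of_lap\<close>
  applies to both signs.\<close>

lemma U2_harmonic:
 fixes x :: "real^'n"
 assumes x: "x : latt" "linf x < real n" and far: "~ near_cl x (pos f)"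
 shows "U2 f x = avg (U2 f) x"
proof -
 have 0: "lap (mnb m) (U2 f) v = 0" if "v : mV m n" "v ~: Sc (pos f)" for v
 using that by (intro lap_U2) (auto simp: mV_def)
 have 1: "lap (mnb m) (U2 f) x = 0" using 0[OF latt_in_mV far_from_cl(1)[OF x far]] x by simp
 have 2: "lap (mnb m) (U2 f) (x + axis i (s * real k / real m)) = 0" if "s = 1 | s = - 1" "0 < k" "k < m" for i s k
 using 0[OF _ far_from_cl(2)[OF x far that]] star_in_box(1)[OF x that] by blast
 have neg: "lap (mnb m) (%v. - U2 f v) v = - lap (mnb m) (U2 f) v" for v by (simp add: lap_def sum_negf[symmetric])
 have "- U2 f x <= avg (%v. - U2 f v) x"
 by (rule avg_ge_of_lap[OF x(1)]) (use 1 2 neg in \<open>simp_all del: of_nat_mult\<close>)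
 moreover have "avg (%v. - U2 f v) x = - avg (U2 f) x" using avg_cmult[of "- 1" "U2 f" x] by simp
 ultimately show ?thesis using U2_subharmonic[OF x, of f] by linarith
qed

lemma card_mV: "real (card (mV m n :: (real^'n) set)) <= real CARD('n) * real m * real (card {x::real^'n. x : latt & linf x <= real n + 1})"
proof -
 let ?B = "{x::real^'n. x : latt & linf x <= real n + 1}"
 have "(mV m n :: (real^'n) set) <= (%(x, i, k). x + axis i (real k / real m)) ` (?B \<times> UNIV \<times> {..<m})"
 proof
 fix v :: "real^'n" assume v: "v : mV m n"
 then have vX: "v : mX m" by (simp add: mV_def)
 obtain x i k where x: "x : latt" "k < m" "v = x + axis i (real k / real m)" by (rule mX_cases[OF vX])
 have "\<bar>x $ j\<bar> <= real n + 1" for j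
 proof -
 have a: "\<bar>v $ j\<bar> <= real n" using v by (simp add: mV_def linf_le_iff)
 have "0 <= real k / real m" "real k / real m <= 1" using x(2) by (auto intro!: fraction_bounds)
 then have "\<bar>v $ j - x $ j\<bar> <= 1" unfolding x(3) by simp
 then show ?thesis using a by linarith
 qed
 then have "linf x <= real n + 1" by (simp add: linf_le_iff)
 then show "v : (%(x, i, k). x + axis i (real k / real m)) ` (?B \<times> UNIV \<times> {..<m})"
 using x by (intro image_eqI[of _ _ "(x, i, k)"]) auto
 qed
 moreover have fin: "finite (?B \<times> (UNIV :: 'n set) \<times> {..<m})" by (intro finite_cartesian_product finite_latt_box) auto
 ultimately have "card (mV m n :: (real^'n) set) <= card (?B \<times> (UNIV :: 'n set) \<times> {..<m})" by (rule surj_card_le[rotated])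
 also have "... = card ?B * (CARD('n) * m)" by (simp add: card_cartesian_product)
 finally have "real (card (mV m n :: (real^'n) set)) <= real (card ?B * (CARD('n) * m))" by (rule of_nat_mono)
 then show ?thesis by (simp add: algebra_simps)
qed

text \<open>96 = 12 * 2^2 * 2 arises from the fourth moment bound 12 \<kappa>^2 with \<kappa> = 2d/m
  and 2d neighbours for each of at most d m b mesh vertices, b being the number of lattice points in
  the enlarged box; one factor 1/m survives.\<close>

lemma osc_small:
 assumes e: "ep > 0" and ml: "96 * real CARD('n) ^ 4 * real (card {x::real^'n. x : latt & linf x <= real n + 1}) / ep ^ 4 <= real m"
 shows "EE (%f. (osc f)\<^sup>2) <= ep\<^sup>2"
proof -
 let ?d = "real CARD('n)" and ?b = "real (card {x::real^'n. x : latt & linf x <= real n + 1})"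
 have m0: "real m > 0" using m by simp
 have "(\<Sum>v\<in>mV m n. real (card (mnb m (v::real^'n)))) <= (\<Sum>v\<in>(mV m n :: (real^'n) set). 2 * ?d)"
 proof (rule sum_mono)
 fix v :: "real^'n" assume "v : mV m n"
 then have "card (mnb m v) <= 2 * CARD('n)" by (intro mnb_props) (simp add: mV_def)
 then have "real (card (mnb m v)) <= real (2 * CARD('n))" by (rule of_nat_mono)
 then show "real (card (mnb m v)) <= 2 * ?d" by simp
 qed
 also have "... = real (card (mV m n :: (real^'n) set)) * (2 * ?d)" by simp
 also have "... <= (?d * real m * ?b) * (2 * ?d)" by (intro mult_right_mono card_mV) simp
 finally have s: "(\<Sum>v\<in>mV m n. real (card (mnb m (v::real^'n)))) <= (?d * real m * ?b) * (2 * ?d)" .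
 have "EE (%f. osc f ^ 4) <= 12 * (2 * ?d / real m)\<^sup>2 * ((?d * real m * ?b) * (2 * ?d))"
 by (rule order_trans[OF expectation_osc4(2)]) (intro mult_left_mono s, simp)
 also have "... = 96 * ?d ^ 4 * ?b / real m" using m0 by (simp add: power2_eq_square power4_eq_xxxx field_simps)
 also have "... <= ep ^ 4" using ml e m0 by (simp add: field_simps)
 finally have o4: "EE (%f. osc f ^ 4) <= ep ^ 4" .
 have "EE (%f. (osc f)\<^sup>2) <= EE (%f. (osc f ^ 4 / ep\<^sup>2 + ep\<^sup>2) / 2)"
 proof (rule integral_mono)
 show "integrable M (%om. (osc (res (mV m n) om))\<^sup>2)" using L2_osc by (simp add: L2_def)
 show "integrable M (%om. (osc (res (mV m n) om) ^ 4 / ep\<^sup>2 + ep\<^sup>2) / 2)" using expectation_osc4(1) by simp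
 fix om
 let ?o = "(osc (res (mV m n) om))\<^sup>2"
 have "0 <= (?o - ep\<^sup>2)\<^sup>2" by simp
 then have "2 * ?o * ep\<^sup>2 <= ?o\<^sup>2 + ep\<^sup>2 * ep\<^sup>2" by (simp add: power2_diff power2_eq_square[of "ep\<^sup>2"] algebra_simps)
 moreover have "?o\<^sup>2 = osc (res (mV m n) om) ^ 4" by (simp flip: power_mult)
 ultimately show "?o <= (osc (res (mV m n) om) ^ 4 / ep\<^sup>2 + ep\<^sup>2) / 2" using e by (simp add: field_simps)
 qed
 also have "... = (EE (%f. osc f ^ 4) / ep\<^sup>2 + ep\<^sup>2) / 2" using expectation_osc4(1) by (simp add: prob_space)
 also have "... <= ep\<^sup>2"
 proof -
 have "EE (%f. osc f ^ 4) / ep\<^sup>2 <= ep ^ 4 / ep\<^sup>2" using o4 e by (intro divide_right_mono) auto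
 also have "... = ep\<^sup>2" using e by (simp add: power2_eq_square power4_eq_xxxx)
 finally show ?thesis by simp
 qed
 finally show ?thesis .
qed

end

section \<open>Two-point and second-moment estimates\<close>

lemma avg_mono_neighbours:
 fixes u w :: "real^'n => real"
 assumes "!!i. u (x + axis i 1) <= w (x + axis i 1)" "!!i. u (x - axis i 1) <= w (x - axis i 1)"
 shows "avg u x <= avg w x"
 unfolding avg_def by (intro divide_right_mono sum_mono add_mono assms) simp

lemma norm_latt_nb:
 fixes x w :: "real^'n"
 assumes "norm (w - (x + axis i s)) <= r" "\<bar>s\<bar> = 1"
 shows "norm (w - x) <= r + 1"
proof -
 have "norm (w - x) <= norm (w - (x + axis i s)) + norm (axis i s :: real^'n)"
 using norm_triangle_ineq[of "w - (x + axis i s)" "axis i s"] by simp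
 then show ?thesis using assms norm_axis_real[of i s] by simp
qed

lemma latt_neighbours: "x : latt ==> x + axis i 1 : latt" "x : latt ==> x - axis i 1 : latt"
 using latt_axis[of x 1 i] by simp_all

lemma avg_power_mono:
 fixes u w :: "real^'n => real"
 assumes "x : latt" "!!v. v : latt ==> norm (v - x) <= real k ==> u v <= w v"
 shows "(avg ^^ k) u x <= (avg ^^ k) w x"
 using assms
proof (induction k arbitrary: x)
 case (Suc k)
 have nb: "(avg ^^ k) u (x + axis i s) <= (avg ^^ k) w (x + axis i s)" if s: "s = 1 | s = - 1" for i s
 proof (rule Suc.IH)
 show "x + axis i s : latt" using latt_axis(1)[OF Suc.prems(1)] s by auto
 fix v :: "real^'n" assume "v : latt" "norm (v - (x + axis i s)) <= real k"
 then show "u v <= w v" using norm_latt_nb[of v x i s "real k"] s by (intro Suc.prems(2)) auto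
 qed
 have e: "x - axis i 1 = x + axis i (- 1)" for i by (simp add: vec_eq_iff)
 have "avg ((avg ^^ k) u) x <= avg ((avg ^^ k) w) x"
 by (rule avg_mono_neighbours) (use nb in \<open>simp_all only: e simp_thms\<close>)
 then show ?case by simp
qed simp

lemma avg_power_nonneg:
 fixes u :: "real^'n => real"
 assumes "x : latt" "!!v. v : latt ==> norm (v - x) <= real k ==> 0 <= u v"
 shows "0 <= (avg ^^ k) u x"
proof -
 have z: "(avg ^^ k) (%v. 0) x = (0::real)" for x :: "real^'n"
 proof (induction k arbitrary: x)
 case (Suc k)
 then have "(avg ^^ k) (%v::real^'n. 0) = (%v. 0::real)" by (simp add: fun_eq_iff)
 then show ?case by (simp add: avg_const)
 qed simp
 then show ?thesis using avg_power_mono[OF assms(1), of k "%v. 0" u] assms(2) by simp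
qed

lemma avg_power_le_avg_power_Suc:
 fixes u :: "real^'n => real"
 assumes "x : latt" "!!v. v : latt ==> norm (v - x) <= real k ==> u v <= avg u v"
 shows "(avg ^^ k) u x <= (avg ^^ Suc k) u x"
proof -
 have "(avg ^^ k) u x <= (avg ^^ k) (avg u) x" by (rule avg_power_mono[OF assms])
 then show ?thesis by (simp only: funpow_Suc_right o_apply)
qed

lemma le_avg_power:
 fixes u :: "real^'n => real"
 assumes x: "x : latt" and u: "!!v. v : latt ==> norm (v - x) <= real k ==> u v <= avg u v"
 shows "j <= k ==> u x <= (avg ^^ j) u x"
proof (induction j)
 case (Suc j)
 have "(avg ^^ j) u x <= (avg ^^ Suc j) u x"
 proof (rule avg_power_le_avg_power_Suc[OF x])
 fix v :: "real^'n" assume v: "v : latt" "norm (v - x) <= real j"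
 then show "u v <= avg u v" using Suc.prems by (intro u) auto
 qed
 then show ?case using Suc by simp
qed simp

text \<open>The Harnack inequality that holds when the walk can go from x to y in exactly k steps,
  since any such path has probability (2d)^(-k).\<close>

definition reaches :: "nat => real^'n => real^'n => bool" where
 "reaches k x y \<longleftrightarrow> (ALL F. (\<forall>v\<in>latt. (0::real) <= F v) \<longrightarrow> F y <= (2 * real CARD('n)) ^ k * (avg ^^ k) F x)"

definition c0 :: real where "c0 = (\<integral>z. max 0 z \<partial>std_normal)"

definition cn :: real where "cn = measure std_normal {..<0}"

lemma c0_pos: "c0 > 0" and cn: "0 < cn" "cn <= 1"
proof -
 interpret S: prob_space std_normal by (rule prob_space_normal_density) simp
 show "c0 > 0" unfolding c0_def by (rule S.std_normal_half_moments)
 show "0 < cn" unfolding cn_def by (rule S.std_normal_half_moments)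
 show "cn <= 1" unfolding cn_def by (rule S.prob_le_1)
qed

locale mesh_est = mesh_box m ty M \<phi> n
 for m :: nat and ty :: "'n::finite itself" and M :: "'w measure" and \<phi> :: "real^'n => 'w => real" and n :: nat +
 fixes K C ep d2 b2 :: real
 assumes d2_def: "d2 = 2 * real CARD('n)"
 and b2_def: "b2 = real (card {w::real^'n. w : latt & norm (w - 0) <= 2})"
 and KC: "K >= 1" "C >= 1"
 and G: "!!x y::real^'n. green x y <= C * fdec K (12/5) (x - y)"
 and GG: "!!F (x::real^'n) y. finite F ==> (\<Sum>v\<in>F. green x v * green v y) <= C * fdec K (7/5) (x - y)"
 and GGG: "!!F F' (x::real^'n) y. finite F ==> finite F' ==> (\<Sum>v\<in>F. \<Sum>w\<in>F'. green x v * green v w * green w y) <= C * fdec K (2/5) (x - y)"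
 and eps: "0 < ep" "ep <= 1" and osc_eps: "EE (%f. (osc f)\<^sup>2) <= ep\<^sup>2"
begin

lemma d2_ge: "d2 >= 1" unfolding d2_def using d7 by simp

definition cell :: "real^'n => (real^'n) set" where "cell v = {z. ncell z = v}"

definition hit :: "real^'n => (real^'n) set => real" where
 "hit v A = (if A Int cell v ~= {} then 1 else 0)"

definition \<Gamma> :: "real^'n => real" where "\<Gamma> v = EE (%f. hit v (Sc (pos f)))"

lemma hit_nonneg: "0 <= hit v A" by (simp add: hit_def)

lemma cov_latt:
 fixes x :: "real^'n"
 shows "x : latt ==> y : latt ==> mgff_cov x y = green x y"
 using mgff_cov_latt[of x y 0 undefined] by simp

lemma green_pos: "0 <= green x (y::real^'n)" by (rule green_nonneg[OF d7])

lemma cov_nonneg: "x : mX m ==> y : mX m ==> 0 <= mgff_cov x (y::real^'n)" by (rule g_nonneg)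

lemma subV: "A <= mV m n ==> finite (A :: (real^'n) set)" "A <= mV m n ==> A <= (mX m :: (real^'n) set)"
proof -
 show "A <= mV m n ==> finite A" for A :: "(real^'n) set" by (rule finite_subset[OF _ finite_mV])
 show "A <= mV m n ==> A <= mX m" for A :: "(real^'n) set" by (auto simp: mV_def)
qed

lemma ncell_cov: "v : mX m ==> w : latt ==> mgff_cov v w <= d2 * green (ncell v) (w::real^'n)"
 unfolding d2_def by (rule ncell(3))

text \<open>On the cell of v the covariance with v is at least 1/2. Hence the harmonic measure of
  the cell is at most twice the harmonic average of that covariance, which superharmonicity bounds
  by its value at x.\<close>

lemma cell_hm:
 assumes A: "A <= mV m n" and x: "x : mX m" and v: "v : latt"
 shows "(\<Sum>z\<in>A. if ncell z = v then hm A x z else 0) <= hit v A * (2 * mgff_cov x v)"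
proof (cases "A Int cell v = {}")
 case True
 then have "!!z. z : A ==> ncell z ~= v" by (auto simp: cell_def)
 then show ?thesis using True by (simp add: hit_def)
next
 case False
 note AX = subV[OF A]
 have vX: "v : mX m" by (rule latt_in_mX[OF v])
 have "(\<Sum>z\<in>A. if ncell z = v then hm A x z else 0) <= (\<Sum>z\<in>A. 2 * (hm A x z * mgff_cov z v))"
 proof (rule sum_mono)
 fix z assume z: "z : A"
 have zX: "z : mX m" using z AX by blast
 have h: "0 <= hm A x z" by (rule hm_nonneg[OF AX x])
 show "(if ncell z = v then hm A x z else 0) <= 2 * (hm A x z * mgff_cov z v)"
 proof (cases "ncell z = v")
 case True
 then have "1/2 <= mgff_cov z v" using ncell(4)[OF zX] by simp
 from mult_left_mono[OF this h] show ?thesis using True by simp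
 next
 case False
 then show ?thesis using h cov_nonneg[OF zX vX] by simp
 qed
 qed
 also have "... = 2 * (\<Sum>z\<in>A. hm A x z * mgff_cov z v)" by (simp add: sum_distrib_left)
 also have "... <= 2 * mgff_cov x v" using hm_g_le[OF AX x vX] by simp
 finally show ?thesis using False by (simp add: hit_def)
qed

text \<open>Sums over explored mesh points, whose number grows with m, become sums over the lattice
  cells that are met, with constants independent of m. Cells outside the finite set N are charged to
  dl.\<close>

lemma cell_split:
 assumes A: "A <= mV m n" and x: "x : mX m" and N: "finite N" "N <= latt"
 and F: "!!z. z : A ==> F z <= dl + (if ncell z : N then \<Phi> (ncell z) else 0)"
 and nn: "0 <= dl" "!!v. 0 <= \<Phi> v"
 shows "(\<Sum>z\<in>A. hm A x z * F z) <= dl + (\<Sum>v\<in>N. hit v A * (2 * mgff_cov x v * \<Phi> v))"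
proof -
 note AX = subV[OF A]
 have "(\<Sum>z\<in>A. hm A x z * F z) <= (\<Sum>z\<in>A. dl * hm A x z + (\<Sum>v\<in>N. \<Phi> v * (if ncell z = v then hm A x z else 0)))"
 proof (rule sum_mono)
 fix z assume z: "z : A"
 have "hm A x z * F z <= hm A x z * (dl + (if ncell z : N then \<Phi> (ncell z) else 0))"
 by (rule mult_left_mono[OF F[OF z] hm_nonneg[OF AX x]])
 also have "... = dl * hm A x z + (if ncell z : N then \<Phi> (ncell z) * hm A x z else 0)" by (simp add: algebra_simps)
 also have "(if ncell z : N then \<Phi> (ncell z) * hm A x z else 0) = (\<Sum>v\<in>N. if ncell z = v then \<Phi> v * hm A x z else 0)"
 using N(1) by simp
 also have "... = (\<Sum>v\<in>N. \<Phi> v * (if ncell z = v then hm A x z else 0))" by (intro sum.cong) auto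
 finally show "hm A x z * F z <= dl * hm A x z + (\<Sum>v\<in>N. \<Phi> v * (if ncell z = v then hm A x z else 0))" .
 qed
 also have "... = dl * (\<Sum>z\<in>A. hm A x z) + (\<Sum>v\<in>N. \<Phi> v * (\<Sum>z\<in>A. if ncell z = v then hm A x z else 0))"
 unfolding sum.distrib sum_distrib_left by (simp add: sum.swap[of _ A])
 also have "... <= dl * 1 + (\<Sum>v\<in>N. \<Phi> v * (hit v A * (2 * mgff_cov x v)))"
 using N(2) by (intro add_mono mult_left_mono sum_mono sum_hm_le_1[OF AX x] cell_hm[OF A x] nn) auto
 finally show ?thesis by (simp add: algebra_simps)
qed

text \<open>In the factor 4 d2^2 each of the two harmonic measures costs 2 by
  \<open>cell_hm\<close>, and each of the two passages from a mesh point to its cell costs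
  d2.\<close>

lemma double_hm_bound:
 assumes A: "A <= mV m n" and B: "B <= mV m n" and x: "x : latt" and y: "y : latt"
 and N: "finite N" "N <= latt" and dl: "0 <= dl" "!!v. v : latt - N ==> d2 * green v y <= dl"
 shows "(\<Sum>z\<in>A. hm A x z * (\<Sum>w\<in>B. hm B z w * mgff_cov w y)) <=
 dl + (\<Sum>v\<in>N. \<Sum>w\<in>N. (hit v A * hit w B) * (4 * d2\<^sup>2 * (green x v * green v w * green w y)))"
proof -
 note AX = subV[OF A] and BX = subV[OF B]
 have xX: "x : mX m" and yX: "y : mX m" using x y by (auto intro: latt_in_mX)
 define \<Psi> where "\<Psi> v = (\<Sum>w\<in>N. hit w B * (2 * (d2 * green v w) * (d2 * green w y)))" for v
 have \<Psi>0: "0 <= \<Psi> v" for v unfolding \<Psi>_def using d2_ge by (intro sum_nonneg mult_nonneg_nonneg hit_nonneg green_pos) auto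
 have far: "mgff_cov z y <= dl" if z: "z : mX m" "ncell z ~: N" for z
 using ncell_cov[OF z(1) y] dl(2)[of "ncell z"] ncell(1)[OF z(1)] z(2) by auto
 have inner: "(\<Sum>w\<in>B. hm B z w * mgff_cov w y) <= dl + (if ncell z : N then \<Psi> (ncell z) else 0)" if z: "z : A" for z
 proof -
 have zX: "z : mX m" using z AX by blast
 show ?thesis
 proof (cases "ncell z : N")
 case False
 have "(\<Sum>w\<in>B. hm B z w * mgff_cov w y) <= mgff_cov z y" by (rule hm_g_le[OF BX zX yX])
 also have "... <= dl" by (rule far[OF zX False])
 finally show ?thesis using False by simp
 next
 case True
 have "(\<Sum>w\<in>B. hm B z w * mgff_cov w y) <= dl + (\<Sum>w\<in>N. hit w B * (2 * mgff_cov z w * (d2 * green w y)))"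
 proof (rule cell_split[OF B zX N _ dl(1)])
 fix w assume "w : B"
 then have wX: "w : mX m" using BX by blast
 show "mgff_cov w y <= dl + (if ncell w : N then d2 * green (ncell w) y else 0)"
 using far[OF wX] ncell_cov[OF wX y] dl(1) by auto
 next
 show "0 <= d2 * green v y" for v using green_pos d2_ge by simp
 qed
 also have "... <= dl + \<Psi> (ncell z)" unfolding \<Psi>_def
 proof (intro add_left_mono sum_mono mult_left_mono mult_right_mono hit_nonneg)
 fix w assume "w : N"
 then show "mgff_cov z w <= d2 * green (ncell z) w" using ncell_cov[OF zX] N(2) by blast
 qed (use green_pos d2_ge in simp_all)
 finally show ?thesis using True by simp
 qed
 qed
 have "(\<Sum>z\<in>A. hm A x z * (\<Sum>w\<in>B. hm B z w * mgff_cov w y)) <= dl + (\<Sum>v\<in>N. hit v A * (2 * mgff_cov x v * \<Psi> v))"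
 by (rule cell_split[OF A xX N inner dl(1) \<Psi>0])
 also have "(\<Sum>v\<in>N. hit v A * (2 * mgff_cov x v * \<Psi> v)) = (\<Sum>v\<in>N. \<Sum>w\<in>N. (hit v A * hit w B) * (4 * d2\<^sup>2 * (green x v * green v w * green w y)))"
 proof (rule sum.cong[OF refl])
 fix v assume "v : N"
 then have "mgff_cov x v = green x v" using N(2) cov_latt[OF x] by blast
 then show "hit v A * (2 * mgff_cov x v * \<Psi> v) = (\<Sum>w\<in>N. (hit v A * hit w B) * (4 * d2\<^sup>2 * (green x v * green v w * green w y)))"
 unfolding \<Psi>_def sum_distrib_left by (intro sum.cong refl) (simp add: power2_eq_square)
 qed
 finally show ?thesis .
qed

lemma L2_hit: "L2 (%f. hit v (Sc (pos f)))" "L2 (%f. hit v (Sc (neg f)))"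
 unfolding hit_def using L2_event[of "%P Q. Sc P Int cell v ~= {}"] L2_event[of "%P Q. Sc Q Int cell v ~= {}"] .

lemma hit_pair: "EE (%f. hit v (Sc (pos f)) * hit w (Sc (neg f))) <= \<Gamma> v * \<Gamma> w"
 unfolding \<Gamma>_def hit_def by (rule hit_negative_correlation)

lemma \<Gamma>_nonneg: "0 <= \<Gamma> v" unfolding \<Gamma>_def by (intro Bochner_Integration.integral_nonneg hit_nonneg)

text \<open>To meet both explored sets the walk passes a cell v met by one of them and then a cell w
  met by the other. Negative correlation bounds the probability of such a pair by gm^2, and the
  three Green factors are summed by the triple convolution. The two orders double the constant to
  8.\<close>

lemma K2_bound:
 assumes x: "x : latt" and y: "y : latt"
 and N: "finite N" "N <= latt" and dl: "0 <= dl" "!!v. v : latt - N ==> d2 * green v y <= dl"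
 and gm: "!!v. v : N ==> \<Gamma> v <= gm"
 shows "EE (K2 x y) <= 2 * dl + 8 * d2\<^sup>2 * gm\<^sup>2 * (C * fdec K (2/5) (x - y))"
proof -
 let ?c = "%v w. 4 * d2\<^sup>2 * (green x v * green v w * green w y)"
 let ?p = "%v f. hit v (Sc (pos f))" and ?n = "%v f. hit v (Sc (neg f))"
 have c0: "0 <= ?c v w" for v w using green_pos by simp
 have xX: "x : mX m" "y : mX m" using x y by (auto intro: latt_in_mX)
 have pt: "K2 x y f <= 2 * dl + (\<Sum>v\<in>N. \<Sum>w\<in>N. (?p v f * ?n w f + ?p w f * ?n v f) * ?c v w)" for f
 proof -
 note A = Sc_V[of "pos f"] and B = Sc_V[of "neg f"]
 have "K2 x y f <= (\<Sum>z\<in>Sc (pos f). hm (Sc (pos f)) x z * (\<Sum>w\<in>Sc (neg f). hm (Sc (neg f)) z w * mgff_cov w y))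
 + (\<Sum>z\<in>Sc (neg f). hm (Sc (neg f)) x z * (\<Sum>w\<in>Sc (pos f). hm (Sc (pos f)) z w * mgff_cov w y))"
 unfolding K2_def JJ_def by (rule meeting_both_le[OF subV[OF A] subV[OF B] xX])
 also have "... <= (dl + (\<Sum>v\<in>N. \<Sum>w\<in>N. (?p v f * ?n w f) * ?c v w)) + (dl + (\<Sum>v\<in>N. \<Sum>w\<in>N. (?n v f * ?p w f) * ?c v w))"
 by (intro add_mono double_hm_bound[OF A B x y N dl] double_hm_bound[OF B A x y N dl])
 also have "... = 2 * dl + (\<Sum>v\<in>N. \<Sum>w\<in>N. (?p v f * ?n w f + ?p w f * ?n v f) * ?c v w)"
 unfolding sum.distrib[symmetric] by (simp add: sum.distrib[symmetric] algebra_simps)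
 finally show ?thesis .
 qed
 have i1: "integrable M (%om. ?p v (res (mV m n) om) * ?n w (res (mV m n) om))" for v w by (rule L2_mult[OF L2_hit(1) L2_hit(2)])
 have i2: "integrable M (%om. (?p v (res (mV m n) om) * ?n w (res (mV m n) om) + ?p w (res (mV m n) om) * ?n v (res (mV m n) om)) * ?c v w)" for v w
 by (intro integrable_mult_left Bochner_Integration.integrable_add i1)
 have "EE (K2 x y) <= EE (%f. 2 * dl + (\<Sum>v\<in>N. \<Sum>w\<in>N. (?p v f * ?n w f + ?p w f * ?n v f) * ?c v w))"
 proof (rule integral_mono)
 show "integrable M (%om. K2 x y (res (mV m n) om))" unfolding K2_def using expectation_JJ(1,3,5)[OF xX] by simp
 show "integrable M (%om. 2 * dl + (\<Sum>v\<in>N. \<Sum>w\<in>N. (?p v (res (mV m n) om) * ?n w (res (mV m n) om) + ?p w (res (mV m n) om) * ?n v (res (mV m n) om)) * ?c v w))"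
 by (intro Bochner_Integration.integrable_add Bochner_Integration.integrable_sum i2) simp
 qed (rule pt)
 also have "... = 2 * dl + (\<Sum>v\<in>N. \<Sum>w\<in>N. (EE (%f. ?p v f * ?n w f) + EE (%f. ?p w f * ?n v f)) * ?c v w)"
 proof -
 have "EE (%f. 2 * dl + (\<Sum>v\<in>N. \<Sum>w\<in>N. (?p v f * ?n w f + ?p w f * ?n v f) * ?c v w)) = 2 * dl + EE (%f. \<Sum>v\<in>N. \<Sum>w\<in>N. (?p v f * ?n w f + ?p w f * ?n v f) * ?c v w)"
 by (subst Bochner_Integration.integral_add) (auto intro!: Bochner_Integration.integrable_sum i2 simp: prob_space)
 also have "EE (%f. \<Sum>v\<in>N. \<Sum>w\<in>N. (?p v f * ?n w f + ?p w f * ?n v f) * ?c v w) = (\<Sum>v\<in>N. \<Sum>w\<in>N. EE (%f. (?p v f * ?n w f + ?p w f * ?n v f) * ?c v w))"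
 using i2 by (simp add: Bochner_Integration.integral_sum Bochner_Integration.integrable_sum)
 also have "... = (\<Sum>v\<in>N. \<Sum>w\<in>N. (EE (%f. ?p v f * ?n w f) + EE (%f. ?p w f * ?n v f)) * ?c v w)"
 by (intro sum.cong refl) (simp only: integral_mult_left_zero Bochner_Integration.integral_add[OF i1 i1])
 finally show ?thesis .
 qed
 also have "... <= 2 * dl + (\<Sum>v\<in>N. \<Sum>w\<in>N. (gm\<^sup>2 + gm\<^sup>2) * ?c v w)"
 proof (intro add_left_mono sum_mono mult_right_mono c0 add_mono)
 fix v w assume v: "v : N" and w: "w : N"
 have b: "\<Gamma> a * \<Gamma> b <= gm\<^sup>2" if "a : N" "b : N" for a b
 unfolding power2_eq_square using gm[OF that(1)] gm[OF that(2)] \<Gamma>_nonneg[of a] \<Gamma>_nonneg[of b] by (intro mult_mono) linarith+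
 show "EE (%f. ?p v f * ?n w f) <= gm\<^sup>2" by (rule order_trans[OF hit_pair b[OF v w]])
 show "EE (%f. ?p w f * ?n v f) <= gm\<^sup>2" by (rule order_trans[OF hit_pair b[OF w v]])
 qed
 also have "(\<Sum>v\<in>N. \<Sum>w\<in>N. (gm\<^sup>2 + gm\<^sup>2) * ?c v w) = 8 * d2\<^sup>2 * gm\<^sup>2 * (\<Sum>v\<in>N. \<Sum>w\<in>N. green x v * green v w * green w y)"
 unfolding sum_distrib_left by (intro sum.cong refl) (simp add: algebra_simps)
 also have "... <= 8 * d2\<^sup>2 * gm\<^sup>2 * (C * fdec K (2/5) (x - y))"
 by (intro mult_left_mono GGG N) simp
 finally show ?thesis by simp
qed

text \<open>With one explored set only one hitting probability enters, so the bound is linear in gm,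
  and the double convolution at coincident points is bounded by C.\<close>

lemma second_moment_bound:
 assumes x: "x : latt" "linf x <= real n"
 and N: "finite N" "N <= latt" and dl: "0 <= dl" "!!v. v : latt - N ==> d2 * green v x <= dl"
 and gm: "0 <= gm" "!!v. v : N ==> \<Gamma> v <= gm"
 shows "EE (%f. (ax x f)\<^sup>2) <= dl + 2 * d2 * gm * C"
proof -
 let ?c = "%v. 2 * d2 * (green x v * green v x)"
 have xX: "x : mX m" using x by (intro latt_in_mX)
 have xV: "x : mV m n" using x by (intro latt_in_mV)
 have c0: "0 <= ?c v" for v using green_pos d2_ge by simp
 have pt: "JJ (Sc (pos f)) x x <= dl + (\<Sum>v\<in>N. hit v (Sc (pos f)) * ?c v)" for f
 proof -
 note A = Sc_V[of "pos f"]
 have "JJ (Sc (pos f)) x x = (\<Sum>z\<in>Sc (pos f). hm (Sc (pos f)) x z * mgff_cov z x)" by (simp add: JJ_def kg_def)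
 also have "... <= dl + (\<Sum>v\<in>N. hit v (Sc (pos f)) * (2 * mgff_cov x v * (d2 * green v x)))"
 proof (rule cell_split[OF A xX N _ dl(1)])
 fix w assume "w : Sc (pos f)"
 then have wX: "w : mX m" using subV(2)[OF A] by blast
 show "mgff_cov w x <= dl + (if ncell w : N then d2 * green (ncell w) x else 0)"
 using ncell_cov[OF wX x(1)] dl(1) dl(2)[of "ncell w"] ncell(1)[OF wX] by auto
 next
 show "0 <= d2 * green v x" for v using green_pos d2_ge by simp
 qed
 also have "(\<Sum>v\<in>N. hit v (Sc (pos f)) * (2 * mgff_cov x v * (d2 * green v x))) = (\<Sum>v\<in>N. hit v (Sc (pos f)) * ?c v)"
 proof (rule sum.cong[OF refl])
 fix v assume "v : N"
 then have "mgff_cov x v = green x v" using N(2) cov_latt[OF x(1)] by blast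
 then show "hit v (Sc (pos f)) * (2 * mgff_cov x v * (d2 * green v x)) = hit v (Sc (pos f)) * ?c v" by simp
 qed
 finally show ?thesis .
 qed
 have i: "integrable M (%om. hit v (Sc (pos (res (mV m n) om))) * ?c v)" for v
 by (intro integrable_mult_left L2_integrable[OF L2_hit(1)])
 have "EE (%f. (ax x f)\<^sup>2) <= EE (%f. JJ (Sc (pos f)) x x)" by (rule second_moment_ax[OF xV])
 also have "... <= EE (%f. dl + (\<Sum>v\<in>N. hit v (Sc (pos f)) * ?c v))"
 by (rule integral_mono[OF expectation_JJ(1)[OF xX xX] _ pt]) (intro Bochner_Integration.integrable_add Bochner_Integration.integrable_sum i, simp)
 also have "... = dl + (\<Sum>v\<in>N. \<Gamma> v * ?c v)"
 proof -
 have "EE (%f. dl + (\<Sum>v\<in>N. hit v (Sc (pos f)) * ?c v)) = dl + EE (%f. \<Sum>v\<in>N. hit v (Sc (pos f)) * ?c v)"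
 by (subst Bochner_Integration.integral_add) (auto intro!: Bochner_Integration.integrable_sum i simp: prob_space simp del: integrable_mult_left_iff)
 also have "EE (%f. \<Sum>v\<in>N. hit v (Sc (pos f)) * ?c v) = (\<Sum>v\<in>N. EE (%f. hit v (Sc (pos f)) * ?c v))"
 by (rule Bochner_Integration.integral_sum[OF i])
 also have "... = (\<Sum>v\<in>N. \<Gamma> v * ?c v)" unfolding \<Gamma>_def by (simp only: integral_mult_left_zero)
 finally show ?thesis .
 qed
 also have "... <= dl + (\<Sum>v\<in>N. gm * ?c v)" by (intro add_left_mono sum_mono mult_right_mono gm c0)
 also have "(\<Sum>v\<in>N. gm * ?c v) = 2 * d2 * gm * (\<Sum>v\<in>N. green x v * green v x)"
 unfolding sum_distrib_left by (intro sum.cong refl) simp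
 also have "... <= 2 * d2 * gm * C"
 proof (intro mult_left_mono)
 have "(\<Sum>v\<in>N. green x v * green v x) <= C * fdec K (7/5) (x - x)" by (rule GG[OF N(1)])
 also have "... <= C * 1" using KC by (intro mult_left_mono fdec_le_1) auto
 finally show "(\<Sum>v\<in>N. green x v * green v x) <= C" by simp
 qed (use gm d2_ge in simp)
 finally show ?thesis by simp
qed

lemma EE_osc: "EE osc <= ep" by (rule osc_L1(1)[OF eps(1) osc_eps])

lemma diag_ge_1: "x : latt ==> mgff_cov x (x::real^'n) >= 1"
 using cov_latt[of x x] green_diag_ge_1[OF d7, of x] by simp

lemma diag_le: "x : latt ==> mgff_cov x (x::real^'n) <= C"
proof -
 assume x: "x : latt"
 have "green x x <= C * fdec K (12/5) (x - x)" by (rule G)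
 also have "... <= C * 1" using KC by (intro mult_left_mono fdec_le_1) auto
 finally show ?thesis using cov_latt[OF x x] by simp
qed

lemma pc_le:
 fixes w :: "real^'n"
 assumes w: "w : latt" "linf w <= real n"
 shows "pc w <= (TT w + ep) / c0"
proof -
 have wV: "w : mV m n" by (rule latt_in_mV[OF w])
 have "pc w * c0 <= TT w + ep" unfolding c0_def
 using pc_bound(1)[OF wV diag_ge_1[OF w(1)]] TT_le(2)[OF wV] EE_osc by linarith
 then show ?thesis using c0_pos by (simp add: field_simps)
qed

lemma TT_nonneg: "w : latt ==> linf w <= real n ==> 0 <= TT w" for w :: "real^'n"
 by (rule TT_le(3)[OF latt_in_mV])

lemma card_latt_ball: "card {w::real^'n. w : latt & norm (w - v) <= r} = card {w::real^'n. w : latt & norm (w - 0) <= r}" if v: "v : latt"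
proof -
 have "{w::real^'n. w : latt & norm (w - v) <= r} = (%w. w + v) ` {w. w : latt & norm (w - 0) <= r}"
 proof
 show "{w. w : latt & norm (w - v) <= r} <= (%w. w + v) ` {w. w : latt & norm (w - 0) <= r}"
 proof
 fix w assume "w : {w. w : latt & norm (w - v) <= r}"
 then show "w : (%w. w + v) ` {w. w : latt & norm (w - 0) <= r}"
 using v by (intro image_eqI[of _ _ "w - v"]) (auto simp: latt_def)
 qed
 qed (use v in \<open>auto simp: latt_def\<close>)
 then show ?thesis by (simp add: card_image inj_on_def)
qed

text \<open>A revealed vertex in the cell of v is within 1/2 of v, within 1/m <= 1/2 of a cluster
  vertex, and that vertex is within 1 of a lattice cluster vertex: together at most 2, and b2 counts
  the candidates. The condition on \<open>linf\<close> excludes D, which is revealed whether or not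
  the cluster comes near.\<close>

lemma \<Gamma>_le:
 fixes v :: "real^'n"
 assumes v: "v : latt" and near: "!!w. w : latt ==> norm (w - v) <= 2 ==> linf w < real n & TT w <= s"
 shows "\<Gamma> v <= b2 * ((s + ep) / c0)"
proof -
 let ?B = "{w::real^'n. w : latt & norm (w - v) <= 2}"
 have fin: "finite ?B" by (rule finite_latt_ball)
 have pt: "hit v (Sc P) <= (\<Sum>w\<in>?B. if w : cl P then 1 else 0)" for P
 proof (cases "Sc P Int cell v = {}")
 case True
 then show ?thesis by (simp add: hit_def sum_nonneg)
 next
 case False
 then obtain z where z: "z : Sc P" "ncell z = v" by (auto simp: cell_def)
 have zX: "z : mX m" using Sc_fin(2) z by blast
 have zv: "norm (z - v) <= 1/2" using ncell(2)[OF zX] z by simp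
 have "z ~: mD n"
 proof
 assume "z : mD n"
 then have "z : latt" "linf z = real n" by (auto simp: mD_def)
 then show False using near[of z] zv by auto
 qed
 then have "z : Kc P" using z by (simp add: Sc_def)
 then obtain c where c: "c : cl P" "norm (c - z) <= 1/2"
 proof (unfold Kc_def, elim UnE CollectE conjE)
 assume "z : cl P"
 then show ?thesis using that[of z] by simp
 next
 assume "mnb m z Int cl P ~= {}"
 then obtain c where c: "c : mnb m z" "c : cl P" by blast
 then obtain i where "c = z + axis i (1 / real m) | c = z - axis i (1 / real m)" unfolding mnb_def by blast
 then have "norm (c - z) = 1 / real m" using norm_axis_real[of i "1 / real m"] norm_minus_cancel[of "axis i (1 / real m) :: real^'n"] by auto
 also have "... <= 1/2" using m by (simp add: field_simps)
 finally show ?thesis using that c by blast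
 qed
 obtain w where w: "w : latt" "w : cl P" "norm (w - c) < 1" by (rule cl_near_latt[OF c(1)])
 have "norm (w - v) <= norm (w - c) + norm (c - z) + norm (z - v)"
 using norm_triangle_ineq[of "w - c" "c - z"] norm_triangle_ineq[of "w - z" "z - v"] by simp
 then have "w : ?B" using w c zv by simp
 then have "(if w : cl P then 1 else 0::real) <= (\<Sum>w\<in>?B. if w : cl P then 1 else 0)"
 using fin by (intro member_le_sum) auto
 then show ?thesis using w by (simp add: hit_def)
 qed
 have Lc: "L2 (%f. if w : cl (pos f) then 1 else 0)" for w by (rule L2_event[of "%P Q. w : cl P"])
 have "\<Gamma> v <= EE (%f. \<Sum>w\<in>?B. if w : cl (pos f) then 1 else 0)" unfolding \<Gamma>_def
 by (rule integral_mono[OF L2_integrable[OF L2_hit(1)] L2_integrable[OF L2_sum[OF Lc]] pt])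
 also have "... = (\<Sum>w\<in>?B. pc w)" unfolding pc_def by (rule Bochner_Integration.integral_sum[OF L2_integrable[OF Lc]])
 also have "... <= (\<Sum>w\<in>?B. (s + ep) / c0)"
 proof (rule sum_mono)
 fix w assume "w : ?B"
 then have w: "w : latt" "linf w < real n" "TT w <= s" using near[of w] by auto
 have "pc w <= (TT w + ep) / c0" using w by (intro pc_le) auto
 also have "... <= (s + ep) / c0" using w c0_pos by (intro divide_right_mono) auto
 finally show "pc w <= (s + ep) / c0" .
 qed
 also have "... = b2 * ((s + ep) / c0)" unfolding b2_def by (simp add: card_latt_ball[OF v])
 finally show ?thesis .
qed

end

section \<open>Upper and lower bounds for the lattice Laplacian of \<open>TT\<close>\<close>

context mesh_est begin

lemma avg_minus_axis: "x - axis i 1 = x + axis i (- 1)" for x :: "real^'n" by (simp add: vec_eq_iff)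

lemma avg_power_U2:
 fixes x :: "real^'n"
 assumes "x : latt" "!!v. v : latt ==> norm (v - x) <= real k ==> linf v <= real n"
 shows "L2 (%f. (avg ^^ k) (U2 f) x) & EE (%f. (avg ^^ k) (U2 f) x) = (avg ^^ k) TT x"
 using assms
proof (induction k arbitrary: x)
 case 0
 then have xV: "x : mV m n" using latt_in_mV[of x] by simp
 show ?case using L2_U2[OF xV] by (simp add: TT_def)
next
 case (Suc k)
 have nb: "L2 (%f. (avg ^^ k) (U2 f) (x + axis i s)) & EE (%f. (avg ^^ k) (U2 f) (x + axis i s)) = (avg ^^ k) TT (x + axis i s)"
 if s: "s = 1 | s = - 1" for i s
 proof (rule Suc.IH)
 show "x + axis i s : latt" using latt_axis(1)[OF Suc.prems(1)] s by auto
 fix v :: "real^'n" assume v: "v : latt" "norm (v - (x + axis i s)) <= real k"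
 show "linf v <= real n" using norm_latt_nb[OF v(2)] s by (intro Suc.prems(2) v) auto
 qed
 have L: "L2 (%f. (avg ^^ k) (U2 f) (x + axis i 1))" "L2 (%f. (avg ^^ k) (U2 f) (x + axis i (- 1)))"
 and E: "EE (%f. (avg ^^ k) (U2 f) (x + axis i 1)) = (avg ^^ k) TT (x + axis i 1)" "EE (%f. (avg ^^ k) (U2 f) (x + axis i (- 1))) = (avg ^^ k) TT (x + axis i (- 1))" for i
 using nb[of 1 i] nb[of "- 1" i] by simp_all
 have e: "(avg ^^ Suc k) F x = (1 / (2 * real CARD('n))) * (\<Sum>i\<in>UNIV. (avg ^^ k) F (x + axis i 1) + (avg ^^ k) F (x + axis i (- 1)))" for F
 by (simp add: avg_def avg_minus_axis)
 have Ls: "L2 (%f. (avg ^^ k) (U2 f) (x + axis i 1) + (avg ^^ k) (U2 f) (x + axis i (- 1)))" for i by (rule L2_add[OF L])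
 have "EE (%f. \<Sum>i\<in>UNIV. (avg ^^ k) (U2 f) (x + axis i 1) + (avg ^^ k) (U2 f) (x + axis i (- 1)))
 = (\<Sum>i\<in>UNIV. EE (%f. (avg ^^ k) (U2 f) (x + axis i 1) + (avg ^^ k) (U2 f) (x + axis i (- 1))))"
 by (rule Bochner_Integration.integral_sum[OF L2_integrable[OF Ls]])
 also have "... = (\<Sum>i\<in>UNIV. (avg ^^ k) TT (x + axis i 1) + (avg ^^ k) TT (x + axis i (- 1)))"
 by (intro sum.cong refl) (simp only: Bochner_Integration.integral_add[OF L2_integrable[OF L(1)] L2_integrable[OF L(2)]] E)
 finally have s: "EE (%f. \<Sum>i\<in>UNIV. (avg ^^ k) (U2 f) (x + axis i 1) + (avg ^^ k) (U2 f) (x + axis i (- 1))) = (\<Sum>i\<in>UNIV. (avg ^^ k) TT (x + axis i 1) + (avg ^^ k) TT (x + axis i (- 1)))" .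
 show ?case unfolding e
 by (rule conjI[OF L2_cmult[OF L2_sum[OF Ls]]]) (simp only: integral_mult_right_zero s)
qed

lemma L2_avg_U2:
 fixes x :: "real^'n"
 assumes x: "x : latt" "linf x < real n"
 shows "L2 (%f. avg (U2 f) x)" "EE (%f. avg (U2 f) x) = avg TT x"
proof -
 have "L2 (%f. (avg ^^ 1) (U2 f) x) & EE (%f. (avg ^^ 1) (U2 f) x) = (avg ^^ 1) TT x"
 proof (rule avg_power_U2[OF x(1)])
 fix v :: "real^'n" assume v: "v : latt" "norm (v - x) <= real 1"
 have "\<bar>v $ j\<bar> <= real n" for j
 proof -
 have "\<bar>v $ j - x $ j\<bar> <= 1" using component_le_norm_cart[of "v - x" j] v by simp
 moreover have "\<bar>x $ j\<bar> + 1 <= real n" using x by (intro Ints_abs_less_Suc) (auto simp: latt_def linf_less_iff)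
 ultimately show ?thesis by linarith
 qed
 then show "linf v <= real n" by (simp add: linf_le_iff)
 qed
 then show "L2 (%f. avg (U2 f) x)" "EE (%f. avg (U2 f) x) = avg TT x" by simp_all
qed

lemma TT_subharmonic:
 fixes x :: "real^'n"
 assumes x: "x : latt" "linf x < real n"
 shows "TT x <= avg TT x"
 unfolding L2_avg_U2(2)[OF x, symmetric] TT_def
 using x by (intro integral_mono L2_integrable L2_avg_U2(1)[OF x] L2_U2 latt_in_mV U2_subharmonic) auto

lemma TT_upper:
 fixes x :: "real^'n"
 assumes x: "x : latt" "linf x <= real n"
 shows "TT x <= 1 + C"
proof -
 have xV: "x : mV m n" by (rule latt_in_mV[OF x])
 have "TT x <= EE (ax x)" by (rule TT_le(1)[OF xV])
 also have "... <= EE (%f. 1 + (f x)\<^sup>2)"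
 proof (rule integral_mono[OF L2_integrable[OF L2_ax[OF xV]]])
 show "integrable M (%om. 1 + (res (mV m n) om x)\<^sup>2)" using L2_coord[OF xV] by (simp add: L2_def)
 fix om
 let ?a = "res (mV m n) om x"
 have "ax x (res (mV m n) om) <= \<bar>?a\<bar>" by (auto simp: ax_def abs_ge_self)
 moreover have "\<bar>?a\<bar> <= 1 + \<bar>?a\<bar>\<^sup>2" using zero_le_power2[of "\<bar>?a\<bar> - 1"] by (simp only: power2_diff) simp
 ultimately show "ax x (res (mV m n) om) <= 1 + ?a\<^sup>2" by simp
 qed
 also have "... = 1 + mgff_cov x x"
 using EE_coord_sq[OF xV] L2_coord[OF xV] by (simp add: L2_def prob_space)
 also have "... <= 1 + C" using diag_le[OF x(1)] by simp
 finally show ?thesis .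
qed

text \<open>If x is in the cluster then \<open>U2\<close> vanishes at x, so the k-fold average of
  \<open>U2\<close> at x, which dominates \<open>U2\<close> at y up to d2^k, coincides with its
  increment. Otherwise that increment is nonnegative by subharmonicity. Taking means yields an
  increment of \<open>TT\<close>.\<close>

lemma one_arm_step:
 fixes x y :: "real^'n"
 assumes x: "x : latt" and y: "y : latt" "linf y <= real n" and ball: "!!v. v : latt ==> norm (v - x) <= real k ==> linf v < real n"
 and r: "reaches k x y"
 shows "EE (%f. (if x : cl (pos f) then 1 else 0) * U2 f y) <= d2 ^ k * ((avg ^^ k) TT x - TT x)"
proof -
 have xl: "linf x < real n" using ball[OF x] by simp
 have xV: "x : mV m n" by (rule latt_in_mV[OF x less_imp_le[OF xl]])
 have yV: "y : mV m n" by (rule latt_in_mV[OF y])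
 have A: "L2 (%f. (avg ^^ k) (U2 f) x) & EE (%f. (avg ^^ k) (U2 f) x) = (avg ^^ k) TT x"
 by (rule avg_power_U2[OF x]) (rule less_imp_le[OF ball])
 have d0: "0 <= d2 ^ k" using d2_ge by simp
 have pt: "(if x : cl (pos f) then 1 else 0) * U2 f y <= d2 ^ k * ((avg ^^ k) (U2 f) x - U2 f x)" for f
 proof -
 have le: "U2 f x <= (avg ^^ k) (U2 f) x"
 by (rule le_avg_power[OF x _ order_refl]) (intro U2_subharmonic ball)
 show ?thesis
 proof (cases "x : cl (pos f)")
 case True
 then have "x : Kc (pos f)" by (simp add: Kc_def)
 then have 0: "U2 f x = 0" by (rule U2_Kc)
 have "\<forall>v\<in>latt. 0 <= U2 f v" using U2_nonneg latt_in_mX by blast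
 then have "U2 f y <= d2 ^ k * (avg ^^ k) (U2 f) x" using r unfolding reaches_def d2_def by blast
 then show ?thesis using True 0 by simp
 next
 case False
 then show ?thesis using le d0 by simp
 qed
 qed
 have "EE (%f. (if x : cl (pos f) then 1 else 0) * U2 f y) <= EE (%f. d2 ^ k * ((avg ^^ k) (U2 f) x - U2 f x))"
 by (rule integral_mono[OF L2_integrable[OF L2_pattern[OF L2_U2[OF yV], of "%A B. x : cl A"]] L2_integrable[OF L2_cmult[OF L2_diff[OF conjunct1[OF A] L2_U2[OF xV]]]] pt])
 also have "... = d2 ^ k * ((avg ^^ k) TT x - TT x)"
 using conjunct2[OF A] by (simp only: integral_mult_right_zero Bochner_Integration.integral_diff[OF L2_integrable[OF conjunct1[OF A]] L2_integrable[OF L2_U2[OF xV]]] TT_def)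
 finally show ?thesis .
qed

text \<open>Every term on the right is either small by the choice of dl, of the distance of x and y,
  of R or of ep, or is an increment of \<open>TT\<close>.\<close>

lemma two_point:
 fixes x y :: "real^'n"
 assumes x: "x : latt" and y: "y : latt"
 and ballx: "!!v. v : latt ==> norm (v - x) <= real k ==> linf v < real n"
 and bally: "!!v. v : latt ==> norm (v - y) <= real k ==> linf v < real n"
 and r: "reaches k x y" "reaches k y x"
 and N: "finite N" "N <= latt" and dl: "0 <= dl" "!!v. v : latt - N ==> d2 * green v x <= dl" "!!v. v : latt - N ==> d2 * green v y <= dl"
 and gm: "0 <= gm" "!!v. v : N ==> \<Gamma> v <= gm" and s: "TT x <= s" "TT y <= s" and R: "R > 0"
 shows "TT x * TT y <= 2 * dl + 8 * d2\<^sup>2 * gm\<^sup>2 * (C * fdec K (2/5) (x - y))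
 + R * d2 ^ k * (((avg ^^ k) TT x - TT x) + ((avg ^^ k) TT y - TT y)) + 2 * (dl + 2 * d2 * gm * C) * s / R + (5 + 4 * C) * ep"
proof -
 have l: "linf x < real n" "linf y < real n" using ballx[OF x] bally[OF y] by simp_all
 have V: "x : mV m n" "y : mV m n"
 by (rule latt_in_mV[OF x less_imp_le[OF l(1)]], rule latt_in_mV[OF y less_imp_le[OF l(2)]])
 have l': "linf x <= real n" "linf y <= real n" using l by simp_all
 have q: "EE (%f. (ax v f)\<^sup>2) * TT w / R <= (dl + 2 * d2 * gm * C) * s / R"
 if v: "EE (%f. (ax v f)\<^sup>2) <= dl + 2 * d2 * gm * C" and w: "0 <= TT w" "TT w <= s" for v w
 using v w R dl(1) gm(1) d2_ge KC by (intro divide_right_mono mult_mono) (auto intro!: add_nonneg_nonneg)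
 have sx: "EE (%f. (ax x f)\<^sup>2) <= dl + 2 * d2 * gm * C" by (rule second_moment_bound[OF x l'(1) N dl(1,2) gm])
 have sy: "EE (%f. (ax y f)\<^sup>2) <= dl + 2 * d2 * gm * C" by (rule second_moment_bound[OF y l'(2) N dl(1,3) gm])
 have Tn: "0 <= TT x" "0 <= TT y" using TT_nonneg x y l' by auto
 have "PP (ax x) (%f. U2 f y) <= R * EE (%f. (if x : cl (pos f) then 1 else 0) * U2 f y) + EE (%f. (ax x f)\<^sup>2) * TT y / R"
 by (rule ax_U2_bound[OF V R])
 also have "... <= R * (d2 ^ k * ((avg ^^ k) TT x - TT x)) + (dl + 2 * d2 * gm * C) * s / R"
 by (rule add_mono[OF mult_left_mono[OF one_arm_step[OF x y l'(2) ballx r(1)] less_imp_le[OF R]] q[OF sx Tn(2) s(2)]])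
 finally have 1: "PP (ax x) (%f. U2 f y) <= R * (d2 ^ k * ((avg ^^ k) TT x - TT x)) + (dl + 2 * d2 * gm * C) * s / R" .
 have "PP (ax y) (%f. U2 f x) <= R * EE (%f. (if y : cl (pos f) then 1 else 0) * U2 f x) + EE (%f. (ax y f)\<^sup>2) * TT x / R"
 by (rule ax_U2_bound[OF V(2,1) R])
 also have "... <= R * (d2 ^ k * ((avg ^^ k) TT y - TT y)) + (dl + 2 * d2 * gm * C) * s / R"
 by (rule add_mono[OF mult_left_mono[OF one_arm_step[OF y x l'(1) bally r(2)] less_imp_le[OF R]] q[OF sy Tn(1) s(1)]])
 finally have 2: "PP (ax y) (%f. U2 f x) <= R * (d2 ^ k * ((avg ^^ k) TT y - TT y)) + (dl + 2 * d2 * gm * C) * s / R" .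
 have 3: "EE (K2 x y) <= 2 * dl + 8 * d2\<^sup>2 * gm\<^sup>2 * (C * fdec K (2/5) (x - y))"
 by (rule K2_bound[OF x y N dl(1,3) gm(2)])
 have "2 * ep * (2 + mgff_cov x x + mgff_cov y y) <= 2 * ep * (2 + C + C)"
 using diag_le[OF x] diag_le[OF y] eps by (intro mult_left_mono) auto
 moreover have "ep\<^sup>2 <= ep" using eps by (simp add: power2_eq_square mult_left_le_one_le)
 ultimately have 4: "2 * ep * (2 + mgff_cov x x + mgff_cov y y) + ep\<^sup>2 <= (5 + 4 * C) * ep"
 by (simp add: algebra_simps)
 have 5: "2 * (dl + 2 * d2 * gm * C) * s / R = (dl + 2 * d2 * gm * C) * s / R + (dl + 2 * d2 * gm * C) * s / R" by simp
 have 6: "R * d2 ^ k * (((avg ^^ k) TT x - TT x) + ((avg ^^ k) TT y - TT y)) = R * (d2 ^ k * ((avg ^^ k) TT x - TT x)) + R * (d2 ^ k * ((avg ^^ k) TT y - TT y))"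
 by (simp add: algebra_simps)
 show ?thesis using two_arm_lower[OF V eps(1) osc_eps] 1 2 3 4 unfolding 5 6 by linarith
qed

lemma diag_pos: "w : mX m ==> mgff_cov w (w::real^'n) > 0"
proof -
 assume w: "w : mX m"
 note c = ncell[OF w]
 have cX: "ncell w : mX m" by (rule latt_in_mX[OF c(1)])
 have "1/2 <= mgff_cov w (ncell w)" by (rule c(4))
 also have "... = mgff_cov (ncell w) w" by (rule mgff_sym[OF w cX])
 also have "... <= mgff_cov w w" by (rule g_le_diag[OF cX w])
 finally show ?thesis by simp
qed

lemma mono_near: "mono_fun (%f. if near_cl x (pos f) then 1 else 0)"
 unfolding mono_fun_def
proof (intro allI impI)
 fix f f' :: "real^'n => real" assume "\<forall>v\<in>mV m n. f v <= f' v"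
 then have "cl (pos f) <= cl (pos f')" by (intro cl_mono pos_mono) auto
 then have "near_cl x (pos f) ==> near_cl x (pos f')" unfolding near_cl_def by blast
 then show "(if near_cl x (pos f) then 1 else 0) <= (if near_cl x (pos f') then 1 else (0::real))" by simp
qed

definition pn :: "real^'n => real" where "pn x = EE (%f. if near_cl x (pos f) then 1 else 0)"

lemma L2_near: "L2 (%f. if near_cl x (pos f) then 1 else 0)" by (rule L2_event[of "%P Q. near_cl x P"])

text \<open>\<open>U2\<close> is lattice harmonic at x unless the cluster comes near x. This event
  is increasing and the average of \<open>U2\<close> decreasing in the field, so they are negatively
  correlated.\<close>

lemma TT_increment:
 fixes x :: "real^'n"
 assumes x: "x : latt" "linf x < real n"
 shows "avg TT x - TT x <= pn x * avg TT x"
proof -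
 have xV: "x : mV m n" by (rule latt_in_mV[OF x(1) less_imp_le[OF x(2)]])
 note A = L2_avg_U2[OF x]
 have 0: "0 <= avg (U2 f) x" for f using U2_nonneg[of x f] U2_subharmonic[OF x, of f] latt_in_mX[OF x(1)] by simp
 have pt: "avg (U2 f) x - U2 f x <= (if near_cl x (pos f) then 1 else 0) * avg (U2 f) x" for f
 using U2_harmonic[OF x, of f] U2_nonneg[of x f] latt_in_mX[OF x(1)] by auto
 have "avg TT x - TT x = EE (%f. avg (U2 f) x - U2 f x)"
 unfolding A(2)[symmetric] TT_def by (rule Bochner_Integration.integral_diff[OF L2_integrable[OF A(1)] L2_integrable[OF L2_U2[OF xV]], symmetric])
 also have "... <= EE (%f. (if near_cl x (pos f) then 1 else 0) * avg (U2 f) x)"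
 by (rule integral_mono[OF L2_integrable[OF L2_diff[OF A(1) L2_U2[OF xV]]] L2_mult[OF L2_near A(1)] pt])
 also have "... <= pn x * EE (%f. avg (U2 f) x)" unfolding pn_def
 proof (rule FKG_opp[OF L2_near mono_near A(1)])
 show "mono_fun (%f. - avg (U2 f) x)" unfolding mono_fun_def
 proof (intro allI impI)
 fix f f' :: "real^'n => real" assume le: "\<forall>v\<in>mV m n. f v <= f' v"
 have "avg (U2 f') x <= avg (U2 f) x"
 proof (rule avg_mono_neighbours)
 show "U2 f' (x + axis i 1) <= U2 f (x + axis i 1)" for i
 by (rule U2_antimono[OF bspec[OF le] latt_in_mX[OF latt_neighbours(1)[OF x(1)]]])
 show "U2 f' (x - axis i 1) <= U2 f (x - axis i 1)" for i
 by (rule U2_antimono[OF bspec[OF le] latt_in_mX[OF latt_neighbours(2)[OF x(1)]]])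
 qed
 then show "- avg (U2 f) x <= - avg (U2 f') x" by simp
 qed
 qed
 finally show ?thesis unfolding A(2) .
qed

definition nbs :: "real^'n => (real^'n) set" where
 "nbs x = insert x (range (%i. x + axis i 1) Un range (%i. x + axis i (- 1)))"

lemma nbs: "finite (nbs x)" "card (nbs x) <= 2 * CARD('n) + 1"
proof -
 show "finite (nbs x)" by (simp add: nbs_def)
 have "card (range (%i. x + axis i 1) Un range (%i. x + axis i (- 1))) <= CARD('n) + CARD('n)"
 by (rule order_trans[OF card_Un_le]) (intro add_mono card_image_le, simp_all)
 then show "card (nbs x) <= 2 * CARD('n) + 1"
 using card_insert_le_m1[of "2 * CARD('n) + 1" "range (%i. x + axis i 1) Un range (%i. x + axis i (- 1))" x] unfolding nbs_def by simp
qed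

lemma nbs_latt:
 assumes x: "x : latt" "linf x < real n" and w: "w : nbs x"
 shows "w : latt" "linf w <= real n" "w : mV m n"
proof -
 consider "w = x" | i where "w = x + axis i 1" | i where "w = x + axis i (- 1)" using w unfolding nbs_def by blast
 then have "w : latt & linf w <= real n"
 proof cases
 case 1 then show ?thesis using x by simp
 next
 case (2 i) then show ?thesis using latt_step[OF x, of 1 i] by simp
 next
 case (3 i) then show ?thesis using latt_step[OF x, of "- 1" i] by simp
 qed
 then show 1: "w : latt" and 2: "linf w <= real n" by simp_all
 show "w : mV m n" by (rule latt_in_mV[OF 1 2])
qed

lemma near_cl_iff: "near_cl x P \<longleftrightarrow> nbs x Int cl P ~= {}"
 unfolding near_cl_def nbs_def by blast

lemma pn_le_sum:
 assumes x: "x : latt" "linf x < real n"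
 shows "pn x <= (\<Sum>w\<in>nbs x. pc w)"
proof -
 have Lc: "L2 (%f. if w : cl (pos f) then 1 else 0)" for w by (rule L2_event[of "%P Q. w : cl P"])
 have "pn x <= EE (%f. \<Sum>w\<in>nbs x. if w : cl (pos f) then 1 else 0)" unfolding pn_def
 proof (rule integral_mono[OF L2_integrable[OF L2_near] L2_integrable[OF L2_sum[OF Lc]]])
 fix om
 let ?P = "pos (res (mV m n) om)"
 show "(if near_cl x ?P then 1 else 0) <= (\<Sum>w\<in>nbs x. if w : cl ?P then 1 else (0::real))"
 proof (cases "near_cl x ?P")
 case True
 then obtain w where w: "w : nbs x" "w : cl ?P" unfolding near_cl_iff by blast
 then have "(if w : cl ?P then 1 else (0::real)) <= (\<Sum>w\<in>nbs x. if w : cl ?P then 1 else 0)"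
 using nbs(1) by (intro member_le_sum) auto
 then show ?thesis using w True by simp
 qed (simp add: sum_nonneg)
 qed
 also have "... = (\<Sum>w\<in>nbs x. pc w)" unfolding pc_def by (rule Bochner_Integration.integral_sum[OF L2_integrable[OF Lc]])
 finally show ?thesis .
qed

lemma cn_power_le:
 assumes B: "finite B" "B <= mV m n" "card B <= N"
 shows "cn ^ N <= EE (%f. if B Int pos f = {} then 1 else 0)"
proof -
 have "cn ^ N <= cn ^ card B" using cn B by (intro power_decreasing) auto
 also have "... <= EE (%f. if B Int pos f = {} then 1 else 0)" unfolding cn_def
 by (rule all_negative[OF B(1,2)]) (use diag_pos B in \<open>auto simp: mV_def\<close>)
 finally show ?thesis .
qed

text \<open>The cluster stays away from x whenever the field is negative at x and its lattice
  neighbours, and by FKG this has probability at least the product of the individual ones.\<close>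

lemma pn_le:
 assumes x: "x : latt" "linf x < real n"
 shows "pn x <= 1 - cn ^ (2 * CARD('n) + 1)"
proof -
 have L: "L2 (%f. if nbs x Int pos f = {} then 1 else 0)" by (rule L2_event[of "%P Q. nbs x Int P = {}"])
 have "pn x <= EE (%f. 1 - (if nbs x Int pos f = {} then 1 else 0))" unfolding pn_def
 proof (rule integral_mono[OF L2_integrable[OF L2_near] L2_integrable[OF L2_diff[OF L2_const L]]])
 show "(if near_cl x (pos (res (mV m n) om)) then 1 else 0) <= 1 - (if nbs x Int pos (res (mV m n) om) = {} then 1 else (0::real))" for om
 using cl_sub[of "pos (res (mV m n) om)"] unfolding near_cl_iff by auto
 qed
 also have "... = 1 - EE (%f. if nbs x Int pos f = {} then 1 else 0)"
 using L2_integrable[OF L] by (simp add: prob_space)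
 also have "... <= 1 - cn ^ (2 * CARD('n) + 1)"
 using cn_power_le[OF nbs(1) _ nbs(2), of x] nbs_latt(3)[OF x] by auto
 finally show ?thesis .
qed

text \<open>If x in D and its at most 2d mesh neighbours are all negative, then x is outside the
  explored cluster and \<open>U2\<close> at x equals minus the field. The two decreasing factors are
  separated by FKG, and the bound does not depend on m or n.\<close>

lemma TT_boundary:
 fixes x :: "real^'n"
 assumes x: "x : mD n"
 shows "c0 * cn ^ (2 * CARD('n)) <= TT x"
proof -
 have xV: "x : mV m n" and xl: "x : latt" using x mD_sub by (auto simp: mD_def)
 have xX: "x : mX m" using xV by (simp add: mV_def)
 let ?B = "mnb m x Int mV m n"
 let ?E = "%f. if ?B Int pos f = {} then 1 else (0::real)"
 have LE: "L2 ?E" by (rule L2_event[of "%P Q. ?B Int P = {}"])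
 have LM: "L2 (%f. max 0 (- f x))"
 proof (rule L2_bound[OF _ _ L2_coord[OF xV]])
 show "(%f. max 0 (- f x) :: real) : borel_measurable (PiM (mV m n) (%_. borel))"
 by (intro borel_measurable_max borel_measurable_const borel_measurable_uminus) (use L2_coord[OF xV] in \<open>simp add: L2_def\<close>)
 qed auto
 have antiE: "mono_fun (%f. - ?E f)"
 unfolding mono_fun_def
 proof (intro allI impI)
 fix f f' :: "real^'n => real" assume "\<forall>v\<in>mV m n. f v <= f' v"
 then have "pos f <= pos f'" by (intro pos_mono) auto
 then show "- ?E f <= - ?E f'" by auto
 qed
 have antiM: "mono_fun (%f. - max 0 (- f x))" unfolding mono_fun_def using xV by auto
 have cB: "card ?B <= 2 * CARD('n)"
 using card_mono[OF mnb_props(1)[OF xX], of ?B] mnb_props(3)[OF xX] by auto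
 have "c0 <= EE (%f. max 0 (f x))" unfolding c0_def by (rule expectation_pos_part[OF xV diag_ge_1[OF xl]])
 also have "EE (%f. max 0 (f x)) = EE (%f. max 0 (- f x))"
 proof -
 have m: "(%f. max 0 (f x) :: real) : borel_measurable (PiM (mV m n) (%_. borel))"
 by (intro borel_measurable_max borel_measurable_const) (use L2_coord[OF xV] in \<open>simp add: L2_def\<close>)
 have "EE (%f. max 0 (f x)) = expectation (%om. (%f. max 0 (f x)) (\<lambda>v\<in>mV m n. - \<phi> v om))"
 by (rule symmetric_law[OF finite_mV _ _ m, symmetric]) (use xV in \<open>auto simp: mV_def\<close>)
 then show ?thesis using xV by (simp add: res_def)
 qed
 finally have "c0 * cn ^ (2 * CARD('n)) <= EE (%f. max 0 (- f x)) * EE ?E"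
 using c0_pos cn by (intro mult_mono cn_power_le[OF _ _ cB]) (auto intro: finite_subset[OF _ finite_mV])
 also have "... <= EE (%f. max 0 (- f x) * ?E f)"
 by (rule FKG_anti[OF LM antiM LE antiE])
 also have "... <= TT x" unfolding TT_def
 proof (rule integral_mono[OF L2_mult[OF LM LE] L2_integrable[OF L2_U2[OF xV]]])
 fix om
 let ?f = "res (mV m n) om"
 show "max 0 (- ?f x) * ?E ?f <= U2 ?f x"
 proof (cases "?f x < 0 & ?B Int pos ?f = {}")
 case True
 have "x ~: cl (pos ?f)" using cl_sub[of "pos ?f"] True by (auto simp: pos_def)
 moreover have "mnb m x Int cl (pos ?f) = {}" using cl_sub[of "pos ?f"] cl_V[of "pos ?f"] True by blast
 ultimately have "x ~: Kc (pos ?f)" by (simp add: Kc_def)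
 moreover have "x : Sc (pos ?f)" using x by (simp add: Sc_def)
 ultimately have "U2 ?f x = max 0 (- ?f x)" using U2_on[of x ?f] x by simp
 then show ?thesis by simp
 next
 case False
 then have "max 0 (- ?f x) * ?E ?f = 0" by auto
 then show ?thesis by (rule ord_eq_le_trans[OF _ U2_nonneg[OF xX]])
 qed
 qed
 finally show ?thesis .
qed

text \<open>Cauchy-Schwarz in linear form; the parameter l is chosen in
  \<open>pc_lower\<close>.\<close>

lemma second_moment_method:
 fixes x :: "real^'n"
 assumes x: "x : latt" "linf x <= real n" and l: "l > 0"
 shows "TT x <= (l * EE (%f. (ax x f)\<^sup>2) + pc x / l) / 2"
proof -
 have xV: "x : mV m n" by (rule latt_in_mV[OF x])
 have Lc: "L2 (%f. if x : cl (pos f) then 1 else 0)" by (rule L2_event[of "%P Q. x : cl P"])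
 have i: "integrable M (%om. (ax x (res (mV m n) om))\<^sup>2)" using L2_ax[OF xV] by (simp add: L2_def)
 have "TT x <= EE (ax x)" by (rule TT_le(1)[OF xV])
 also have "... <= EE (%f. (l * (ax x f)\<^sup>2 + (if x : cl (pos f) then 1 else 0) / l) / 2)"
 proof (rule integral_mono[OF L2_integrable[OF L2_ax[OF xV]]])
 show "integrable M (%om. (l * (ax x (res (mV m n) om))\<^sup>2 + (if x : cl (pos (res (mV m n) om)) then 1 else 0) / l) / 2)"
 using i L2_integrable[OF Lc] by (intro integrable_divide_zero Bochner_Integration.integrable_add integrable_mult_right integrable_divide) auto
 fix om
 let ?a = "ax x (res (mV m n) om)" and ?c = "if x : cl (pos (res (mV m n) om)) then 1 else (0::real)"
 show "?a <= (l * ?a\<^sup>2 + ?c / l) / 2"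
 proof (cases "x : cl (pos (res (mV m n) om))")
 case True
 have "0 <= (l * ?a - 1)\<^sup>2" by simp
 then have "2 * l * ?a <= l\<^sup>2 * ?a\<^sup>2 + 1" by (simp add: power2_diff power_mult_distrib)
 then show ?thesis using True l by (simp add: field_simps power2_eq_square)
 qed (simp add: ax_def)
 qed
 also have "... = (l * EE (%f. (ax x f)\<^sup>2) + pc x / l) / 2"
 unfolding pc_def using i L2_integrable[OF Lc] by simp
 finally show ?thesis .
qed

end

section \<open>The discrete growth argument\<close>

lemma finite_argmax:
 fixes f :: "'a => real"
 assumes "finite S" "S ~= {}"
 obtains x where "x : S" "!!w. w : S ==> f w <= f x"
proof -
 have "Max (f ` S) : f ` S" using assms by simp
 then obtain x where x: "x : S" "f x = Max (f ` S)" by auto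
 show ?thesis
 proof (rule that[OF x(1)])
 fix w assume "w : S"
 then show "f w <= f x" unfolding x(2) using assms by simp
 qed
qed

lemma neighbour_le_avg:
 fixes u :: "real^'n => real"
 assumes u: "!!i. 0 <= u (x + axis i 1)" "!!i. 0 <= u (x + axis i (- 1))" and s: "s = 1 | s = - 1"
 shows "u (x + axis i s) <= 2 * real CARD('n) * avg u x"
proof -
 have "u (x + axis i s) <= u (x + axis i 1) + u (x + axis i (- 1))" using u(1)[of i] u(2)[of i] s by auto
 also have "... <= (\<Sum>i\<in>UNIV. u (x + axis i 1) + u (x + axis i (- 1)))"
 using u by (intro member_le_sum[where f = "%i. u (x + axis i 1) + u (x + axis i (- 1))"] add_nonneg_nonneg) auto
 also have "... = 2 * real CARD('n) * avg u x"
 proof -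
 have e: "x - axis i 1 = x + axis i (- 1)" for i by (simp add: vec_eq_iff)
 show ?thesis unfolding avg_def e by simp
 qed
 finally show ?thesis .
qed

lemma avg_power_nonneg_latt: "\<forall>v\<in>latt. 0 <= F v ==> v : latt ==> 0 <= (avg ^^ k) F v"
 by (intro avg_power_nonneg) auto

text \<open>A unit step in a coordinate where x and y differ lowers the l1 distance by 1, and
  \<open>neighbour_le_avg\<close> pays for it with one factor 2d.\<close>

lemma reaches_l1:
 fixes x y :: "real^'n"
 assumes "x : latt" "y : latt" "(\<Sum>i\<in>UNIV. \<bar>x $ i - y $ i\<bar>) = real k"
 shows "reaches k x y"
 using assms
proof (induction k arbitrary: x)
 case 0
 then have "\<forall>i\<in>UNIV. \<bar>x $ i - y $ i\<bar> = 0" by (subst (asm) (1) of_nat_0, subst (asm) sum_nonneg_eq_0_iff) auto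
 then have "x = y" by (simp add: vec_eq_iff)
 then show ?case by (simp add: reaches_def)
next
 case (Suc k)
 obtain i where i: "x $ i ~= y $ i"
 proof (rule ccontr)
 assume "~ thesis"
 then have "!!i. x $ i = y $ i" using that by blast
 then have "(\<Sum>i\<in>UNIV. \<bar>x $ i - y $ i\<bar>) = 0" by simp
 then show False using Suc.prems(3) by simp
 qed
 define s where "s = (if x $ i < y $ i then 1 else - 1 :: real)"
 have s: "s = 1 | s = - 1" by (simp add: s_def)
 let ?x = "x + axis i s"
 have xl: "?x : latt" using latt_axis(1)[OF Suc.prems(1)] s by auto
 have "\<bar>x $ i - y $ i\<bar> >= 1"
 proof (rule ccontr)
 assume "~ ?thesis"
 then have "x $ i = y $ i" using Suc.prems(1,2) by (intro Ints_abs_less_1_eq) (auto simp: latt_def)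
 then show False using i by simp
 qed
 then have e: "\<bar>x $ i + s - y $ i\<bar> = \<bar>x $ i - y $ i\<bar> - 1" by (auto simp: s_def)
 have "(\<Sum>j\<in>UNIV. \<bar>?x $ j - y $ j\<bar>) = (\<Sum>j\<in>UNIV. \<bar>x $ j - y $ j\<bar> - (if j = i then 1 else 0))"
 using e by (intro sum.cong) auto
 also have "... = real k" using Suc.prems(3) by (simp add: sum_subtractf)
 finally have r: "reaches k ?x y" by (rule Suc.IH[OF xl Suc.prems(2)])
 show ?case unfolding reaches_def
 proof (intro allI impI)
 fix F :: "real^'n => real" assume F: "\<forall>v\<in>latt. 0 <= F v"
 have "F y <= (2 * real CARD('n)) ^ k * (avg ^^ k) F ?x" using r F unfolding reaches_def by blast
 also have "... <= (2 * real CARD('n)) ^ k * (2 * real CARD('n) * avg ((avg ^^ k) F) x)"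
 proof (intro mult_left_mono neighbour_le_avg s)
 show "0 <= (avg ^^ k) F (x + axis j 1)" "0 <= (avg ^^ k) F (x + axis j (- 1))" for j
 using latt_axis(1)[OF Suc.prems(1)] by (intro avg_power_nonneg_latt[OF F]; simp)+
 qed simp
 finally show "F y <= (2 * real CARD('n)) ^ Suc k * (avg ^^ Suc k) F x" by (simp add: mult.assoc mult.left_commute)
 qed
qed

lemma reaches_ex:
 fixes x y :: "real^'n"
 assumes x: "x : latt" and y: "y : latt" and n: "norm (y - x) <= real l"
 obtains k where "k <= CARD('n) * l" "reaches k x y" "reaches k y x"
proof -
 let ?S = "\<Sum>i\<in>UNIV. \<bar>x $ i - y $ i\<bar>"
 have "?S : \<int>" using x y by (intro Ints_sum) (auto simp: latt_def intro!: Ints_abs Ints_diff)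
 then obtain a where a: "?S = of_int a" by (elim Ints_cases)
 have "0 <= ?S" by (intro sum_nonneg) simp
 then have k: "?S = real (nat a)" using a by simp
 have "?S <= (\<Sum>i\<in>(UNIV::'n set). real l)"
 proof (rule sum_mono)
 fix i show "\<bar>x $ i - y $ i\<bar> <= real l"
 using component_le_norm_cart[of "y - x" i] n by (simp add: abs_minus_commute)
 qed
 then have "real (nat a) <= real (CARD('n) * l)" using k by simp
 then have "nat a <= CARD('n) * l" by (simp only: of_nat_le_iff)
 moreover have "(\<Sum>i\<in>UNIV. \<bar>y $ i - x $ i\<bar>) = real (nat a)" using k by (simp add: abs_minus_commute)
 ultimately show ?thesis using that reaches_l1[OF x y k] reaches_l1[OF y x] by blast
qed

lemma avg_norm_sq: "avg (%w. (norm (w - a))\<^sup>2) x = (norm (x - a))\<^sup>2 + 1" for x :: "real^'n"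
proof -
 have e: "x + axis i 1 - a = (x - a) + axis i 1" "x - axis i 1 - a = (x - a) - axis i 1" for i by simp_all
 show ?thesis unfolding avg_def e norm_axis_step by (simp add: field_simps)
qed

lemma avg_power_norm_sq: "(avg ^^ j) (%w. b + c * (norm (w - a))\<^sup>2) = (%x. b + c * ((norm (x - a))\<^sup>2 + real j))" for a :: "real^'n"
proof (induction j)
 case (Suc j)
 have "avg (%x. b + c * ((norm (x - a))\<^sup>2 + real j)) x = b + c * ((norm (x - a))\<^sup>2 + real (Suc j))" for x
 by (simp only: avg_add avg_cmult avg_const avg_norm_sq) (simp add: algebra_simps)
 then show ?case unfolding funpow.simps o_apply Suc by (rule ext)
qed simp

lemma avg_power_add_diff: "(avg ^^ k) (%v. u v - w v) x = (avg ^^ k) u x - (avg ^^ k) w x" for x :: "real^'n"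
proof (induction k arbitrary: x)
 case (Suc k)
 then have "(avg ^^ k) (%v. u v - w v) = (%x. (avg ^^ k) u x + (- 1) * (avg ^^ k) w x)" by (simp add: fun_eq_iff)
 then have "(avg ^^ Suc k) (%v. u v - w v) x = avg (%x. (avg ^^ k) u x + (- 1) * (avg ^^ k) w x) x" by simp
 also have "... = avg ((avg ^^ k) u) x + (- 1) * avg ((avg ^^ k) w) x" by (simp only: avg_add avg_cmult)
 finally show ?case by simp
qed simp

lemma powr_le_square: "0 <= u ==> u <= 1 ==> u powr (12/5) <= u\<^sup>2" for u :: real
proof (cases "u = 0")
 case False
 assume "0 <= u" "u <= 1"
 then have "u powr (12/5) <= u powr 2" using False by (intro powr_mono') auto
 then show ?thesis using False \<open>0 <= u\<close> by simp
qed simp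

lemma fdec_le_powr:
 assumes "K >= 1" "b >= 0" "0 < r" "r <= norm x"
 shows "fdec K b x <= (r\<^sup>2) powr (- b)"
proof -
 have "r\<^sup>2 <= (norm x)\<^sup>2" using assms by (intro power_mono) auto
 then have "r\<^sup>2 <= (norm x)\<^sup>2 + K" using assms(1) by linarith
 then show ?thesis unfolding fdec_def using assms by (intro powr_mono2') auto
qed

text \<open>R is the truncation level for \<open>ax\<close>, L a distance at which the triple
  convolution is negligible, k0 bounds the steps needed to cover L + 1, and kp is the curvature of
  the comparison quadratic. Each of c1 to c4 makes one term of \<open>two_point\<close> at most
  t^2/20, the condition on ep does so for the mesh error, and c5 and c6 make the scale r of
  \<open>upper_step\<close> large compared with 1, L and k0.\<close>

locale mesh_growth = mesh_est m ty M \<phi> n K C ep d2 b2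
 for m :: nat and ty :: "'n::finite itself" and M :: "'w measure" and \<phi> :: "real^'n => 'w => real" and n :: nat and K C ep d2 b2 :: real +
 fixes R kp g1 A :: real and L k0 :: nat
 assumes k0: "k0 = CARD('n) * (L + 1)" and L: "L >= 1" and R: "R > 0" and kp: "kp > 0" and g1: "g1 = 3 * b2 / c0"
 and c1: "4 * d2 * C * (1 + 2 * g1) / R <= 1/20" and c2: "8 * d2\<^sup>2 * g1\<^sup>2 * C * ((real L)\<^sup>2) powr (- 2/5) <= 1/20"
 and c3: "512 * d2 * C * kp\<^sup>2 <= 1/20" and c4: "3 * R * real k0 * d2 ^ (2 * k0) * kp <= 1/20"
 and c5: "16 * kp * (1 + C) <= 1" and c6: "kp * (1 + C) * (8 * (real L + 1) + 4 * real k0 + 16)\<^sup>2 <= 4"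
 and A: "A >= 1" "A >= 64 / kp" and eps_n: "20 * (5 + 4 * C) * ep * real n ^ 4 <= 1"
begin

lemma b2_nonneg: "b2 >= 0" by (simp add: b2_def)
lemma g1_nonneg: "g1 >= 0" using g1 b2_nonneg c0_pos by simp

text \<open>A quadratic with coefficient kp t^2 touches \<open>TT\<close> from above at some x,
  which limits the growth of iterated averages there to kp t^2 per step; r is twice the distance at
  which the quadratic reaches t. A second quadratic leads to a point y at distance between L and L +
  1 with \<open>TT\<close> at least t/2. Then T(x) T(y) >= t^2/2, while the five terms of
  \<open>two_point\<close> sum to at most 5 t^2/20.\<close>

lemma upper_step:
 fixes x0 :: "real^'n"
 defines "t \<equiv> TT x0"
 assumes x0: "x0 : latt" and t: "t > 0" "t <= 1 + C" and r: "r > 0" "kp * t * r\<^sup>2 = 4"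
 and ball: "!!w. w : latt ==> norm (w - x0) <= r ==> linf w < real n & TT w <= 2 * t"
 and e: "20 * (5 + 4 * C) * ep <= t\<^sup>2" "ep <= t"
 shows False
proof -
 let ?b = "8 * (real L + 1) + 4 * real k0 + 16"
 have r_ge: "r >= ?b"
 proof (rule power2_le_imp_le)
 have "kp * t * ?b\<^sup>2 <= kp * (1 + C) * ?b\<^sup>2" using t kp by (intro mult_right_mono mult_left_mono) auto
 also have "... <= kp * t * r\<^sup>2" using c6 r by simp
 finally show "?b\<^sup>2 <= r\<^sup>2" using kp t by (simp add: mult_le_cancel_left)
 qed (use r in simp)
 let ?W = "{w::real^'n. w : latt & norm (w - x0) <= r}"
 let ?\<Phi> = "%w. TT w - kp * t\<^sup>2 * (norm (w - x0))\<^sup>2"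
 have "finite ?W" "?W ~= {}" using finite_latt_ball x0 r by auto
 then obtain x where x: "x : ?W" "!!w. w : ?W ==> ?\<Phi> w <= ?\<Phi> x"
 by (rule finite_argmax[of ?W ?\<Phi>]) (rule that; blast)
 have xl: "x : latt" and xr: "norm (x - x0) <= r" using x by auto
 have Tx2: "TT x <= 2 * t" using ball[OF xl xr] by simp
 have \<Phi>0: "t <= ?\<Phi> x" using x(2)[of x0] x0 r by (simp add: t_def)
 have kt: "kp * t\<^sup>2 > 0" using kp t by simp
 have Tx: "t <= TT x" using \<Phi>0 mult_nonneg_nonneg[OF less_imp_le[OF kt] zero_le_power2[of "norm (x - x0)"]] by linarith
 \<comment> \<open>Since \<open>TT\<close> is at most 2t at x while the difference is still at least
   t, the quadratic at x is at most t, its value at distance r/2. This leaves a ball of radius r/2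
   around x inside the region of control.\<close>
 have xr2: "norm (x - x0) <= r / 2"
 proof (rule power2_le_imp_le)
 have "kp * t\<^sup>2 * (norm (x - x0))\<^sup>2 <= t" using \<Phi>0 Tx2 by linarith
 also have "... = kp * t\<^sup>2 * (r / 2)\<^sup>2" using r(2) t by (simp add: power2_eq_square field_simps)
 finally show "(norm (x - x0))\<^sup>2 <= (r / 2)\<^sup>2" using kt by (simp only: mult_le_cancel_left_pos)
 qed (use r in simp)
 have inW: "linf w < real n & TT w <= 2 * t & TT w <= TT x + kp * t\<^sup>2 * ((norm (w - x0))\<^sup>2 - (norm (x - x0))\<^sup>2)"
 if w: "w : latt" "norm (w - x) <= r / 2" for w
 proof -
 have "norm (w - x0) <= r" using norm_triangle_ineq[of "w - x" "x - x0"] w xr2 by simp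
 then show ?thesis using ball[OF w(1)] x(2)[of w] w(1) by (simp add: algebra_simps)
 qed
 have incr: "(avg ^^ j) TT x - TT x <= kp * t\<^sup>2 * real j" if j: "real j <= r / 2" for j
 proof -
 let ?b = "TT x - kp * t\<^sup>2 * (norm (x - x0))\<^sup>2"
 have "(avg ^^ j) TT x <= (avg ^^ j) (%w. ?b + kp * t\<^sup>2 * (norm (w - x0))\<^sup>2) x"
 proof (rule avg_power_mono[OF xl])
 fix v :: "real^'n" assume "v : latt" "norm (v - x) <= real j"
 then show "TT v <= ?b + kp * t\<^sup>2 * (norm (v - x0))\<^sup>2" using inW[of v] j by (simp add: algebra_simps)
 qed
 also have "... = TT x + kp * t\<^sup>2 * real j" unfolding avg_power_norm_sq by (simp add: algebra_simps)
 finally show ?thesis by simp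
 qed
 \<comment> \<open>On the ball of radius L + 1 the added quadratic is at most t/2, so
   \<open>TT\<close> at the maximiser y is at least t/2. The sum is strictly subharmonic, so y
   cannot have all its neighbours in the ball, which forces its distance from x above L.\<close>
 define \<eta> where "\<eta> = t / (2 * (real L + 1)\<^sup>2)"
 have \<eta>: "\<eta> > 0" using t by (simp add: \<eta>_def)
 let ?B = "{w::real^'n. w : latt & norm (w - x) <= real (L + 1)}"
 let ?\<Psi> = "%w. TT w + \<eta> * (norm (w - x))\<^sup>2"
 have "finite ?B" "?B ~= {}" using finite_latt_ball xl by auto
 then obtain y where y: "y : ?B" "!!w. w : ?B ==> ?\<Psi> w <= ?\<Psi> y"
 by (rule finite_argmax[of ?B ?\<Psi>]) (rule that; blast)
 have yl: "y : latt" and yn: "norm (y - x) <= real (L + 1)" using y by auto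
 have yb: "norm (y - x) <= r / 2" using yn r_ge by simp
 have far: "norm (y - x) > real L"
 proof (rule ccontr)
 assume "~ ?thesis"
 then have near: "norm (y - x) <= real L" by simp
 have nb: "?\<Psi> (y + axis i s) <= ?\<Psi> y" if s: "s = 1 | s = - 1" for i s
 proof (rule y(2))
 have "norm (y + axis i s - x) <= norm (y - x) + norm (axis i s :: real^'n)"
 using norm_triangle_ineq[of "y - x" "axis i s"] by (simp add: algebra_simps)
 also have "... <= real (L + 1)" using near s norm_axis_real[of i s] by auto
 finally show "y + axis i s : ?B" using latt_axis(1)[OF yl] s by auto
 qed
 have "avg ?\<Psi> y <= avg (%w. ?\<Psi> y) y"
 by (rule avg_mono_neighbours) (use nb in \<open>simp_all only: avg_minus_axis simp_thms\<close>)
 also have "... = ?\<Psi> y" by (rule avg_const)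
 finally have "avg TT y + \<eta> * ((norm (y - x))\<^sup>2 + 1) <= ?\<Psi> y" by (simp only: avg_add avg_cmult avg_norm_sq)
 moreover have "TT y <= avg TT y" using TT_subharmonic[OF yl] inW[OF yl yb] by simp
 ultimately show False using \<eta> by (simp add: distrib_left)
 qed
 have Ty: "t / 2 <= TT y"
 proof -
 have "TT x <= ?\<Psi> y" using y(2)[of x] xl by simp
 moreover have "\<eta> * (norm (y - x))\<^sup>2 <= \<eta> * (real L + 1)\<^sup>2" using yn \<eta> by (intro mult_left_mono power_mono) auto
 moreover have "\<eta> * (real L + 1)\<^sup>2 = t / 2" by (simp add: \<eta>_def)
 ultimately show ?thesis using Tx by linarith
 qed
 have Ty2: "TT y <= 2 * t" using inW[OF yl yb] by simp
 obtain k where k: "k <= CARD('n) * (L + 1)" "reaches k x y" "reaches k y x" by (rule reaches_ex[OF xl yl yn])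
 have kk: "k <= k0" using k k0 by simp
 have kr: "2 * real k + real (L + 1) <= r / 2" using kk r_ge by simp
 have nyx: "norm (v - x) <= norm (v - y) + norm (y - x)" for v using norm_triangle_ineq[of "v - y" "y - x"] by simp
 have bx: "linf v < real n" if "v : latt" "norm (v - x) <= real k" for v using inW[OF that(1)] that(2) kr by simp
 have byk: "linf v < real n" if "v : latt" "norm (v - y) <= real k" for v
 using inW[OF that(1)] that(2) kr nyx[of v] yn by simp
 let ?N = "{w::real^'n. w : latt & norm (w - x) <= r / 4}"
 define gm where "gm = g1 * t"
 \<comment> \<open>Outside the r/4 ball around x both x and y are at distance at least r/8, because
   L + 1 <= r/8. As (r/8)^2 = 1/(16 kp t) and the Green exponent 12/5 exceeds 2, the far
   contribution is of order t^2.\<close>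
 define dl where "dl = d2 * (C * (16 * kp * t)\<^sup>2)"
 have u: "0 <= 16 * kp * t" "16 * kp * t <= 1"
 proof -
 show "0 <= 16 * kp * t" using kp t by simp
 have "16 * kp * t <= 16 * kp * (1 + C)" using kp t by (intro mult_left_mono) auto
 then show "16 * kp * t <= 1" using c5 by linarith
 qed
 have gr: "d2 * green v w <= dl" if v: "norm (v - w) >= r / 8" for v w :: "real^'n"
 proof -
 have "(r / 8)\<^sup>2 = 1 / (16 * kp * t)" using r(2) kp t by (simp add: power2_eq_square field_simps)
 then have "((r / 8)\<^sup>2) powr (- (12/5)) = (16 * kp * t) powr (12/5)"
 using kp t by (simp add: powr_minus_divide powr_divide)
 then have "fdec K (12/5) (v - w) <= (16 * kp * t) powr (12/5)"
 using fdec_le_powr[OF KC(1) _ _ v, of "12/5"] r by simp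
 also have "... <= (16 * kp * t)\<^sup>2" by (rule powr_le_square[OF u])
 finally have "C * fdec K (12/5) (v - w) <= C * (16 * kp * t)\<^sup>2" using KC by (intro mult_left_mono) auto
 then have "green v w <= C * (16 * kp * t)\<^sup>2" using G[of v w] by linarith
 then show ?thesis unfolding dl_def using d2_ge by (intro mult_left_mono) auto
 qed
 have dx: "d2 * green v x <= dl" if "v : latt - ?N" for v using that r by (intro gr) auto
 have dy: "d2 * green v y <= dl" if "v : latt - ?N" for v
 using that nyx[of v] yn r_ge by (intro gr) auto
 have \<Gamma>b: "\<Gamma> v <= gm" if v: "v : ?N" for v
 proof -
 have "\<Gamma> v <= b2 * ((2 * t + ep) / c0)"
 proof (rule \<Gamma>_le)
 show "v : latt" using v by simp
 fix w :: "real^'n" assume w: "w : latt" "norm (w - v) <= 2"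
 have "norm (w - x) <= r / 2" using norm_triangle_ineq[of "w - v" "v - x"] w v r_ge by simp
 then show "linf w < real n & TT w <= 2 * t" using inW[OF w(1)] by simp
 qed
 also have "... <= b2 * ((3 * t) / c0)" using e b2_nonneg c0_pos by (intro mult_left_mono divide_right_mono) auto
 also have "b2 * ((3 * t) / c0) = gm" by (simp add: gm_def g1)
 finally show ?thesis .
 qed
 have dl0: "0 <= dl" unfolding dl_def using d2_ge KC by simp
 have gm0: "0 <= gm" unfolding gm_def using g1_nonneg t by simp
 have main: "TT x * TT y <= 2 * dl + 8 * d2\<^sup>2 * gm\<^sup>2 * (C * fdec K (2/5) (x - y))
 + R * d2 ^ k * (((avg ^^ k) TT x - TT x) + ((avg ^^ k) TT y - TT y)) + 2 * (dl + 2 * d2 * gm * C) * (2 * t) / R + (5 + 4 * C) * ep"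
 by (rule two_point[OF xl yl bx byk k(2,3) finite_latt_ball[of x "r / 4"] _ dl0 dx dy gm0 \<Gamma>b Tx2 Ty2 R]) auto
 have t1: "2 * dl <= t\<^sup>2 / 20"
 proof -
 have "2 * dl = (512 * d2 * C * kp\<^sup>2) * t\<^sup>2" by (simp add: dl_def power_mult_distrib)
 also have "... <= (1/20) * t\<^sup>2" by (intro mult_right_mono c3) simp
 finally show ?thesis by simp
 qed
 have t2: "8 * d2\<^sup>2 * gm\<^sup>2 * (C * fdec K (2/5) (x - y)) <= t\<^sup>2 / 20"
 proof -
 have "fdec K (2/5) (x - y) <= ((real L)\<^sup>2) powr (- (2/5))"
 using fdec_le_powr[OF KC(1), of "2/5" "real L" "x - y"] far L by (simp add: norm_minus_commute)
 then have "8 * d2\<^sup>2 * gm\<^sup>2 * (C * fdec K (2/5) (x - y)) <= 8 * d2\<^sup>2 * gm\<^sup>2 * (C * ((real L)\<^sup>2) powr (- (2/5)))"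
 using KC by (intro mult_left_mono) auto
 also have "... = (8 * d2\<^sup>2 * g1\<^sup>2 * C * ((real L)\<^sup>2) powr (- 2/5)) * t\<^sup>2" by (simp add: gm_def power_mult_distrib)
 also have "... <= (1/20) * t\<^sup>2" by (intro mult_right_mono c2) simp
 finally show ?thesis by simp
 qed
 have t3: "R * d2 ^ k * (((avg ^^ k) TT x - TT x) + ((avg ^^ k) TT y - TT y)) <= t\<^sup>2 / 20"
 proof -
 \<comment> \<open>The increment at y is transported to x: F is nonnegative on the lattice, so its
   value at y is at most d2^k times its k-fold average at x, and that average is the difference of
   the 2k-fold and k-fold averages of \<open>TT\<close>.\<close>
 define F where "F v = (if norm (v - x) <= r / 2 - real k & v : latt then (avg ^^ k) TT v - TT v else 0)" for v
 have sub: "TT v <= (avg ^^ k) TT v" if v: "v : latt" "norm (v - x) <= r / 2 - real k" for v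
 proof (rule le_avg_power[OF v(1) _ order_refl])
 fix w :: "real^'n" assume w: "w : latt" "norm (w - v) <= real k"
 have "norm (w - x) <= r / 2" using norm_triangle_ineq[of "w - v" "v - x"] w v by simp
 then show "TT w <= avg TT w" using inW[OF w(1)] TT_subharmonic[OF w(1)] by simp
 qed
 have "\<forall>v\<in>latt. 0 <= F v" using sub by (auto simp: F_def)
 then have "F y <= d2 ^ k * (avg ^^ k) F x" using k(2) unfolding reaches_def d2_def by blast
 moreover have "F y = (avg ^^ k) TT y - TT y" using yn yl kr by (simp add: F_def)
 moreover have "(avg ^^ k) F x <= (avg ^^ k) (%v. (avg ^^ k) TT v - TT v) x"
 proof (rule avg_power_mono[OF xl])
 fix v :: "real^'n" assume "v : latt" "norm (v - x) <= real k"
 then show "F v <= (avg ^^ k) TT v - TT v" using kr by (simp add: F_def)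
 qed
 moreover have "(avg ^^ k) (%v. (avg ^^ k) TT v - TT v) x = (avg ^^ (k + k)) TT x - (avg ^^ k) TT x"
 unfolding avg_power_add_diff by (simp add: funpow_add)
 moreover have kx: "(avg ^^ k) TT x - TT x <= kp * t\<^sup>2 * real k" using kr by (intro incr) simp
 moreover have "(avg ^^ (k + k)) TT x - TT x <= kp * t\<^sup>2 * real (k + k)" using kr by (intro incr) simp
 moreover have "TT x <= (avg ^^ k) TT x" using kr by (intro sub xl) simp
 ultimately have y1: "(avg ^^ k) TT y - TT y <= d2 ^ k * ((avg ^^ (k + k)) TT x - (avg ^^ k) TT x)"
 and y2: "(avg ^^ (k + k)) TT x - (avg ^^ k) TT x <= 2 * (kp * t\<^sup>2 * real k)"
 using mult_left_mono[of "(avg ^^ k) F x" "(avg ^^ (k + k)) TT x - (avg ^^ k) TT x" "d2 ^ k"] d2_ge by (simp_all add: algebra_simps)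
 have p1: "1 <= d2 ^ k" using d2_ge by simp
 have q0: "0 <= kp * t\<^sup>2 * real k" using kt by simp
 have "d2 ^ k * ((avg ^^ (k + k)) TT x - (avg ^^ k) TT x) <= d2 ^ k * (2 * (kp * t\<^sup>2 * real k))"
 by (rule mult_left_mono[OF y2]) (use p1 in simp)
 moreover have "1 * (kp * t\<^sup>2 * real k) <= d2 ^ k * (kp * t\<^sup>2 * real k)" by (rule mult_right_mono[OF p1 q0])
 ultimately have s: "((avg ^^ k) TT x - TT x) + ((avg ^^ k) TT y - TT y) <= d2 ^ k * (3 * (kp * t\<^sup>2 * real k))"
 using y1 kx by (simp add: algebra_simps)
 have "R * d2 ^ k * (((avg ^^ k) TT x - TT x) + ((avg ^^ k) TT y - TT y)) <= R * d2 ^ k * (d2 ^ k * (3 * (kp * t\<^sup>2 * real k)))"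
 using R p1 by (intro mult_left_mono s) auto
 also have "... = (3 * R * real k * d2 ^ (2 * k) * kp) * t\<^sup>2" 
 proof -
 have "d2 ^ (2 * k) = d2 ^ k * d2 ^ k" by (simp add: mult_2 power_add)
 then show ?thesis by (simp add: ac_simps)
 qed
 also have "... <= (3 * R * real k0 * d2 ^ (2 * k0) * kp) * t\<^sup>2"
 using R kp kk d2_ge by (intro mult_right_mono mult_mono power_increasing) auto
 also have "... <= (1/20) * t\<^sup>2" by (intro mult_right_mono c4) simp
 finally show ?thesis by simp
 qed
 have t4: "2 * (dl + 2 * d2 * gm * C) * (2 * t) / R <= t\<^sup>2 / 20"
 proof -
 have "(16 * kp * t)\<^sup>2 <= 16 * kp * t" using mult_right_mono[OF u(2) u(1)] by (simp only: power2_eq_square mult_1)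
 also have "... <= 1 * t"
 proof (rule mult_right_mono)
 have "16 * kp * 1 <= 16 * kp * (1 + C)" using kp KC by (intro mult_left_mono) auto
 then show "16 * kp <= 1" using c5 by simp
 qed (use t in simp)
 finally have "dl <= d2 * (C * t)" unfolding dl_def using d2_ge KC by (intro mult_left_mono) auto
 then have "2 * (dl + 2 * d2 * gm * C) * (2 * t) / R <= 2 * (d2 * (C * t) + 2 * d2 * gm * C) * (2 * t) / R"
 using t R by (intro divide_right_mono mult_right_mono) auto
 also have "... = (4 * d2 * C * (1 + 2 * g1) / R) * t\<^sup>2" by (simp add: gm_def power2_eq_square algebra_simps add_divide_distrib)
 also have "... <= (1/20) * t\<^sup>2" by (intro mult_right_mono c1) simp
 finally show ?thesis by simp
 qed
 have "20 * ((5 + 4 * C) * ep) <= t\<^sup>2" using e(1) by (simp only: mult.assoc)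
 then have t5: "(5 + 4 * C) * ep <= t\<^sup>2 / 20" by linarith
 have "t * (t / 2) <= TT x * TT y" using Tx Ty t by (intro mult_mono) auto
 then have "t\<^sup>2 / 2 <= 5 * (t\<^sup>2 / 20)" using main t1 t2 t3 t4 t5 by (simp add: power2_eq_square)
 then show False using t by simp
qed

lemma n_pow: "1 <= real n" "real n ^ 2 <= real n ^ 4" using n1 by (auto intro: power_increasing)

lemma eps_small: "20 * (5 + 4 * C) * ep <= 1 / real n ^ 4" "ep <= 1 / real n ^ 2"
proof -
 have n0: "real n ^ 4 > 0" using n_pow(1) by simp
 show 1: "20 * (5 + 4 * C) * ep <= 1 / real n ^ 4" using eps_n n0 by (simp add: pos_le_divide_eq)
 have "1 * ep <= 20 * (5 + 4 * C) * ep" using eps KC by (intro mult_right_mono) auto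
 also have "... <= 1 / real n ^ 4" by (rule 1)
 also have "... <= 1 / real n ^ 2" using n_pow by (intro divide_left_mono) auto
 finally show "ep <= 1 / real n ^ 2" by simp
qed

text \<open>The weight (3n/4 - |w|)^2 selects a maximiser z around which \<open>TT\<close> at most
  doubles within a quarter of its distance rh to the edge of the ball, because 2 (3/4)^2 > 1. If the
  weighted maximum exceeded A, the scale r of \<open>upper_step\<close> would fit into that
  neighbourhood. For |x| <= n/4 the weight is at least (n/2)^2, hence 4A.\<close>

lemma upper_bound:
 fixes x :: "real^'n"
 assumes x: "x : latt" "norm x <= real n / 4"
 shows "TT x <= 4 * A / (real n)\<^sup>2"
proof -
 let ?b = "3 * real n / 4"
 let ?W = "{w::real^'n. w : latt & norm (w - 0) <= ?b}"
 let ?\<Phi> = "%w. TT w * (?b - norm w)\<^sup>2"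
 have n0: "real n > 0" using n_pow by simp
 have xW: "x : ?W" using x by simp
 have "finite ?W" "?W ~= {}" using finite_latt_ball xW by blast+
 then obtain z where z: "z : ?W" "!!w. w : ?W ==> ?\<Phi> w <= ?\<Phi> z"
 by (rule finite_argmax[of ?W ?\<Phi>]) (rule that; blast)
 have inb: "linf w < real n" if "norm w <= ?b" for w :: "real^'n"
 using linf_le_norm[of w] that n0 by linarith
 have zl: "z : latt" "norm z <= ?b" using z by auto
 have "?\<Phi> z <= A"
 proof (rule ccontr)
 assume "~ ?thesis"
 then have big: "A < ?\<Phi> z" by simp
 define t where "t = TT z"
 define rh where "rh = ?b - norm z"
 have tr: "A < t * rh\<^sup>2" using big by (simp add: t_def rh_def)
 have rh0: "rh >= 0" "rh <= real n" unfolding rh_def using zl(2) n0 norm_ge_zero[of z] by linarith+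
 have t0: "t >= 0" unfolding t_def using TT_nonneg[OF zl(1)] inb[OF zl(2)] by simp
 have tp: "t > 0" using tr A t0 by (cases "t = 0") auto
 have rp: "rh > 0" using tr A rh0 by (cases "rh = 0") auto
 define r where "r = sqrt (4 / (kp * t))"
 have r: "r > 0" "kp * t * r\<^sup>2 = 4" using tp kp by (simp_all add: r_def)
 \<comment> \<open>This is where A >= 64/kp enters: kp t rh^2 > 64 = 16 kp t r^2.\<close>
 have rr: "r <= rh / 4"
 proof (rule power2_le_imp_le)
 have "64 <= kp * A" using A(2) kp by (simp add: field_simps)
 also have "... <= kp * (t * rh\<^sup>2)" using tr kp by (intro mult_left_mono) auto
 finally have "16 * (kp * t * r\<^sup>2) <= kp * t * rh\<^sup>2" unfolding r(2) by (simp add: mult.assoc)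
 then have "kp * t * (16 * r\<^sup>2) <= kp * t * rh\<^sup>2" by (simp add: algebra_simps)
 then have "16 * r\<^sup>2 <= rh\<^sup>2" using kp tp by (simp add: mult_le_cancel_left)
 then show "r\<^sup>2 <= (rh / 4)\<^sup>2" by (simp add: power_divide)
 qed (use rp in simp)
 have tn: "1 / (real n)\<^sup>2 <= t"
 proof -
 have "1 <= t * rh\<^sup>2" using tr A by simp
 also have "... <= t * (real n)\<^sup>2" using t0 rh0 by (intro mult_left_mono power_mono) auto
 finally show ?thesis using n0 by (simp add: field_simps)
 qed
 show False
 proof (rule upper_step[of z r])
 show "z : latt" by (rule zl)
 show "0 < TT z" using tp by (simp add: t_def)
 show "TT z <= 1 + C" using TT_upper[OF zl(1)] inb[OF zl(2)] by simp
 show "0 < r" by (rule r)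
 show "kp * TT z * r\<^sup>2 = 4" using r(2) by (simp add: t_def)
 have "20 * (5 + 4 * C) * ep <= (1 / (real n)\<^sup>2)\<^sup>2" using eps_small(1) by (simp add: power_divide power_mult[symmetric])
 also have "... <= t\<^sup>2" using tn by (intro power_mono) auto
 finally show "20 * (5 + 4 * C) * ep <= (TT z)\<^sup>2" by (simp add: t_def)
 show "ep <= TT z" using eps_small(2) tn by (simp add: t_def)
 fix w :: "real^'n" assume w: "w : latt" "norm (w - z) <= r"
 have wz: "norm w <= norm z + rh / 4" using norm_triangle_ineq[of "w - z" z] w rr by simp
 moreover have "norm z = ?b - rh" by (simp add: rh_def)
 ultimately have wb: "norm w <= ?b" "3 * rh / 4 <= ?b - norm w" using rp by linarith+
 have "TT w <= 2 * t"
 proof (rule ccontr)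
 assume "~ ?thesis"
 then have "2 * t * (3 * rh / 4)\<^sup>2 <= TT w * (?b - norm w)\<^sup>2"
 using tp rp wb by (intro mult_mono power_mono) auto
 also have "... <= t * rh\<^sup>2" using z(2)[of w] w wb by (simp add: t_def rh_def)
 finally have "t * rh\<^sup>2 * (9 / 8) <= t * rh\<^sup>2" by (simp add: power2_eq_square field_simps)
 moreover have "t * rh\<^sup>2 > 0" using tp rp by simp
 ultimately show False by simp
 qed
 then show "linf w < real n & TT w <= 2 * TT z" using inb[OF wb(1)] by (simp add: t_def)
 qed
 qed
 then have "?\<Phi> x <= A" using z(2)[OF xW] by linarith
 moreover have "TT x * (real n / 2)\<^sup>2 <= ?\<Phi> x"
 proof (intro mult_left_mono power_mono)
 show "real n / 2 <= ?b - norm x" using x by simp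
 have "norm x <= ?b" using x n0 by simp
 then show "0 <= TT x" using TT_nonneg[OF x(1)] inb[of x] by simp
 qed (use n0 in simp)
 ultimately have "TT x * (real n / 2)\<^sup>2 <= A" by linarith
 then show ?thesis using n0 by (simp add: power2_eq_square field_simps)
qed

text \<open>Minimise \<open>TT\<close> minus c (1 + |w|^2/n^2) with c = bt/n^2. A negative minimum
  cannot lie on the boundary by \<open>TT_boundary\<close>. At an interior minimum the average of
  \<open>TT\<close> exceeds its value by at least c/n^2, whereas \<open>TT_increment\<close> allows
  at most Q c^2; this would give bt Q >= 1.\<close>

lemma lower_bound:
 fixes bt q Q :: real
 assumes b: "bt > 0" "bt * (1 + real CARD('n)) <= c0 * cn ^ (2 * CARD('n))" "bt * Q < 1" and e: "ep <= bt / (real n)\<^sup>2"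
 and q: "q = cn ^ (2 * CARD('n) + 1)" and Q: "Q = (1 + real CARD('n)) * (d2 + 1) / (c0 * q) * (d2 * (1 + real CARD('n)) / q + 1)"
 shows "bt / (real n)\<^sup>2 <= TT (0::real^'n)"
proof -
 let ?h = "%x::real^'n. 1 + (norm x)\<^sup>2 / (real n)\<^sup>2" and ?d = "real CARD('n)"
 define c where "c = bt / (real n)\<^sup>2"
 have n0: "real n > 0" using n_pow by simp
 have c: "c > 0" using b n0 by (simp add: c_def)
 let ?W = "{w::real^'n. w : latt & linf w <= real n}"
 let ?\<Phi> = "%w. - (TT w - c * ?h w)"
 have zW: "(0::real^'n) : ?W" by (simp add: latt_def linf_le_iff)
 have "finite ?W" "?W ~= {}" using finite_latt_box zW by blast+
 then obtain x where x: "x : ?W" "!!w. w : ?W ==> ?\<Phi> w <= ?\<Phi> x"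
 by (rule finite_argmax[of ?W ?\<Phi>]) (rule that; blast)
 have xl: "x : latt" "linf x <= real n" using x by auto
 have h_le: "?h x <= 1 + ?d"
 proof -
 have "(norm x)\<^sup>2 <= (\<Sum>i\<in>(UNIV::'n set). (real n)\<^sup>2)" unfolding norm_sq_sum
 proof (rule sum_mono)
 fix i
 have "\<bar>x $ i\<bar> <= real n" using xl by (simp add: linf_le_iff)
 from power_mono[OF this abs_ge_zero, of 2] show "(x $ i)\<^sup>2 <= (real n)\<^sup>2" by simp
 qed
 then show ?thesis using n0 by (simp add: field_simps)
 qed
 have "c * ?h x <= TT x"
 proof (rule ccontr)
 assume "~ ?thesis"
 then have neg: "TT x < c * ?h x" by simp
 have Tc: "TT x <= c * (1 + ?d)" using neg mult_left_mono[OF h_le less_imp_le[OF c]] by linarith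
 show False
 proof (cases "linf x = real n")
 case True
 then have "c0 * cn ^ (2 * CARD('n)) <= TT x" using xl by (intro TT_boundary) (simp add: mD_def)
 also have "... < c * ?h x" by (rule neg)
 also have "... <= bt * (1 + ?d)"
 proof (intro mult_mono h_le)
 have "bt <= bt * (real n)\<^sup>2" using b n_pow(1) by simp
 then show "c <= bt" using n0 by (simp add: c_def field_simps)
 qed (use b in auto)
 finally show False using b by simp
 next
 case False
 then have xi: "linf x < real n" using xl by simp
 have q0: "0 < q" using cn by (simp add: q)
 have nbV: "w : latt" "linf w <= real n" if "w : nbs x" for w using nbs_latt[OF xl(1) xi that] by auto
 have nb_in: "x : nbs x" "x + axis i 1 : nbs x" "x + axis i (- 1) : nbs x" for i by (auto simp: nbs_def)
 have avg1: "c / (real n)\<^sup>2 <= avg TT x - TT x"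
 proof -
 have ge: "TT x - c * ?h x + c * ?h w <= TT w" if "w : nbs x" for w
 proof -
 have "w : ?W" using nbV[OF that] by simp
 from x(2)[OF this] show ?thesis by linarith
 qed
 have he: "(TT x - c * ?h x + c) + c / (real n)\<^sup>2 * (norm (w - 0))\<^sup>2 = TT x - c * ?h x + c * ?h w" for w by (simp add: algebra_simps)
 have "avg (%w. (TT x - c * ?h x + c) + c / (real n)\<^sup>2 * (norm (w - 0))\<^sup>2) x <= avg TT x"
 by (rule avg_mono_neighbours; unfold he avg_minus_axis; rule ge; rule nb_in)
 moreover have "avg (%w. (TT x - c * ?h x + c) + c / (real n)\<^sup>2 * (norm (w - 0))\<^sup>2) x = TT x + c / (real n)\<^sup>2"
 by (simp only: avg_add avg_const avg_cmult avg_norm_sq) (simp add: algebra_simps add_divide_distrib)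
 ultimately show ?thesis by simp
 qed
 have Tn: "0 <= TT w" if "w : nbs x" for w using TT_nonneg nbV[OF that] by blast
 have a0: "0 <= avg TT x" using TT_subharmonic[OF xl(1) xi] Tn[OF nb_in(1)] by linarith
 \<comment> \<open>As \<open>pn x\<close> stays below 1 - q, the increment bound yields a Harnack
   inequality avg T <= T/q, so \<open>TT\<close> is of order c at x and at all its
   neighbours.\<close>
 have "avg TT x - TT x <= (1 - q) * avg TT x"
 using TT_increment[OF xl(1) xi] mult_right_mono[OF pn_le[OF xl(1) xi] a0] by (simp add: q)
 then have "q * avg TT x <= TT x" by (simp add: algebra_simps)
 then have aq: "avg TT x <= TT x / q" using q0 by (simp add: field_simps)
 have Tx0: "0 <= TT x" by (rule Tn[OF nb_in(1)])
 have Tw: "TT w <= d2 * (TT x / q)" if w: "w : nbs x" for w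
 proof -
 have na: "TT (x + axis i s) <= d2 * avg TT x" if "s = 1 | s = - 1" for i s
 unfolding d2_def by (rule neighbour_le_avg[OF _ _ that]) (rule Tn, rule nb_in)+
 have "TT x <= d2 * avg TT x"
 using TT_subharmonic[OF xl(1) xi] mult_right_mono[OF d2_ge a0] by simp
 then have "TT w <= d2 * avg TT x" using w na unfolding nbs_def by blast
 also have "... <= d2 * (TT x / q)" using aq d2_ge by (intro mult_left_mono) auto
 finally show ?thesis .
 qed
 have T2: "TT x / q <= c * (1 + ?d) / q" using Tc q0 by (intro divide_right_mono) auto
 have "pn x <= (\<Sum>w\<in>nbs x. pc w)" by (rule pn_le_sum[OF xl(1) xi])
 also have "... <= (\<Sum>w\<in>nbs x. (d2 * (1 + ?d) / q + 1) * c / c0)"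
 proof (rule sum_mono)
 fix w assume w: "w : nbs x"
 have "pc w <= (TT w + ep) / c0" by (rule pc_le[OF nbV[OF w]])
 also have "... <= (d2 * (c * (1 + ?d) / q) + c) / c0"
 using Tw[OF w] mult_left_mono[OF T2, of d2] d2_ge e c0_pos by (intro divide_right_mono add_mono) (auto simp: c_def)
 also have "... = (d2 * (1 + ?d) / q + 1) * c / c0" by (simp add: algebra_simps)
 finally show "pc w <= (d2 * (1 + ?d) / q + 1) * c / c0" .
 qed
 also have "... = real (card (nbs x)) * ((d2 * (1 + ?d) / q + 1) * c / c0)" by simp
 also have "... <= (d2 + 1) * ((d2 * (1 + ?d) / q + 1) * c / c0)"
 proof (rule mult_right_mono)
 have "real (card (nbs x)) <= real (2 * CARD('n) + 1)" using nbs(2)[of x] by (simp only: of_nat_le_iff)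
 then show "real (card (nbs x)) <= d2 + 1" by (simp add: d2_def)
 qed (use d2_ge q0 c c0_pos in simp)
 finally have pnb: "pn x <= (d2 + 1) * ((d2 * (1 + ?d) / q + 1) * c / c0)" .
 have "c / (real n)\<^sup>2 <= pn x * avg TT x" using avg1 TT_increment[OF xl(1) xi] by linarith
 also have "... <= ((d2 + 1) * ((d2 * (1 + ?d) / q + 1) * c / c0)) * (c * (1 + ?d) / q)"
 using aq T2 d2_ge q0 c c0_pos by (intro mult_mono pnb a0) auto
 also have "... = c * (c * Q)" unfolding Q using q0 c0_pos by (simp add: field_simps)
 finally have "c * (1 / (real n)\<^sup>2) <= c * (c * Q)" by simp
 then have "1 / (real n)\<^sup>2 <= c * Q" using c by (simp only: mult_le_cancel_left_pos)
 also have "c * Q = bt * Q / (real n)\<^sup>2" by (simp add: c_def)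
 finally have "1 <= bt * Q" using n0 by (simp add: field_simps)
 then show False using b by simp
 qed
 qed
 then have "?\<Phi> x <= 0" by simp
 with x(2)[OF zW] have "c * ?h 0 <= TT 0" by linarith
 then show ?thesis by (simp add: c_def)
qed

lemma zero_latt: "(0::real^'n) : latt" "linf (0::real^'n) <= real n"
 by (simp_all add: latt_def linf_le_iff)

lemma pc_upper: "pc (0::real^'n) <= ((4 * A + 1) / c0) / (real n)\<^sup>2"
proof -
 have "pc (0::real^'n) <= (TT 0 + ep) / c0" by (rule pc_le[OF zero_latt])
 also have "... <= (4 * A / (real n)\<^sup>2 + 1 / (real n)\<^sup>2) / c0"
 using upper_bound[OF zero_latt(1)] eps_small(2) c0_pos by (intro divide_right_mono add_mono) auto
 also have "... = ((4 * A + 1) / c0) / (real n)\<^sup>2" by (simp add: add_divide_distrib mult.commute)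
 finally show ?thesis .
qed

text \<open>Cells near the origin are met with probability of order n^(-2) by the upper bound. For n
  >= 16 the 2-neighbourhood of the ball of radius n/8 lies in the ball of radius n/4 where that
  bound holds; smaller n are covered by the term 256 C.\<close>

lemma second_moment_zero:
 assumes B: "256 * C <= B" "64 * d2 * C + 2 * d2 * C * b2 * (4 * A + 1) / c0 <= B"
 shows "EE (%f. (ax (0::real^'n) f)\<^sup>2) <= B / (real n)\<^sup>2"
proof (cases "n < 16")
 case True
 have zV: "(0::real^'n) : mV m n" by (rule latt_in_mV[OF zero_latt])
 have "EE (%f. (ax (0::real^'n) f)\<^sup>2) <= EE (%f. (f (0::real^'n))\<^sup>2)"
 proof (rule integral_mono)
 show "integrable M (%om. (ax (0::real^'n) (res (mV m n) om))\<^sup>2)" using L2_ax[OF zV] by (simp add: L2_def)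
 show "integrable M (%om. (res (mV m n) om (0::real^'n))\<^sup>2)" using L2_coord[OF zV] by (simp add: L2_def)
 qed (auto simp: ax_def)
 also have "... = mgff_cov 0 (0::real^'n)" by (rule EE_coord_sq[OF zV])
 also have "... <= C" by (rule diag_le[OF zero_latt(1)])
 also have "... <= B / (real n)\<^sup>2"
 proof -
 have "(real n)\<^sup>2 <= 16\<^sup>2" using True by (intro power_mono) auto
 then have "C * (real n)\<^sup>2 <= C * 256" using KC by (intro mult_left_mono) auto
 then show ?thesis using B(1) n_pow(1) by (simp add: field_simps)
 qed
 finally show ?thesis .
next
 case False
 then have n16: "real n >= 16" by simp
 define dl where "dl = d2 * (C * (64 / (real n)\<^sup>2))"
 define gm where "gm = b2 * ((4 * A / (real n)\<^sup>2 + 1 / (real n)\<^sup>2) / c0)"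
 let ?N = "{w::real^'n. w : latt & norm (w - 0) <= real n / 8}"
 have "EE (%f. (ax (0::real^'n) f)\<^sup>2) <= dl + 2 * d2 * gm * C"
 proof (rule second_moment_bound[OF zero_latt finite_latt_ball[of 0 "real n / 8"]])
 show "?N <= latt" by auto
 show "0 <= dl" using d2_ge KC by (simp add: dl_def)
 show "0 <= gm" using b2_nonneg A c0_pos by (simp add: gm_def)
 fix v :: "real^'n"
 show "d2 * green v 0 <= dl" if v: "v : latt - ?N"
 proof -
 have "(real n / 8)\<^sup>2 >= 1" using n16 by simp
 have "fdec K (12/5) (v - 0) <= ((real n / 8)\<^sup>2) powr (- (12/5))"
 using v n16 by (intro fdec_le_powr KC) auto
 also have "... <= ((real n / 8)\<^sup>2) powr (- 1)" using \<open>(real n / 8)\<^sup>2 >= 1\<close> by (intro powr_mono) auto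
 also have "... = 64 / (real n)\<^sup>2" using n16 by (simp add: powr_minus_divide power_divide)
 finally have "C * fdec K (12/5) (v - 0) <= C * (64 / (real n)\<^sup>2)" using KC by (intro mult_left_mono) auto
 then have "green v 0 <= C * (64 / (real n)\<^sup>2)" using G[of v 0] by linarith
 then show ?thesis unfolding dl_def using d2_ge by (intro mult_left_mono) auto
 qed
 show "\<Gamma> v <= gm" if v: "v : ?N"
 proof -
 have "\<Gamma> v <= b2 * ((4 * A / (real n)\<^sup>2 + ep) / c0)"
 proof (rule \<Gamma>_le)
 show "v : latt" using v by simp
 fix w :: "real^'n" assume w: "w : latt" "norm (w - v) <= 2"
 have "norm w <= real n / 4" using norm_triangle_ineq[of "w - v" v] w v n16 by simp
 then show "linf w < real n & TT w <= 4 * A / (real n)\<^sup>2"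
 using upper_bound[OF w(1)] linf_le_norm[of w] n16 by simp
 qed
 also have "... <= gm" unfolding gm_def using eps_small(2) b2_nonneg c0_pos by (intro mult_left_mono divide_right_mono) auto
 finally show ?thesis .
 qed
 qed
 also have "... = (64 * d2 * C + 2 * d2 * C * b2 * (4 * A + 1) / c0) / (real n)\<^sup>2"
 by (simp add: dl_def gm_def add_divide_distrib algebra_simps)
 also have "... <= B / (real n)\<^sup>2" using B by (intro divide_right_mono) auto
 finally show ?thesis .
qed

lemma pc_lower:
 assumes T: "bt / (real n)\<^sup>2 <= TT (0::real^'n)" "bt > 0"
 and B: "256 * C <= B" "64 * d2 * C + 2 * d2 * C * b2 * (4 * A + 1) / c0 <= B"
 shows "(bt\<^sup>2 / B) / (real n)\<^sup>2 <= pc (0::real^'n)"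
proof -
 have B0: "B > 0" using B KC by linarith
 \<comment> \<open>With l = bt/B the second moment consumes at most half of the lower bound for
   \<open>TT\<close>; the other half must come from the probability.\<close>
 have l: "bt / B > 0" using T B0 by simp
 have n0: "(real n)\<^sup>2 > 0" using n_pow by simp
 have "TT (0::real^'n) <= (bt / B * EE (%f. (ax (0::real^'n) f)\<^sup>2) + pc (0::real^'n) / (bt / B)) / 2"
 by (rule second_moment_method[OF zero_latt l])
 also have "... <= (bt / B * (B / (real n)\<^sup>2) + pc (0::real^'n) / (bt / B)) / 2"
 by (intro divide_right_mono add_right_mono mult_left_mono second_moment_zero[OF B]) (use l in simp_all)
 also have "bt / B * (B / (real n)\<^sup>2) = bt / (real n)\<^sup>2" using B0 by simp
 finally have "TT (0::real^'n) <= (bt / (real n)\<^sup>2 + pc (0::real^'n) / (bt / B)) / 2" .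
 moreover have "a <= p" if "t <= (a + p) / 2" "a <= t" for t a p :: real
 proof -
 have "t * 2 <= a + p" using that(1) by (simp add: pos_le_divide_eq)
 then show ?thesis using that(2) by linarith
 qed
 ultimately have "bt / (real n)\<^sup>2 <= pc (0::real^'n) / (bt / B)" using T(1) by blast
 then have "bt / (real n)\<^sup>2 * (bt / B) <= pc (0::real^'n)" using l by (simp only: pos_le_divide_eq)
 moreover have "bt / (real n)\<^sup>2 * (bt / B) = (bt\<^sup>2 / B) / (real n)\<^sup>2" by (simp add: power2_eq_square)
 ultimately show ?thesis by simp
qed

end

section \<open>Passage to the metric graph\<close>

lemma linf_latt_le_floor:
 fixes x :: "real^'n"
 assumes x: "x : latt" and N: "0 <= N"
 shows "linf x <= N \<longleftrightarrow> linf x <= real (nat \<lfloor>N\<rfloor>)"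
proof -
 have "\<bar>x $ j\<bar> <= N \<longleftrightarrow> \<bar>x $ j\<bar> <= real (nat \<lfloor>N\<rfloor>)" for j
 proof -
 have "x $ j : \<int>" using x by (simp add: latt_def)
 then obtain a where a: "x $ j = of_int a" by (elim Ints_cases)
 have "real_of_int \<bar>a\<bar> <= N \<longleftrightarrow> \<bar>a\<bar> <= \<lfloor>N\<rfloor>" by (rule le_floor_iff[symmetric])
 moreover have "real (nat \<lfloor>N\<rfloor>) = real_of_int \<lfloor>N\<rfloor>" using N by simp
 ultimately show ?thesis using a by (simp only: of_int_abs[symmetric] of_int_le_iff)
 qed
 then show ?thesis by (simp add: linf_le_iff)
qed

lemma lat_bdry_eq:
 assumes N: "N > 1"
 shows "lat_bdry (lat_ball N) = (mD (nat \<lfloor>N\<rfloor>) :: (real^'n) set)"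
proof -
 define n where "n = nat \<lfloor>N\<rfloor>"
 have ball: "w : lat_ball N \<longleftrightarrow> w : latt & linf w <= real n" for w :: "real^'n"
 unfolding lat_ball_def n_def using linf_latt_le_floor[of w N] N by auto
 have "lat_bdry (lat_ball N) <= (mD n :: (real^'n) set)"
 proof
 fix x :: "real^'n" assume "x : lat_bdry (lat_ball N)"
 then obtain y where x: "x : latt" "linf x <= real n" and y: "y : latt" "~ linf y <= real n" and s: "(\<Sum>i\<in>UNIV. \<bar>x $ i - y $ i\<bar>) = 1"
 unfolding lat_bdry_def lat_adj_def by (auto simp: ball)
 obtain j where j: "\<bar>y $ j\<bar> > real n" using y(2) by (auto simp: linf_le_iff not_le)
 have d: "\<bar>x $ j - y $ j\<bar> <= 1" using member_le_sum[of j UNIV "%i. \<bar>x $ i - y $ i\<bar>"] s by simp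
 have "~ \<bar>x $ j\<bar> < real n"
 proof
 assume "\<bar>x $ j\<bar> < real n"
 then have "\<bar>x $ j\<bar> + 1 <= real n" using x(1) by (intro Ints_abs_less_Suc) (auto simp: latt_def)
 then show False using j d by linarith
 qed
 then have "linf x = real n" using x by (intro linf_eqI[of _ _ j]) (auto simp: linf_le_iff intro: antisym)
 then show "x : mD n" using x by (simp add: mD_def)
 qed
 moreover have "(mD n :: (real^'n) set) <= lat_bdry (lat_ball N)"
 proof
 fix x :: "real^'n" assume "x : mD n"
 then have x: "x : latt" "linf x = real n" by (auto simp: mD_def)
 obtain i where i: "\<bar>x $ i\<bar> = linf x" by (rule linf_attained)
 define s where "s = (if x $ i >= 0 then 1 else - 1 :: real)"
 let ?y = "x + axis i s"
 have yl: "?y : latt" by (rule latt_axis(1)[OF x(1)]) (simp add: s_def)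
 have "\<bar>?y $ i\<bar> = real n + 1" using i x(2) by (auto simp: s_def)
 then have "~ linf ?y <= real n" by (metis linf_le_iff less_add_one not_le)
 moreover have "(\<Sum>j\<in>UNIV. \<bar>x $ j - ?y $ j\<bar>) = (\<Sum>j\<in>UNIV. if j = i then 1 else 0)" by (intro sum.cong) (auto simp: s_def)
 ultimately have "?y : latt - lat_ball N" "lat_adj x ?y" using yl x by (auto simp: ball lat_adj_def)
 then show "x : lat_bdry (lat_ball N)" using x ball[of x] unfolding lat_bdry_def by auto
 qed
 ultimately show ?thesis unfolding n_def by (rule subset_antisym)
qed

lemma two_coordinates_le_norm:
 fixes z :: "real^'n"
 assumes "i ~= j"
 shows "(z $ i)\<^sup>2 + (z $ j)\<^sup>2 <= (norm z)\<^sup>2"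
proof -
 have "(\<Sum>k\<in>{i, j}. (z $ k)\<^sup>2) <= (\<Sum>k\<in>UNIV. (z $ k)\<^sup>2)" by (rule sum_mono2) auto
 then show ?thesis using assms by (simp add: norm_sq_sum)
qed

context mesh_box begin

text \<open>If two coordinates differed, one of them would be an integer for p and hence differ by
  at least 1/m, and together with the other the distance would exceed 1/m.\<close>

lemma near_mesh_point:
 fixes p a :: "real^'n"
 assumes p: "p : mgraph" and a: "a : mX m" and d: "norm (p - a) <= 1 / real m"
 obtains i c where "p = a + axis i c" "\<bar>c\<bar> = norm (p - a)"
proof -
 have m2: "1 / real m <= 1/2" and m0: "1 / real m > 0" using m by (auto simp: field_simps)
 have comp: "\<bar>p $ k - a $ k\<bar> <= 1 / real m" for k using component_le_norm_cart[of "p - a" k] d by simp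
 obtain l where l: "!!k. k ~= l ==> p $ k : \<int>" using p by (auto simp: mgraph_def)
 obtain l' where l': "!!k. k ~= l' ==> a $ k : \<int>" using a by (auto simp: mX_def mgraph_def)
 have both: "p $ k = a $ k" if "k ~= l" "k ~= l'" for k
 using l[OF that(1)] l'[OF that(2)] comp[of k] m2 by (intro Ints_abs_less_1_eq) auto
 have absurd: "False" if ij: "i ~= j" and ddi: "p $ i ~= a $ i" and ddj: "p $ j ~= a $ j" and pj: "p $ j : \<int>" for i j
 proof -
 have "real m * a $ j : \<int>" using a by (simp add: mX_def)
 moreover have "real m * p $ j : \<int>" using pj by (intro Ints_mult) auto
 moreover have "real m * p $ j ~= real m * a $ j" using ddj m by simp
 ultimately have "~ \<bar>real m * p $ j - real m * a $ j\<bar> < 1" using Ints_abs_less_1_eq by blast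
 then have "1 <= real m * \<bar>p $ j - a $ j\<bar>" by (simp add: mult_nat_abs right_diff_distrib)
 then have g: "1 / real m <= \<bar>p $ j - a $ j\<bar>" using m by (simp add: field_simps)
 have "(1 / real m)\<^sup>2 <= \<bar>p $ j - a $ j\<bar>\<^sup>2" using g m0 by (intro power_mono) auto
 moreover have "(p $ i - a $ i)\<^sup>2 > 0" using ddi by simp
 moreover have "(p $ i - a $ i)\<^sup>2 + (p $ j - a $ j)\<^sup>2 <= (norm (p - a))\<^sup>2" using two_coordinates_le_norm[OF ij, of "p - a"] by simp
 moreover have "(norm (p - a))\<^sup>2 <= (1 / real m)\<^sup>2" using d by (intro power_mono) auto
 ultimately show False by simp
 qed
 have "EX i. ALL k. k ~= i \<longrightarrow> p $ k = a $ k"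
 proof (cases "p $ l = a $ l")
 case True
 then have "ALL k. k ~= l' \<longrightarrow> p $ k = a $ k" using both by metis
 then show ?thesis by blast
 next
 case False
 have "ALL k. k ~= l \<longrightarrow> p $ k = a $ k" using absurd l False by metis
 then show ?thesis by blast
 qed
 then obtain i where i: "!!k. k ~= i ==> p $ k = a $ k" by blast
 have "p $ k = (a + axis i (p $ i - a $ i)) $ k" for k using i[of k] by (cases "k = i") auto
 then have e: "p = a + axis i (p $ i - a $ i)" unfolding vec_eq_iff by blast
 then have "p - a = axis i (p $ i - a $ i)" by (metis add_diff_cancel_left')
 then have "norm (p - a) = \<bar>p $ i - a $ i\<bar>" by (simp only: norm_axis_real)
 then show ?thesis using that e by metis
qed

definition Q :: "'w => (real^'n) set" where "Q om = {v\<in>mgraph. linf v <= real n & 0 <= \<phi> v om}"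

lemma pos_res: "v : pos (res (mV m n) om) \<longleftrightarrow> v : mV m n & 0 <= \<phi> v om" for v :: "real^'n"
 by (auto simp: pos_def res_def)

text \<open>Let R0 be the mesh points joined to 0 by nonnegative mesh steps, and suppose that it
  avoids D. A path point at distance exactly 1/m from a point of R0 is a mesh neighbour where the
  field is nonnegative, hence again in R0. So the closed 1/m-balls around R0 meet the path in a
  relatively open set, connectedness traps the whole path there, and its endpoint would lie in both
  R0 and D.\<close>

lemma connection_in_cluster:
 fixes p :: "real => real^'n"
 assumes p: "path p" "path_image p <= {v\<in>mgraph. 0 <= \<phi> v om}" "pathstart p = 0" "pathfinish p : mD n"
 shows "0 : cl (pos (res (mV m n) om))"
proof (rule ccontr)
 assume no: "0 ~: cl (pos (res (mV m n) om))"
 define P where "P = pos (res (mV m n) om)"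
 define E where "E = {(a, b). a : P & b : P & b : mnb m a}"
 define R0 where "R0 = {v. (0, v) : E\<^sup>*}"
 have m0: "1 / real m > 0" using m by simp
 have img: "v : mgraph" "0 <= \<phi> v om" if "v : path_image p" for v using p(2) that by auto
 have z0: "0 : path_image p" using pathstart_in_path_image[of p] p(3) by simp
 have "(0::real^'n) : mV m n" by (rule latt_in_mV) (simp_all add: latt_def linf_le_iff)
 then have 0: "0 : P" unfolding P_def pos_res using img[OF z0] by simp
 have R0P: "R0 <= P"
 proof
 fix v assume "v : R0"
 then have "(0, v) : E\<^sup>*" by (simp add: R0_def)
 then show "v : P" by (induction rule: rtrancl_induct) (use 0 in \<open>auto simp: E_def\<close>)
 qed
 have PV: "P <= mV m n" by (auto simp: P_def pos_def)
 have reach: "u : cl P" if "(u, v) : E\<^sup>*" "v : cl P" for u v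
 using that
 proof (induction rule: converse_rtrancl_induct)
 case (step a b)
 then have "b : cl P" "a : P" "b : mnb m a" by (auto simp: E_def)
 then show ?case using PV by (intro cl.cl_step[of b P a]) auto
 qed
 have RD: "v ~: mD n" if v: "v : R0" for v
 proof
 assume "v : mD n"
 then have "v : cl P" using R0P v by (intro cl.cl_base) auto
 then show False using reach[of 0 v] v no by (simp add: R0_def P_def)
 qed
 have finR: "finite R0" by (rule finite_subset[OF subset_trans[OF R0P PV] finite_mV])
 let ?H = "\<Union>a\<in>R0. ball a (1 / real m)" and ?H' = "\<Union>a\<in>R0. cball a (1 / real m)"
 have sub: "v : ?H" if v: "v : path_image p" "v : ?H'" for v
 proof -
 obtain a where a: "a : R0" "norm (v - a) <= 1 / real m" using v(2) by (auto simp: dist_norm norm_minus_commute)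
 have aV: "a : mV m n - mD n" using a R0P PV RD by blast
 then have aX: "a : mX m" by (simp add: mV_def)
 show ?thesis
 proof (cases "norm (v - a) < 1 / real m")
 case True
 then show ?thesis using a by (auto simp: dist_norm norm_minus_commute)
 next
 case False
 then have eq: "norm (v - a) = 1 / real m" using a by simp
 obtain i c where c: "v = a + axis i c" "\<bar>c\<bar> = norm (v - a)" by (rule near_mesh_point[OF img(1)[OF v(1)] aX a(2)])
 have "c = 1 / real m | c = - (1 / real m)" using c(2) eq by linarith
 then have nb: "v : mnb m a" unfolding mnb_def axis_uminus using c(1) img(1)[OF v(1)] by blast
 have "v : P" unfolding P_def pos_res using mnb_in_mV[OF aV nb] img(2)[OF v(1)] by simp
 then have "(a, v) : E" using nb R0P a unfolding E_def by blast
 then have "v : R0" using a(1) unfolding R0_def by (simp add: rtrancl.rtrancl_into_rtrancl)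
 then show ?thesis using m0 by (intro UN_I[of v]) auto
 qed
 qed
 have "?H Int path_image p = {} | (- ?H') Int path_image p = {}"
 proof (rule connectedD[OF connected_path_image[OF p(1)]])
 show "open ?H" by auto
 show "open (- ?H')" using finR by (intro open_Compl closed_UN) auto
 show "?H Int - ?H' Int path_image p = {}" using ball_subset_cball by blast
 show "path_image p <= ?H Un - ?H'" using sub by blast
 qed
 moreover have "0 : ?H Int path_image p" using z0 m0 by (auto simp: R0_def intro!: UN_I[of 0])
 ultimately have all: "path_image p <= ?H'" by blast
 let ?z = "pathfinish p"
 have zI: "?z : path_image p" by (rule pathfinish_in_path_image)
 have "?z : ?H" using sub[OF zI] all zI by blast
 then obtain a where a: "a : R0" "norm (?z - a) < 1 / real m" by (auto simp: dist_norm norm_minus_commute)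
 have aX: "a : mX m" using a R0P PV by (auto simp: mV_def)
 obtain i c where c: "?z = a + axis i c" "\<bar>c\<bar> = norm (?z - a)" by (rule near_mesh_point[OF img(1)[OF zI] aX less_imp_le[OF a(2)]])
 have zX: "?z : mX m" using p(4) by (intro latt_in_mX) (simp add: mD_def)
 have "real m * ?z $ i : \<int>" "real m * a $ i : \<int>" using zX aX by (simp_all add: mX_def)
 moreover have "\<bar>real m * ?z $ i - real m * a $ i\<bar> < 1"
 proof -
 have "\<bar>real m * ?z $ i - real m * a $ i\<bar> = real m * \<bar>c\<bar>" unfolding c(1) by (simp add: distrib_left abs_mult)
 also have "... < real m * (1 / real m)" unfolding c(2) using a m by (intro mult_strict_left_mono) auto
 finally show ?thesis using m by simp
 qed
 ultimately have "real m * ?z $ i = real m * a $ i" by (intro Ints_abs_less_1_eq)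
 then have "c = 0" using m c(1) by simp
 then have "?z = a" using c(1) by simp
 then show False using RD[OF a(1)] p(4) by simp
qed

lemma RR_Q: "RR (Q om) = RR (pos (res (mV m n) om))"
proof -
 have mem: "w + axis i (s * real l / real m) : Q om \<longleftrightarrow> w + axis i (s * real l / real m) : pos (res (mV m n) om)"
 if w: "w : latt" and s: "s = 1 | s = - 1" for w :: "real^'n" and i s and l :: nat
 proof -
 have "w + axis i (of_int (if s = 1 then int l else - int l) / real m) : mX m" by (rule edge_in_mX[OF w])
 moreover have "of_int (if s = 1 then int l else - int l) / real m = s * real l / real m" using s by auto
 ultimately have X: "w + axis i (s * real l / real m) : mX m" by simp
 then have V: "w + axis i (s * real l / real m) : mV m n \<longleftrightarrow> linf (w + axis i (s * real l / real m)) <= real n"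
 by (simp add: mV_def)
 have "w + axis i (s * real l / real m) : mgraph" using X by (simp add: mX_def)
 then show ?thesis unfolding pos_res V unfolding Q_def by simp
 qed
 show ?thesis unfolding RR_def using mem by blast
qed

text \<open>A connection along complete lattice edges, stated with the field on the metric graph so
  that the events for different m are comparable.\<close>

definition hitD :: "'w set" where
 "hitD = {om\<in>space M. \<exists>z\<in>mD n. (z, 0) : (RR (Q om))\<^sup>*}"

lemma event_measure:
 "{om\<in>space M. \<Phi> (pos (res (mV m n) om))} : sets M"
 "measure M {om\<in>space M. \<Phi> (pos (res (mV m n) om))} = EE (%f. if \<Phi> (pos f) then 1 else 0)"
proof -
 let ?S = "{om\<in>space M. \<Phi> (pos (res (mV m n) om))}"
 have "(%om. if \<Phi> (pos (res (mV m n) om)) then 1 else 0 :: real) : borel_measurable M"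
 using L2_integrable[OF L2_event[of "%A B. \<Phi> A"]] by (rule borel_measurable_integrable)
 from measurable_sets[OF this, of "{1}"]
 have "(%om. if \<Phi> (pos (res (mV m n) om)) then 1 else 0 :: real) -` {1} Int space M : sets M" by simp
 moreover have "(%om. if \<Phi> (pos (res (mV m n) om)) then 1 else 0 :: real) -` {1} Int space M = ?S" by (auto split: if_splits)
 ultimately show S: "?S : sets M" by simp
 have "EE (%f. if \<Phi> (pos f) then 1 else 0) = expectation (indicat_real ?S)"
 by (intro Bochner_Integration.integral_cong) (auto simp: indicator_def)
 also have "... = measure M ?S" using S by simp
 finally show "measure M ?S = EE (%f. if \<Phi> (pos f) then 1 else 0)" by simp
qed

lemma cluster_hitD:
 assumes om: "om : space M" and 0: "0 : cl (pos (res (mV m n) om))"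
 shows "om : hitD"
proof -
 let ?P = "pos (res (mV m n) om)"
 obtain w z where w: "w : latt" and sp: "on_spur ?P w 0" and z: "z : mD n" "(z, w) : (RR ?P)\<^sup>*"
 using cl_spur[OF 0] by blast
 obtain s i j where s: "s = 1 | s = - 1" and j: "j < m" and c: "0 = w + axis i (s * real j / real m)"
 using sp unfolding on_spur_def by blast
 \<comment> \<open>A partial edge contains no lattice point besides its starting vertex, so the
   origin is itself reached by complete edges.\<close>
 have "j = 0"
 proof (rule ccontr)
 assume "j ~= 0"
 define q where "q = real j / real m"
 have q: "0 < q" "q < 1" unfolding q_def using \<open>j ~= 0\<close> j by auto
 have "0 = w $ i + s * real j / real m" using arg_cong[OF c, of "%v. v $ i"] by simp
 then have "w $ i = - (s * q)" by (simp add: q_def)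
 then have "\<bar>w $ i - 0\<bar> < 1" "w $ i ~= 0" using s q by auto
 then show False using Ints_abs_less_1_eq[of "w $ i" 0] w by (simp add: latt_def)
 qed
 then have "w = 0" using c by simp
 then show "om : hitD" unfolding hitD_def RR_Q using om z by auto
qed

lemma connection_hitD:
 assumes "om : space M" "EX p. path p & path_image p <= {v\<in>mgraph. 0 <= \<phi> v om} & pathstart p = 0 & pathfinish p : mD n"
 shows "om : hitD"
 using assms(2) connection_in_cluster[of _ om] cluster_hitD[OF assms(1)] by blast

lemma hitD_sets: "hitD : sets M"
 unfolding hitD_def RR_Q by (rule event_measure(1)[of "%P. \<exists>z\<in>mD n. (z, 0) : (RR P)\<^sup>*"])

lemma pc_measure: "pc x = measure M {om\<in>space M. x : cl (pos (res (mV m n) om))}"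
 unfolding pc_def by (rule event_measure(2)[symmetric, of "%P. x : cl P"])

lemma pc_le_hitD: "pc (0::real^'n) <= measure M hitD"
 unfolding pc_measure
 by (rule finite_measure_mono[OF _ hitD_sets]) (use cluster_hitD in blast)

lemma connection_le_pc:
 assumes S: "S <= {om\<in>space M. EX p. path p & path_image p <= {v\<in>mgraph. 0 <= \<phi> v om} & pathstart p = 0 & pathfinish p : mD n}"
 shows "measure M S <= pc (0::real^'n)"
proof -
 have "S <= {om\<in>space M. 0 : cl (pos (res (mV m n) om))}" using S connection_in_cluster by blast
 then show "measure M S <= pc (0::real^'n)" unfolding pc_measure
 by (rule finite_measure_mono[OF _ event_measure(1)[of "%P. 0 : cl P"]])
qed

end

section \<open>Dyadic refinement of the mesh\<close>

definition edge_rel :: "nat => (real^'n) set => ((real^'n) \<times> (real^'n)) set" where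
 "edge_rel m P = {(w, w'). w : latt & w' : latt & (EX i s. (s = 1 | s = - 1) & w' = w + axis i s & (ALL l<=m. w + axis i (s * real l / real m) : P))}"

lemma edge_rel_double: "m > 0 ==> edge_rel (2 * m) P <= edge_rel m (P :: (real^'n) set)"
proof (rule subrelI)
 fix w w' :: "real^'n" assume m: "m > 0" and "(w, w') : edge_rel (2 * m) P"
 then obtain i s where w: "w : latt" "w' : latt" and s: "s = 1 | s = - 1" "w' = w + axis i s"
 and P: "!!l. l <= 2 * m ==> w + axis i (s * real l / real (2 * m)) : P" unfolding edge_rel_def by blast
 have "w + axis i (s * real l / real m) : P" if "l <= m" for l
 using P[of "2 * l"] that m by simp
 then show "(w, w') : edge_rel m P" unfolding edge_rel_def using w s by blast
qed

lemma dyadic_floor: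
 fixes u :: real
 assumes u: "0 <= u" "u <= 1"
 shows "nat \<lfloor>u * 2 ^ j\<rfloor> <= 2 ^ j" "(%j. real (nat \<lfloor>u * 2 ^ j\<rfloor>) / 2 ^ j) \<longlonglongrightarrow> u"
proof -
 have r: "real (nat \<lfloor>u * 2 ^ j\<rfloor>) = of_int \<lfloor>u * 2 ^ j\<rfloor>" for j using u by simp
 have "real (nat \<lfloor>u * 2 ^ j\<rfloor>) <= u * 2 ^ j" unfolding r by (rule of_int_floor_le)
 also have "... <= real (2 ^ j)" using u by simp
 finally show "nat \<lfloor>u * 2 ^ j\<rfloor> <= 2 ^ j" by (simp only: of_nat_le_iff)
 have "(%j. real (nat \<lfloor>u * 2 ^ j\<rfloor>) / 2 ^ j - u) \<longlonglongrightarrow> 0"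
 proof (rule Lim_null_comparison)
 show "(%j. (1/2::real) ^ j) \<longlonglongrightarrow> 0" by (rule LIMSEQ_realpow_zero) auto
 show "\<forall>\<^sub>F j in sequentially. norm (real (nat \<lfloor>u * 2 ^ j\<rfloor>) / 2 ^ j - u) <= (1/2) ^ j"
 proof (intro always_eventually allI)
 fix j
 have e: "real (nat \<lfloor>u * 2 ^ j\<rfloor>) / 2 ^ j - u = (of_int \<lfloor>u * 2 ^ j\<rfloor> - u * 2 ^ j) / 2 ^ j" unfolding r by (simp add: field_simps)
 have "\<bar>of_int \<lfloor>u * 2 ^ j\<rfloor> - u * 2 ^ j\<bar> <= 1" by linarith
 then show "norm (real (nat \<lfloor>u * 2 ^ j\<rfloor>) / 2 ^ j - u) <= (1/2) ^ j"
 unfolding e by (simp add: power_one_over divide_right_mono)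
 qed
 qed
 then show "(%j. real (nat \<lfloor>u * 2 ^ j\<rfloor>) / 2 ^ j) \<longlonglongrightarrow> u" by (simp only: LIM_zero_iff)
qed

lemma edge_nonneg:
 fixes w :: "real^'n" and F :: "real^'n => real"
 assumes w: "w : latt" and cont: "continuous_on mgraph F"
 and nn: "!!j l. j >= j0 ==> l <= 2 ^ j ==> 0 <= F (w + axis i (s * real l / real (2 ^ j)))"
 and u: "0 <= u" "u <= 1"
 shows "0 <= F (w + axis i (s * u))"
proof -
 let ?G = "%t. F (w + axis i (s * t))"
 have e: "axis i (s * t) = (s * t) *\<^sub>R (axis i 1 :: real^'n)" for t by (simp add: vec_eq_iff)
 have "continuous_on UNIV (%t. w + axis i (s * t))" unfolding e by (intro continuous_intros)
 then have "continuous_on UNIV ?G" by (rule continuous_on_compose2[OF cont]) (use edge_in_mgraph(1)[OF w] in auto)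
 then have c: "isCont ?G u" by (simp add: continuous_on_eq_continuous_at)
 have "(%j. ?G (real (nat \<lfloor>u * 2 ^ j\<rfloor>) / 2 ^ j)) \<longlonglongrightarrow> ?G u"
 by (rule isCont_tendsto_compose[OF c dyadic_floor(2)[OF u]])
 then show ?thesis
 proof (rule LIMSEQ_le_const)
 have "0 <= ?G (real (nat \<lfloor>u * 2 ^ j\<rfloor>) / 2 ^ j)" if "j >= j0" for j
 using nn[OF that dyadic_floor(1)[OF u]] by simp
 then show "EX N. ALL j>=N. 0 <= ?G (real (nat \<lfloor>u * 2 ^ j\<rfloor>) / 2 ^ j)" by blast
 qed
qed

text \<open>The connecting lattice path may change with the scale. But the edge relations decrease
  under refinement and are finite, so they are eventually constant; an edge that survives is
  nonnegative at all fine dyadic points and hence, by continuity, everywhere.\<close>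

lemma connected_of_all_scales:
 fixes F :: "real^'n => real"
 assumes n: "n >= 1" and cont: "continuous_on mgraph F"
 and scales: "!!k. k >= 1 ==> \<exists>z\<in>mD n. (z, 0) : (edge_rel (2 ^ k) {v\<in>mgraph. linf v <= real n & 0 <= F v})\<^sup>*"
 shows "\<exists>z\<in>mD n. path_component {v\<in>mgraph. 0 <= F v} 0 z"
proof -
 let ?Q = "{v\<in>mgraph. linf v <= real n & 0 <= F v}"
 define S where "S k = edge_rel (2 ^ k) ?Q" for k :: nat
 have dec: "decseq S" 
 proof (rule decseq_SucI)
 fix k show "S (Suc k) <= S k" unfolding S_def using edge_rel_double[of "2 ^ k" ?Q] by simp
 qed
 let ?B = "{x::real^'n. x : latt & linf x <= real n}"
 have SB: "S k <= ?B \<times> ?B" for k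
 proof (rule subrelI)
 fix w w' assume "(w, w') : S k"
 then obtain i s where w: "w : latt" "w' : latt" and s: "w' = w + axis i s"
 and P: "!!l. l <= 2 ^ k ==> w + axis i (s * real l / real (2 ^ k)) : ?Q" unfolding S_def edge_rel_def by blast
 show "(w, w') : ?B \<times> ?B" using P[of 0] P[of "2 ^ k"] w s by simp
 qed
 have finS: "finite (S k)" for k by (rule finite_subset[OF SB]) (intro finite_cartesian_product finite_latt_box)
 obtain k0 where k0: "!!j. card (S k0) <= card (S j)" using ex_has_least_nat[of "%_. True" 0 "%k. card (S k)"] by blast
 have stab: "S j = S k0" if "j >= k0" for j
 by (rule card_seteq[OF finS decseqD[OF dec that] k0])
 have edge: "path_component {v\<in>mgraph. 0 <= F v} w w'" if e: "(w, w') : S k0" for w w'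
 proof -
 obtain i s where w: "w : latt" and s: "s = 1 | s = - 1" "w' = w + axis i s" using e unfolding S_def edge_rel_def by blast
 have nn: "0 <= F (w + axis i (s * real l / real (2 ^ j)))" if j: "j >= k0" and l: "l <= 2 ^ j" for j l
 proof -
 have "(w, w') : S j" using e stab[OF j] by simp
 then obtain i' s' where s': "w' = w + axis i' s'"
 and P: "w + axis i' (s' * real l / real (2 ^ j)) : ?Q" unfolding S_def edge_rel_def using l by blast
 have "axis i s = (axis i' s' :: real^'n)" using s(2) s' by simp
 then have "axis i s $ i = (axis i' s' :: real^'n) $ i" by simp
 then have "i' = i" "s' = s" using s(1) by (auto split: if_splits)
 then show ?thesis using P by simp
 qed
 have "closed_segment w w' <= {v\<in>mgraph. 0 <= F v}"
 proof
 fix p assume "p : closed_segment w w'"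
 then obtain u where u: "0 <= u" "u <= 1" "p = (1 - u) *\<^sub>R w + u *\<^sub>R w'" unfolding closed_segment_def by blast
 have "p = w + axis i (s * u)" unfolding u(3) s(2) by (simp add: vec_eq_iff algebra_simps)
 then show "p : {v\<in>mgraph. 0 <= F v}"
 using edge_nonneg[OF w cont nn u(1,2)] edge_in_mgraph(1)[OF w] by simp
 qed
 then show ?thesis by (rule path_component_linepath)
 qed
 obtain z where z: "z : mD n" "(z, 0) : (S (max k0 1))\<^sup>*" using scales[of "max k0 1"] unfolding S_def by auto
 then have "(z, 0) : (S k0)\<^sup>*" using stab[of "max k0 1"] by simp
 \<comment> \<open>n >= 1 makes the path nonempty, so transitive closure suffices and the empty
   path, for which 0 would need a separate argument, does not occur.\<close>
 moreover have "z ~= 0" using z n by (auto simp: mD_def linf_def)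
 ultimately have "(z, 0) : (S k0)\<^sup>+" by (simp add: rtrancl_eq_or_trancl)
 then have "path_component {v\<in>mgraph. 0 <= F v} z 0"
 proof (induction rule: trancl_induct)
 case (step y y')
 then show ?case using edge path_component_trans by blast
 qed (rule edge)
 then show ?thesis using z path_component_sym by blast
qed

text \<open>A continuous connection forces the mesh connection at every scale, which gives the upper
  bound at a single scale. Conversely the connection event is the decreasing intersection of the
  events \<open>A k\<close>, so continuity of the measure from above carries the lower bound to the
  limit.\<close>

lemma connection_probability_bounds:
 fixes M :: "'w measure" and \<phi> :: "real^'n => 'w => real" and N :: real
 assumes gff: "metric_gff M \<phi>" and N: "N > 1" and d7: "CARD('n) > 6"
 and k1: "!!k. k >= k1 ==> k >= 1 ==> a <= box.pc M (mnb (2 ^ k)) \<phi> (mV (2 ^ k) (nat \<lfloor>N\<rfloor>)) (mD (nat \<lfloor>N\<rfloor>)) 0 \<and>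
 box.pc M (mnb (2 ^ k)) \<phi> (mV (2 ^ k) (nat \<lfloor>N\<rfloor>)) (mD (nat \<lfloor>N\<rfloor>)) 0 <= b"
 shows "a <= measure M {om\<in>space M. conn_nonneg \<phi> om N}" "measure M {om\<in>space M. conn_nonneg \<phi> om N} <= b"
proof -
 define n where "n = nat \<lfloor>N\<rfloor>"
 have n: "n >= 1" using N unfolding n_def by linarith
 interpret prob_space M using gff by (simp add: metric_gff_def)
 let ?Q = "%om. {v\<in>mgraph. linf v <= real n & 0 <= \<phi> v om}"
 let ?E = "{om\<in>space M. conn_nonneg \<phi> om N}"
 define A where "A k = {om\<in>space M. \<exists>z\<in>mD n. (z, 0) : (edge_rel (2 ^ Suc k) (?Q om))\<^sup>*}" for k
 have mb: "mesh_box (2 ^ Suc k) M \<phi> n" for k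
 by (intro mesh_box.intro mesh.intro mesh_box_axioms.intro gff n d7) simp
 have E: "?E = {om\<in>space M. EX p. path p & path_image p <= {v\<in>mgraph. 0 <= \<phi> v om} & pathstart p = 0 & pathfinish p : mD n}"
 unfolding conn_nonneg_def lat_bdry_eq[OF N] n_def by simp
 have hit: "A k = mesh_box.hitD (2 ^ Suc k) M \<phi> n" for k
 unfolding A_def mesh_box.hitD_def[OF mb] mesh_box.Q_def[OF mb] mesh_box.RR_def[OF mb] edge_rel_def ..
 have le_pc: "measure M S <= box.pc M (mnb (2 ^ Suc k)) \<phi> (mV (2 ^ Suc k) n) (mD n) 0" if "S <= ?E" for S k
 by (rule mesh_box.connection_le_pc[OF mb]) (use that E in simp)
 show "measure M ?E <= b"
 using le_pc[OF subset_refl, of k1] k1[of "Suc k1"] unfolding n_def by linarith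
 have decA: "decseq A"
 proof (rule decseq_SucI, rule subsetI)
 fix k om assume "om : A (Suc k)"
 then obtain z where z: "om : space M" "z : mD n" "(z, 0) : (edge_rel (2 * 2 ^ Suc k) (?Q om))\<^sup>*" unfolding A_def by auto
 have "(edge_rel (2 * 2 ^ Suc k) (?Q om))\<^sup>* <= (edge_rel (2 ^ Suc k) (?Q om))\<^sup>*" by (intro rtrancl_mono edge_rel_double) simp
 then show "om : A k" unfolding A_def using z by blast
 qed
 have Asets: "range A <= sets M" using mesh_box.hitD_sets[OF mb] by (auto simp: hit)
 have IA: "(\<Inter>k. A k) <= ?E"
 proof
 fix om assume om: "om : (\<Inter>k. A k)"
 then have sp: "om : space M" unfolding A_def by auto
 have cont: "continuous_on mgraph (%v. \<phi> v om)" using gff sp unfolding metric_gff_def by blast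
 have "\<exists>z\<in>mD n. path_component {v\<in>mgraph. 0 <= \<phi> v om} 0 z"
 proof (rule connected_of_all_scales[OF n cont])
 fix k :: nat assume "k >= 1"
 then obtain j where "k = Suc j" using Suc_le_D[of 0 k] by auto
 then show "\<exists>z\<in>mD n. (z, 0) : (edge_rel (2 ^ k) (?Q om))\<^sup>*" using om unfolding A_def by blast
 qed
 then show "om : ?E" unfolding E path_component_def using sp by blast
 qed
 have "?E <= A k" for k
 proof
 fix om assume om: "om : ?E"
 show "om : A k" unfolding hit using om E mesh_box.connection_hitD[OF mb] by blast
 qed
 then have eq: "?E = (\<Inter>k. A k)" using IA by blast
 have "(%k. measure M (A k)) \<longlonglongrightarrow> measure M ?E" unfolding eq by (rule finite_Lim_measure_decseq[OF Asets decA])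
 then show "a <= measure M ?E"
 proof (rule LIMSEQ_le_const)
 have "a <= measure M (A k)" if "k >= k1" for k
 using k1[of "Suc k"] that mesh_box.pc_le_hitD[OF mb, of k] unfolding hit n_def by linarith
 then show "EX N. ALL k>=N. a <= measure M (A k)" by blast
 qed
qed

theorem theorem1p1:
  assumes "CARD('n::finite) > 6"
  shows "\<exists>C1 C2::real. C1 > 0 \<and> C2 > 0 \<and>
    (\<forall>(M::'w measure) (\<phi>::real^'n \<Rightarrow> 'w \<Rightarrow> real). metric_gff M \<phi> \<longrightarrow>
      (\<forall>N::real. N > 1 \<longrightarrow>
         C1 * N powr (-2) \<le> measure M {\<omega> \<in> space M. conn_nonneg \<phi> \<omega> N} \<and>
         measure M {\<omega> \<in> space M. conn_nonneg \<phi> \<omega> N} \<le> C2 * N powr (-2)))"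
proof -
 let ?D = "real CARD('n)"
 obtain K C where KC: "K >= 1" "C >= 1"
 and G: "!!x y::real^'n. green x y <= C * fdec K (12/5) (x - y)"
 and GG: "!!F (x::real^'n) y. finite F ==> (\<Sum>v\<in>F. green x v * green v y) <= C * fdec K (7/5) (x - y)"
 and GGG: "!!F F' (x::real^'n) y. finite F ==> finite F' ==> (\<Sum>v\<in>F. \<Sum>w\<in>F'. green x v * green v w * green w y) <= C * fdec K (2/5) (x - y)"
 by (rule green_convolutions[OF assms]) (rule that; assumption)
 define d2 where "d2 = 2 * ?D"
 define b2 where "b2 = real (card {w::real^'n. w : latt & norm (w - 0) <= 2})"
 have b2: "b2 >= 0" by (simp add: b2_def)
 have d2: "d2 >= 1" using assms by (simp add: d2_def)
 define g1 where "g1 = 3 * b2 / c0"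
 have g1: "g1 >= 0" using b2 c0_pos by (simp add: g1_def)
 \<comment> \<open>Solves c1, with 80 = 4 * 20.\<close>
 define R where "R = 80 * d2 * C * (1 + 2 * g1) + 1"
 have X0: "0 <= d2 * C * (1 + 2 * g1)" using d2 KC g1 by simp
 then have R: "R > 0" "20 * (4 * d2 * C * (1 + 2 * g1)) <= R" by (simp_all add: R_def)
 have c1: "4 * d2 * C * (1 + 2 * g1) / R <= 1/20" using R by (simp add: pos_divide_le_eq)
 \<comment> \<open>c2 asks that W times L^(-4/5) be at most 1, with 160 = 8 * 20; L >= (W + 1)^(5/4)
   makes it at most W/(W + 1).\<close>
 define W where "W = 160 * d2\<^sup>2 * g1\<^sup>2 * C"
 have W: "W >= 0" using KC by (simp add: W_def)
 define L where "L = nat \<lceil>(W + 1) powr (5/4)\<rceil>"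
 have Lge: "(W + 1) powr (5/4) <= real L" unfolding L_def by linarith
 have W1: "1 <= (W + 1) powr (5/4)" using W by (intro ge_one_powr_ge_zero) auto
 then have Lr: "real L >= 1" using Lge by linarith
 then have L1: "L >= 1" by simp
 have c2: "8 * d2\<^sup>2 * g1\<^sup>2 * C * ((real L)\<^sup>2) powr (- 2/5) <= 1/20"
 proof -
 have "((real L)\<^sup>2) powr (- 2/5) = (real L powr 2) powr (- 2/5)" using Lr by simp
 also have "... = real L powr (2 * (- 2/5))" by (rule powr_powr)
 also have "2 * (- 2/5) = (- (4/5) :: real)" by simp
 also have "real L powr (- (4/5)) <= ((W + 1) powr (5/4)) powr (- (4/5))" using Lge W1 by (intro powr_mono2') auto
 also have "((W + 1) powr (5/4)) powr (- (4/5)) = (W + 1) powr (5/4 * (- (4/5)))" by (rule powr_powr)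
 also have "5/4 * (- (4/5)) = (- 1 :: real)" by simp
 also have "(W + 1) powr (- 1) = 1 / (W + 1)" using W by (simp add: powr_minus_divide)
 finally have "((real L)\<^sup>2) powr (- 2/5) <= 1 / (W + 1)" .
 then have "W * ((real L)\<^sup>2) powr (- 2/5) <= W * (1 / (W + 1))" using W by (intro mult_left_mono)
 also have "... <= 1" using W by (simp add: pos_divide_le_eq)
 finally have "20 * (8 * d2\<^sup>2 * g1\<^sup>2 * C * ((real L)\<^sup>2) powr (- 2/5)) <= 1" by (simp add: W_def)
 then show ?thesis by linarith
 qed
 define k0 where "k0 = CARD('n) * (L + 1)"
 define X1 where "X1 = 512 * d2 * C"
 define X2 where "X2 = 3 * R * real k0 * d2 ^ (2 * k0)"
 define X3 where "X3 = 16 * (1 + C)"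
 define X4 where "X4 = (1 + C) * (8 * (real L + 1) + 4 * real k0 + 16)\<^sup>2"
 have X: "0 <= X1" "0 <= X2" "0 <= X3" "0 <= X4" using d2 KC R by (simp_all add: X1_def X2_def X3_def X4_def)
 \<comment> \<open>One denominator for the conditions c3 to c6, each of which asks that kp times a
   constant be small; for c3 also kp <= 1 is used.\<close>
 define T where "T = 1 + 20 * X1 + 20 * X2 + X3 + X4"
 have T: "T >= 1" "20 * X1 <= T" "20 * X2 <= T" "X3 <= T" "X4 <= T" using X by (simp_all add: T_def)
 define kp where "kp = 1 / T"
 have kp: "kp > 0" "kp <= 1" using T by (simp_all add: kp_def)
 have c3: "512 * d2 * C * kp\<^sup>2 <= 1/20"
 proof -
 have "X1 * kp\<^sup>2 <= X1 * kp" using kp X by (intro mult_left_mono) (auto simp: power2_eq_square mult_left_le_one_le)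
 also have "... <= 1/20" using T by (simp add: kp_def pos_divide_le_eq)
 finally show ?thesis by (simp add: X1_def)
 qed
 have c4: "3 * R * real k0 * d2 ^ (2 * k0) * kp <= 1/20"
 using T unfolding X2_def[symmetric] by (simp add: kp_def pos_divide_le_eq)
 have "X3 * kp <= 1" using T by (simp add: kp_def pos_divide_le_eq)
 then have c5: "16 * kp * (1 + C) <= 1" by (simp add: X3_def mult.commute mult.left_commute)
 have "X4 * kp <= 1" using T by (simp add: kp_def pos_divide_le_eq)
 then have "X4 * kp <= 4" by linarith
 then have c6: "kp * (1 + C) * (8 * (real L + 1) + 4 * real k0 + 16)\<^sup>2 <= 4" by (simp only: X4_def mult.commute mult.left_commute)
 define A where "A = max 1 (64 / kp)"
 have A: "A >= 1" "A >= 64 / kp" by (simp_all add: A_def)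
 define q where "q = cn ^ (2 * CARD('n) + 1)"
 define H where "H = (1 + ?D) * (d2 + 1) / (c0 * q) * (d2 * (1 + ?D) / q + 1)"
 have q: "q > 0" using cn by (simp add: q_def)
 have H: "H >= 0" using q d2 c0_pos by (simp add: H_def)
 \<comment> \<open>The first entry keeps the comparison function below \<open>TT\<close> on the
   boundary, the second gives bt H < 1.\<close>
 define bt where "bt = min (c0 * cn ^ (2 * CARD('n)) / (1 + ?D)) (1 / (1 + H))"
 have bt: "bt > 0" using c0_pos cn H by (simp add: bt_def)
 have bt1: "bt * (1 + ?D) <= c0 * cn ^ (2 * CARD('n))"
 proof -
 have "bt <= c0 * cn ^ (2 * CARD('n)) / (1 + ?D)" by (simp add: bt_def)
 then show ?thesis by (simp only: pos_le_divide_eq[of "1 + ?D"] add_pos_nonneg zero_less_one of_nat_0_le_iff)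
 qed
 have bt2: "bt * H < 1"
 proof -
 have "bt * H <= 1 / (1 + H) * H" using H by (intro mult_right_mono) (simp_all add: bt_def)
 also have "... < 1" using H by (simp add: pos_divide_less_eq)
 finally show ?thesis .
 qed
 define B where "B = 256 * C + (64 * d2 * C + 2 * d2 * C * b2 * (4 * A + 1) / c0)"
 have B: "256 * C <= B" "64 * d2 * C + 2 * d2 * C * b2 * (4 * A + 1) / c0 <= B"
 using KC d2 b2 A c0_pos by (simp_all add: B_def)
 have B0: "B > 0" using B KC by linarith
 show ?thesis
 proof (intro exI conjI allI impI)
 show "bt\<^sup>2 / B > 0" using bt B0 by simp
 \<comment> \<open>The factor 4 compensates for replacing N by its integer part n, since N <=
   2n.\<close>
 show "4 * ((4 * A + 1) / c0) > 0" using A c0_pos by simp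
 fix M :: "'w measure" and \<phi> :: "real^'n => 'w => real" and N :: real
 assume gff: "metric_gff M \<phi>" and N: "N > 1"
 define n where "n = nat \<lfloor>N\<rfloor>"
 have fl: "1 <= \<lfloor>N\<rfloor>" using N by linarith
 then have rn: "real n = of_int \<lfloor>N\<rfloor>" by (simp add: n_def)
 have n: "n >= 1" "real n <= N" "N <= 2 * real n"
 proof -
 have f1: "1 <= real n" unfolding rn using fl by linarith
 then show "n >= 1" by simp
 show "real n <= N" unfolding rn by (rule of_int_floor_le)
 have "N < real n + 1" unfolding rn by linarith
 then show "N <= 2 * real n" using f1 by linarith
 qed
 have n0: "real n > 0" using n by simp
 \<comment> \<open>Chosen after n: the upper bound squares values t >= n^(-2), hence the power n^4,
   and the lower bound needs ep below bt/n^2. Only then is the mesh made fine enough for this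
   ep.\<close>
 define ep where "ep = min (1 / (20 * (5 + 4 * C) * real n ^ 4)) (min (bt / (real n)\<^sup>2) 1)"
 have den: "20 * (5 + 4 * C) * real n ^ 4 > 0" using KC n0 by simp
 have e: "0 < ep" "ep <= 1" "ep <= bt / (real n)\<^sup>2" using den bt n0 by (simp_all add: ep_def)
 have "ep <= 1 / (20 * (5 + 4 * C) * real n ^ 4)" by (simp add: ep_def)
 then have "ep * (20 * (5 + 4 * C) * real n ^ 4) <= 1" using den by (simp only: pos_le_divide_eq)
 then have e4: "20 * (5 + 4 * C) * ep * real n ^ 4 <= 1" by (simp only: mult.commute mult.left_commute)
 let ?x = "96 * real CARD('n) ^ 4 * real (card {x::real^'n. x : latt & linf x <= real n + 1}) / ep ^ 4"
 obtain k1 where k1: "?x < 2 ^ k1" using real_arch_pow[of 2 ?x] by auto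
 have bounds: "bt\<^sup>2 / B / (real n)\<^sup>2 <= box.pc M (mnb (2 ^ k)) \<phi> (mV (2 ^ k) n) (mD n) 0 \<and>
 box.pc M (mnb (2 ^ k)) \<phi> (mV (2 ^ k) n) (mD n) 0 <= (4 * A + 1) / c0 / (real n)\<^sup>2" if k: "k >= k1" "k >= 1" for k
 proof -
 have "(2::nat) ^ 1 <= 2 ^ k" using k by (intro power_increasing) auto
 then have mb: "mesh_box (2 ^ k) M \<phi> n"
 by (intro mesh_box.intro mesh.intro mesh_box_axioms.intro gff n assms) simp
 have x2: "(2::real) ^ k1 <= 2 ^ k" using k by (intro power_increasing) auto
 have r2: "real (2 ^ k) = 2 ^ k" by simp
 have "?x <= real (2 ^ k)" unfolding r2 using k1 x2 by linarith
 note osc = mesh_box.osc_small[OF mb e(1) this]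
 have me: "mesh_est (2 ^ k) M \<phi> n K C ep d2 b2"
 by (rule mesh_est.intro[OF mb], unfold mesh_est_axioms_def, intro conjI allI impI)
 (rule d2_def b2_def KC G GG GGG e osc; assumption)+
 have mg: "mesh_growth (2 ^ k) M \<phi> n K C ep d2 b2 R kp g1 A L k0"
 by (rule mesh_growth.intro[OF me], rule mesh_growth_axioms.intro)
 (rule k0_def L1 R(1) kp(1) g1_def c1 c2 c3 c4 c5 c6 A e4)+
 note lb = mesh_growth.lower_bound[OF mg bt bt1 bt2 e(3) q_def H_def]
 show ?thesis
 using mesh_growth.pc_lower[OF mg lb bt B] mesh_growth.pc_upper[OF mg] by blast
 qed
 note P = connection_probability_bounds[OF gff N assms, of k1 "bt\<^sup>2 / B / (real n)\<^sup>2" "(4 * A + 1) / c0 / (real n)\<^sup>2", folded n_def, OF bounds]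
 have Np: "N powr (-2) = 1 / N\<^sup>2" using N by (simp add: powr_minus_divide)
 have "(real n)\<^sup>2 <= N\<^sup>2" using n by (intro power_mono) auto
 then have "bt\<^sup>2 / B / N\<^sup>2 <= bt\<^sup>2 / B / (real n)\<^sup>2" using B0 n0 N by (intro divide_left_mono) auto
 then show "bt\<^sup>2 / B * N powr (-2) <= measure M {om : space M. conn_nonneg \<phi> om N}" unfolding Np using P(1) by simp
 have "N\<^sup>2 <= (2 * real n)\<^sup>2" using n N by (intro power_mono) auto
 then have N4: "N\<^sup>2 <= 4 * (real n)\<^sup>2" by (simp add: power_mult_distrib)
 have "y / z = 4 * y / (4 * z)" for y z :: real by simp
 then have "(4 * A + 1) / c0 / (real n)\<^sup>2 = 4 * ((4 * A + 1) / c0) / (4 * (real n)\<^sup>2)" .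
 also have "... <= 4 * ((4 * A + 1) / c0) / N\<^sup>2" using N4 N A c0_pos n0 by (intro divide_left_mono mult_pos_pos) auto
 finally show "measure M {om : space M. conn_nonneg \<phi> om N} <= 4 * ((4 * A + 1) / c0) * N powr (-2)" unfolding Np using P(2) by simp
 qed
qed

end
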